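(* Let $(c_1,\dots,c_m)\in\mathbb{C}^m$ be a root of $-p_ic_i=f_i^A(c_1,\dots,c_m)$ $(i=1,\dots,m)$ with $c_j\ne0$. Let $\lambda_1=-1,\lambda_2,\dots,\lambda_m$ be the associated Kovalevskaya exponents, numbered so that $\mathrm{Re}(\lambda_i)\le0$ for $i=2,\dots,k$ and $\mathrm{Re}(\lambda_i)>0$ for $i=k+1,\dots,m$. Then the system $\frac{dx_i}{dz}=f_i+g_i$ has an $(m-k+1)$-parameter family of convergent Laurent series solutions of the form $$x_i(z)=c_i(z-z_0)^{-p_i}+\sum_{n=1}^\infty a_{i,n}(z-z_0)^{-p_i+n},\qquad i=1,\dots,m,$$ where $\{a_{i,n}\}$ includes $m-k$ free parameters other than $z_0$, if and only if (i) $\lambda_{k+1},\dots,\lambda_m$ are positive integers, (ii) $J_u$ is semisimple, and (iii) the system $\frac{d\boldsymbol{X}_u}{dt}=J_u\boldsymbol{X}_u+F_u(\boldsymbol{X}_u,\varphi(\boldsymbol{X}_u))$ on the unstable manifold is linearizable by a local analytic transformation near the origin. In particular, the system has an $m$-parameter family of Laurent series solutions of this form if and only if (i) all Kovalevskaya exponents except for $\lambda_1=-1$ are positive integers, (ii) the Jacobi matrix $J$ is semisimple, and (iii) the system $\frac{d\hat{\boldsymbol{X}}}{dt}=J\hat{\boldsymbol{X}}+F(\hat{\boldsymbol{X}})$ is linearizable by a local analytic transformation near the origin.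
   Context: Consider the system $\frac{dx_i}{dz}=f_i(x_1,\dots,x_m,z)+g_i(x_1,\dots,x_m,z)$, $i=1,\dots,m$, with $f_i,g_i$ polynomials on $\mathbb{C}^{m+1}$, satisfying: (A1) there are positive integers $p_1,\dots,p_m,r$ with $f_i(\lambda^{p_1}x_1,\dots,\lambda^{p_m}x_m,\lambda^rz)=\lambda^{p_i+1}f_i(x_1,\dots,x_m,z)$ for all $\lambda\in\mathbb{C}$ and all $i$; (A2) $g_i(\lambda^{p_1}x_1,\dots,\lambda^{p_m}x_m,\lambda^rz)=o(\lambda^{p_i+1})$ as $|\lambda|\to\infty$; (A3) with $s=r+1$ and $\omega=e^{2\pi i/s}$, the system is invariant under $(x_1,\dots,x_m,z)\mapsto(\omega^{p_1}x_1,\dots,\omega^{p_m}x_m,\omega^rz)$. Put $f_i^A(x_1,\dots,x_m):=f_i(x_1,\dots,x_m,0)$. The Kovalevskaya exponents associated with a root $(c_1,\dots,c_m)$ of $-p_ic_i=f_i^A(c_1,\dots,c_m)$ are the eigenvalues of $K=\left(\frac{\partial f_i^A}{\partial x_l}(c_1,\dots,c_m)+p_i\delta_{il}\right)_{i,l=1}^m$; $\lambda_1=-1$ is always one of them (for a nonzero root). In the coordinates defined by $x_i=X_i\varepsilon^{-p_i/s}$ $(i\ne j)$, $x_j=\varepsilon^{-p_j/s}$, $z=Z\varepsilon^{-r/s}$, the integral curves of the system are those of the vector field $$\frac{dX_i}{dt}=p_iX_i-p_j\frac{f_i+\varepsilon G_i}{f_j+\varepsilon G_j}\ (i\neq j),\qquad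 \frac{dZ}{dt}=rZ-\frac{p_j\varepsilon}{f_j+\varepsilon G_j},\qquad \frac{d\varepsilon}{dt}=s\varepsilon,$$ where $f_i$ means $f_i(X_1,\dots,X_{j-1},1,X_{j+1},\dots,X_m,Z)$ and $G_i$ is the polynomial in $(X_1,\dots,X_{j-1},X_{j+1},\dots,X_m,Z,\varepsilon)$ determined by $g_i(X_1\varepsilon^{-p_1/s},\dots,\varepsilon^{-p_j/s},\dots,X_m\varepsilon^{-p_m/s},Z\varepsilon^{-r/s})=\varepsilon^{1-(1+p_i)/s}G_i$. It has the fixed point $X_i=c_ic_j^{-p_i/p_j}$ $(i\ne j)$, $Z=\varepsilon=0$ (a branch of $c_j^{1/p_j}$ being fixed). Put $\hat X_i=X_i-c_ic_j^{-p_i/p_j}$ and $\hat{\boldsymbol{X}}=(\hat X_1,\dots,\hat X_{j-1},\hat X_{j+1},\dots,\hat X_m,Z,\varepsilon)$, and write the vector field as $\frac{d\hat{\boldsymbol{X}}}{dt}=J\hat{\boldsymbol{X}}+F(\hat{\boldsymbol{X}})$, with $J$ the Jacobi matrix at the fixed point and $F$ the nonlinear part. The eigenvalues of $J$ are $\lambda_2,\dots,\lambda_m,r,s$. By a linear change of coordinates this takes the form $$\frac{d\boldsymbol{X}_u}{dt}=J_u\boldsymbol{X}_u+F_u(\boldsymbol{X}_u,\boldsymbol{X}_s),\quad \boldsymbol{X}_u\in\mathbb{C}^{m-k+2},\qquad \frac{d\boldsymbol{X}_s}{dt}=J_s\boldsymbol{X}_s+F_s(\boldsymbol{X}_u,\boldsymbol{X}_s),\quad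 \boldsymbol{X}_s\in\mathbb{C}^{k-1},$$ where the eigenvalues of $J_u$ have positive real parts and those of $J_s$ have nonpositive real parts. The unstable manifold of the origin is locally the graph $\boldsymbol{X}_s=\varphi(\boldsymbol{X}_u)$ of a local analytic function $\varphi$ with $\varphi(0)=0$, $D\varphi(0)=0$. "Linearizable by a local analytic transformation" means that some analytic change of variables defined near the origin and fixing it transforms the system into a linear one. *)

theory Defs
  imports "HOL-Analysis.Analysis" "HOL-Library.Landau_Symbols"
begin

section \<open>The polynomial system\<close>

definition polynomial_fun :: "(complex^'n \<Rightarrow> complex) \<Rightarrow> bool" where
  "polynomial_fun h \<longleftrightarrow> (\<exists>(E :: ('n \<Rightarrow> nat) set) a. finite E \<and>
     (\<forall>x. h x = (\<Sum>e\<in>E. a e * (\<Prod>i\<in>UNIV. (x $ i) ^ e i))))"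

text \<open>A point \<open>(x\<^sub>1, \<dots>, x\<^sub>m, z)\<close> of \<open>m+1\<close>-space is read as a vector indexed by \<open>'m option\<close>, the index
  \<^const>\<open>None\<close> belonging to \<open>z\<close>.\<close>

definition polynomial_xz :: "(complex^'m \<Rightarrow> complex \<Rightarrow> complex) \<Rightarrow> bool" where
  "polynomial_xz h \<longleftrightarrow>
     polynomial_fun (\<lambda>v :: complex^('m option). h (\<chi> l. v $ Some l) (v $ None))"

definition wscale :: "('m \<Rightarrow> nat) \<Rightarrow> complex \<Rightarrow> complex^'m \<Rightarrow> complex^'m" where
  "wscale p \<mu> x = (\<chi> l. \<mu> ^ p l * x $ l)"

text \<open>The standing assumptions on \<open>dx\<^sub>i/dz = f\<^sub>i(x,z) + g\<^sub>i(x,z)\<close>. The last clause is the invariance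
  under \<open>x\<^sub>l \<mapsto> \<omega>^(p\<^sub>l) x\<^sub>l\<close>, \<open>z \<mapsto> \<omega>^r z\<close> with the factors \<open>\<omega>^(p\<^sub>i)\<close> of \<open>dx\<^sub>i\<close> and \<open>\<omega>^r\<close> of \<open>dz\<close> written out.\<close>

definition quasihomogeneous_system ::
  "('m::finite \<Rightarrow> complex^'m \<Rightarrow> complex \<Rightarrow> complex) \<Rightarrow> ('m \<Rightarrow> complex^'m \<Rightarrow> complex \<Rightarrow> complex)
    \<Rightarrow> ('m \<Rightarrow> nat) \<Rightarrow> nat \<Rightarrow> bool" where
  "quasihomogeneous_system f g p r \<longleftrightarrow>
     (\<forall>i. polynomial_xz (f i) \<and> polynomial_xz (g i)) \<and>
     (\<forall>i. 0 < p i) \<and> 0 < r \<and>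
     (\<forall>i \<mu> x z. f i (wscale p \<mu> x) (\<mu> ^ r * z) = \<mu> ^ (p i + 1) * f i x z) \<and>
     (\<forall>i x z. (\<lambda>\<mu>. g i (wscale p \<mu> x) (\<mu> ^ r * z)) \<in> o[at_infinity](\<lambda>\<mu>. \<mu> ^ (p i + 1))) \<and>
     (let \<omega> = exp (2 * complex_of_real pi * \<i> / of_nat (r + 1)) in
        \<forall>i x z. \<omega> ^ r * (f i (wscale p \<omega> x) (\<omega> ^ r * z) + g i (wscale p \<omega> x) (\<omega> ^ r * z))
                = \<omega> ^ p i * (f i x z + g i x z))"

definition kovalevskaya_matrix ::
  "('m::finite \<Rightarrow> complex^'m \<Rightarrow> complex \<Rightarrow> complex) \<Rightarrow> ('m \<Rightarrow> nat) \<Rightarrow> complex^'m \<Rightarrow> complex^'m^'m" where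
  "kovalevskaya_matrix f p c =
     (\<chi> i l. deriv (\<lambda>w. f i (c + axis l w) 0) 0 + (if i = l then of_nat (p i) else 0))"


section \<open>Families of Laurent series solutions\<close>

text \<open>The coefficient \<open>a i 0\<close> is not used; the leading coefficient is \<open>c $ i\<close>.\<close>

definition laurent_sum ::
  "('m::finite \<Rightarrow> nat) \<Rightarrow> complex^'m \<Rightarrow> ('m \<Rightarrow> nat \<Rightarrow> complex) \<Rightarrow> complex \<Rightarrow> complex \<Rightarrow> complex^'m" where
  "laurent_sum p c a z0 z =
     (\<chi> i. c $ i * (z - z0) powi (- int (p i)) +
           (\<Sum>n. a i (Suc n) * (z - z0) powi (- int (p i) + int (Suc n))))"

definition laurent_solution ::
  "('m::finite \<Rightarrow> complex^'m \<Rightarrow> complex \<Rightarrow> complex) \<Rightarrow> ('m \<Rightarrow> complex^'m \<Rightarrow> complex \<Rightarrow> complex)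
    \<Rightarrow> ('m \<Rightarrow> nat) \<Rightarrow> complex^'m \<Rightarrow> complex \<Rightarrow> ('m \<Rightarrow> nat \<Rightarrow> complex) \<Rightarrow> bool" where
  "laurent_solution f g p c z0 a \<longleftrightarrow>
     (\<exists>\<rho>>0. \<forall>z. 0 < dist z z0 \<and> dist z z0 < \<rho> \<longrightarrow>
        (\<forall>i. summable (\<lambda>n. a i (Suc n) * (z - z0) powi (- int (p i) + int (Suc n))) \<and>
             ((\<lambda>w. laurent_sum p c a z0 w $ i) has_field_derivative
                f i (laurent_sum p c a z0 z) z + g i (laurent_sum p c a z0 z) z) (at z)))"

text \<open>The coefficients \<open>a\<^sub>i\<^sub>,\<^sub>n\<close> include \<open>N\<close> free parameters other than \<open>z\<^sub>0\<close>: there are \<open>N\<close> positions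
  \<open>(i,n)\<close> with \<open>n \<ge> 1\<close> such that, for every \<open>z\<^sub>0\<close>, the coefficients at these positions can be given
  arbitrary values. Together with \<open>z\<^sub>0\<close> this makes an \<open>(N+1)\<close>-parameter family.\<close>

definition laurent_family ::
  "('m::finite \<Rightarrow> complex^'m \<Rightarrow> complex \<Rightarrow> complex) \<Rightarrow> ('m \<Rightarrow> complex^'m \<Rightarrow> complex \<Rightarrow> complex)
    \<Rightarrow> ('m \<Rightarrow> nat) \<Rightarrow> complex^'m \<Rightarrow> nat \<Rightarrow> bool" where
  "laurent_family f g p c N \<longleftrightarrow>
     (\<exists>S :: ('m \<times> nat) set. finite S \<and> card S = N \<and> (\<forall>(i, n)\<in>S. 1 \<le> n) \<and>
        (\<forall>z0 (\<alpha> :: 'm \<Rightarrow> nat \<Rightarrow> complex).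
           \<exists>a. laurent_solution f g p c z0 a \<and> (\<forall>(i, n)\<in>S. a i n = \<alpha> i n)))"


section \<open>The vector field in the chart \<open>x\<^sub>j \<noteq> 0\<close>\<close>

text \<open>The coordinates \<open>(X\<^sub>i (i \<noteq> j), Z, \<epsilon>)\<close> form a vector \<open>Y\<close> indexed by \<open>'m option\<close>: \<open>Y $ Some i = X\<^sub>i\<close>
  for \<open>i \<noteq> j\<close>, \<open>Y $ None = Z\<close>, and the slot \<open>Some j\<close>, which is free because \<open>X\<^sub>j = 1\<close>, holds \<open>\<epsilon>\<close>.\<close>

definition chart_X :: "'m \<Rightarrow> complex^('m option) \<Rightarrow> complex^'m" where
  "chart_X j Y = (\<chi> i. if i = j then 1 else Y $ Some i)"

text \<open>The equation \<open>g\<^sub>i(X\<^sub>1 \<epsilon>^(-p\<^sub>1/s), \<dots>, Z \<epsilon>^(-r/s)) = \<epsilon>^(1-(1+p\<^sub>i)/s) G\<^sub>i(X,Z,\<epsilon>)\<close>, with \<open>s = r + 1\<close> and \<open>\<eta>\<close>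
  running over all \<open>s\<close>-th roots of \<open>\<epsilon> \<noteq> 0\<close>. It determines the polynomial \<open>G\<^sub>i\<close>.\<close>

definition chart_G ::
  "('m::finite \<Rightarrow> complex^'m \<Rightarrow> complex \<Rightarrow> complex) \<Rightarrow> ('m \<Rightarrow> nat) \<Rightarrow> nat \<Rightarrow> 'm
    \<Rightarrow> ('m \<Rightarrow> complex^('m option) \<Rightarrow> complex) \<Rightarrow> bool" where
  "chart_G g p r j G \<longleftrightarrow>
     (\<forall>i. polynomial_fun (G i) \<and>
        (\<forall>Y \<eta>. \<eta> \<noteq> 0 \<and> Y $ Some j = \<eta> ^ (r + 1) \<longrightarrow>
           g i (\<chi> l. chart_X j Y $ l * \<eta> powi (- int (p l))) (Y $ None * \<eta> powi (- int r))
             = \<eta> powi (int (r + 1) - (1 + int (p i))) * G i Y))"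

definition chart_field ::
  "('m::finite \<Rightarrow> complex^'m \<Rightarrow> complex \<Rightarrow> complex) \<Rightarrow> ('m \<Rightarrow> complex^('m option) \<Rightarrow> complex)
    \<Rightarrow> ('m \<Rightarrow> nat) \<Rightarrow> nat \<Rightarrow> 'm \<Rightarrow> complex^('m option) \<Rightarrow> complex^('m option)" where
  "chart_field f G p r j Y =
     (let Z = Y $ None; \<epsilon> = Y $ Some j;
          h = (\<lambda>i. f i (chart_X j Y) Z + \<epsilon> * G i Y)
      in \<chi> q. case q of
           None \<Rightarrow> of_nat r * Z - of_nat (p j) * \<epsilon> / h j
         | Some i \<Rightarrow> if i = j then of_nat (r + 1) * \<epsilon>
                     else of_nat (p i) * Y $ Some i - of_nat (p j) * (h i / h j))"

text \<open>\<open>b\<close> is the chosen branch of \<open>c\<^sub>j^(1/p\<^sub>j)\<close>.\<close>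

definition chart_fixpoint :: "('m \<Rightarrow> nat) \<Rightarrow> complex^'m \<Rightarrow> 'm \<Rightarrow> complex \<Rightarrow> complex^('m option)" where
  "chart_fixpoint p c j b =
     (\<chi> q. case q of None \<Rightarrow> 0 | Some i \<Rightarrow> if i = j then 0 else c $ i * b powi (- int (p i)))"

definition jacobi_matrix :: "(complex^'n::finite \<Rightarrow> complex^'n) \<Rightarrow> complex^'n \<Rightarrow> complex^'n^'n" where
  "jacobi_matrix V y = (\<chi> i l. deriv (\<lambda>w. V (y + axis l w) $ i) 0)"

definition nonlinear_part :: "(complex^'n::finite \<Rightarrow> complex^'n) \<Rightarrow> complex^'n \<Rightarrow> complex^'n \<Rightarrow> complex^'n" where
  "nonlinear_part V y x = V (y + x) - jacobi_matrix V y *v x"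


section \<open>Coordinate subspaces, semisimplicity, linearization\<close>

text \<open>For a set \<open>U\<close> of indices, the space of vectors with coordinates indexed by \<open>U\<close> only is realised as
  the coordinate subspace \<open>coord_space U\<close>; in this way its dimension \<open>card U\<close> need not be a type
  (and may be \<open>0\<close>). Maps on it are functions on the whole vector type, of which only the values on
  \<open>coord_space U\<close> matter.\<close>

definition coord_space :: "'n set \<Rightarrow> (complex^'n) set" where
  "coord_space U = {x. \<forall>i. i \<notin> U \<longrightarrow> x $ i = 0}"

definition coord_proj :: "'n set \<Rightarrow> complex^'n \<Rightarrow> complex^'n" where
  "coord_proj U x = (\<chi> i. if i \<in> U then x $ i else 0)"

text \<open>Analytic near the origin: complex differentiable in a neighbourhood, as for \<^const>\<open>analytic_on\<close>.\<close>

definition analytic_near_0 :: "'n::finite set \<Rightarrow> (complex^'n \<Rightarrow> complex^'n) \<Rightarrow> bool" where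
  "analytic_near_0 U h \<longleftrightarrow>
     (\<exists>e>0. \<forall>x\<in>ball 0 e. \<exists>A :: complex^'n^'n.
        ((\<lambda>y. h (coord_proj U y)) has_derivative (\<lambda>v. A *v v)) (at x))"

text \<open>Below, \<open>A\<close> is a matrix that maps \<open>coord_space U\<close> to itself.\<close>

definition semisimple_on :: "'n::finite set \<Rightarrow> complex^'n^'n \<Rightarrow> bool" where
  "semisimple_on U A \<longleftrightarrow>
     (\<exists>B. vec.independent B \<and> vec.span B = coord_space U \<and> (\<forall>v\<in>B. \<exists>\<mu>. A *v v = \<mu> *s v))"

definition eigenvalue_on :: "'n::finite set \<Rightarrow> complex^'n^'n \<Rightarrow> complex \<Rightarrow> bool" where
  "eigenvalue_on U A \<mu> \<longleftrightarrow> (\<exists>v\<in>coord_space U. v \<noteq> 0 \<and> A *v v = \<mu> *s v)"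

text \<open>\<open>dy/dt = h y\<close> on \<open>coord_space U\<close> becomes \<open>dw/dt = L w\<close> under \<open>w = \<psi> y\<close>, where \<open>\<psi>\<close> is analytic with
  analytic inverse \<open>\<theta>\<close>: the derivative of \<open>\<psi>\<close> at \<open>y\<close> in the direction \<open>h y\<close> is \<open>L (\<psi> y)\<close>.\<close>

definition linearizable_on :: "'n::finite set \<Rightarrow> (complex^'n \<Rightarrow> complex^'n) \<Rightarrow> bool" where
  "linearizable_on U h \<longleftrightarrow>
     (\<exists>\<psi> \<theta> (L :: complex^'n^'n).
        analytic_near_0 U \<psi> \<and> analytic_near_0 U \<theta> \<and> \<psi> 0 = 0 \<and> \<theta> 0 = 0 \<and>
        \<psi> ` coord_space U \<subseteq> coord_space U \<and> \<theta> ` coord_space U \<subseteq> coord_space U \<and>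
        (\<exists>e>0. \<forall>y\<in>coord_space U \<inter> ball 0 e.
           \<theta> (\<psi> y) = y \<and> \<psi> (\<theta> y) = y \<and>
           frechet_derivative (\<lambda>x. \<psi> (coord_proj U x)) (at y) (h y) = L *v \<psi> y))"


section \<open>Splitting and unstable manifold\<close>

text \<open>New linear coordinates \<open>y = P x\<close> with \<open>X\<^sub>u\<close> the coordinates indexed by \<open>U\<close> and \<open>X\<^sub>s\<close> the remaining
  ones. The matrix \<open>conj_matrix P J\<close> of the linear part is then block diagonal; its blocks \<open>J\<^sub>u\<close> and \<open>J\<^sub>s\<close>
  are its restrictions to \<open>coord_space U\<close> and \<open>coord_space (- U)\<close>.\<close>

definition conj_matrix :: "complex^'n::finite^'n \<Rightarrow> complex^'n^'n \<Rightarrow> complex^'n^'n" where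
  "conj_matrix P J = P ** J ** matrix_inv P"

definition conj_map ::
  "complex^'n::finite^'n \<Rightarrow> (complex^'n \<Rightarrow> complex^'n) \<Rightarrow> complex^'n \<Rightarrow> complex^'n" where
  "conj_map P F y = P *v F (matrix_inv P *v y)"

definition spectral_splitting ::
  "complex^'n::finite^'n \<Rightarrow> complex^'n^'n \<Rightarrow> 'n set \<Rightarrow> bool" where
  "spectral_splitting J P U \<longleftrightarrow>
     invertible P \<and>
     (\<forall>i l. (i \<in> U) \<noteq> (l \<in> U) \<longrightarrow> conj_matrix P J $ i $ l = 0) \<and>
     (\<forall>\<mu>. eigenvalue_on U (conj_matrix P J) \<mu> \<longrightarrow> 0 < Re \<mu>) \<and>
     (\<forall>\<mu>. eigenvalue_on (- U) (conj_matrix P J) \<mu> \<longrightarrow> Re \<mu> \<le> 0)"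

text \<open>Points whose backward orbit stays in \<open>N\<close> and tends to the origin exponentially. The exponential
  rate is essential: there may be centre directions (eigenvalues with real part 0), along which
  backward orbits can tend to the origin at a slower rate.\<close>

definition local_unstable_set ::
  "(complex^'n::finite \<Rightarrow> complex^'n) \<Rightarrow> (complex^'n) set \<Rightarrow> (complex^'n) set" where
  "local_unstable_set V N =
     {y. \<exists>(X :: real \<Rightarrow> complex^'n) C \<delta>. 0 < \<delta> \<and> X 0 = y \<and>
        (\<forall>t\<le>0. X t \<in> N \<and> (X has_vector_derivative V (X t)) (at t within {..0}) \<and>
                norm (X t) \<le> C * exp (\<delta> * t))}"

definition unstable_graph ::
  "(complex^'n::finite \<Rightarrow> complex^'n) \<Rightarrow> 'n set \<Rightarrow> (complex^'n \<Rightarrow> complex^'n) \<Rightarrow> bool" where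
  "unstable_graph V U \<phi> \<longleftrightarrow>
     analytic_near_0 U \<phi> \<and> \<phi> ` coord_space U \<subseteq> coord_space (- U) \<and> \<phi> 0 = 0 \<and>
     ((\<lambda>x. \<phi> (coord_proj U x)) has_derivative (\<lambda>_. 0)) (at 0) \<and>
     (\<exists>N. open N \<and> 0 \<in> N \<and>
        local_unstable_set V N = {y\<in>N. coord_proj (- U) y = \<phi> (coord_proj U y)})"

text \<open>The reduced field \<open>J\<^sub>u X\<^sub>u + F\<^sub>u(X\<^sub>u, \<phi>(X\<^sub>u))\<close>, for \<open>A\<close>, \<open>F\<close> in the new coordinates.\<close>

definition unstable_field ::
  "'n set \<Rightarrow> complex^'n::finite^'n \<Rightarrow> (complex^'n \<Rightarrow> complex^'n) \<Rightarrow> (complex^'n \<Rightarrow> complex^'n)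
    \<Rightarrow> complex^'n \<Rightarrow> complex^'n" where
  "unstable_field U A F \<phi> y = A *v y + coord_proj U (F (y + \<phi> y))"

definition positive_integer :: "complex \<Rightarrow> bool" where
  "positive_integer x \<longleftrightarrow> (\<exists>n::nat. 0 < n \<and> x = of_nat n)"

end

theory Submission
 imports Defs "HOL-Complex_Analysis.Complex_Analysis" "HOL-Computational_Algebra.Fundamental_Theorem_Algebra"
begin

text \<open>A Laurent solution becomes, in the time \<open>\<tau>\<close> with \<open>\<epsilon> = \<tau>\<^sup>s\<close>, a holomorphic curve \<open>Y\<close> with \<open>Y 0\<close> the fixed
  point and \<open>\<tau> Y' = V Y\<close>; it lies on the unstable manifold. The quantities \<open>\<epsilon>\<close>, \<open>z\<^sub>0\<close> and \<open>a\<^sub>i\<^sub>,\<^sub>n\<close> are, up to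
  powers of \<open>\<tau>\<close>, contour integrals over the loop \<open>\<theta> \<mapsto> Y (\<tau> e\<^sup>i\<^sup>\<theta>)\<close> and hence analytic functions of the initial point.

  If they can be prescribed, the points whose orbit under \<open>\<i> V\<close> has period \<open>2\<pi>\<close> form a non-negligible set, so by
  the identity theorem the whole flow is periodic. Its Fourier modes are analytic eigenfunctions of the reduced
  field; suitable ones form a linearizing chart, with positive integers as eigenvalues.

  Conversely a linearization with positive integer eigenvalues turns the orbits into curves \<open>\<Xi> (\<tau>\<^sup>n s)\<close>. A row
  selection in the derivatives of \<open>\<epsilon>\<close>, \<open>z\<^sub>0\<close>, \<open>a\<^sub>i\<^sub>,\<^sub>n\<close> with respect to \<open>s\<close> gives an invertible derivative, the
  inverse function theorem gives small values of the parameters, and quasi-homogeneity gives all of them.\<close>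

unbundle no fps_syntax

section \<open>Holomorphic functions of several variables\<close>

text \<open>A Laurent family provides, for each choice of the parameters, some solution; nothing is
  known of its radius, its uniqueness or its dependence on the parameters. Necessity therefore runs
  backwards: the parameters are functions of the initial point, and only the size of the set of
  initial points counts. A null set of initial points has a null image, so it could not produce all
  parameters. A solution may live on a tiny disc only, but parameters are multiplied by powers of
  \<tau>, and countably many integer dilations reach all values. Rotation of \<tau> is the flow of
  \<open>\<i> V\<close>; that is why closed orbits appear. Periodicity is an analytic condition, so
  integrality of the eigenvalues, absence of Jordan blocks and linearization all come from one
  identity theorem, without formal normal forms. In the converse it is not evident which positions
  (i,n) can carry the free parameters. They are found by a rank argument, with two rows reserved for
  \<epsilon> and z_0; these need eigenvectors of weight r+1 and r on the unstable part, obtained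
  from left eigenvectors of \<open>J\<close>.\<close>

definition chol :: "(complex^'n) set => (complex^'n::finite => complex) => bool" where
 "chol S f \<longleftrightarrow> (\<forall>x\<in>S. \<exists>D. (f has_derivative D) (at x) \<and> (\<forall>c v. D (c *s v) = c * D v))"

text \<open>Derivatives along complex lines reduce every estimate to one complex variable. A
  function in \<open>chol\<close> is Frechet differentiable in the full space with
  complex-homogeneous derivative, so these directional derivatives make up the whole derivative
  (\<open>chol_deriv\<close>).\<close>

definition cdir :: "(complex^'n::finite => complex) => complex^'n => complex^'n => complex" where
 "cdir f x v = deriv (%\<zeta>. f (x + \<zeta> *s v)) 0"

lemma norm_cvec_smult: "norm (c *s v) = norm c * norm (v :: complex^'n::finite)"
proof -
 have "norm (c *s v) = L2_set (%i. norm c * norm (v $ i)) UNIV"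
  by (simp add: norm_vec_def norm_mult)
 also have "\<dots> = norm c * L2_set (%i. norm (v $ i)) UNIV"
  by (simp add: L2_set_right_distrib)
 finally show ?thesis by (simp add: norm_vec_def)
qed

lemma bounded_linear_smult_vec [bounded_linear]: "bounded_linear (%\<zeta>::complex. \<zeta> *s (v :: complex^'n::finite))"
 by (rule bounded_linear_intro[where K = "norm v"])
   (simp_all add: vec_eq_iff norm_cvec_smult algebra_simps)

lemma bounded_linear_smult_scalar [bounded_linear]: "bounded_linear (%v :: complex^'n::finite. (c::complex) *s v)"
 by (rule bounded_linear_intro[where K = "norm c"])
   (simp_all add: vec_eq_iff norm_cvec_smult algebra_simps)

lemma bounded_linear_axis: "bounded_linear (%y::'b::real_normed_vector. axis i y :: 'b^'n::finite)"
 by (rule bounded_linear_intro[where K = 1])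
   (simp_all add: axis_def vec_eq_iff norm_vec_def L2_set_def if_distrib[of norm] if_distrib[of "%z. z\<^sup>2"] sum.delta cong: if_cong)

lemma vec_sum_axis: "x = (\<Sum>i\<in>UNIV. axis i (x $ i :: 'b::comm_monoid_add))"
 by (simp add: vec_eq_iff axis_def sum.delta cong: if_cong)

lemma has_derivative_vecI:
 fixes f :: "'a::real_normed_vector => ('b::real_normed_vector)^'n::finite"
 assumes "\<And>i. ((%x. f x $ i) has_derivative (%v. D v $ i)) (at x within S)"
 shows "(f has_derivative D) (at x within S)"
proof -
 have "((%x. \<Sum>i\<in>UNIV. axis i (f x $ i)) has_derivative (%v. \<Sum>i\<in>UNIV. axis i (D v $ i))) (at x within S)"
  by (intro has_derivative_sum bounded_linear.has_derivative[OF bounded_linear_axis] assms)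
 thus ?thesis by (simp flip: vec_sum_axis)
qed

text \<open>A remainder bounded by \<open>C * (norm v)\<^sup>2\<close> on a ball of fixed radius
  survives limits and integrals over a parameter, which a mere little-o does not. The derivatives of
  limits and of parameter integrals below are obtained in this way.\<close>

lemma has_derivative_quadraticI:
 fixes f :: "'a::real_normed_vector => 'b::real_normed_vector"
 assumes "bounded_linear D" "e > 0"
  "\<And>v. norm v < e ==> norm (f (x + v) - f x - D v) \<le> C * (norm v)\<^sup>2"
 shows "(f has_derivative D) (at x)"
 unfolding has_derivative_at
proof (intro conjI assms(1))
 have ev: "\<forall>\<^sub>F v in at 0. norm (norm (f (x + v) - f x - D v) / norm v) \<le> \<bar>C\<bar> * norm v"
 proof -
  have "\<forall>\<^sub>F v in at (0::'a). v \<in> ball 0 e - {0}"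
   using eventually_at_in_open[of "ball (0::'a) e" 0] \<open>e > 0\<close> by simp
  thus ?thesis
  proof eventually_elim
   case (elim v)
   have "norm (f (x + v) - f x - D v) \<le> \<bar>C\<bar> * (norm v)\<^sup>2"
    using assms(3)[of v] elim by (intro order.trans[OF _ mult_right_mono[OF abs_ge_self]]) auto
   thus ?case using elim by (simp add: divide_simps power2_eq_square)
  qed
 qed
 have "((%v::'a. \<bar>C\<bar> * norm v) \<longlongrightarrow> \<bar>C\<bar> * norm (0::'a)) (at 0)"
  by (intro tendsto_intros)
 hence lim: "((%v::'a. \<bar>C\<bar> * norm v) \<longlongrightarrow> 0) (at 0)" by simp
 show "(%v. norm (f (x + v) - f x - D v) / norm v) \<midarrow>0\<rightarrow> 0"
  by (rule Lim_null_comparison[OF ev lim])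
qed

lemma chol_line:
 fixes f :: "complex^'n::finite => complex"
 assumes "(f has_derivative D) (at (x + \<zeta> *s v))" "\<And>c v. D (c *s v) = c * D v"
 shows "((%\<zeta>. f (x + \<zeta> *s v)) has_field_derivative D v) (at \<zeta>)"
proof -
 have "((%\<zeta>. x + \<zeta> *s v) has_derivative (%h. h *s v)) (at \<zeta>)"
  using has_derivative_add[OF has_derivative_const[of x] bounded_linear_imp_has_derivative[OF bounded_linear_smult_vec[of v]], of "at \<zeta>"]
  by simp
 from has_derivative_compose[OF this assms(1)]
 show ?thesis unfolding has_field_derivative_def by (simp add: assms(2) mult_commute_abs)
qed

lemma chol_deriv:
 assumes "chol S f" "x \<in> S"
 shows "(f has_derivative cdir f x) (at x)" and "cdir f x (c *s v) = c * cdir f x v"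
proof -
 obtain D where D: "(f has_derivative D) (at x)" "\<And>c v. D (c *s v) = c * D v"
  using assms unfolding chol_def by blast
 have "D v = cdir f x v" for v
 proof -
  have "((%\<zeta>. f (x + \<zeta> *s v)) has_field_derivative D v) (at 0)"
   by (rule chol_line) (use D in auto)
  thus ?thesis unfolding cdir_def by (simp add: DERIV_imp_deriv)
 qed
 hence "D = cdir f x" by auto
 with D show "(f has_derivative cdir f x) (at x)" and "cdir f x (c *s v) = c * cdir f x v" by auto
qed

lemma cdir_eqI:
 assumes "(f has_derivative D) (at x)" "\<And>c v. D (c *s v) = c * D v"
 shows "cdir f x = D"
proof
 fix v
 have "((%\<zeta>. f (x + \<zeta> *s v)) has_field_derivative D v) (at 0)"
  by (rule chol_line) (use assms in auto)
 thus "cdir f x v = D v" unfolding cdir_def by (simp add: DERIV_imp_deriv)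
qed

lemma chol_line_deriv:
 assumes "chol S f" "x + \<zeta> *s v \<in> S"
 shows "((%\<zeta>. f (x + \<zeta> *s v)) has_field_derivative cdir f (x + \<zeta> *s v) v) (at \<zeta>)"
 by (rule chol_line) (simp_all add: chol_deriv[OF assms])

lemma chol_line_holomorphic:
 assumes "chol S f" "\<And>\<zeta>. \<zeta> \<in> U ==> x + \<zeta> *s v \<in> S"
 shows "(%\<zeta>. f (x + \<zeta> *s v)) holomorphic_on U"
 unfolding holomorphic_on_def
proof
 fix \<zeta> assume "\<zeta> \<in> U"
 from chol_line_deriv[OF assms(1) assms(2)[OF this]]
 show "(%\<zeta>. f (x + \<zeta> *s v)) field_differentiable at \<zeta> within U"
  using field_differentiable_at_within field_differentiable_def by blast
qed

lemma cdir_linear: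
 assumes "chol S f" "x \<in> S"
 shows "bounded_linear (cdir f x)"
 using chol_deriv(1)[OF assms] by (rule has_derivative_bounded_linear)

lemma chol_subset: "chol S f ==> T \<subseteq> S ==> chol T f"
 unfolding chol_def by blast

lemma chol_continuous: "chol S f ==> continuous_on S f"
 by (intro continuous_at_imp_continuous_on ballI has_derivative_continuous[OF chol_deriv(1)])

lemma chol_const [simp]: "chol S (%x. c)"
 unfolding chol_def by (auto intro!: exI[of _ "%_. 0"])

lemma chol_nth [simp]: "chol S (%x. x $ i)"
 unfolding chol_def
 by (auto intro!: exI[of _ "%v. v $ i"] bounded_linear_imp_has_derivative bounded_linear_vec_nth)

lemma chol_add:
 assumes "chol S f" "chol S g" shows "chol S (%x. f x + g x)"
 unfolding chol_def
proof (intro ballI exI conjI allI)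
 fix x assume x: "x \<in> S"
 show "((%x. f x + g x) has_derivative (%v. cdir f x v + cdir g x v)) (at x)"
  by (intro has_derivative_add chol_deriv(1)[OF assms(1) x] chol_deriv(1)[OF assms(2) x])
qed (simp add: chol_deriv(2)[OF assms(1)] chol_deriv(2)[OF assms(2)] algebra_simps)

lemma chol_mult:
 assumes "chol S f" "chol S g" shows "chol S (%x. f x * g x)"
 unfolding chol_def
proof (intro ballI exI conjI allI)
 fix x assume x: "x \<in> S"
 show "((%x. f x * g x) has_derivative (%v. f x * cdir g x v + cdir f x v * g x)) (at x)"
  by (intro has_derivative_mult chol_deriv(1)[OF assms(1) x] chol_deriv(1)[OF assms(2) x])
qed (simp add: chol_deriv(2)[OF assms(1)] chol_deriv(2)[OF assms(2)] algebra_simps)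

lemma chol_uminus: "chol S f ==> chol S (%x. - f x)"
 using chol_mult[OF chol_const[of S "-1"], of f] by simp

lemma chol_diff: "chol S f ==> chol S g ==> chol S (%x. f x - g x)"
 using chol_add[OF _ chol_uminus, of S f g] by simp

lemma chol_sum: "(\<And>i. i \<in> I ==> chol S (f i)) ==> chol S (%x. \<Sum>i\<in>I. f i x)"
 by (induction I rule: infinite_finite_induct) (simp_all add: chol_add)

lemma chol_prod: "(\<And>i. i \<in> I ==> chol S (f i)) ==> chol S (%x. \<Prod>i\<in>I. f i x)"
 by (induction I rule: infinite_finite_induct) (simp_all add: chol_mult)

lemma chol_power: "chol S f ==> chol S (%x. f x ^ n)"
 by (induction n) (simp_all add: chol_mult)

lemma chol_holomorphic_comp:
 assumes "chol S f" "\<phi> holomorphic_on T" "open T" "f ` S \<subseteq> T"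
 shows "chol S (%x. \<phi> (f x))"
 unfolding chol_def
proof (intro ballI exI conjI allI)
 fix x assume x: "x \<in> S"
 have "(\<phi> has_field_derivative deriv \<phi> (f x)) (at (f x))"
  using assms x by (auto intro!: holomorphic_derivI)
 hence "(\<phi> has_derivative (*) (deriv \<phi> (f x))) (at (f x))"
  by (simp add: has_field_derivative_def)
 from has_derivative_compose[OF chol_deriv(1)[OF assms(1) x] this]
 show "((%x. \<phi> (f x)) has_derivative (%v. deriv \<phi> (f x) * cdir f x v)) (at x)" .
qed (simp add: chol_deriv(2)[OF assms(1)])

lemma chol_inverse:
 assumes "chol S f" "\<And>x. x \<in> S ==> f x ~= 0" shows "chol S (%x. inverse (f x))"
 by (rule chol_holomorphic_comp[OF assms(1), where T = "- {0}"])
   (use assms(2) in \<open>auto intro!: holomorphic_intros\<close>)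

lemma chol_divide:
 assumes "chol S f" "chol S g" "\<And>x. x \<in> S ==> g x ~= 0" shows "chol S (%x. f x / g x)"
 using chol_mult[OF assms(1) chol_inverse[OF assms(2,3)]] by (simp add: divide_inverse)

lemma chol_powi:
 assumes "chol S f" "\<And>x. x \<in> S ==> f x ~= 0" shows "chol S (%x. f x powi n)"
 using chol_power[OF assms(1)] chol_power[OF chol_inverse[OF assms]]
 by (cases "n \<ge> 0") (simp_all add: power_int_def)

lemma chol_cong:
 assumes "open S" "\<And>x. x \<in> S ==> f x = g x" "chol S f" shows "chol S g"
 unfolding chol_def
proof (intro ballI exI conjI allI)
 fix x assume x: "x \<in> S"
 show "(g has_derivative cdir f x) (at x)"
  using has_derivative_transform_within_open[OF chol_deriv(1)[OF assms(3) x] assms(1) x] assms(2) by auto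
 show "cdir f x (c *s v) = c * cdir f x v" for c v
  by (rule chol_deriv(2)[OF assms(3) x])
qed

section \<open>Holomorphic maps between spaces of vectors\<close>

definition cholv :: "(complex^'n) set => (complex^'n::finite => complex^'k::finite) => bool" where
 "cholv S f \<longleftrightarrow> (\<forall>i. chol S (%x. f x $ i))"

definition cjac :: "(complex^'n::finite => complex^'k::finite) => complex^'n => complex^'n^'k" where
 "cjac f x = (\<chi> i l. cdir (%x. f x $ i) x (axis l 1))"

lemma cdir_expand:
 assumes "chol S f" "x \<in> S"
 shows "cdir f x v = (\<Sum>l\<in>UNIV. cdir f x (axis l 1) * v $ l)"
proof -
 interpret bounded_linear "cdir f x" by (rule cdir_linear[OF assms])
 have "cdir f x v = cdir f x (\<Sum>l\<in>UNIV. v $ l *s axis l 1)" by (simp add: basis_expansion)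
 also have "\<dots> = (\<Sum>l\<in>UNIV. v $ l * cdir f x (axis l 1))"
  by (simp add: sum chol_deriv(2)[OF assms])
 finally show ?thesis by (simp add: mult.commute)
qed

lemma cjac_nth: "cholv S f ==> x \<in> S ==> (cjac f x *v v) $ i = cdir (%x. f x $ i) x v"
 unfolding cholv_def cjac_def
 by (simp add: matrix_vector_mult_def cdir_expand[of S "%x. f x $ i" x v])

lemma cholv_deriv:
 assumes "cholv S f" "x \<in> S" shows "(f has_derivative (*v) (cjac f x)) (at x)"
proof -
 have "((%x. \<chi> i. f x $ i) has_derivative (%v. \<chi> i. cdir (%x. f x $ i) x v)) (at x)"
  using assms unfolding cholv_def
  by (intro has_derivative_vecI) (auto intro!: chol_deriv(1))
 moreover have "(%v. \<chi> i. cdir (%x. f x $ i) x v) = (*v) (cjac f x)"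
  by (auto simp: vec_eq_iff cjac_nth[OF assms])
 ultimately show ?thesis by simp
qed

lemma matrix_vec_smult: "(A :: complex^'n::finite^'k::finite) *v (c *s v) = c *s (A *v v)"
 by (simp add: matrix_vector_mult_def vec_eq_iff sum_distrib_left algebra_simps)

text \<open>A real derivative that happens to be given by a complex matrix is complex linear; this
  is the bridge from real calculus to holomorphy.\<close>

lemma cholvI:
 assumes "\<And>x. x \<in> S ==> \<exists>A. (f has_derivative (*v) A) (at x)"
 shows "cholv S f"
 unfolding cholv_def chol_def
proof (intro allI ballI)
 fix i x assume "x \<in> S"
 then obtain A where A: "(f has_derivative (*v) A) (at x)" using assms by blast
 have "((%x. f x $ i) has_derivative (%v. (A *v v) $ i)) (at x)"
  by (rule bounded_linear.has_derivative[OF bounded_linear_vec_nth A])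
 thus "\<exists>D. ((%x. f x $ i) has_derivative D) (at x) \<and> (\<forall>c v. D (c *s v) = c * D v)"
  by (intro exI[of _ "%v. (A *v v) $ i"]) (auto simp: matrix_vec_smult)
qed

lemma cholv_continuous: "cholv S f ==> continuous_on S f"
 by (intro continuous_at_imp_continuous_on ballI has_derivative_continuous[OF cholv_deriv])

lemma cholv_nth: "cholv S f ==> chol S (%x. f x $ i)" by (simp add: cholv_def)

lemma cholv_subset: "cholv S f ==> T \<subseteq> S ==> cholv T f"
 unfolding cholv_def using chol_subset by blast

lemma chol_comp:
 assumes "chol T f" "cholv S g" "g ` S \<subseteq> T"
 shows "chol S (%x. f (g x))"
 unfolding chol_def
proof (intro ballI exI conjI allI)
 fix x assume x: "x \<in> S"
 hence gx: "g x \<in> T" using assms by auto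
 show "((%x. f (g x)) has_derivative (%v. cdir f (g x) (cjac g x *v v))) (at x)"
  by (rule has_derivative_compose[OF cholv_deriv[OF assms(2) x] chol_deriv(1)[OF assms(1) gx]])
 show "cdir f (g x) (cjac g x *v (c *s v)) = c * cdir f (g x) (cjac g x *v v)" for c v
  by (simp add: matrix_vec_smult chol_deriv(2)[OF assms(1) gx])
qed

lemma cholv_comp:
 assumes "cholv T f" "cholv S g" "g ` S \<subseteq> T" shows "cholv S (%x. f (g x))"
 unfolding cholv_def
proof
 fix i show "chol S (%x. f (g x) $ i)"
  by (rule chol_comp[OF cholv_nth[OF assms(1)] assms(2,3)])
qed

lemma cholv_vec: "(\<And>i. chol S (f i)) ==> cholv S (%x. \<chi> i. f i x)"
 by (simp add: cholv_def)

lemma cholv_const [simp]: "cholv S (%x. c)" by (simp add: cholv_def)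
lemma cholv_id [simp]: "cholv S (%x. x)" by (simp add: cholv_def)
lemma cholv_add: "cholv S f ==> cholv S g ==> cholv S (%x. f x + g x)"
 unfolding cholv_def vector_add_component by (intro allI chol_add) (erule spec)+
lemma cholv_matrix: "cholv S f ==> cholv S (%x. A *v f x)"
 unfolding cholv_def matrix_vector_mult_def vec_lambda_beta
 by (intro allI chol_sum chol_mult chol_const) (erule spec)

lemma bounded_imageD: "bounded (f ` S) ==> \<exists>B. \<forall>y\<in>S. norm (f y) \<le> B"
 by (simp add: bounded_iff)

section \<open>Cauchy estimates on complex lines, limits and parameter integrals\<close>

lemma cdir_diff:
 assumes "chol S f" "chol S g" "x \<in> S"
 shows "cdir (%x. f x - g x) x v = cdir f x v - cdir g x v"
proof -
 have "cdir (%x. f x - g x) x = (%v. cdir f x v - cdir g x v)"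
  by (rule cdir_eqI) (use chol_deriv[OF assms(1,3)] chol_deriv[OF assms(2,3)] in
    \<open>auto intro!: has_derivative_diff simp: algebra_simps\<close>)
 thus ?thesis by simp
qed

lemma smult_mem_ball:
 fixes x v :: "complex^'n::finite"
 assumes "norm \<zeta> * norm v < d" shows "x + \<zeta> *s v \<in> ball x d"
 using assms by (simp add: dist_norm norm_cvec_smult)

text \<open>Cauchy's inequality for \<open>\<zeta> \<mapsto> f (x + \<zeta> v)\<close> on the disc
  of radius \<open>d / (2 |v|)\<close>, which the line maps into the ball; the factor 2 is the price
  for staying off its boundary.\<close>

lemma cdir_bound:
 fixes f :: "complex^'n::finite => complex"
 assumes f: "chol (ball x d) f" and d: "d > 0" and M: "\<And>y. y \<in> ball x d ==> norm (f y) \<le> M"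
 shows "norm (cdir f x v) \<le> 2 * M / d * norm v"
proof (cases "v = 0")
 case True
 interpret bounded_linear "cdir f x" using cdir_linear[OF f] d by auto
 show ?thesis using True by (simp add: zero)
next
 case False
 define r where "r = d / (2 * norm v)"
 have r: "r > 0" using d False by (simp add: r_def)
 have mem: "x + \<zeta> *s v \<in> ball x d" if "norm \<zeta> \<le> r" for \<zeta>
 proof (rule smult_mem_ball)
  have "norm \<zeta> * norm v \<le> r * norm v" using that by (intro mult_right_mono) auto
  also have "\<dots> < d" using d False by (simp add: r_def)
  finally show "norm \<zeta> * norm v < d" .
 qed
 have hol: "(%\<zeta>. f (x + \<zeta> *s v)) holomorphic_on cball 0 r"
  by (rule chol_line_holomorphic[OF f]) (use mem in auto)
 have "norm ((deriv ^^ 1) (%\<zeta>. f (x + \<zeta> *s v)) 0) \<le> fact 1 * M / r ^ 1"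
  by (rule Cauchy_inequality)
    (use hol holomorphic_on_subset[OF hol ball_subset_cball] r M mem in
     \<open>auto intro: holomorphic_on_imp_continuous_on\<close>)
 thus ?thesis using False by (simp add: cdir_def r_def field_simps)
qed

text \<open>The line through \<open>x\<close> in direction \<open>v\<close> reaches
  \<open>x + v\<close> at parameter 1 and stays in the ball up to parameter
  \<open>2 * \<rho> = d / |v|\<close>. Taylor's formula on the unit disc, with Cauchy's inequality
  for the second derivative on circles of radius \<open>\<rho>\<close>, gives the constant:
  \<open>2 * M / \<rho>\<^sup>2 = 8 * M * |v|\<^sup>2 / d\<^sup>2\<close>.\<close>

lemma chol_quadratic_remainder:
 fixes f :: "complex^'n::finite => complex"
 assumes f: "chol (ball x d) f" and d: "d > 0" and M: "\<And>y. y \<in> ball x d ==> norm (f y) \<le> M"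
  and v: "norm v < d / 2"
 shows "norm (f (x + v) - f x - cdir f x v) \<le> 8 * M / d\<^sup>2 * (norm v)\<^sup>2"
proof (cases "v = 0")
 case True
 interpret bounded_linear "cdir f x" using cdir_linear[OF f] d by auto
 show ?thesis using True by (simp add: zero)
next
 case False
 define \<rho> where "\<rho> = d / (2 * norm v)"
 have \<rho>: "\<rho> > 1" using v False by (simp add: \<rho>_def field_simps)
 define g where "g = (%\<zeta>. f (x + \<zeta> *s v))"
 have mem: "x + \<zeta> *s v \<in> ball x d" if "norm \<zeta> < 2 * \<rho>" for \<zeta>
 proof (rule smult_mem_ball)
  have "norm \<zeta> * norm v < 2 * \<rho> * norm v" using that False by (intro mult_strict_right_mono) auto
  also have "\<dots> = d" using False by (simp add: \<rho>_def)
  finally show "norm \<zeta> * norm v < d" .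
 qed
 have hol: "g holomorphic_on ball 0 (2 * \<rho>)"
  unfolding g_def by (rule chol_line_holomorphic[OF f]) (use mem in auto)
 have hol': "(deriv ^^ i) g holomorphic_on ball 0 (2 * \<rho>)" for i
  by (rule holomorphic_higher_deriv[OF hol]) auto
 have "cmod ((deriv ^^ 0) g 1 - (\<Sum>i\<le>1. (deriv ^^ i) g 0 * (1 - 0) ^ i / fact i))
    \<le> (2 * M / \<rho>\<^sup>2) * cmod (1 - 0) ^ Suc 1 / fact 1"
 proof (rule complex_Taylor[where S = "cball 0 1"])
  fix i and \<zeta> :: complex assume "\<zeta> \<in> cball 0 1"
  hence "\<zeta> \<in> ball 0 (2 * \<rho>)" using \<rho> by auto
  from holomorphic_derivI[OF hol' open_ball this]
  show "((deriv ^^ i) g has_field_derivative (deriv ^^ Suc i) g \<zeta>) (at \<zeta> within cball 0 1)"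
   by (simp add: has_field_derivative_at_within)
 next
  fix \<zeta> :: complex assume \<zeta>: "\<zeta> \<in> cball 0 1"
  have sub: "cball \<zeta> \<rho> \<subseteq> ball 0 (2 * \<rho>)"
  proof
   fix w assume "w \<in> cball \<zeta> \<rho>"
   hence "norm (\<zeta> - w) \<le> \<rho>" by (simp add: dist_norm)
   moreover have "norm w \<le> norm \<zeta> + norm (\<zeta> - w)" by (metis norm_minus_commute norm_triangle_sub)
   ultimately show "w \<in> ball 0 (2 * \<rho>)" using \<zeta> \<rho> by auto
  qed
  have "norm ((deriv ^^ 2) g \<zeta>) \<le> fact 2 * M / \<rho> ^ 2"
  proof (rule Cauchy_inequality)
   show "g holomorphic_on ball \<zeta> \<rho>"
    using hol by (rule holomorphic_on_subset) (use sub in auto)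
   show "continuous_on (cball \<zeta> \<rho>) g"
    by (rule holomorphic_on_imp_continuous_on[OF holomorphic_on_subset[OF hol sub]])
   show "norm (g w) \<le> M" if "norm (\<zeta> - w) = \<rho>" for w
   proof -
    have "w \<in> ball 0 (2 * \<rho>)" using sub that by (auto simp: dist_norm)
    thus ?thesis unfolding g_def by (intro M mem) auto
   qed
  qed (use \<rho> in auto)
  thus "cmod ((deriv ^^ Suc 1) g \<zeta>) \<le> 2 * M / \<rho>\<^sup>2" by (simp add: numeral_2_eq_2)
 qed auto
 moreover have "deriv g 0 = cdir f x v" by (simp add: g_def cdir_def)
 ultimately show ?thesis using False d
  by (simp add: g_def \<rho>_def power_divide power_mult_distrib field_simps)
qed

text \<open>Weierstrass' theorem in several variables: the directional derivatives of the sequence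
  converge, since Cauchy's bound applies to differences of its members, and the quadratic remainder
  bound, uniform in \<open>n\<close>, passes to the limit.\<close>

lemma chol_uniform_limit:
 fixes f :: "nat => complex^'n::finite => complex"
 assumes S: "open S" and f: "\<And>n. chol S (f n)" and lim: "uniform_limit S f F sequentially"
 shows "chol S F"
 unfolding chol_def
proof
 fix x assume x: "x \<in> S"
 obtain d where d: "d > 0" "cball x d \<subseteq> S" using S x open_contains_cball by blast
 have sub: "ball x d \<subseteq> S" using d by auto
 have fb: "chol (ball x d) (f n)" for n using chol_subset[OF f sub] .
 have close: "\<exists>N. \<forall>n\<ge>N. \<forall>y\<in>S. norm (f n y - F y) < e" if "e > 0" for e
  using uniform_limitD[OF lim that] by (auto simp: eventually_sequentially dist_norm)
 obtain N where N: "\<And>n y. n \<ge> N ==> y \<in> S ==> norm (f n y - F y) < 1" using close[of 1] by auto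
 have "bounded (f N ` cball x d)"
  using chol_continuous[OF f] d by (intro compact_imp_bounded compact_continuous_image)
   (auto intro: continuous_on_subset)
 from bounded_imageD[OF this] obtain B where "\<forall>y\<in>cball x d. norm (f N y) \<le> B" ..
 hence B: "\<And>y. y \<in> cball x d ==> norm (f N y) \<le> B" by blast
 have M: "norm (f n y) \<le> B + 2" if "n \<ge> N" "y \<in> ball x d" for n y
 proof -
  have y: "y \<in> S" "y \<in> cball x d" using that sub by auto
  show ?thesis
   using N[OF that(1) y(1)] N[OF order_refl y(1)] B[OF y(2)] norm_triangle_ineq4[of "f n y - F y" "f N y - F y"]
    norm_triangle_ineq[of "f n y - f N y" "f N y"] by simp
 qed
 have xb: "x \<in> ball x d" using d by auto
 have "Cauchy (%n. cdir (f n) x v)" for v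
 proof (rule CauchyI)
  fix e :: real assume e: "e > 0"
  define N where "N = norm v + 1"
  have N0: "N > 0" "norm v < N" by (auto simp: N_def add_nonneg_pos)
  define \<eta> where "\<eta> = e * d / (8 * N)"
  have \<eta>: "\<eta> > 0" using e d N0 by (simp add: \<eta>_def)
  obtain N' where N': "\<And>n y. n \<ge> N' ==> y \<in> S ==> norm (f n y - F y) < \<eta>" using close[OF \<eta>] by blast
  have "norm (cdir (f m) x v - cdir (f n) x v) < e" if "m \<ge> N'" "n \<ge> N'" for m n
  proof -
   have "norm (cdir (%y. f m y - f n y) x v) \<le> 2 * (2 * \<eta>) / d * norm v"
   proof (rule cdir_bound[OF chol_diff[OF fb fb] d(1)])
    fix y assume "y \<in> ball x d"
    hence "y \<in> S" using sub by auto
    from N'[OF that(1) this] N'[OF that(2) this]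
    show "norm (f m y - f n y) \<le> 2 * \<eta>"
     using norm_triangle_ineq4[of "f m y - F y" "f n y - F y"] by simp
   qed
   also have "\<dots> = e * (norm v / (2 * N))" using d N0 by (simp add: \<eta>_def field_simps)
   also have "\<dots> < e * 1" using e N0 by (intro mult_strict_left_mono) (auto simp: divide_less_eq)
   finally show ?thesis by (simp add: cdir_diff[OF fb fb xb])
  qed
  thus "\<exists>M. \<forall>m\<ge>M. \<forall>n\<ge>M. norm (cdir (f m) x v - cdir (f n) x v) < e" by blast
 qed
 hence "\<forall>v. \<exists>l. (%n. cdir (f n) x v) \<longlonglongrightarrow> l" by (simp add: Cauchy_convergent_iff convergent_def)
 from choice[OF this] obtain D where D: "\<And>v. (%n. cdir (f n) x v) \<longlonglongrightarrow> D v" by blast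
 have lin: "bounded_linear (cdir (f n) x)" for n by (rule cdir_linear[OF fb xb])
 have Fl: "(%n. f n y) \<longlonglongrightarrow> F y" if "y \<in> S" for y
  by (rule tendsto_uniform_limitI[OF lim that])
 have smult: "D (c *s v) = c * D v" for c v
 proof -
  have "(%n. c * cdir (f n) x v) \<longlonglongrightarrow> c * D v" by (intro tendsto_intros D)
  with D[of "c *s v"] show ?thesis using LIMSEQ_unique by (auto simp: chol_deriv(2)[OF fb xb])
 qed
 have "bounded_linear D"
 proof (rule bounded_linear_intro[where K = "2 * (B + 2) / d"])
  show "D (u + v) = D u + D v" for u v
  proof -
   have "(%n. cdir (f n) x u + cdir (f n) x v) \<longlonglongrightarrow> D u + D v" by (intro tendsto_intros D)
   with D[of "u + v"] show ?thesis using LIMSEQ_unique by (auto simp: linear_simps[OF lin])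
  qed
  show "D (r *\<^sub>R v) = r *\<^sub>R D v" for r v
   using smult[of "of_real r" v] by (simp add: scaleR_conv_of_real vec_eq_iff scaleR_vec_def vector_scalar_mult_def)
  show "norm (D v) \<le> norm v * (2 * (B + 2) / d)" for v
  proof (rule Lim_bounded)
   show "(%n. norm (cdir (f n) x v)) \<longlonglongrightarrow> norm (D v)" by (intro tendsto_intros D)
   show "\<forall>n\<ge>N. norm (cdir (f n) x v) \<le> norm v * (2 * (B + 2) / d)"
    using cdir_bound[OF fb d(1) M] by (auto simp: mult.commute)
  qed
 qed
 hence "(F has_derivative D) (at x)"
 proof (rule has_derivative_quadraticI[where e = "d / 2" and C = "8 * (B + 2) / d\<^sup>2"])
  fix v :: "complex^'n" assume v: "norm v < d / 2"
  hence xv: "x + v \<in> S" using sub d by (auto simp: dist_norm)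
  show "norm (F (x + v) - F x - D v) \<le> 8 * (B + 2) / d\<^sup>2 * (norm v)\<^sup>2"
  proof (rule Lim_bounded)
   show "(%n. norm (f n (x + v) - f n x - cdir (f n) x v)) \<longlonglongrightarrow> norm (F (x + v) - F x - D v)"
    by (intro tendsto_intros D Fl xv x)
   show "\<forall>n\<ge>N. norm (f n (x + v) - f n x - cdir (f n) x v) \<le> 8 * (B + 2) / d\<^sup>2 * (norm v)\<^sup>2"
    using chol_quadratic_remainder[OF fb d(1) M v] by auto
  qed
 qed (use d in auto)
 with smult show "\<exists>D. (F has_derivative D) (at x) \<and> (\<forall>c v. D (c *s v) = c * D v)" by blast
qed

text \<open>Differentiation under the integral sign. Cauchy's bound turns uniform continuity of
  \<open>F\<close> on a compact set into continuity in \<open>t\<close> of its directional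
  derivatives, and the quadratic remainder bound can be integrated.\<close>

lemma chol_integral:
 fixes F :: "complex^'n::finite => real => complex"
 assumes S: "open S" and ab: "a \<le> b" and cont: "continuous_on (S \<times> {a..b}) (%(x, t). F x t)"
  and F: "\<And>t. t \<in> {a..b} ==> chol S (%x. F x t)"
 shows "chol S (%x. integral {a..b} (F x))"
 unfolding chol_def
proof
 fix x assume x: "x \<in> S"
 obtain d where d: "d > 0" "cball x d \<subseteq> S" using S x open_contains_cball by blast
 have sub: "ball x d \<subseteq> S" using d by auto
 have xb: "x \<in> ball x d" using d by auto
 have fb: "chol (ball x d) (%x. F x t)" if "t \<in> {a..b}" for t using chol_subset[OF F[OF that] sub] .
 have contd: "continuous_on (cball x d \<times> {a..b}) (%(x, t). F x t)"
  by (rule continuous_on_subset[OF cont]) (use d in auto)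
 have comp: "compact (cball x d \<times> {a..b})" by (intro compact_Times) auto
 have "bounded ((%(x, t). F x t) ` (cball x d \<times> {a..b}))"
  by (intro compact_imp_bounded compact_continuous_image contd comp)
 then obtain M where M: "\<And>y t. y \<in> cball x d ==> t \<in> {a..b} ==> norm (F y t) \<le> M"
  unfolding bounded_iff by force
 have Fcont: "continuous_on {a..b} (F y)" if "y \<in> S" for y
 proof -
  have "continuous_on {a..b} (%t. (%(x, t). F x t) (y, t))"
   by (rule continuous_on_compose2[OF cont]) (use that in \<open>auto intro!: continuous_intros\<close>)
  thus ?thesis by simp
 qed
 have uc: "uniformly_continuous_on (cball x d \<times> {a..b}) (%(x, t). F x t)"
  by (rule compact_uniformly_continuous[OF contd comp])
 have Dcont: "continuous_on {a..b} (%t. cdir (%y. F y t) x v)" for v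
  unfolding continuous_on_iff
 proof (intro ballI allI impI)
  fix t0 e :: real assume t0: "t0 \<in> {a..b}" and e: "e > 0"
  define N where "N = norm v + 1"
  have N0: "N > 0" "norm v < N" by (auto simp: N_def add_nonneg_pos)
  define \<eta> where "\<eta> = e * d / (4 * N)"
  have \<eta>: "\<eta> > 0" using e d N0 by (simp add: \<eta>_def)
  obtain \<delta> where \<delta>: "\<delta> > 0" "\<And>p q. p \<in> cball x d \<times> {a..b} ==> q \<in> cball x d \<times> {a..b} ==> dist q p < \<delta> ==>
    dist ((%(x, t). F x t) q) ((%(x, t). F x t) p) < \<eta>"
   using uc \<eta> unfolding uniformly_continuous_on_def by blast
  have "dist (cdir (%y. F y t) x v) (cdir (%y. F y t0) x v) < e" if t: "t \<in> {a..b}" "dist t t0 < \<delta>" for t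
  proof -
   have "norm (cdir (%y. F y t - F y t0) x v) \<le> 2 * \<eta> / d * norm v"
   proof (rule cdir_bound[OF chol_diff[OF fb fb] d(1)])
    fix y assume "y \<in> ball x d"
    hence "dist (F y t) (F y t0) < \<eta>" using \<delta>(2)[of "(y, t0)" "(y, t)"] t t0 by (auto simp: dist_Pair_Pair)
    thus "norm (F y t - F y t0) \<le> \<eta>" by (simp add: dist_norm)
   qed (use t t0 in auto)
   also have "\<dots> = e * (norm v / (2 * N))" using d N0 by (simp add: \<eta>_def field_simps)
   also have "\<dots> < e * 1" using e N0 by (intro mult_strict_left_mono) (auto simp: divide_less_eq)
   finally show ?thesis using cdir_diff[OF fb fb xb] t t0 by (simp add: dist_norm)
  qed
  thus "\<exists>d>0. \<forall>x'\<in>{a..b}. dist x' t0 < d \<longrightarrow> dist (cdir (%y. F y x') x v) (cdir (%y. F y t0) x v) < e"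
   using \<delta>(1) by blast
 qed
 define D where "D = (%v. integral {a..b} (%t. cdir (%y. F y t) x v))"
 have Dint: "(%t. cdir (%y. F y t) x v) integrable_on {a..b}" for v
  by (rule integrable_continuous_real[OF Dcont])
 have Fint: "F y integrable_on {a..b}" if "y \<in> S" for y
  by (rule integrable_continuous_real[OF Fcont[OF that]])
 have smult: "D (c *s v) = c * D v" for c v
 proof -
  have "D (c *s v) = integral {a..b} (%t. c * cdir (%y. F y t) x v)"
   unfolding D_def by (intro integral_cong) (auto simp: chol_deriv(2)[OF fb xb])
  thus ?thesis by (simp add: D_def)
 qed
 have "bounded_linear D"
 proof (rule bounded_linear_intro[where K = "2 * M / d * (b - a)"])
  show "D (u + v) = D u + D v" for u v
  proof -
   have "D (u + v) = integral {a..b} (%t. cdir (%y. F y t) x u + cdir (%y. F y t) x v)"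
    unfolding D_def by (intro integral_cong) (auto simp: linear_simps[OF cdir_linear[OF fb xb]])
   also have "\<dots> = D u + D v" unfolding D_def by (intro integral_add Dint)
   finally show ?thesis .
  qed
  show "D (r *\<^sub>R v) = r *\<^sub>R D v" for r v
   using smult[of "of_real r" v] by (simp add: scaleR_conv_of_real vec_eq_iff scaleR_vec_def vector_scalar_mult_def)
  show "norm (D v) \<le> norm v * (2 * M / d * (b - a))" for v
  proof -
   have "norm (D v) \<le> (2 * M / d * norm v) * (b - a)"
    unfolding D_def by (intro integral_bound ab Dcont cdir_bound[OF fb d(1)]) (use M in auto)
   thus ?thesis by (simp add: algebra_simps)
  qed
 qed
 hence "((%x. integral {a..b} (F x)) has_derivative D) (at x)"
 proof (rule has_derivative_quadraticI[where e = "d / 2" and C = "8 * M / d\<^sup>2 * (b - a)"])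
  fix v :: "complex^'n" assume v: "norm v < d / 2"
  hence xv: "x + v \<in> S" using sub d by (auto simp: dist_norm)
  have "integral {a..b} (F (x + v)) - integral {a..b} (F x) - D v
    = integral {a..b} (%t. F (x + v) t - F x t - cdir (%y. F y t) x v)"
   unfolding D_def by (simp add: integral_diff integrable_diff Dint Fint xv x)
  also have "norm \<dots> \<le> (8 * M / d\<^sup>2 * (norm v)\<^sup>2) * (b - a)"
   by (intro integral_bound ab continuous_intros Fcont xv x Dcont chol_quadratic_remainder[OF fb d(1) _ v])
     (use M in auto)
  finally show "norm (integral {a..b} (F (x + v)) - integral {a..b} (F x) - D v) \<le> 8 * M / d\<^sup>2 * (b - a) * (norm v)\<^sup>2"
   by (simp add: algebra_simps)
 qed (use d in auto)
 with smult show "\<exists>D. ((%x. integral {a..b} (F x)) has_derivative D) (at x) \<and> (\<forall>c v. D (c *s v) = c * D v)" by blast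
qed

section \<open>Lipschitz bounds for holomorphic maps and their derivatives\<close>

lemma chol_bounded_cball:
 fixes f :: "complex^'n::finite => complex"
 assumes f: "chol (ball 0 R) f" and r: "r < R"
 shows "\<exists>M\<ge>0. \<forall>y\<in>cball 0 r. norm (f y) \<le> M"
proof -
 have "bounded (f ` cball 0 r)"
  using chol_continuous[OF f] r by (intro compact_imp_bounded compact_continuous_image)
   (auto intro: continuous_on_subset)
 from bounded_imageD[OF this] obtain B where B: "\<forall>y\<in>cball 0 r. norm (f y) \<le> B" ..
 thus ?thesis by (intro exI[of _ "max B 0"]) fastforce
qed

lemma chol_Lipschitz:
 fixes f :: "complex^'n::finite => complex"
 assumes f: "chol (ball 0 R) f" and r: "r < R"
 shows "\<exists>L\<ge>0. \<forall>x\<in>cball 0 r. \<forall>y\<in>cball 0 r. norm (f x - f y) \<le> L * norm (x - y)"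
proof -
 define d where "d = (R - r) / 2"
 have d: "d > 0" using r by (simp add: d_def)
 obtain M where M: "M \<ge> 0" "\<And>y. y \<in> cball 0 (r + d) ==> norm (f y) \<le> M"
  using chol_bounded_cball[OF f, of "r + d"] r unfolding d_def by (auto simp: field_simps)
 have sub: "ball x d \<subseteq> cball 0 (r + d)" if "x \<in> cball 0 r" for x :: "complex^'n"
 proof
  fix y assume "y \<in> ball x d"
  thus "y \<in> cball 0 (r + d)" using that norm_triangle_sub[of y x] by (auto simp: dist_norm norm_minus_commute)
 qed
 have sub2: "cball (0::complex^'n) (r + d) \<subseteq> ball 0 R" using r by (auto simp: d_def field_simps)
 have on: "onorm (cdir f x) \<le> 2 * M / d" if x: "x \<in> cball 0 r" for x
  by (rule onorm_le, rule cdir_bound[OF chol_subset[OF f] d]) (use sub[OF x] sub2 M in auto)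
 have "norm (f x - f y) \<le> 2 * M / d * norm (x - y)" if "x \<in> cball 0 r" "y \<in> cball 0 r" for x y
  by (rule differentiable_bound[OF convex_cball _ on that])
    (use r in \<open>auto intro!: has_derivative_at_withinI chol_deriv(1)[OF f]\<close>)
 moreover have "2 * M / d \<ge> 0" using M d by simp
 ultimately show ?thesis by blast
qed

text \<open>Translation by \<open>x - y\<close> changes \<open>f\<close> by at most
  \<open>L * |x - y|\<close> near \<open>y\<close>; Cauchy's bound for the difference of
  \<open>f\<close> and its translate then bounds the difference of the derivatives. Taking a third
  of \<open>R - r\<close> leaves room for the ball around \<open>y\<close> and for its
  translate.\<close>

lemma cdir_Lipschitz:
 fixes f :: "complex^'n::finite => complex"
 assumes f: "chol (ball 0 R) f" and r: "r < R"
 shows "\<exists>L\<ge>0. \<forall>x\<in>cball 0 r. \<forall>y\<in>cball 0 r. \<forall>v. norm (cdir f x v - cdir f y v) \<le> L * norm (x - y) * norm v"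
proof -
 define d where "d = (R - r) / 3"
 have d: "d > 0" using r by (simp add: d_def)
 obtain L where L: "L \<ge> 0" "\<And>x y. x \<in> cball 0 (r + 2 * d) ==> y \<in> cball 0 (r + 2 * d) ==> norm (f x - f y) \<le> L * norm (x - y)"
  using chol_Lipschitz[OF f, of "r + 2 * d"] r unfolding d_def by (auto simp: field_simps)
 have bnd: "norm (cdir f x v - cdir f y v) \<le> 2 * L / d * norm (x - y) * norm v"
  if x: "x \<in> cball 0 r" and y: "y \<in> cball 0 r" for x y v
 proof -
  have incl: "z + (x - y) \<in> cball 0 (r + 2 * d)" "z \<in> cball 0 (r + 2 * d)" if z: "z \<in> ball y d" for z
  proof -
   have "norm (z + (x - y)) \<le> norm (z - y) + norm x" "norm z \<le> norm (z - y) + norm y"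
    by norm+
   thus "z + (x - y) \<in> cball 0 (r + 2 * d)" "z \<in> cball 0 (r + 2 * d)"
    using z x y d norm_minus_commute[of y z] unfolding mem_cball_0 mem_ball dist_norm by linarith+
  qed
  have sub: "cball (0::complex^'n) (r + 2 * d) \<subseteq> ball 0 R" using r by (auto simp: d_def field_simps)
  have c1: "chol (ball y d) (%z. f (z + (x - y)))"
   by (rule chol_comp[OF f]) (use incl(1) sub in \<open>auto intro!: cholv_add\<close>)
  have c2: "chol (ball y d) f" by (rule chol_subset[OF f]) (use incl(2) sub in blast)
  have yb: "y \<in> ball y d" using d by simp
  have xR: "x \<in> ball 0 R" using x r by auto
  have "cdir (%z. f (z + (x - y))) y v = cdir f x v"
   by (simp add: cdir_def algebra_simps)
  hence "cdir f x v - cdir f y v = cdir (%z. f (z + (x - y)) - f z) y v"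
   by (simp add: cdir_diff[OF c1 c2 yb])
  also have "norm \<dots> \<le> 2 * (L * norm (x - y)) / d * norm v"
  proof (rule cdir_bound[OF chol_diff[OF c1 c2] d])
   fix z assume "z \<in> ball y d"
   from L(2)[OF incl[OF this]] show "norm (f (z + (x - y)) - f z) \<le> L * norm (x - y)" by simp
  qed
  finally show ?thesis by (simp add: algebra_simps)
 qed
 have "2 * L / d \<ge> 0" using L d by simp
 with bnd show ?thesis by blast
qed

lemma cholv_Lipschitz:
 fixes f :: "complex^'n::finite => complex^'k::finite"
 assumes f: "cholv (ball 0 R) f" and r: "r < R"
 shows "\<exists>L\<ge>0. \<forall>x\<in>cball 0 r. \<forall>y\<in>cball 0 r. norm (f x - f y) \<le> L * norm (x - y)"
proof -
 obtain L where L: "\<And>i. L i \<ge> 0" "\<And>i x y. x \<in> cball 0 r ==> y \<in> cball 0 r ==> norm (f x $ i - f y $ i) \<le> L i * norm (x - y)"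
  using chol_Lipschitz[OF cholv_nth[OF f] r] by metis
 have "norm (f x - f y) \<le> sum L UNIV * norm (x - y)" if "x \<in> cball 0 r" "y \<in> cball 0 r" for x y
 proof -
  have "norm (f x - f y) \<le> (\<Sum>i\<in>UNIV. norm ((f x - f y) $ i))"
   unfolding norm_vec_def by (rule L2_set_le_sum) auto
  also have "\<dots> \<le> (\<Sum>i\<in>UNIV. L i * norm (x - y))" by (intro sum_mono) (use L(2)[OF that] in auto)
  finally show ?thesis by (simp add: sum_distrib_right)
 qed
 thus ?thesis using L(1) by (intro exI[of _ "sum L UNIV"]) (auto intro: sum_nonneg)
qed

lemma cjac_Lipschitz:
 fixes f :: "complex^'n::finite => complex^'k::finite"
 assumes f: "cholv (ball 0 R) f" and r: "r < R"
 shows "\<exists>L\<ge>0. \<forall>x\<in>cball 0 r. \<forall>y\<in>cball 0 r. \<forall>v. norm (cjac f x *v v - cjac f y *v v) \<le> L * norm (x - y) * norm v"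
proof -
 obtain L where L: "\<And>i. L i \<ge> 0" "\<And>i x y v. x \<in> cball 0 r ==> y \<in> cball 0 r ==>
   norm (cdir (%x. f x $ i) x v - cdir (%x. f x $ i) y v) \<le> L i * norm (x - y) * norm v"
  using cdir_Lipschitz[OF cholv_nth[OF f] r] by metis
 have "norm (cjac f x *v v - cjac f y *v v) \<le> sum L UNIV * norm (x - y) * norm v"
  if "x \<in> cball 0 r" "y \<in> cball 0 r" for x y v
 proof -
  have xy: "x \<in> ball 0 R" "y \<in> ball 0 R" using that r by auto
  have "norm (cjac f x *v v - cjac f y *v v) \<le> (\<Sum>i\<in>UNIV. norm ((cjac f x *v v - cjac f y *v v) $ i))"
   unfolding norm_vec_def by (rule L2_set_le_sum) auto
  also have "\<dots> \<le> (\<Sum>i\<in>UNIV. L i * norm (x - y) * norm v)"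
   by (intro sum_mono) (use L(2)[OF that] in \<open>auto simp: cjac_nth[OF f xy(1)] cjac_nth[OF f xy(2)]\<close>)
  finally show ?thesis by (simp add: sum_distrib_right)
 qed
 thus ?thesis using L(1) by (intro exI[of _ "sum L UNIV"]) (auto intro: sum_nonneg)
qed

lemma cjac_continuous:
 fixes f :: "complex^'n::finite => complex^'k::finite"
 assumes f: "cholv (ball 0 R) f"
 shows "continuous_on (ball 0 R) (%x. cjac f x *v v)"
 unfolding continuous_on_eq_continuous_at[OF open_ball]
proof
 fix x :: "complex^'n" assume x: "x \<in> ball 0 R"
 define r where "r = (norm x + R) / 2"
 have r: "norm x < r" "r < R" using x by (auto simp: r_def)
 obtain L where L: "L \<ge> 0" "\<And>x y. x \<in> cball 0 r ==> y \<in> cball 0 r ==> norm (cjac f x *v v - cjac f y *v v) \<le> L * norm (x - y) * norm v"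
  using cjac_Lipschitz[OF f r(2)] by blast
 have "((%y. L * norm (y - x) * norm v) \<longlongrightarrow> L * norm (x - x) * norm v) (at x)" by (intro tendsto_intros)
 hence lim: "((%y. L * norm (y - x) * norm v) \<longlongrightarrow> 0) (at x)" by simp
 have "\<forall>\<^sub>F y in at x. y \<in> ball 0 r" using r by (intro eventually_at_in_open') auto
 hence "\<forall>\<^sub>F y in at x. norm (cjac f y *v v - cjac f x *v v) \<le> L * norm (y - x) * norm v"
  by eventually_elim (use L(2) r in auto)
 from Lim_null_comparison[OF this lim]
 show "isCont (%x. cjac f x *v v) x" unfolding isCont_def by (rule LIM_zero_cancel)
qed

text \<open>The real inverse function theorem, with the Jacobian as a bounded linear map. The
  inverse is holomorphic because its derivative is the inverse of a complex matrix, hence again a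
  complex matrix. The radius \<open>e\<close> is small enough for both compositions.\<close>

lemma cholv_inverse_function:
 fixes f :: "complex^'n::finite => complex^'n"
 assumes f: "cholv (ball 0 R) f" and R: "R > 0" and f0: "f 0 = 0" and inv: "invertible (cjac f 0)"
 shows "\<exists>e g. e > 0 \<and> cholv (ball 0 e) g \<and> g 0 = 0 \<and>
      (\<forall>y\<in>ball 0 e. f (g y) = y \<and> g y \<in> ball 0 R) \<and> (\<forall>x\<in>ball 0 e. g (f x) = x)"
proof -
 define F where "F = (%x. Blinfun ((*v) (cjac f x)))"
 have F: "blinfun_apply (F x) = (*v) (cjac f x)" for x
  unfolding F_def by (rule bounded_linear_Blinfun_apply) simp
 obtain B where B: "B ** cjac f 0 = mat 1" using inv unfolding invertible_def by blast
 have F0: "Blinfun ((*v) B) o\<^sub>L F 0 = id_blinfun"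
  by (rule blinfun_eqI) (simp add: F bounded_linear_Blinfun_apply matrix_vector_mul_assoc B)
 have R2: "R / 2 < R" using R by simp
 obtain L where L: "L \<ge> 0" "\<And>x y v. x \<in> cball 0 (R/2) ==> y \<in> cball 0 (R/2) ==> norm (cjac f x *v v - cjac f y *v v) \<le> L * norm (x - y) * norm v"
  using cjac_Lipschitz[OF f R2] by blast
 have dF: "norm (F x - F y) \<le> L * norm (x - y)" if "x \<in> cball 0 (R/2)" "y \<in> cball 0 (R/2)" for x y
  by (rule norm_blinfun_bound) (use L that in \<open>auto simp: F blinfun.diff_left\<close>)
 have "L-lipschitz_on (ball 0 (R/2)) F"
  by (rule lipschitz_onI) (use dF L in \<open>auto simp: dist_norm\<close>)
 hence contF: "continuous_on (ball 0 (R/2)) F" by (rule lipschitz_on_continuous_on)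
 obtain U' V g g' where *: "open U'" "U' \<subseteq> ball 0 (R/2)" "0 \<in> U'" "open V" "f 0 \<in> V" "homeomorphism U' V f g"
  "\<And>y. y \<in> V ==> (g has_derivative (g' y)) (at y)"
  "\<And>y. y \<in> V ==> g' y = inv (blinfun_apply (F (g y)))"
  "\<And>y. y \<in> V ==> bij (blinfun_apply (F (g y)))"
 proof (rule inverse_function_theorem[of "ball 0 (R/2)" f F 0 "Blinfun ((*v) B)"])
  show "(f has_derivative blinfun_apply (F x)) (at x)" if "x \<in> ball 0 (R/2)" for x
   using cholv_deriv[OF f, of x] that R by (auto simp: F)
 qed (use contF F0 R in auto)
 obtain e1 where e1: "e1 > 0" "ball 0 e1 \<subseteq> V" using *(4,5) f0 open_contains_ball by metis
 obtain e2 where e2: "e2 > 0" "ball 0 e2 \<subseteq> U'" using *(1,3) open_contains_ball by metis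
 define e where "e = min e1 e2"
 have "cholv (ball 0 e) g"
 proof (rule cholvI)
  fix y :: "complex^'n" assume "y \<in> ball 0 e"
  hence y: "y \<in> V" using e1 by (auto simp: e_def)
  have bij: "bij ((*v) (cjac f (g y)))" using *(9)[OF y] by (simp add: F)
  then obtain C where C: "C ** cjac f (g y) = mat 1" using matrix_left_invertible_injective bij_is_inj by blast
  hence "inv ((*v) (cjac f (g y))) = (*v) C"
   using matrix_left_right_inverse1[OF C] by (intro inv_equality) (auto simp: matrix_vector_mul_assoc)
  thus "\<exists>A. (g has_derivative (*v) A) (at y)" using *(7)[OF y] *(8)[OF y] by (auto simp: F)
 qed
 moreover have "f (g y) = y \<and> g y \<in> ball 0 R" if "y \<in> ball 0 e" for y
 proof -
  have y: "y \<in> V" using that e1 by (auto simp: e_def)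
  have "g y \<in> U'" using *(6) y by (auto simp: homeomorphism_def)
  moreover have "U' \<subseteq> ball 0 R" using *(2) R by auto
  ultimately show ?thesis using *(6) y by (auto simp: homeomorphism_def)
 qed
 moreover have "g (f x) = x" if "x \<in> ball 0 e" for x
 proof -
  have "x \<in> U'" using that e2 by (auto simp: e_def)
  thus ?thesis using *(6) by (auto simp: homeomorphism_def)
 qed
 moreover have "g 0 = 0" using *(3,6) f0 by (metis homeomorphism_apply1)
 ultimately show ?thesis using e1 e2 by (intro exI[of _ e] exI[of _ g]) (auto simp: e_def)
qed

section \<open>The identity theorem on sets that are not negligible\<close>

lemma open_imp_fsigma:
 fixes S :: "'a::euclidean_space set"
 assumes "open S" shows "fsigma S"
proof (rule open_Union_compact_subsets[OF assms])
 fix C :: "nat => 'a set" assume C: "\<And>n. compact (C n)" "\<Union>(range C) = S"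
 show ?thesis unfolding C(2)[symmetric] by (intro fsigma.intros compact_imp_closed C(1))
qed

text \<open>If \<open>f q\<close> is not zero, every real ray from \<open>q\<close> meets the zero
  set in countably many points, because the zeros of \<open>f\<close> on the complex line through
  the ray are isolated. Fubini then yields a single scale \<open>c\<close> for which the directions
  \<open>v\<close> with \<open>q + c v\<close> in the zero set form a null set, and the zero set is
  an affine image of that set.\<close>

lemma chol_zero_negligible:
 fixes f :: "complex^'n::finite => complex"
 assumes f: "chol (ball 0 R) f" and neg: "\<not> negligible {x \<in> ball 0 R. f x = 0}" and q: "q \<in> ball 0 R"
 shows "f q = 0"
proof (rule ccontr)
 assume fq: "f q ~= 0"
 define Z where "Z = {x \<in> ball 0 R. f x = 0}"
 have Zb: "Z \<in> sets borel"
 proof -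
  have "closedin (top_of_set (ball 0 R)) Z"
   unfolding Z_def by (rule continuous_closedin_preimage_constant[OF chol_continuous[OF f]])
  then obtain T where "closed T" "Z = ball 0 R \<inter> T" by (auto simp: closedin_closed)
  thus ?thesis by auto
 qed
 \<comment> \<open>The scale \<open>c\<close> is confined to \<open>{1..2}\<close>, a set of
   positive length which avoids 0, so that \<open>v \<mapsto> q + c v\<close> is invertible.\<close>
 define P where "P = (%(c::real) v. \<not> (c \<in> {1..2} \<and> q + c *\<^sub>R v \<in> Z))"
 have meas: "(%p. q + fst p *\<^sub>R snd p) \<in> borel_measurable (borel :: (real \<times> (complex^'n)) measure)"
  by (intro borel_measurable_continuous_onI continuous_intros)
 have Pset: "{p \<in> space (lborel \<Otimes>\<^sub>M lborel). P (fst p) (snd p)} \<in> sets (lborel \<Otimes>\<^sub>M (lborel :: (complex^'n) measure))"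
 proof -
  have eq: "{p. \<not> (fst p \<in> {1..2::real} \<and> q + fst p *\<^sub>R snd p \<in> Z)} = - (({1..2} \<times> UNIV) \<inter> (%p. q + fst p *\<^sub>R snd p) -` Z)" by auto
  have A: "({1..2::real} \<times> (UNIV :: (complex^'n) set)) \<in> sets borel"
   by (intro borel_closed closed_Times) auto
  have "{p. \<not> (fst p \<in> {1..2::real} \<and> q + fst p *\<^sub>R snd p \<in> Z)} \<in> sets borel"
   unfolding eq by (rule borel_comp[OF sets.Int[OF A measurable_sets_borel[OF meas Zb]]])
  thus ?thesis unfolding P_def lborel_prod by simp
 qed
 have count: "countable {c. q + c *\<^sub>R v \<in> Z}" for v
 proof -
  define U where "U = {\<zeta>. q + \<zeta> *s v \<in> ball 0 R}"
  define g where "g = (%\<zeta>. f (q + \<zeta> *s v))"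
  have U: "U = (%\<zeta>. q + \<zeta> *s v) -` ball 0 R" by (auto simp: U_def)
  have cont: "continuous_on UNIV (%\<zeta>. q + \<zeta> *s v)"
   by (intro continuous_intros bounded_linear.continuous_on[OF bounded_linear_smult_vec])
  have "open U" unfolding U using open_vimage[OF open_ball cont] .
  moreover have "convex U"
  proof -
   have "convex ((%\<zeta>. \<zeta> *s v) -` ball (-q) R)"
    by (rule convex_linear_vimage[OF bounded_linear.linear[OF bounded_linear_smult_vec] convex_ball])
   moreover have "(%\<zeta>. \<zeta> *s v) -` ball (-q) R = U" unfolding U_def
    by (auto simp: dist_norm)
   ultimately show ?thesis by simp
  qed
  moreover have "0 \<in> U" using q by (simp add: U_def)
  moreover have hol: "g holomorphic_on U" unfolding g_def
   by (rule chol_line_holomorphic[OF f]) (simp add: U_def)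
  moreover have "\<not> g constant_on U \<or> (\<forall>\<zeta>\<in>U. g \<zeta> ~= 0)"
  proof -
   have "g 0 ~= 0" using fq by (simp add: g_def)
   thus ?thesis using \<open>0 \<in> U\<close> unfolding constant_on_def by metis
  qed
  ultimately have "countable {\<zeta>\<in>U. g \<zeta> = 0}"
   using holomorphic_countable_zeros[OF hol _ convex_connected open_imp_fsigma]
   by (cases "\<forall>\<zeta>\<in>U. g \<zeta> ~= 0") (simp_all cong: conj_cong)
  moreover have "of_real ` {c. q + c *\<^sub>R v \<in> Z} \<subseteq> {\<zeta>\<in>U. g \<zeta> = 0}"
  proof -
   have "of_real c *s v = c *\<^sub>R v" for c
    by (simp add: scaleR_conv_of_real vec_eq_iff scaleR_vec_def vector_scalar_mult_def)
   thus ?thesis by (auto simp: U_def g_def Z_def)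
  qed
  ultimately have "countable ((of_real :: real => complex) ` {c. q + c *\<^sub>R v \<in> Z})" using countable_subset by blast
  moreover have "inj_on (of_real :: real => complex) {c. q + c *\<^sub>R v \<in> Z}" by (auto simp: inj_on_def)
  ultimately show ?thesis using countable_image_inj_on by blast
 qed
 have "AE v in lborel. AE c in lborel. P c v"
 proof (rule AE_I2)
  fix v
  show "AE c in lborel. P c v"
   by (rule AE_I'[OF countable_imp_null_set_lborel[OF count[of v]]]) (auto simp: P_def)
 qed
 hence ae: "AE c in lborel. AE v in lborel. P c v"
  using pair_sigma_finite.AE_commute[OF _ Pset] by (auto simp: pair_sigma_finite_def lborel.sigma_finite_measure_axioms)
 have "\<exists>c\<in>{1..2}. AE v in lborel. P c v"
 proof (rule ccontr)
  assume no: "\<not> ?thesis"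
  have "AE c in lborel. c \<notin> {1..2::real}" using ae by eventually_elim (use no in blast)
  hence "emeasure lborel {1..2::real} = 0"
   by (subst AE_iff_measurable[symmetric, where M = lborel and P = "%c. c \<notin> {1..2}"]) auto
  thus False by simp
 qed
 then obtain c where c: "c \<in> {1..2}" "AE v in lborel. P c v" by blast
 have "AE v in lborel. q + c *\<^sub>R v \<notin> Z" using c by (auto simp: P_def)
 hence "{v. q + c *\<^sub>R v \<in> Z} \<in> null_sets lborel"
 proof -
  have m: "{v. q + c *\<^sub>R v \<in> Z} \<in> sets borel"
  proof -
   have "(%v. q + c *\<^sub>R v) \<in> borel_measurable (borel :: (complex^'n) measure)"
    by (intro borel_measurable_continuous_onI continuous_intros)
   from measurable_sets_borel[OF this Zb] show ?thesis by (simp add: vimage_def)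
  qed
  thus ?thesis using \<open>AE v in lborel. q + c *\<^sub>R v \<notin> Z\<close>
   by (subst AE_iff_null_sets) auto
 qed
 hence "negligible {v. q + c *\<^sub>R v \<in> Z}"
  using null_sets_completionI negligible_iff_null_sets by blast
 hence "negligible ((%v. q + c *\<^sub>R v) ` {v. q + c *\<^sub>R v \<in> Z})"
  by (rule negligible_differentiable_image_negligible[OF order_refl])
    (auto intro!: derivative_intros simp: differentiable_on_def)
 moreover have "(%v. q + c *\<^sub>R v) ` {v. q + c *\<^sub>R v \<in> Z} = Z"
 proof -
  have *: "q + c *\<^sub>R ((1 / c) *\<^sub>R (x - q)) = x" for x using c by simp
  show ?thesis
  proof (intro equalityI subsetI)
   fix x assume "x \<in> Z"
   thus "x \<in> (%v. q + c *\<^sub>R v) ` {v. q + c *\<^sub>R v \<in> Z}"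
    by (intro image_eqI[of _ _ "(1 / c) *\<^sub>R (x - q)"]) (simp_all only: * mem_Collect_eq)
  qed auto
 qed
 ultimately show False using neg by (simp add: Z_def)
qed

section \<open>Flows of holomorphic vector fields\<close>

text \<open>The right-hand side of the integral inequality, damped by \<open>exp (- L * t)\<close>,
  is the function \<open>G\<close>; it decreases and equals \<open>c\<close> at 0.\<close>

lemma gronwall:
 fixes d :: "real => real"
 assumes cont: "continuous_on {0..R} d" and L: "L \<ge> 0"
  and le: "\<And>t. t \<in> {0..R} ==> d t \<le> c + L * integral {0..t} d" and t: "t \<in> {0..R}"
 shows "d t \<le> c * exp (L * t)"
proof -
 define G where "G = (%t. exp (- L * t) * (c + L * integral {0..t} d))"
 have der: "(G has_real_derivative exp (- L * x) * L * (d x - (c + L * integral {0..x} d))) (at x within {0..R})"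
  if "x \<in> {0..R}" for x
  unfolding G_def
  by (rule derivative_eq_intros integral_has_real_derivative[OF cont that] refl)+ (simp add: algebra_simps)
 have "G t \<le> G 0"
 proof (rule DERIV_nonpos_imp_decreasing_open[where a = 0 and b = t and f = G])
  show "0 \<le> t" using t by simp
  show "continuous_on {0..t} G"
   using DERIV_continuous_on[OF der] t by (auto intro: continuous_on_subset)
  fix x assume x: "0 < x" "x < t"
  have "(G has_real_derivative exp (- L * x) * L * (d x - (c + L * integral {0..x} d))) (at x)"
   using der[of x] x t by (simp add: at_within_Icc_at)
  moreover have "exp (- L * x) * L * (d x - (c + L * integral {0..x} d)) \<le> 0"
   using le[of x] x t L by (intro mult_nonneg_nonpos) auto
  ultimately show "\<exists>y. DERIV G x :> y \<and> y \<le> 0" by blast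
 qed
 hence "exp (- L * t) * (c + L * integral {0..t} d) \<le> c" by (simp add: G_def)
 hence "exp (L * t) * (exp (- L * t) * (c + L * integral {0..t} d)) \<le> exp (L * t) * c"
  by (intro mult_left_mono) auto
 hence "c + L * integral {0..t} d \<le> exp (L * t) * c"
  by (simp add: mult.assoc[symmetric] exp_add[symmetric])
 with le[OF t] show ?thesis by (simp add: mult.commute)
qed

text \<open>\<open>x\<close> is an approximate solution with defect \<open>\<delta>\<close>,
  \<open>y\<close> an exact one. The case \<open>\<delta> = 0\<close> gives uniqueness; the general
  case serves to compare the flow with its linear part along an eigenvector.\<close>

lemma ode_compare:
 fixes x y :: "real => 'a::banach"
 assumes lip: "\<And>u v. u \<in> B ==> v \<in> B ==> norm (K u - K v) \<le> L * norm (u - v)" and L: "L \<ge> 0"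
  and x: "\<And>t. t \<in> {0..R} ==> (x has_vector_derivative x' t) (at t within {0..R})"
  and xK: "\<And>t. t \<in> {0..R} ==> norm (x' t - K (x t)) \<le> \<delta>" "\<And>t. t \<in> {0..R} ==> x t \<in> B"
  and y: "\<And>t. t \<in> {0..R} ==> (y has_vector_derivative K (y t)) (at t within {0..R})" "\<And>t. t \<in> {0..R} ==> y t \<in> B"
  and t: "t \<in> {0..R}"
 shows "norm (x t - y t) \<le> (norm (x 0 - y 0) + \<delta> * R) * exp (L * t)"
proof (rule gronwall[OF _ L _ t])
 define e where "e = (%t. x t - y t)"
 have e: "(e has_vector_derivative (x' t - K (y t))) (at t within {0..R})" if "t \<in> {0..R}" for t
  unfolding e_def by (intro has_vector_derivative_diff x y that)
 have conte: "continuous_on {0..R} e"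
  unfolding continuous_on_eq_continuous_within by (intro ballI has_vector_derivative_continuous[OF e])
 show cont: "continuous_on {0..R} (%t. norm (x t - y t))"
  using continuous_on_norm[OF conte] by (simp add: e_def)
 fix t assume t: "t \<in> {0..R}"
 have \<delta>: "\<delta> \<ge> 0" using xK(1)[OF t] norm_ge_zero order_trans by blast
 have int: "((%t. x' t - K (y t)) has_integral (e t - e 0)) {0..t}"
  by (rule fundamental_theorem_of_calculus)
    (use t in \<open>auto intro: has_vector_derivative_within_subset[OF e]\<close>)
 have contt: "continuous_on {0..t} (%t. norm (x t - y t))"
  by (rule continuous_on_subset[OF cont]) (use t in auto)
 have "norm (integral {0..t} (%t. x' t - K (y t))) \<le> integral {0..t} (%s. \<delta> + L * norm (x s - y s))"
 proof (rule integral_norm_bound_integral)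
  show "(%t. x' t - K (y t)) integrable_on {0..t}" using int by blast
  show "(%s. \<delta> + L * norm (x s - y s)) integrable_on {0..t}"
   by (intro integrable_continuous_real continuous_intros contt)
  fix s assume "s \<in> {0..t}"
  hence s: "s \<in> {0..R}" using t by auto
  have "norm (x' s - K (y s)) \<le> norm (x' s - K (x s)) + norm (K (x s) - K (y s))"
   using norm_triangle_ineq[of "x' s - K (x s)" "K (x s) - K (y s)"] by simp
  thus "norm (x' s - K (y s)) \<le> \<delta> + L * norm (x s - y s)"
   using xK(1)[OF s] lip[OF xK(2)[OF s] y(2)[OF s]] by linarith
 qed
 also have "integral {0..t} (%t. x' t - K (y t)) = e t - e 0" using int by (rule integral_unique)
 also have "integral {0..t} (%s. \<delta> + L * norm (x s - y s)) = \<delta> * t + L * integral {0..t} (%s. norm (x s - y s))"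
  using t by (subst integral_add) (auto intro!: integrable_continuous_real continuous_intros contt)
 finally have "norm (e t - e 0) \<le> \<delta> * t + L * integral {0..t} (%s. norm (x s - y s))" .
 moreover have "\<delta> * t \<le> \<delta> * R" using t \<delta> by (intro mult_left_mono) auto
 moreover have "norm (e t) \<le> norm (e 0) + norm (e t - e 0)" using norm_triangle_sub[of "e t" "e 0"] by simp
 ultimately show "norm (x t - y t) \<le> norm (x 0 - y 0) + \<delta> * R + L * integral {0..t} (%t. norm (x t - y t))"
  unfolding e_def by linarith
qed

text \<open>The substitution \<open>s \<mapsto> t * s\<close> moves the variable endpoint into the
  integrand over the fixed interval from 0 to 1.\<close>

lemma continuous_on_indefinite_integral_param:
 fixes F :: "'a::topological_space => real => 'b::banach"
 assumes F: "continuous_on (S \<times> {0..R}) (%(y, s). F y s)"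
 shows "continuous_on (S \<times> {0..R}) (%(y, t). integral {0..t} (F y))"
proof -
 have eq: "integral {0..t} (F y) = integral {0..1} (%s. t *\<^sub>R F y (t * s))" if "y \<in> S" "t \<in> {0..R}" for y t
 proof -
  have Fy: "continuous_on {0..R} (F y)"
  proof -
   have "continuous_on {0..R} (%s. (%(y, s). F y s) (y, s))"
    by (rule continuous_on_compose2[OF F]) (use that in \<open>auto intro!: continuous_intros\<close>)
   thus ?thesis by simp
  qed
  define \<Phi> where "\<Phi> = (%u. integral {0..u} (F y))"
  have "((%s. t *\<^sub>R F y (t * s)) has_integral ((\<Phi> \<circ> (%s. t * s)) 1 - (\<Phi> \<circ> (%s. t * s)) 0)) {0..1}"
  proof (rule fundamental_theorem_of_calculus)
   fix s :: real assume s: "s \<in> {0..1}"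
   have ts: "t * s' \<in> {0..R}" if "s' \<in> {0..1}" for s'
    using that \<open>t \<in> {0..R}\<close> mult_mono[of t R s' 1] by auto
   have "((%s. t * s) has_vector_derivative t) (at s within {0..1})"
    by (auto intro!: derivative_eq_intros simp: has_real_derivative_iff_has_vector_derivative[symmetric])
   moreover have "(\<Phi> has_vector_derivative F y (t * s)) (at (t * s) within (%s. t * s) ` {0..1})"
    unfolding \<Phi>_def by (rule has_vector_derivative_within_subset[OF integral_has_vector_derivative[OF Fy ts[OF s]]])
      (use ts in auto)
   ultimately show "(\<Phi> \<circ> (%s. t * s) has_vector_derivative t *\<^sub>R F y (t * s)) (at s within {0..1})"
    by (rule vector_diff_chain_within)
  qed auto
  from integral_unique[OF this] show ?thesis unfolding \<Phi>_def by simp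
 qed
 have "continuous_on (S \<times> {0..R}) (%p. integral (cbox 0 1) (%s. snd p *\<^sub>R F (fst p) (snd p * s)))"
 proof (rule integral_continuous_on_param)
  have "continuous_on ((S \<times> {0..R}) \<times> cbox 0 (1::real)) (%p. (%(y, s). F y s) (fst (fst p), snd (fst p) * snd p))"
  proof (rule continuous_on_compose2[OF F])
   show "(%p. (fst (fst p), snd (fst p) * snd p)) ` ((S \<times> {0..R}) \<times> cbox 0 1) \<subseteq> S \<times> {0..R}"
   proof -
    have "b * s \<le> R" if "0 \<le> b" "b \<le> R" "s \<le> 1" for b s :: real
     using mult_left_le[of s b] that by linarith
    thus ?thesis by auto
   qed
  qed (intro continuous_intros)
  thus "continuous_on ((S \<times> {0..R}) \<times> cbox 0 1) (%(p, s). snd p *\<^sub>R F (fst p) (snd p * s))"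
   unfolding case_prod_beta by (intro continuous_intros) simp
 qed
 thus ?thesis by (rule continuous_on_eq) (auto simp: eq)
qed

lemma integral_vec_nth:
 fixes f :: "real => complex^'n::finite"
 assumes "f integrable_on S" shows "integral S f $ i = integral S (%x. f x $ i)"
 using integral_linear[OF assms bounded_linear_vec_nth[of i]] by (simp add: o_def)

lemma cholv_integral:
 fixes F :: "complex^'n::finite => real => complex^'k::finite"
 assumes S: "open S" and ab: "a \<le> b" and cont: "continuous_on (S \<times> {a..b}) (%(x, t). F x t)"
  and F: "\<And>t. t \<in> {a..b} ==> cholv S (%x. F x t)"
 shows "cholv S (%x. integral {a..b} (F x))"
 unfolding cholv_def
proof
 fix i
 have "chol S (%x. integral {a..b} (%t. F x t $ i))"
 proof (rule chol_integral[OF S ab])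
  show "continuous_on (S \<times> {a..b}) (%(x, t). F x t $ i)"
   using bounded_linear.continuous_on[OF bounded_linear_vec_nth cont, of i] by (simp add: case_prod_beta)
 qed (use cholv_nth[OF F] in auto)
 thus "chol S (%x. integral {a..b} (F x) $ i)"
 proof (rule chol_cong[OF S, rotated])
  fix x assume x: "x \<in> S"
  have "continuous_on {a..b} (%t. (%(x, t). F x t) (x, t))"
   by (rule continuous_on_compose2[OF cont]) (use x in \<open>auto intro!: continuous_intros\<close>)
  hence "F x integrable_on {a..b}" by (intro integrable_continuous_real) simp
  thus "integral {a..b} (%t. F x t $ i) = integral {a..b} (F x) $ i" by (simp add: integral_vec_nth)
 qed
qed

lemma integral_exp_le:
 fixes c :: real assumes "c > 0" "t \<ge> 0"
 shows "integral {0..t} (%s. exp (c * s)) \<le> exp (c * t) / c"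
proof -
 have "((%s. exp (c * s)) has_integral (exp (c * t) / c - exp (c * 0) / c)) {0..t}"
  by (rule fundamental_theorem_of_calculus)
    (use assms in \<open>auto intro!: derivative_eq_intros simp: has_real_derivative_iff_has_vector_derivative[symmetric]\<close>)
 thus ?thesis using assms by (simp add: integral_unique)
qed

text \<open>Picard iteration on the whole time interval at once. As \<open>K 0 = 0\<close>, the
  iterates are bounded by a multiple of \<open>norm y\<close>, so a small ball of initial points
  keeps all of them in \<open>cball 0 r\<close> for any prescribed \<open>T\<close>. The iterates
  are holomorphic in \<open>y\<close>, and so is their uniform limit.\<close>

lemma flow_exists:
 fixes K :: "complex^'n::finite => complex^'n"
 assumes K: "cholv (ball 0 R0) K" and K0: "K 0 = 0" and r: "0 < r" "r < R0" and T: "T \<ge> 0"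
 shows "\<exists>\<rho> u. 0 < \<rho> \<and> \<rho> \<le> r \<and>
   continuous_on (ball 0 \<rho> \<times> {0..T}) (%(y, t). u y t) \<and>
   (\<forall>t\<in>{0..T}. cholv (ball 0 \<rho>) (%y. u y t)) \<and>
   (\<forall>y\<in>ball 0 \<rho>. u y 0 = y \<and> (\<forall>t\<in>{0..T}. u y t \<in> cball 0 r \<and>
     ((%t. u y t) has_vector_derivative K (u y t)) (at t within {0..T})))"
proof -
 obtain L' where L': "L' \<ge> 0" "\<And>x y. x \<in> cball 0 r ==> y \<in> cball 0 r ==> norm (K x - K y) \<le> L' * norm (x - y)"
  using cholv_Lipschitz[OF K r(2)] by blast
 \<comment> \<open>Made positive because \<open>2 * L\<close> is a divisor below.\<close>
 define L where "L = L' + 1"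
 have L: "L > 0" using L' by (simp add: L_def)
 have lip: "norm (K x - K y) \<le> L * norm (x - y)" if "x \<in> cball 0 r" "y \<in> cball 0 r" for x y
 proof -
  have "L' * norm (x - y) \<le> L * norm (x - y)" by (intro mult_right_mono) (auto simp: L_def)
  thus ?thesis using L'(2)[OF that] by linarith
 qed
 \<comment> \<open>The iterates stay below \<open>norm y\<close> times
   \<open>1 + exp (2 * L * t)\<close>, which is at most \<open>2 * exp (2 * L * T)\<close>.\<close>
 define \<rho> where "\<rho> = r / (2 * exp (2 * L * T))"
 have \<rho>: "\<rho> > 0" using r by (simp add: \<rho>_def)
 have \<rho>r: "\<rho> * (2 * exp (2 * L * T)) = r" by (simp add: \<rho>_def)
 define u where "u = rec_nat (%y (t::real). y) (%_ v y t. y + integral {0..t} (%s. K (v y s)))"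
 have u0: "u 0 = (%y t. y)" and uS: "u (Suc k) = (%y t. y + integral {0..t} (%s. K (u k y s)))" for k
  by (simp_all add: u_def)
 have Kc: "continuous_on (cball 0 r) K"
  by (rule continuous_on_subset[OF cholv_continuous[OF K]]) (use r in auto)
 let ?D = "ball (0::complex^'n) \<rho> \<times> {0..T}"
 \<comment> \<open>The weight \<open>exp (2 * L * t)\<close> makes each integration gain a factor
   1/2: \<open>L\<close> times the integral of the weight is at most half the weight. Hence
   \<open>T\<close> may be large.\<close>
 have "continuous_on ?D (%(y, t). u k y t) \<and>
    (\<forall>y\<in>ball 0 \<rho>. \<forall>t\<in>{0..T}. norm (u k y t) \<le> norm y * (1 + (1 - (1/2)^k) * exp (2 * L * t)))
    \<and> (\<forall>y\<in>ball 0 \<rho>. \<forall>t\<in>{0..T}. norm (u (Suc k) y t - u k y t) \<le> norm y * (1/2)^(Suc k) * exp (2 * L * t))" for k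
 proof (induction k)
  case 0
  have "norm (u (Suc 0) y t - u 0 y t) \<le> norm y * (1/2) * exp (2 * L * t)" if y: "y \<in> ball 0 \<rho>" and t: "t \<in> {0..T}" for y t
  proof -
   have yr: "norm y \<le> r"
   proof -
    have "1 \<le> exp (2 * L * T)" using L T by simp
    hence "1 \<le> 2 * exp (2 * L * T)" by linarith
  hence "\<rho> * 1 \<le> \<rho> * (2 * exp (2 * L * T))" using \<rho> by (intro mult_left_mono) linarith+
    thus ?thesis using y \<rho>r by auto
   qed
   have "norm (u (Suc 0) y t - u 0 y t) = t * norm (K y)" using t by (simp add: uS u0)
   also have "norm (K y) \<le> L * norm y" using lip[of y 0] yr r K0 by auto
   hence "t * norm (K y) \<le> t * (L * norm y)" using t by (intro mult_left_mono) auto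
   also have "\<dots> = norm y * (1/2) * (2 * L * t)" by simp
   also have "\<dots> \<le> norm y * (1/2) * exp (2 * L * t)"
   proof (intro mult_left_mono)
    show "2 * L * t \<le> exp (2 * L * t)" using exp_ge_add_one_self[of "2 * L * t"] by linarith
   qed auto
   finally show ?thesis .
  qed
  thus ?case by (auto simp: u0 case_prod_beta intro!: continuous_intros)
 next
  case (Suc k)
  have bnd: "norm (u k y t) \<le> norm y * (1 + (1 - (1/2)^k) * exp (2 * L * t))"
   and dif: "norm (u (Suc k) y t - u k y t) \<le> norm y * (1/2)^(Suc k) * exp (2 * L * t)"
   if "y \<in> ball 0 \<rho>" "t \<in> {0..T}" for y t using Suc that by auto
  have bnd': "norm (u (Suc k) y t) \<le> norm y * (1 + (1 - (1/2)^(Suc k)) * exp (2 * L * t))"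
   if "y \<in> ball 0 \<rho>" "t \<in> {0..T}" for y t
  proof -
   have "norm (u (Suc k) y t) \<le> norm (u k y t) + norm (u (Suc k) y t - u k y t)"
    using norm_triangle_sub by blast
   also have "\<dots> \<le> norm y * (1 + (1 - (1/2)^k) * exp (2 * L * t)) + norm y * (1/2)^(Suc k) * exp (2 * L * t)"
    by (intro add_mono bnd dif that)
   also have "\<dots> = norm y * (1 + (1 - (1/2)^(Suc k)) * exp (2 * L * t))" by (simp add: algebra_simps)
   finally show ?thesis .
  qed
  have in_r: "norm y * (1 + (1 - (1/2)^i) * exp (2 * L * t)) \<le> r" if "y \<in> ball 0 \<rho>" "t \<in> {0..T}" for y :: "complex^'n" and i t
  proof -
   have "(1 - (1/2)^i) * exp (2 * L * t) \<le> 1 * exp (2 * L * T)"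
    using that L by (intro mult_mono) (auto simp: power_le_one)
   moreover have "1 \<le> exp (2 * L * T)" using L T by simp
   ultimately have "1 + (1 - (1/2)^i) * exp (2 * L * t) \<le> 2 * exp (2 * L * T)" by linarith
   hence "norm y * (1 + (1 - (1/2)^i) * exp (2 * L * t)) \<le> \<rho> * (2 * exp (2 * L * T))"
    using that \<rho> by (intro mult_mono) (auto simp: power_le_one)
   thus ?thesis by (simp add: \<rho>r)
  qed
  have ck: "continuous_on ?D (%(y, t). u k y t)" using Suc by blast
  have Kck: "continuous_on ?D (%(y, s). K (u k y s))"
  proof -
   have "continuous_on ?D (%p. K ((%(y, t). u k y t) p))"
    by (rule continuous_on_compose2[OF Kc ck]) (use order_trans[OF bnd in_r] in auto)
   thus ?thesis by (simp add: case_prod_beta)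
  qed
  have cS: "continuous_on ?D (%(y, t). u (Suc k) y t)"
   using continuous_on_indefinite_integral_param[OF Kck] unfolding uS case_prod_beta
   by (intro continuous_intros)
  have KcS: "continuous_on ?D (%(y, s). K (u (Suc k) y s))"
  proof -
   have "continuous_on ?D (%p. K ((%(y, t). u (Suc k) y t) p))"
    by (rule continuous_on_compose2[OF Kc cS]) (use order_trans[OF bnd' in_r] in auto)
   thus ?thesis by (simp add: case_prod_beta)
  qed
  have sect: "continuous_on {0..t} (F y)" if "continuous_on ?D (%(y, s). F y s)" "y \<in> ball 0 \<rho>" "t \<in> {0..T}" for F :: "_ => _ => complex^'n" and y t
  proof -
   have "continuous_on {0..t} (%s. (%(y, s). F y s) (y, s))"
    by (rule continuous_on_compose2[OF that(1)]) (use that in \<open>auto intro!: continuous_intros\<close>)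
   thus ?thesis by simp
  qed
  have "norm (u (Suc (Suc k)) y t - u (Suc k) y t) \<le> norm y * (1/2)^(Suc (Suc k)) * exp (2 * L * t)"
   if y: "y \<in> ball 0 \<rho>" and t: "t \<in> {0..T}" for y t
  proof -
   have "u (Suc (Suc k)) y t - u (Suc k) y t = integral {0..t} (%s. K (u (Suc k) y s)) - integral {0..t} (%s. K (u k y s))"
    by (subst (1) uS, subst (2) uS) simp
   also have "\<dots> = integral {0..t} (%s. K (u (Suc k) y s) - K (u k y s))"
    by (intro integral_diff[symmetric] integrable_continuous_real sect[OF KcS y t] sect[OF Kck y t])
   also have "norm \<dots> \<le> integral {0..t} (%s. (L * (norm y * (1/2)^(Suc k))) * exp (2 * L * s))"
   proof (rule integral_norm_bound_integral)
    show "(%s. K (u (Suc k) y s) - K (u k y s)) integrable_on {0..t}"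
     by (intro integrable_continuous_real continuous_intros sect[OF KcS y t] sect[OF Kck y t])
    show "(%s. (L * (norm y * (1/2)^(Suc k))) * exp (2 * L * s)) integrable_on {0..t}"
     by (intro integrable_continuous_real continuous_intros)
    fix s assume "s \<in> {0..t}"
    hence s: "s \<in> {0..T}" using t by auto
    have "norm (K (u (Suc k) y s) - K (u k y s)) \<le> L * norm (u (Suc k) y s - u k y s)"
     by (rule lip) (use order_trans[OF bnd'[OF y s] in_r[OF y s]] order_trans[OF bnd[OF y s] in_r[OF y s]] in auto)
    also have "\<dots> \<le> L * (norm y * (1/2)^(Suc k) * exp (2 * L * s))"
     using L dif[OF y s] by (intro mult_left_mono) auto
    finally show "norm (K (u (Suc k) y s) - K (u k y s)) \<le> (L * (norm y * (1/2)^(Suc k))) * exp (2 * L * s)" by simp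
   qed
   also have "\<dots> = (L * (norm y * (1/2)^(Suc k))) * integral {0..t} (%s. exp (2 * L * s))" by simp
   also have "\<dots> \<le> (L * (norm y * (1/2)^(Suc k))) * (exp (2 * L * t) / (2 * L))"
    using L t by (intro mult_left_mono integral_exp_le) auto
   also have "\<dots> = norm y * (1/2)^(Suc (Suc k)) * exp (2 * L * t)" using L by simp
   finally show ?thesis .
  qed
  with cS bnd' show ?case by blast
 qed
 note ind = this
 have cu: "continuous_on ?D (%(y, t). u k y t)" for k using ind by blast
 have inr: "u k y t \<in> cball 0 r" if "y \<in> ball 0 \<rho>" "t \<in> {0..T}" for k y t
 proof -
  have "(1 - (1/2)^k) * exp (2 * L * t) \<le> 1 * exp (2 * L * T)"
   using that L by (intro mult_mono) (auto simp: power_le_one)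
  moreover have "1 \<le> exp (2 * L * T)" using L T by simp
  ultimately have "1 + (1 - (1/2)^k) * exp (2 * L * t) \<le> 2 * exp (2 * L * T)" by linarith
  hence "norm y * (1 + (1 - (1/2)^k) * exp (2 * L * t)) \<le> \<rho> * (2 * exp (2 * L * T))"
   using that \<rho> by (intro mult_mono) (auto simp: power_le_one)
  moreover have "norm (u k y t) \<le> norm y * (1 + (1 - (1/2)^k) * exp (2 * L * t))" using ind that by blast
  ultimately show ?thesis by (simp add: \<rho>r)
 qed
 define U where "U = (%y t. y + (\<Sum>i. u (Suc i) y t - u i y t))"
 have "uniform_limit ?D (%n p. \<Sum>i<n. u (Suc i) (fst p) (snd p) - u i (fst p) (snd p))
     (%p. \<Sum>i. u (Suc i) (fst p) (snd p) - u i (fst p) (snd p)) sequentially"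
 proof (rule Weierstrass_m_test[where M = "%i. (r * exp (2 * L * T) * (1/2)) * (1/2)^i"])
  fix n and p :: "(complex^'n) \<times> real" assume p: "p \<in> ?D"
  have yr: "norm (fst p) \<le> r" using inr[of "fst p" "0" 0] p T by (auto simp: u0)
  have "norm (u (Suc n) (fst p) (snd p) - u n (fst p) (snd p)) \<le> norm (fst p) * (1/2)^(Suc n) * exp (2 * L * snd p)"
   using ind[of n] p by auto
  also have "\<dots> \<le> r * (1/2)^(Suc n) * exp (2 * L * T)"
   using yr p L r by (intro mult_mono) auto
  finally show "norm (u (Suc n) (fst p) (snd p) - u n (fst p) (snd p)) \<le> (r * exp (2 * L * T) * (1/2)) * (1/2)^n"
   by (simp add: algebra_simps)
 qed (intro summable_mult summable_geometric, simp)
 hence "uniform_limit ?D (%n p. fst p + (\<Sum>i<n. u (Suc i) (fst p) (snd p) - u i (fst p) (snd p)))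
     (%p. fst p + (\<Sum>i. u (Suc i) (fst p) (snd p) - u i (fst p) (snd p))) sequentially"
  by (intro uniform_limit_add uniform_limit_const)
 moreover have "fst p + (\<Sum>i<n. u (Suc i) (fst p) (snd p) - u i (fst p) (snd p)) = u n (fst p) (snd p)" for n and p :: "(complex^'n) \<times> real"
  using sum_lessThan_telescope[of "%i. u i (fst p) (snd p)" n] by (simp add: u0)
 ultimately have ul: "uniform_limit ?D (%n p. u n (fst p) (snd p)) (%p. U (fst p) (snd p)) sequentially"
  by (simp add: U_def)
 have Ucont: "continuous_on ?D (%(y, t). U y t)"
 proof -
  have "continuous_on ?D (%p. U (fst p) (snd p))"
   by (rule uniform_limit_theorem[OF _ ul]) (use cu in \<open>auto simp: case_prod_beta\<close>)
  thus ?thesis by (simp add: case_prod_beta)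
 qed
 have close: "\<exists>N. \<forall>n\<ge>N. \<forall>y\<in>ball 0 \<rho>. \<forall>t\<in>{0..T}. norm (u n y t - U y t) < e" if "e > 0" for e
  using uniform_limitD[OF ul that] by (auto simp: eventually_sequentially dist_norm)
 have Ulim: "(%n. u n y t) \<longlonglongrightarrow> U y t" if "y \<in> ball 0 \<rho>" "t \<in> {0..T}" for y t
  using tendsto_uniform_limitI[OF ul, of "(y, t)"] that by auto
 have Ur: "U y t \<in> cball 0 r" if "y \<in> ball 0 \<rho>" "t \<in> {0..T}" for y t
  by (rule closed_sequentially[OF closed_cball inr[OF that] Ulim[OF that]])
 have sect: "continuous_on {0..t} (F y)" if "continuous_on ?D (%(y, s). F y s)" "y \<in> ball 0 \<rho>" "t \<in> {0..T}" for F :: "_ => _ => complex^'n" and y t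
 proof -
  have "continuous_on {0..t} (%s. (%(y, s). F y s) (y, s))"
   by (rule continuous_on_compose2[OF that(1)]) (use that in \<open>auto intro!: continuous_intros\<close>)
  thus ?thesis by simp
 qed
 have KU: "continuous_on ?D (%(y, s). K (U y s))"
 proof -
  have "continuous_on ?D (%p. K ((%(y, t). U y t) p))"
   by (rule continuous_on_compose2[OF Kc Ucont]) (use Ur in auto)
  thus ?thesis by (simp add: case_prod_beta)
 qed
 have Ku: "continuous_on ?D (%(y, s). K (u k y s))" for k
 proof -
  have "continuous_on ?D (%p. K ((%(y, t). u k y t) p))"
   by (rule continuous_on_compose2[OF Kc cu]) (use inr in auto)
  thus ?thesis by (simp add: case_prod_beta)
 qed
 have fix_eq: "U y t = y + integral {0..t} (%s. K (U y s))" if y: "y \<in> ball 0 \<rho>" and t: "t \<in> {0..T}" for y t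
 proof -
  have "norm (U y t - (y + integral {0..t} (%s. K (U y s)))) \<le> e" if e: "e > 0" for e
  proof -
   define \<eta> where "\<eta> = e / (1 + L * T)"
   have LT: "1 + L * T > 0" using L T by (simp add: add_pos_nonneg)
   have \<eta>: "\<eta> > 0" using e LT by (simp add: \<eta>_def)
   obtain N where N: "\<And>n y t. n \<ge> N ==> y \<in> ball 0 \<rho> ==> t \<in> {0..T} ==> norm (u n y t - U y t) < \<eta>"
    using close[OF \<eta>] by blast
   have "norm (integral {0..t} (%s. K (u N y s) - K (U y s))) \<le> (L * \<eta>) * (t - 0)"
   proof (rule integral_bound)
    show "continuous_on {0..t} (%s. K (u N y s) - K (U y s))"
     by (intro continuous_intros sect[OF Ku y t] sect[OF KU y t])
    fix s assume "s \<in> {0..t}"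
    hence s: "s \<in> {0..T}" using t by auto
    have "norm (K (u N y s) - K (U y s)) \<le> L * norm (u N y s - U y s)"
     by (rule lip[OF inr[OF y s] Ur[OF y s]])
    also have "\<dots> \<le> L * \<eta>" using N[OF order_refl y s] L by (intro mult_left_mono) auto
    finally show "norm (K (u N y s) - K (U y s)) \<le> L * \<eta>" .
   qed (use t in auto)
   also have "\<dots> \<le> L * \<eta> * T" using t L \<eta> by (intro mult_left_mono) auto
   also have "integral {0..t} (%s. K (u N y s) - K (U y s)) = integral {0..t} (%s. K (u N y s)) - integral {0..t} (%s. K (U y s))"
    by (intro integral_diff integrable_continuous_real sect[OF Ku y t] sect[OF KU y t])
   finally have 1: "norm (integral {0..t} (%s. K (u N y s)) - integral {0..t} (%s. K (U y s))) \<le> L * \<eta> * T" .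
   have 2: "norm (u (Suc N) y t - U y t) < \<eta>" by (rule N) (use y t in auto)
   have "U y t - (y + integral {0..t} (%s. K (U y s))) =
     (integral {0..t} (%s. K (u N y s)) - integral {0..t} (%s. K (U y s))) - (u (Suc N) y t - U y t)"
    by (simp add: uS)
   also have "norm \<dots> \<le> L * \<eta> * T + \<eta>" using 1 2 norm_triangle_ineq4 by (smt (verit, best))
   also have "\<dots> = \<eta> * (1 + L * T)" by (simp add: algebra_simps)
   also have "\<dots> = e" using LT by (simp add: \<eta>_def)
   finally show ?thesis .
  qed
  hence "norm (U y t - (y + integral {0..t} (%s. K (U y s)))) \<le> 0" by (rule field_le_epsilon) simp
  thus ?thesis by simp
 qed
 have der: "((%t. U y t) has_vector_derivative K (U y t)) (at t within {0..T})" if y: "y \<in> ball 0 \<rho>" and t: "t \<in> {0..T}" for y t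
 proof -
  have "((%t. y + integral {0..t} (%s. K (U y s))) has_vector_derivative 0 + K (U y t)) (at t within {0..T})"
   using y t T by (intro has_vector_derivative_add has_vector_derivative_const integral_has_vector_derivative sect[OF KU]) auto
  thus ?thesis using fix_eq[OF y] t by (auto intro: has_vector_derivative_transform)
 qed
 have ch: "cholv (ball 0 \<rho>) (%y. u k y t)" if "t \<in> {0..T}" for k t
  using that
 proof (induction k arbitrary: t)
  case (Suc k)
  have "cholv (ball 0 \<rho>) (%y. integral {0..t} (%s. K (u k y s)))"
  proof (rule cholv_integral)
   show "continuous_on (ball 0 \<rho> \<times> {0..t}) (%(y, s). K (u k y s))"
    by (rule continuous_on_subset[OF Ku]) (use Suc in auto)
   fix s assume "s \<in> {0..t}"
   hence s: "s \<in> {0..T}" using Suc by auto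
   show "cholv (ball 0 \<rho>) (%y. K (u k y s))"
   proof (rule cholv_comp[OF K Suc.IH[OF s]])
    have "u k y s \<in> ball 0 R0" if "y \<in> ball 0 \<rho>" for y using inr[OF that s, of k] r by auto
    thus "(%y. u k y s) ` ball 0 \<rho> \<subseteq> ball 0 R0" by blast
   qed
  qed (use Suc in auto)
  thus ?case unfolding uS by (intro cholv_add cholv_id)
 qed (simp add: u0)
 have chU: "cholv (ball 0 \<rho>) (%y. U y t)" if t: "t \<in> {0..T}" for t
  unfolding cholv_def
 proof
  fix i
  show "chol (ball 0 \<rho>) (%y. U y t $ i)"
  proof (rule chol_uniform_limit[OF open_ball cholv_nth[OF ch[OF t]]])
   show "uniform_limit (ball 0 \<rho>) (%n y. u n y t $ i) (%y. U y t $ i) sequentially"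
   proof (rule uniform_limitI)
    fix e :: real assume "e > 0"
    from close[OF this] obtain N where "\<forall>n\<ge>N. \<forall>y\<in>ball 0 \<rho>. \<forall>t\<in>{0..T}. norm (u n y t - U y t) < e" by blast
    hence "\<forall>n\<ge>N. \<forall>y\<in>ball 0 \<rho>. dist (u n y t $ i) (U y t $ i) < e"
     using t by (metis (no_types, lifting) dist_norm dist_vec_nth_le order_le_less_trans)
    thus "\<forall>\<^sub>F n in sequentially. \<forall>y\<in>ball 0 \<rho>. dist (u n y t $ i) (U y t $ i) < e"
     by (auto simp: eventually_sequentially)
   qed
  qed
 qed
 have U0: "U y 0 = y" if "y \<in> ball 0 \<rho>" for y using fix_eq[OF that, of 0] T by simp
 have "\<rho> \<le> r"
 proof -
  have "1 \<le> exp (2 * L * T)" using L T by simp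
  hence "1 \<le> 2 * exp (2 * L * T)" by linarith
  hence "\<rho> * 1 \<le> \<rho> * (2 * exp (2 * L * T))" using \<rho> by (intro mult_left_mono) linarith+
  thus ?thesis by (simp add: \<rho>r)
 qed
 with \<rho> Ucont chU U0 Ur der show ?thesis by (intro exI[of _ \<rho>] exI[of _ U]) auto
qed

section \<open>The chart\<close>

lemma chol_polynomial_fun:
 assumes "polynomial_fun h" shows "chol S h"
proof -
 obtain E a where *: "h = (%x. \<Sum>e\<in>E. a e * (\<Prod>i\<in>UNIV. (x $ i) ^ e i))"
  using assms unfolding polynomial_fun_def by blast
 show ?thesis unfolding * by (intro chol_sum chol_mult chol_const chol_prod chol_power chol_nth)
qed

lemma det_zero_iff_kernel:
 fixes A :: "complex^'n::finite^'n"
 shows "det A = 0 \<longleftrightarrow> (\<exists>u. u ~= 0 \<and> A *v u = 0)"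
 using invertible_det_nz[of A] invertible_left_inverse[of A] matrix_left_invertible_ker[of A] by metis

lemma det_column_scale:
 fixes A :: "'a::comm_ring_1^'n::finite^'n"
 shows "det (\<chi> i l. if l = k then t * u i else A $ i $ l) = t * det (\<chi> i l. if l = k then u i else A $ i $ l)"
proof -
 have "det (\<chi> i l. if l = k then t * u i else A $ i $ l) = det (\<chi> i. if i = k then t *s (\<chi> l. u l) else (\<chi> l. A $ l $ i))"
  by (subst det_transpose[symmetric]) (auto intro!: arg_cong[where f = det] simp: transpose_def vec_eq_iff)
 also have "\<dots> = t * det (\<chi> i. if i = k then (\<chi> l. u l) else (\<chi> l. A $ l $ i))" by (rule det_row_mul)
 also have "det (\<chi> i. if i = k then (\<chi> l. u l) else (\<chi> l. A $ l $ i)) = det (\<chi> i l. if l = k then u i else A $ i $ l)"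
  by (subst det_transpose[symmetric]) (auto intro!: arg_cong[where f = det] simp: transpose_def vec_eq_iff)
 finally show ?thesis .
qed

lemma continuous_on_det:
 fixes A :: "complex => complex^'n::finite^'n"
 assumes "\<And>i l. continuous_on S (%x. A x $ i $ l)"
 shows "continuous_on S (%x. det (A x))"
 unfolding det_def by (intro continuous_intros assms)

text \<open>Dividing the eigenvector \<open>v\<close> out of \<open>K\<close> removes one factor \<open>x + 1\<close> of the characteristic polynomial.\<close>

lemma quotient_eigenvalues:
 fixes K :: "complex^'m::finite^'m" and v :: "complex^'m" and m :: nat and \<Lambda> :: "nat => complex"
 assumes Kv: "K *v v = - v" and vj: "v $ j ~= 0" and m: "m \<ge> 1"
  and chi: "\<And>x. det (mat x - K) = (\<Prod>i=1..m. x - \<Lambda> i)" and first: "\<Lambda> 1 = -1"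
 shows "(\<exists>i\<in>{2..m}. \<mu> = \<Lambda> i) \<longleftrightarrow> (\<exists>w t. w $ j = 0 \<and> w ~= 0 \<and> K *v w = \<mu> *s w + t *s v)"
proof -
 \<comment> \<open>By Cramer's rule, \<open>v $ j * det (mat x - K)\<close> is the determinant in
   which column \<open>j\<close> is replaced by \<open>(mat x - K) *v v = (x + 1) *s v\<close>.
   Pulling out \<open>x + 1\<close> leaves column \<open>j\<close> equal to
   \<open>v\<close>.\<close>
 define N where "N = (%x. (\<chi> i l. if l = j then v $ i else (mat x - K) $ i $ l) :: complex^'m^'m)"
 have 1: "v $ j * det (mat x - K) = (x + 1) * det (N x)" for x
 proof -
  have "(mat x - K) *v v = (x + 1) *s v"
  proof -
   have "mat x *v v = x *s v" by (simp add: matrix_vector_mult_def mat_def vec_eq_iff if_distrib if_distribR sum.delta cong: if_cong)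
   thus ?thesis using Kv by (simp add: matrix_vector_mult_diff_rdistrib vec_eq_iff algebra_simps)
  qed
  hence h: "((mat x - K) *v v) $ i = (x + 1) * v $ i" for i by (simp add: distrib_right)
  have "v $ j * det (mat x - K) = det (\<chi> i l. if l = j then (x + 1) * v $ i else (mat x - K) $ i $ l)"
   using cramer_lemma[of j "mat x - K" v] unfolding h by simp
  also have "\<dots> = (x + 1) * det (N x)" unfolding N_def by (rule det_column_scale)
  finally show ?thesis .
 qed
 have split: "(\<Prod>i=1..m. x - \<Lambda> i) = (x + 1) * (\<Prod>i=2..m. x - \<Lambda> i)" for x
  using m first by (subst prod.atLeast_Suc_atMost) (auto simp: numeral_2_eq_2)
 have 2: "det (N x) = v $ j * (\<Prod>i=2..m. x - \<Lambda> i)" if "x ~= -1" for x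
 proof -
  have "x + 1 ~= 0" using that by (simp add: add_eq_0_iff2)
  thus ?thesis using 1[of x] chi[of x] split[of x] by simp
 qed
 \<comment> \<open>At \<open>x = -1\<close> the factor \<open>x + 1\<close> cannot be cancelled, but
   both sides are continuous in \<open>x\<close>.\<close>
 have 3: "det (N x) = v $ j * (\<Prod>i=2..m. x - \<Lambda> i)" for x
 proof (cases "x = -1")
  case True
  have c1: "continuous_on UNIV (%x. det (N x))"
  proof (rule continuous_on_det)
   fix i l
   show "continuous_on UNIV (%x. N x $ i $ l)"
    by (cases "l = j"; cases "i = l") (auto simp: N_def mat_def intro!: continuous_intros)
  qed
  have c2: "continuous_on UNIV (%x. v $ j * (\<Prod>i=2..m. x - \<Lambda> i))" by (intro continuous_intros)
  have l1: "((%x. det (N x)) \<longlongrightarrow> det (N (-1))) (at (-1))"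
   using c1 by (simp add: continuous_on_eq_continuous_at isCont_def)
  have l2: "((%x. v $ j * (\<Prod>i=2..m. x - \<Lambda> i)) \<longlongrightarrow> v $ j * (\<Prod>i=2..m. -1 - \<Lambda> i)) (at (-1))"
   using c2 unfolding continuous_on_eq_continuous_at[OF open_UNIV] isCont_def by blast
  have "((%x. det (N x)) \<longlongrightarrow> v $ j * (\<Prod>i=2..m. -1 - \<Lambda> i)) (at (-1))"
   by (rule Lim_transform_eventually[OF l2]) (auto simp: eventually_at_filter 2)
  with l1 have "det (N (-1)) = v $ j * (\<Prod>i=2..m. -1 - \<Lambda> i)"
   by (intro tendsto_unique[OF _ l1]) auto
  thus ?thesis using True by simp
 qed (rule 2)
 \<comment> \<open>A vector \<open>u\<close> in the kernel of \<open>N \<mu>\<close> encodes a pair: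
   its entries off \<open>j\<close> form \<open>w\<close>, and its entry at \<open>j\<close> is the
   multiple of \<open>v\<close> by which \<open>w\<close> fails to be an eigenvector.\<close>
 have Nw: "N \<mu> *v u = \<mu> *s w - K *v w + u $ j *s v" if "w = (\<chi> l. if l = j then 0 else u $ l)" for u w
 proof -
  have "(N \<mu> *v u) $ i = (\<mu> *s w - K *v w + u $ j *s v) $ i" for i
  proof -
   have "(N \<mu> *v u) $ i = v $ i * u $ j + (\<Sum>l\<in>UNIV - {j}. (mat \<mu> - K) $ i $ l * u $ l)"
    by (simp add: matrix_vector_mult_def N_def sum.remove[of UNIV j])
   also have "(\<Sum>l\<in>UNIV - {j}. (mat \<mu> - K) $ i $ l * u $ l) = (\<Sum>l\<in>UNIV. (mat \<mu> - K) $ i $ l * w $ l)"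
    by (rule sum.mono_neutral_cong_left) (auto simp: that)
   also have "\<dots> = (\<Sum>l\<in>UNIV. mat \<mu> $ i $ l * w $ l) - (\<Sum>l\<in>UNIV. K $ i $ l * w $ l)"
    by (simp add: algebra_simps sum_subtractf)
   also have "(\<Sum>l\<in>UNIV. mat \<mu> $ i $ l * w $ l) = \<mu> * w $ i"
    by (simp add: mat_def if_distrib if_distribR sum.delta cong: if_cong)
   finally show ?thesis by (simp add: matrix_vector_mult_def mult.commute)
  qed
  thus ?thesis by (simp add: vec_eq_iff)
 qed
 have "(\<exists>i\<in>{2..m}. \<mu> = \<Lambda> i) \<longleftrightarrow> det (N \<mu>) = 0" using vj by (auto simp: 3)
 also have "\<dots> \<longleftrightarrow> (\<exists>u. u ~= 0 \<and> N \<mu> *v u = 0)" by (rule det_zero_iff_kernel)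
 also have "\<dots> \<longleftrightarrow> (\<exists>w t. w $ j = 0 \<and> w ~= 0 \<and> K *v w = \<mu> *s w + t *s v)"
 proof
  assume "\<exists>u. u ~= 0 \<and> N \<mu> *v u = 0"
  then obtain u where u: "u ~= 0" "N \<mu> *v u = 0" by blast
  define w where "w = (\<chi> l. if l = j then 0 else u $ l)"
  have eq: "\<mu> *s w - K *v w + u $ j *s v = 0" using Nw[OF w_def] u by simp
  hence "K *v w = \<mu> *s w + u $ j *s v" by (simp add: algebra_simps eq_neg_iff_add_eq_0)
  moreover have "w ~= 0"
  proof
   assume w: "w = 0"
   hence "u $ j *s v = 0" using eq by simp
   hence "u $ j = 0" using vj by (metis mult_eq_0_iff vector_smult_component zero_index)
   moreover have "u $ l = 0" if "l ~= j" for l using w that by (simp add: w_def vec_eq_iff) metis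
   ultimately show False using u by (metis vec_eq_iff zero_index)
  qed
  moreover have "w $ j = 0" by (simp add: w_def)
  ultimately show "\<exists>w t. w $ j = 0 \<and> w ~= 0 \<and> K *v w = \<mu> *s w + t *s v" by blast
 next
  assume "\<exists>w t. w $ j = 0 \<and> w ~= 0 \<and> K *v w = \<mu> *s w + t *s v"
  then obtain w t where w: "w $ j = 0" "w ~= 0" "K *v w = \<mu> *s w + t *s v" by blast
  define u where "u = (\<chi> l. if l = j then t else w $ l)"
  have wu: "w = (\<chi> l. if l = j then 0 else u $ l)" using w by (auto simp: u_def vec_eq_iff)
  have "N \<mu> *v u = 0" using Nw[OF wu] w by (simp add: u_def)
  moreover have "u ~= 0"
  proof
   assume "u = 0"
   hence "w = 0" unfolding wu by (simp add: vec_eq_iff)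
   with w(2) show False by simp
  qed
  ultimately show "\<exists>u. u ~= 0 \<and> N \<mu> *v u = 0" by blast
 qed
 finally show ?thesis .
qed

section \<open>The vector field in the chart and its fixed point\<close>

locale qh_chart =
 fixes f g :: "'m::finite => complex^'m => complex => complex"
  and p :: "'m => nat" and r :: nat
  and c :: "complex^'m" and j :: 'm and b :: complex
  and G :: "'m => complex^('m option) => complex"
 assumes system: "quasihomogeneous_system f g p r"
  and root: "\<And>i. - of_nat (p i) * c $ i = f i c 0"
  and cj: "c $ j ~= 0"
  and branch: "b ^ p j = c $ j"
  and chartG: "chart_G g p r j G"
begin

abbreviation "V \<equiv> chart_field f G p r j"
abbreviation "ys \<equiv> chart_fixpoint p c j b"
abbreviation "J \<equiv> jacobi_matrix V ys"
text \<open>\<open>hh j\<close> is the common denominator of the chart field. With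
  \<open>kk\<close>, each component of \<open>V\<close>, that of \<epsilon> excepted, is its weight
  times the coordinate plus \<open>kk\<close> times a further term. Along a solution with
  \<open>\<epsilon> = \<tau>\<^sup>s\<close>, \<open>kk\<close> is the derivative of
  \<open>z\<close> with respect to \<open>\<tau>\<close>.\<close>

definition "hh i Y = f i (chart_X j Y) (Y $ None) + Y $ Some j * G i Y"
definition "kk Y = - of_nat (p j) / hh j Y"

lemma p_pos: "p i > 0" and r_pos: "r > 0"
 using system unfolding quasihomogeneous_system_def by blast+

lemma homog: "f i (wscale p \<mu> x) (\<mu> ^ r * z) = \<mu> ^ (p i + 1) * f i x z"
 using system unfolding quasihomogeneous_system_def by blast

lemma homog0: "f i (wscale p \<mu> x) 0 = \<mu> ^ (p i + 1) * f i x 0"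
 using homog[of i \<mu> x 0] by simp

lemma b_nz: "b ~= 0" using cj branch p_pos[of j] by (metis power_0_left less_irrefl)

lemma V_None: "V Y $ None = of_nat r * Y $ None + kk Y * Y $ Some j"
 and V_j: "V Y $ Some j = of_nat (r + 1) * Y $ Some j"
 and V_i: "i ~= j ==> V Y $ Some i = of_nat (p i) * Y $ Some i + kk Y * hh i Y"
 by (simp_all add: chart_field_def Let_def kk_def hh_def)

lemma chol_poly_xz:
 fixes q :: "complex^'m => complex => complex"
 assumes "polynomial_xz q" "cholv S X" "chol S z" shows "chol S (%Y. q (X Y) (z Y))"
proof -
 have "chol S (%Y. (%v :: complex^('m option). q (\<chi> l. v $ Some l) (v $ None)) (\<chi> q. case q of None => z Y | Some l => X Y $ l))"
 proof (rule chol_comp[where T = UNIV])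
  show "chol UNIV (%v :: complex^('m option). q (\<chi> l. v $ Some l) (v $ None))"
   using assms(1) unfolding polynomial_xz_def by (rule chol_polynomial_fun)
  show "cholv S (%Y. \<chi> q. case q of None => z Y | Some l => X Y $ l)"
  proof (rule cholv_vec)
   fix q :: "'m option"
   show "chol S (%Y. case q of None => z Y | Some l => X Y $ l)"
    by (cases q) (use assms cholv_nth in auto)
  qed
 qed auto
 thus ?thesis by simp
qed

lemma cholv_chart_X: "cholv S (chart_X j)"
 unfolding chart_X_def
proof (rule cholv_vec)
 fix i show "chol S (%Y. if i = j then 1 else Y $ Some i)" by (cases "i = j") auto
qed

lemma chol_hh: "chol S (hh i)"
proof -
 have pf: "polynomial_xz (f i)" using system unfolding quasihomogeneous_system_def by blast
 have "polynomial_fun (G i)" using chartG unfolding chart_G_def by blast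
 hence "chol S (%Y. Y $ Some j * G i Y)" by (intro chol_mult chol_nth chol_polynomial_fun)
 with chol_poly_xz[OF pf cholv_chart_X chol_nth] show ?thesis unfolding hh_def by (rule chol_add)
qed

lemma ys_simps [simp]: "ys $ None = 0" "ys $ Some j = 0"
 by (simp_all add: chart_fixpoint_def)

lemma X_ys: "chart_X j ys = wscale p (1 / b) c"
proof -
 have "(1 / b) ^ p j * c $ j = 1" using cj by (simp add: power_divide branch)
 thus ?thesis by (auto simp: vec_eq_iff chart_X_def chart_fixpoint_def wscale_def power_int_minus power_divide field_simps)
qed

text \<open>Homogeneity at the factor \<open>1 / b\<close> carries the root equation from
  \<open>c\<close> to the chart. From this follow \<open>kk ys = b\<close> and the vanishing of
  \<open>V\<close> at \<open>ys\<close>.\<close>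

lemma hh_ys: "hh i ys = - of_nat (p i) * chart_X j ys $ i / b"
proof -
 have "hh i ys = f i (wscale p (1 / b) c) 0" by (simp add: hh_def X_ys)
 also have "\<dots> = (1 / b) ^ (p i + 1) * f i c 0" by (rule homog0)
 also have "f i c 0 = - of_nat (p i) * c $ i" using root by simp
 finally show ?thesis by (simp add: X_ys wscale_def)
qed

lemma hh_j_ys: "hh j ys = - of_nat (p j) / b"
 by (simp add: hh_ys chart_X_def)

lemma hh_j_ys_nz: "hh j ys ~= 0"
 using hh_j_ys p_pos[of j] b_nz by simp

lemma kk_ys: "kk ys = b"
 using p_pos[of j] b_nz by (simp add: kk_def hh_j_ys)

lemma V_ys: "V ys = 0"
proof -
 have "V ys $ q = 0" for q
 proof (cases q)
  case (Some i)
  show ?thesis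
  proof (cases "i = j")
   case False
   thus ?thesis using b_nz Some by (simp add: V_i kk_ys hh_ys chart_X_def)
  qed (use Some in \<open>simp add: V_j\<close>)
 qed (simp add: V_None)
 thus ?thesis by (simp add: vec_eq_iff)
qed

lemma chol_kk: "(\<And>Y. Y \<in> S ==> hh j Y ~= 0) ==> chol S kk"
 unfolding kk_def by (intro chol_divide chol_const chol_hh)

lemma cholv_V:
 assumes "\<And>Y. Y \<in> S ==> hh j Y ~= 0" shows "cholv S V"
 unfolding cholv_def
proof
 fix q show "chol S (%Y. V Y $ q)"
 proof (cases q)
  case (Some i)
  show ?thesis
  proof (cases "i = j")
   case True
   show ?thesis unfolding Some True V_j by (intro chol_mult chol_const chol_nth)
  next
   case False
   show ?thesis unfolding Some V_i[OF False] by (intro chol_add chol_mult chol_const chol_nth chol_kk assms chol_hh)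
  qed
 next
  case None
  show ?thesis unfolding None V_None by (intro chol_add chol_mult chol_const chol_nth chol_kk assms)
 qed
qed

text \<open>A ball on which the loops of the contour formula stay away from the singularities.\<close>

lemma good_ball: "\<exists>R>0. \<forall>Y\<in>ball ys R. hh j Y ~= 0 \<and> norm (kk Y - b) < norm b / 16"
proof -
 have "isCont (hh j) ys" using chol_continuous[OF chol_hh[of UNIV]] by (simp add: continuous_on_eq_continuous_at)
 hence 1: "\<forall>\<^sub>F Y in nhds ys. hh j Y ~= 0"
  using hh_j_ys_nz unfolding isCont_def by (metis continuous_within isCont_def t1_space_nhds tendsto_at_iff_tendsto_nhds tendsto_imp_eventually_ne)
 have "isCont kk ys" unfolding kk_def
  using \<open>isCont (hh j) ys\<close> hh_j_ys_nz by (intro continuous_intros)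
 \<comment> \<open>The 16 is dictated by \<open>tt_near\<close>: there the deviation of
   \<open>kk\<close> from \<open>b\<close> is integrated over an interval of length 2 pi and counted
   twice, and \<open>2 * (2 * pi) / 16 = pi / 4 < 1\<close>.\<close>
 hence "\<forall>\<^sub>F Y in nhds ys. dist (kk Y) (kk ys) < norm b / 16"
  by (intro tendstoD) (use b_nz in \<open>simp_all add: isCont_def tendsto_at_iff_tendsto_nhds\<close>)
 with 1 have "\<forall>\<^sub>F Y in nhds ys. hh j Y ~= 0 \<and> norm (kk Y - b) < norm b / 16"
  by eventually_elim (simp add: kk_ys dist_norm)
 thus ?thesis by (auto simp: eventually_nhds_metric dist_commute)
qed

definition RV where "RV = (SOME R. R > 0 \<and> (\<forall>Y\<in>ball ys R. hh j Y ~= 0 \<and> norm (kk Y - b) < norm b / 16))"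

lemma RV: "RV > 0" "Y \<in> ball ys RV ==> hh j Y ~= 0" "Y \<in> ball ys RV ==> norm (kk Y - b) < norm b / 16"
proof -
 have "\<exists>R. R > 0 \<and> (\<forall>Y\<in>ball ys R. hh j Y ~= 0 \<and> norm (kk Y - b) < norm b / 16)" using good_ball by blast
 note * = someI_ex[OF this, folded RV_def]
 show "RV > 0" using * by (rule conjunct1)
 show "hh j Y ~= 0" "norm (kk Y - b) < norm b / 16" if "Y \<in> ball ys RV"
  using conjunct2[OF *] that by blast+
qed

lemma cholv_W: "cholv (ball 0 RV) (%x. V (ys + x))"
 by (rule cholv_comp[of "ball ys RV", OF cholv_V]) (auto intro!: cholv_add RV simp: dist_norm)

section \<open>The Jacobi matrix and the Kovalevskaya matrix\<close>

lemma J_cjac: "cjac (%x. V (ys + x)) 0 = J"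
proof -
 have "w *s axis l 1 = (axis l w :: complex^('m option))" for w l by (simp add: axis_def vec_eq_iff)
 thus ?thesis by (simp add: cjac_def jacobi_matrix_def cdir_def)
qed

lemma V_deriv: "((%x. V (ys + x)) has_derivative (*v) J) (at 0)"
 using cholv_deriv[OF cholv_W, of 0] RV by (simp add: J_cjac)

lemma J_line: "((%\<zeta>. V (ys + \<zeta> *s v) $ q) has_field_derivative (J *v v) $ q) (at 0)"
 using chol_line_deriv[OF cholv_nth[OF cholv_W, of q], of 0 0 v] RV
 by (simp flip: J_cjac add: cjac_nth[OF cholv_W])

lemma J_eps: "(J *v v) $ Some j = of_nat (r + 1) * v $ Some j"
proof -
 have "((%\<zeta>. V (ys + \<zeta> *s v) $ Some j) has_field_derivative of_nat (r + 1) * v $ Some j) (at 0)"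
  unfolding V_j by (auto intro!: derivative_eq_intros)
 thus ?thesis using J_line[of v "Some j"] DERIV_unique by blast
qed

lemma kk_line: "((%\<zeta>. kk (ys + \<zeta> *s v)) has_field_derivative cdir kk ys v) (at 0)"
proof -
 have "chol (ball ys RV) kk" by (rule chol_kk[OF RV(2)])
 from chol_line_deriv[OF this, of ys 0 v] show ?thesis using RV(1) by simp
qed

text \<open>The rows of \<epsilon> and \<open>Z\<close> involve only these two coordinates, so
  \<open>J\<close> is block triangular with \<open>r + 1\<close> and \<open>r\<close> on that part
  of the diagonal. The off-diagonal entry \<open>b\<close> is \<open>kk ys\<close>.\<close>

lemma J_Z: "(J *v v) $ None = of_nat r * v $ None + b * v $ Some j"
proof -
 have "((%\<zeta>. V (ys + \<zeta> *s v) $ None) has_field_derivative of_nat r * v $ None + b * v $ Some j) (at 0)"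
  unfolding V_None by (auto intro!: derivative_eq_intros kk_line simp: kk_ys)
 thus ?thesis using J_line[of v None] DERIV_unique by blast
qed

text \<open>Chart directions as tangent vectors at \<open>c\<close>: undoing the scaling by
  \<open>1 / b\<close> multiplies entry \<open>l\<close> by \<open>b ^ p l\<close>, and the
  normalization \<open>X\<^sub>j = 1\<close> makes entry \<open>j\<close> zero.\<close>

definition liftX :: "complex^('m option) => complex^'m" where
 "liftX y = (\<chi> l. if l = j then 0 else b ^ p l * y $ Some l)"

abbreviation "K \<equiv> kovalevskaya_matrix f p c"
text \<open>The Euler vector of the weighted dilations at \<open>c\<close>; it is the eigenvector of
  \<open>K\<close> for the exponent -1.\<close>

definition "vc = (\<chi> i. of_nat (p i) * c $ i)"

lemma chol_f0: "chol S (%x. f i x 0)"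
proof -
 have "polynomial_xz (f i)" using system unfolding quasihomogeneous_system_def by blast
 from chol_poly_xz[OF this cholv_id chol_const] show ?thesis .
qed

lemma K_line: "((%\<zeta>. f i (c + \<zeta> *s w) 0) has_field_derivative (K *v w) $ i - of_nat (p i) * w $ i) (at 0)"
proof -
 have "((%\<zeta>. f i (c + \<zeta> *s w) 0) has_field_derivative cdir (%x. f i x 0) c w) (at 0)"
  using chol_line_deriv[OF chol_f0[of UNIV i], where x = c and \<zeta> = 0 and v = w] by simp
 moreover have "cdir (%x. f i x 0) c w = (\<Sum>l\<in>UNIV. deriv (%t. f i (c + axis l t) 0) 0 * w $ l)"
 proof -
  have "t *s axis l 1 = (axis l t :: complex^'m)" for t l by (simp add: axis_def vec_eq_iff)
  thus ?thesis using cdir_expand[OF chol_f0[of UNIV i], of c w] by (simp add: cdir_def)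
 qed
 moreover have "(K *v w) $ i = (\<Sum>l\<in>UNIV. deriv (%t. f i (c + axis l t) 0) 0 * w $ l) + of_nat (p i) * w $ i"
 proof -
  have "(K *v w) $ i = (\<Sum>l\<in>UNIV. deriv (%t. f i (c + axis l t) 0) 0 * w $ l) + (\<Sum>l\<in>UNIV. (if i = l then of_nat (p i) else 0) * w $ l)"
   by (simp only: matrix_vector_mult_def kovalevskaya_matrix_def vec_lambda_beta distrib_right sum.distrib)
  also have "(\<Sum>l\<in>UNIV. (if i = l then of_nat (p i) else 0) * w $ l) = (\<Sum>l\<in>UNIV. if i = l then of_nat (p i) * w $ l else 0)"
   by (intro sum.cong) auto
  finally show ?thesis by simp
 qed
 ultimately show ?thesis by simp
qed

text \<open>The function \<open>f i (wscale p \<mu> c) 0\<close> is differentiated at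
  \<open>\<mu> = 1\<close> in two ways, by homogeneity and by the chain rule.\<close>

lemma K_vc: "K *v vc = - vc"
proof -
 have "(K *v vc) $ i = - vc $ i" for i
 proof -
  have "((%\<mu>. f i (wscale p \<mu> c) 0) has_field_derivative of_nat (p i + 1) * f i c 0) (at 1)"
   unfolding homog0 by (auto intro!: derivative_eq_intros)
  moreover have "((%\<mu>. f i (wscale p \<mu> c) 0) has_field_derivative (K *v vc) $ i - of_nat (p i) * vc $ i) (at 1)"
  proof -
   have "((%\<mu>. wscale p \<mu> c) has_derivative (%h. h *s vc)) (at 1)"
   proof (rule has_derivative_vecI)
    fix l
    have "((%\<mu>. \<mu> ^ p l * c $ l) has_field_derivative vc $ l) (at 1)"
     by (auto intro!: derivative_eq_intros simp: vc_def)
    thus "((%\<mu>. wscale p \<mu> c $ l) has_derivative (%v. (v *s vc) $ l)) (at 1)"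
     by (simp add: wscale_def has_field_derivative_def mult_commute_abs)
   qed
   moreover have "wscale p 1 c = c" by (simp add: wscale_def)
   ultimately have "((%\<mu>. f i (wscale p \<mu> c) 0) has_derivative (%h. cdir (%x. f i x 0) c (h *s vc))) (at 1)"
    using has_derivative_compose[of "%\<mu>. wscale p \<mu> c" _ 1 UNIV "%x. f i x 0"] chol_deriv(1)[OF chol_f0[of UNIV i], of c] by simp
   moreover have "cdir (%x. f i x 0) c vc = (K *v vc) $ i - of_nat (p i) * vc $ i"
    using chol_line_deriv[OF chol_f0[of UNIV i], where x = c and \<zeta> = 0 and v = vc] K_line[of i vc] DERIV_unique by force
   ultimately show ?thesis
    by (simp add: has_field_derivative_def chol_deriv(2)[OF chol_f0[of UNIV i]] mult_commute_abs)
  qed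
  ultimately have "(K *v vc) $ i - of_nat (p i) * vc $ i = of_nat (p i + 1) * f i c 0" using DERIV_unique by blast
  thus ?thesis by (simp add: vc_def root[symmetric] algebra_simps)
 qed
 thus ?thesis by (simp add: vec_eq_iff)
qed

text \<open>On directions with \<open>\<epsilon> = Z = 0\<close>, the matrix \<open>J\<close> acts
  like \<open>K\<close> on the quotient by \<open>vc\<close>: the multiple of \<open>vc\<close> that
  is subtracted is the one which makes entry \<open>j\<close> vanish again.\<close>

lemma J_X:
 assumes y: "y $ Some j = 0" "y $ None = 0" and i: "i ~= j"
 shows "b ^ p i * (J *v y) $ Some i = (K *v liftX y) $ i - vc $ i / vc $ j * (K *v liftX y) $ j"
proof -
 let ?w = "liftX y"
 have ch: "chart_X j (ys + \<zeta> *s y) = wscale p (1 / b) (c + \<zeta> *s ?w)" for \<zeta>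
 proof -
  have "(1 / b) ^ p j * c $ j = 1" using cj by (simp add: power_divide branch)
  thus ?thesis using b_nz by (auto simp: vec_eq_iff chart_X_def chart_fixpoint_def wscale_def liftX_def power_int_minus power_divide field_simps)
 qed
 have h: "hh l (ys + \<zeta> *s y) = (1 / b) ^ (p l + 1) * f l (c + \<zeta> *s ?w) 0" for l \<zeta>
  by (simp add: hh_def ch homog0 y)
 let ?a = "(K *v ?w) $ i - of_nat (p i) * ?w $ i" and ?d = "(K *v ?w) $ j - of_nat (p j) * ?w $ j"
 have pj: "(of_nat (p j) :: complex) ~= 0" using p_pos[of j] by simp
 have fj: "f j c 0 = - of_nat (p j) * c $ j" "f i c 0 = - of_nat (p i) * c $ i" using root by simp_all
 have fj0: "f j c 0 ~= 0" using fj pj cj by simp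
 have q: "((%\<zeta>. f i (c + \<zeta> *s ?w) 0 / f j (c + \<zeta> *s ?w) 0) has_field_derivative (?a * f j c 0 - f i c 0 * ?d) / (f j c 0 * f j c 0)) (at 0)"
  using DERIV_divide[OF K_line[of i ?w] K_line[of j ?w]] fj0 by simp
 have "V (ys + \<zeta> *s y) $ Some i = of_nat (p i) * (ys $ Some i + \<zeta> * y $ Some i)
   - of_nat (p j) * b ^ p j / b ^ p i * (f i (c + \<zeta> *s ?w) 0 / f j (c + \<zeta> *s ?w) 0)" for \<zeta>
  unfolding V_i[OF i] kk_def h using b_nz by (simp add: power_divide field_simps)
 moreover have "((%\<zeta>. of_nat (p i) * (ys $ Some i + \<zeta> * y $ Some i)) has_field_derivative of_nat (p i) * y $ Some i) (at 0)"
  by (auto intro!: derivative_eq_intros)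
 note DERIV_diff[OF this DERIV_cmult[OF q, of "of_nat (p j) * b ^ p j / b ^ p i"]]
 ultimately have "((%\<zeta>. V (ys + \<zeta> *s y) $ Some i) has_field_derivative
    (of_nat (p i) * y $ Some i - of_nat (p j) * b ^ p j / b ^ p i * ((?a * f j c 0 - f i c 0 * ?d) / (f j c 0 * f j c 0)))) (at 0)"
  by (simp only:)
 hence "(J *v y) $ Some i = of_nat (p i) * y $ Some i - of_nat (p j) * b ^ p j / b ^ p i * ((?a * f j c 0 - f i c 0 * ?d) / (f j c 0 * f j c 0))"
  using J_line[of y "Some i"] DERIV_unique by blast
 moreover define Q where "Q = (?a * f j c 0 - f i c 0 * ?d) / (f j c 0 * f j c 0)"
 ultimately have "(J *v y) $ Some i = of_nat (p i) * y $ Some i - of_nat (p j) * b ^ p j / b ^ p i * Q" by (simp only:)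
 hence "b ^ p i * (J *v y) $ Some i = of_nat (p i) * (b ^ p i * y $ Some i) - of_nat (p j) * c $ j * Q"
  using b_nz by (simp add: branch field_simps)
 also have "b ^ p i * y $ Some i = ?w $ i" using i by (simp add: liftX_def)
 also have "of_nat (p j) * c $ j * Q = - ?a + vc $ i / vc $ j * ?d"
 proof -
  have *: "P * ((A * (- P) - (- M) * D) / ((- P) * (- P))) = - A + M / P * D" if "P ~= 0" for A D M P :: complex
   using that by (simp add: field_simps)
  have "Q = (?a * (- vc $ j) - (- vc $ i) * ?d) / ((- vc $ j) * (- vc $ j))"
   unfolding Q_def fj by (simp add: vc_def)
  moreover have "vc $ j ~= 0" using pj cj by (simp add: vc_def)
  moreover have "of_nat (p j) * c $ j = vc $ j" by (simp add: vc_def)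
  ultimately show ?thesis using *[of "vc $ j" ?a "vc $ i" ?d] by (simp only: not_False_eq_True)
 qed
 also have "?w $ j = 0" by (simp add: liftX_def)
 finally show ?thesis by simp
qed

lemma eigen_eps: "J *v y = \<mu> *s y ==> \<mu> ~= of_nat (r + 1) ==> y $ Some j = 0"
 using J_eps[of y] by (simp del: of_nat_add of_nat_Suc)

lemma eigen_Z: "J *v y = \<mu> *s y ==> \<mu> ~= of_nat r ==> y $ Some j = 0 ==> y $ None = 0"
 using J_Z[of y] by simp

context
 fixes \<Lambda> :: "nat => complex" and m :: nat
 assumes m: "m = CARD('m)"
  and exponents: "\<And>x. det (mat x - K) = (\<Prod>i=1..m. x - \<Lambda> i)"
  and first: "\<Lambda> 1 = -1"
begin

lemma quotient_eigenvalues': "(\<exists>i\<in>{2..m}. \<mu> = \<Lambda> i) \<longleftrightarrow> (\<exists>w t. w $ j = 0 \<and> w ~= 0 \<and> K *v w = \<mu> *s w + t *s vc)"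
proof (rule quotient_eigenvalues[OF K_vc _ _ exponents first])
 show "vc $ j ~= 0" using p_pos[of j] cj by (simp add: vc_def)
 show "m \<ge> 1" unfolding m by (simp add: Suc_leI)
qed

text \<open>For any other eigenvalue the triangular form forces \<open>\<epsilon> = Z = 0\<close>,
  so the eigenvector lifts to an eigenvector of \<open>K\<close> modulo \<open>vc\<close>, and the
  quotient has the eigenvalues \<open>\<Lambda> i\<close> with \<open>i \<ge> 2\<close>.\<close>

lemma J_eigenvalue_cases:
 assumes y: "J *v y = \<mu> *s y" "y ~= 0"
 shows "\<mu> = of_nat r \<or> \<mu> = of_nat (r + 1) \<or> (\<exists>i\<in>{2..m}. \<mu> = \<Lambda> i)"
proof (rule ccontr)
 assume no: "\<not> ?thesis"
 have e: "y $ Some j = 0" using eigen_eps[OF y(1)] no by blast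
 have z: "y $ None = 0" using eigen_Z[OF y(1) _ e] no by blast
 have vcj: "vc $ j ~= 0" using p_pos[of j] cj by (simp add: vc_def)
 define \<kappa> where "\<kappa> = (K *v liftX y) $ j / vc $ j"
 have "(K *v liftX y) $ i = \<mu> * liftX y $ i + \<kappa> * vc $ i" for i
 proof (cases "i = j")
  case False
  have "b ^ p i * (\<mu> * y $ Some i) = (K *v liftX y) $ i - vc $ i / vc $ j * (K *v liftX y) $ j"
   using J_X[OF e z False] y(1) by simp
  moreover have "b ^ p i * (\<mu> * y $ Some i) = \<mu> * liftX y $ i" using False by (simp add: liftX_def)
  moreover have "vc $ i / vc $ j * (K *v liftX y) $ j = \<kappa> * vc $ i" by (simp add: \<kappa>_def)
  ultimately show ?thesis by (simp add: eq_diff_eq)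
 qed (use vcj in \<open>simp add: liftX_def \<kappa>_def\<close>)
 hence "K *v liftX y = \<mu> *s liftX y + \<kappa> *s vc" by (simp add: vec_eq_iff)
 moreover have "liftX y ~= 0"
 proof
  assume l: "liftX y = 0"
  have "y $ q = 0" for q
  proof (cases q)
   case (Some i)
   have "liftX y $ i = 0" using l by simp
   thus ?thesis using Some e b_nz by (cases "i = j") (auto simp: liftX_def)
  qed (use z in simp)
  thus False using y(2) by (simp add: vec_eq_iff)
 qed
 moreover have "liftX y $ j = 0" by (simp add: liftX_def)
 ultimately show False using quotient_eigenvalues'[of \<mu>] no by blast
qed

text \<open>An eigenvector of \<open>K\<close> modulo \<open>vc\<close> has a representative whose
  entry \<open>j\<close> is zero; this one is a lifted chart direction.\<close>

lemma J_eigenvector: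
 assumes "i \<in> {2..m}" shows "\<exists>y. y ~= 0 \<and> J *v y = \<Lambda> i *s y"
proof -
 obtain w t where w: "w $ j = 0" "w ~= 0" "K *v w = \<Lambda> i *s w + t *s vc"
  using quotient_eigenvalues'[of "\<Lambda> i"] assms by blast
 define y where "y = (\<chi> q. case q of None => 0 | Some l => if l = j then 0 else w $ l / b ^ p l)"
 have e: "y $ Some j = 0" and z: "y $ None = 0" by (simp_all add: y_def)
 have ly: "liftX y = w" using b_nz w(1) by (auto simp: liftX_def y_def vec_eq_iff)
 have vcj: "vc $ j ~= 0" using p_pos[of j] cj by (simp add: vc_def)
 have "(J *v y) $ q = \<Lambda> i * y $ q" for q
 proof (cases q)
  case (Some l)
  show ?thesis
  proof (cases "l = j")
   case False
   have "b ^ p l * (J *v y) $ Some l = \<Lambda> i * w $ l"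
    unfolding J_X[OF e z False] ly using w vcj by (simp add: field_simps)
   moreover have "b ^ p l * y $ Some l = w $ l" using False b_nz by (simp add: y_def)
   ultimately have "b ^ p l * (J *v y) $ Some l = b ^ p l * (\<Lambda> i * y $ Some l)" by (metis mult.left_commute)
   thus ?thesis using Some b_nz by simp
  qed (use Some e in \<open>simp add: J_eps del: of_nat_add of_nat_Suc\<close>)
 qed (use e z in \<open>simp add: J_Z\<close>)
 moreover have "y ~= 0"
 proof
  assume "y = 0"
  hence "liftX y = 0" by (simp add: liftX_def vec_eq_iff)
  with ly w(2) show False by simp
 qed
 ultimately show ?thesis by (auto simp: vec_eq_iff)
qed

end

end

section \<open>Laurent solutions as curves in the chart\<close>

lemma holomorphicI:
 assumes "\<And>x. x \<in> S ==> \<exists>D. (f has_field_derivative D) (at x)"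
 shows "f holomorphic_on S"
 unfolding holomorphic_on_def field_differentiable_def
 using assms has_field_derivative_at_within by blast

lemma circle_derivative:
 assumes "(F has_field_derivative D) (at (\<tau> * cis th))"
 shows "((%th. F (\<tau> * cis th)) has_vector_derivative D * (\<i> * (\<tau> * cis th))) (at th within A)"
proof -
 have "((%th. \<tau> * cis th) has_vector_derivative \<tau> * (\<i> * cis th)) (at th)"
  unfolding has_vector_derivative_def
  by (rule derivative_eq_intros refl)+ (simp add: scaleR_conv_of_real algebra_simps)
 from field_vector_diff_chain_at[OF this assms]
 have "((%th. F (\<tau> * cis th)) has_vector_derivative D * (\<i> * (\<tau> * cis th))) (at th)"
  by (simp add: o_def algebra_simps)
 thus ?thesis by (rule has_vector_derivative_at_within)
qed

text \<open>The integral of a derivative over a closed circle, with the constant factor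
  \<open>\<i>\<close> of the line element divided out.\<close>

lemma circle_integral_exact:
 assumes "\<And>th. (F has_field_derivative D (\<tau> * cis th)) (at (\<tau> * cis th))"
 shows "((%th. D (\<tau> * cis th) * (\<tau> * cis th)) has_integral 0) {0..2*pi}"
proof -
 have "((%th. D (\<tau> * cis th) * (\<i> * (\<tau> * cis th))) has_integral (F (\<tau> * cis (2*pi)) - F (\<tau> * cis 0))) {0..2*pi}"
  by (rule fundamental_theorem_of_calculus) (auto intro!: circle_derivative assms)
 note int = has_integral_mult_right[OF this, of "-\<i>"]
 have eq: "-\<i> * (d * (\<i> * w)) = d * w" for d w by (simp add: mult.left_commute)
 show ?thesis using int unfolding eq by simp
qed

text \<open>\<open>h z - h 0\<close> is \<open>z\<close> times a holomorphic function, which has a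
  primitive on the disc.\<close>

lemma circle_mean_value:
 fixes h :: "complex => complex"
 assumes h: "h holomorphic_on ball 0 \<rho>" and \<tau>: "norm \<tau> < \<rho>"
 shows "((%th. h (\<tau> * cis th)) has_integral (2 * pi * h 0)) {0..2*pi}"
proof -
 define h1 where "h1 = (%z. if z = 0 then deriv h 0 else (h z - h 0) / (z - 0))"
 have "h1 holomorphic_on ball 0 \<rho>" unfolding h1_def by (rule pole_lemma_open[OF h open_ball])
 then obtain \<Phi> where "\<And>x. x \<in> ball 0 \<rho> ==> (\<Phi> has_field_derivative h1 x) (at x within ball 0 \<rho>)"
  using holomorphic_convex_primitive'[OF convex_ball open_ball] by blast
 hence \<Phi>: "(\<Phi> has_field_derivative h1 x) (at x)" if "x \<in> ball 0 \<rho>" for x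
  using that at_within_open[OF that open_ball] by metis
 have in_ball: "\<tau> * cis th \<in> ball 0 \<rho>" for th using \<tau> by (simp add: norm_mult)
 have "((%th. h1 (\<tau> * cis th) * (\<tau> * cis th)) has_integral 0) {0..2*pi}"
  by (rule circle_integral_exact[OF \<Phi>[OF in_ball]])
 moreover have "h1 z * z = h z - h 0" for z by (simp add: h1_def)
 ultimately have 1: "((%th. h (\<tau> * cis th) - h 0) has_integral 0) {0..2*pi}" by simp
 have 2: "((%th. h 0) has_integral (2 * pi * h 0)) {0..2*pi}"
  using has_integral_const_real[of "h 0" 0 "2*pi"] by (simp add: scaleR_conv_of_real)
 from has_integral_add[OF 1 2] show ?thesis by simp
qed

text \<open>The point is that \<open>a\<close> is the same for all \<open>\<tau>\<close>: a
  coefficient computed on one tiny circle is then known on every circle in the domain. The induction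
  divides out one factor \<open>z\<close>; the integral of a pure negative power vanishes.\<close>

lemma circle_coefficient:
 fixes M :: "complex => complex"
 assumes M: "M holomorphic_on ball 0 \<rho>"
 shows "\<exists>a::complex. \<forall>\<tau>::complex. norm \<tau> < \<rho> \<longrightarrow> ((%th. M (\<tau> * cis th) * cis th powi (- int n)) has_integral (2 * pi * (\<tau> ^ n * a))) {0..2*pi}"
 using M
proof (induction n arbitrary: M)
 case 0
 thus ?case using circle_mean_value[OF 0] by auto
next
 case (Suc n)
 define M1 where "M1 = (%z. if z = 0 then deriv M 0 else (M z - M 0) / (z - 0))"
 have "M1 holomorphic_on ball 0 \<rho>" unfolding M1_def by (rule pole_lemma_open[OF Suc.prems open_ball])
 from Suc.IH[OF this] obtain a :: complex where a: "\<And>\<tau>::complex. norm \<tau> < \<rho> ==>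
   ((%th. M1 (\<tau> * cis th) * cis th powi (- int n)) has_integral (2 * pi * (\<tau> ^ n * a))) {0..2*pi}" by blast
 have M_eq: "M z = M 0 + z * M1 z" for z by (simp add: M1_def)
 have "((%th. M (\<tau> * cis th) * cis th powi (- int (Suc n))) has_integral (2 * pi * (\<tau> ^ Suc n * a))) {0..2*pi}" if \<tau>: "norm \<tau> < \<rho>" for \<tau> :: complex
 proof -
  let ?k = "- int (Suc n)"
  have "((%th. (of_int ?k * (1 * cis th) powi (?k - 1)) * (1 * cis th)) has_integral 0) {0..2*pi}"
   by (rule circle_integral_exact[where F = "%z. z powi ?k"]) (auto intro!: derivative_eq_intros)
  from has_integral_mult_right[OF this, of "M 0 / of_int ?k"]
  have 1: "((%th. M 0 * cis th powi ?k) has_integral (M 0 / of_int ?k * 0)) {0..2*pi}"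
  proof (rule has_integral_eq[rotated])
   fix th :: real
   have "cis th powi (?k - 1) * cis th = cis th powi ?k"
    by (rule power_int_minus_mult) simp
   moreover have "(of_int ?k :: complex) ~= 0" by (simp only: of_int_eq_0_iff)
   moreover have "A / k * ((k * P) * w) = A * Q" if "P * w = Q" "k ~= 0" for A k P w Q :: complex
    using that by (simp add: mult.assoc)
   ultimately show "M 0 / of_int ?k * ((of_int ?k * (1 * cis th) powi (?k - 1)) * (1 * cis th)) = M 0 * cis th powi ?k"
    unfolding mult_1 by blast
  qed
  have 2: "((%th. \<tau> * (M1 (\<tau> * cis th) * cis th powi (- int n))) has_integral \<tau> * (2 * pi * (\<tau> ^ n * a))) {0..2*pi}"
   by (rule has_integral_mult_right[OF a[OF \<tau>]])
  have eq: "M 0 * cis th powi ?k + \<tau> * (M1 (\<tau> * cis th) * cis th powi (- int n)) = M (\<tau> * cis th) * cis th powi ?k" for th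
  proof -
   have "cis th powi (?k + 1) = cis th powi ?k * cis th" by (rule power_int_add_1) simp
   hence "cis th powi (- int n) = cis th powi ?k * cis th" by simp
   thus ?thesis by (subst (2) M_eq) (simp add: algebra_simps)
  qed
  from has_integral_add[OF 1 2] show ?thesis unfolding eq by (simp add: algebra_simps)
 qed
 thus ?case by blast
qed

lemma vec_curve_derivative:
 fixes Y :: "complex => complex^'n::finite"
 assumes "\<And>q. ((%t. Y t $ q) has_field_derivative D $ q) (at t)"
 shows "(Y has_derivative (%h. h *s D)) (at t)"
 by (rule has_derivative_vecI) (use assms in \<open>simp add: has_field_derivative_def mult_commute_abs\<close>)

lemma chol_curve:
 fixes Y :: "complex => complex^'n::finite"
 assumes f: "chol S f" "Y t \<in> S" and Y: "(Y has_derivative (%h. h *s D)) (at t)"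
 shows "((%t. f (Y t)) has_field_derivative cdir f (Y t) D) (at t)"
 using has_derivative_compose[OF Y chol_deriv(1)[OF f]]
 by (simp add: has_field_derivative_def chol_deriv(2)[OF f] mult_commute_abs)

section \<open>Curves in the chart and the functionals that read off their parameters\<close>

context qh_chart
begin

text \<open>\<open>T\<close> is \<open>z - z0\<close>, and \<open>\<tau>\<close> is the local
  parameter with \<open>x\<^sub>j = \<tau> ^ (- p j)\<close>. The equation
  \<open>\<tau> Y' = V Y\<close> is required at \<open>\<tau> = 0\<close> too, where it says that
  \<open>V\<close> vanishes at \<open>Y 0\<close>.\<close>

definition chart_sol :: "complex => (complex => complex^('m option)) => (complex => complex) => real => bool" where
 "chart_sol z0 Y T \<rho> \<longleftrightarrow> \<rho> > 0 \<and> Y 0 = ys \<and> T 0 = 0 \<and>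
   (\<forall>\<tau>\<in>ball 0 \<rho>. Y \<tau> \<in> ball ys RV \<and> (T has_field_derivative kk (Y \<tau>)) (at \<tau>) \<and>
    Y \<tau> $ Some j = \<tau> ^ (r + 1) \<and> Y \<tau> $ None = (z0 + T \<tau>) * \<tau> ^ r \<and>
    (\<forall>q. \<exists>D. ((%t. Y t $ q) has_field_derivative D) (at \<tau>) \<and> \<tau> * D = V (Y \<tau>) $ q))"

text \<open>Puts the leading coefficient in position 0, so that \<open>t ^ p i * x\<^sub>i\<close>
  becomes a single power series in \<open>t = z - z0\<close>.\<close>

definition lcoef :: "('m => nat => complex) => 'm => nat => complex" where
 "lcoef a i n = (if n = 0 then c $ i else a i n)"

text \<open>The relation \<open>x\<^sub>i = X\<^sub>i \<tau> ^ (- p i)\<close> without denominators: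
  \<open>u i t\<close> is \<open>t ^ p i * x\<^sub>i (z0 + t)\<close>, taken at
  \<open>t = T \<tau>\<close>. Small discs are enough, as the coefficient formula is checked on one
  tiny circle.\<close>

definition linked :: "('m => nat => complex) => (complex => complex^('m option)) => (complex => complex) => bool" where
 "linked a Y T \<longleftrightarrow> (\<exists>\<delta>>0. \<exists>\<delta>'>0. \<exists>u. \<forall>i.
   (\<forall>t\<in>ball 0 \<delta>. (%n. lcoef a i n * t ^ n) sums u i t) \<and>
   (\<forall>\<tau>\<in>ball 0 \<delta>'. T \<tau> \<in> ball 0 \<delta> \<and> u i (T \<tau>) * \<tau> ^ p i = chart_X j (Y \<tau>) $ i * T \<tau> ^ p i))"

definition Iint :: "(real => complex^('m option)) => real => complex" where
 "Iint W th = integral {0..th} (%s. kk (W s) * (\<i> * cis s))"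

text \<open>For the loop \<open>Y (\<tau> e\<^sup>i\<^sup>\<theta>)\<close> of a chart solution this is \<open>T (\<tau> e\<^sup>i\<^sup>\<theta>) / \<tau>\<close>: it has the derivative of that function and, like it, mean value 0.\<close>

definition tt :: "(real => complex^('m option)) => real => complex" where
 "tt W th = Iint W th - integral {0..2*pi} (Iint W) / (2 * pi)"

text \<open>The coefficient of \<open>(z - z\<^sub>0)\<^sup>n\<^sup>-\<^sup>p\<close> of \<open>x\<^sub>i\<close> as a contour integral, written in the variable \<open>\<tau>\<close>.\<close>

definition alp :: "(real => complex^('m option)) => 'm => nat => complex" where
 "alp W i n = integral {0..2*pi} (%th. chart_X j (W th) $ i * cis th powi (1 - int (p i)) *
   tt W th powi (int (p i) - int n - 1) * kk (W th)) / (2 * pi)"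

text \<open>Up to the factor \<open>\<tau> ^ r\<close>, this is the mean over the circle of
  \<open>Z \<tau> ^ (- r) = z0 + T\<close>, in which \<open>T\<close> has mean 0.\<close>

definition zhat :: "(real => complex^('m option)) => complex" where
 "zhat W = integral {0..2*pi} (%th. W th $ None * cis th powi (- int r)) / (2 * pi)"

lemma chart_sol_curve:
 assumes "chart_sol z0 Y T \<rho>" "\<tau> \<in> ball 0 \<rho>"
 shows "\<exists>D. (Y has_derivative (%h. h *s D)) (at \<tau>) \<and> \<tau> *s D = V (Y \<tau>)"
proof -
 have "\<forall>q. \<exists>D. ((%t. Y t $ q) has_field_derivative D) (at \<tau>) \<and> \<tau> * D = V (Y \<tau>) $ q"
  using assms unfolding chart_sol_def by blast
 from choice[OF this] obtain D where D: "\<And>q. ((%t. Y t $ q) has_field_derivative D q) (at \<tau>) \<and> \<tau> * D q = V (Y \<tau>) $ q" by blast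
 have "(Y has_derivative (%h. h *s (\<chi> q. D q))) (at \<tau>)"
  by (rule vec_curve_derivative) (use D in simp)
 moreover have "\<tau> *s (\<chi> q. D q) = V (Y \<tau>)" using D by (simp add: vec_eq_iff)
 ultimately show ?thesis by blast
qed

lemma chart_sol_holomorphic:
 assumes sol: "chart_sol z0 Y T \<rho>" and F: "chol (ball ys RV) F"
 shows "(%\<tau>. F (Y \<tau>)) holomorphic_on ball 0 \<rho>"
proof (rule holomorphicI)
 fix \<tau> :: complex assume \<tau>: "\<tau> \<in> ball 0 \<rho>"
 obtain D where D: "(Y has_derivative (%h. h *s D)) (at \<tau>)" using chart_sol_curve[OF sol \<tau>] by blast
 have "Y \<tau> \<in> ball ys RV" using sol \<tau> unfolding chart_sol_def by blast
 from chol_curve[OF F this D] show "\<exists>D. ((%\<tau>. F (Y \<tau>)) has_field_derivative D) (at \<tau>)" by blast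
qed

lemma chol_kk_ball: "chol (ball ys RV) kk"
 by (rule chol_kk[OF RV(2)])

lemma kk_nz: "Y \<in> ball ys RV ==> kk Y ~= 0"
 using RV(3)[of Y] b_nz by auto

text \<open>The bound \<open>|T \<tau> - b \<tau>| \<le> |b| / 16 * |\<tau>|\<close> keeps
  \<open>T\<close> away from zero off the centre, so that all integer powers of
  \<open>T / \<tau>\<close> are holomorphic on the whole disc.\<close>

lemma chart_sol_T:
 assumes sol: "chart_sol z0 Y T \<rho>"
 shows "\<exists>v. v holomorphic_on ball 0 \<rho> \<and> v 0 = b \<and> (\<forall>\<tau>\<in>ball 0 \<rho>. v \<tau> ~= 0) \<and> (\<forall>\<tau>. T \<tau> = \<tau> * v \<tau>)"
proof -
 define v where "v = (%z. if z = 0 then deriv T 0 else (T z - T 0) / (z - 0))"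
 have T0: "T 0 = 0" "Y 0 = ys" and \<rho>: "\<rho> > 0" using sol unfolding chart_sol_def by blast+
 have dT: "(T has_field_derivative kk (Y \<tau>)) (at \<tau>)" "Y \<tau> \<in> ball ys RV" if "\<tau> \<in> ball 0 \<rho>" for \<tau>
  using sol that unfolding chart_sol_def by blast+
 have "T holomorphic_on ball 0 \<rho>" by (rule holomorphicI) (use dT in blast)
 hence "v holomorphic_on ball 0 \<rho>" unfolding v_def by (rule pole_lemma_open[OF _ open_ball])
 moreover have v0: "v 0 = b" using dT(1)[of 0] \<rho> by (simp add: v_def DERIV_imp_deriv T0 kk_ys)
 moreover have Tv: "T \<tau> = \<tau> * v \<tau>" for \<tau> by (simp add: v_def T0)
 moreover have "v \<tau> ~= 0" if \<tau>: "\<tau> \<in> ball 0 \<rho>" for \<tau>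
 proof (cases "\<tau> = 0")
  case False
  have "norm ((T \<tau> - b * \<tau>) - (T 0 - b * 0)) \<le> norm b / 16 * norm (\<tau> - 0)"
  proof (rule field_differentiable_bound[OF convex_ball])
   fix z :: complex assume z: "z \<in> ball 0 \<rho>"
   show "((%z. T z - b * z) has_field_derivative kk (Y z) - b) (at z within ball 0 \<rho>)"
    by (rule has_field_derivative_at_within) (auto intro!: derivative_eq_intros dT z)
   show "norm (kk (Y z) - b) \<le> norm b / 16" using RV(3)[OF dT(2)[OF z]] by simp
  qed (use \<tau> \<rho> in auto)
  moreover have "norm b / 16 * norm \<tau> < norm (b * \<tau>)" using False b_nz by (simp add: norm_mult)
  ultimately have "T \<tau> ~= 0" using T0 by (auto simp: norm_minus_commute)
  thus ?thesis using Tv by auto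
 qed (use v0 b_nz in simp)
 ultimately show ?thesis by blast
qed

context
 fixes z0 Y T \<rho> and \<tau> :: complex
 assumes sol: "chart_sol z0 Y T \<rho>" and \<tau>: "norm \<tau> < \<rho>" "\<tau> ~= 0"
begin

lemma circle_in: "\<tau> * cis th \<in> ball 0 \<rho>"
 using \<tau> by (simp add: norm_mult)

lemma tt_chart_sol:
 assumes th: "th \<in> {0..2*pi}" shows "tt (%th. Y (\<tau> * cis th)) th = T (\<tau> * cis th) / \<tau>"
proof -
 have T0: "T 0 = 0" using sol unfolding chart_sol_def by blast
 have dT: "(T has_field_derivative kk (Y \<tau>)) (at \<tau>)" if "\<tau> \<in> ball 0 \<rho>" for \<tau>
  using sol that unfolding chart_sol_def by blast
 have I: "Iint (%th. Y (\<tau> * cis th)) th = T (\<tau> * cis th) / \<tau> - T \<tau> / \<tau>" if "th \<ge> 0" for th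
 proof -
  have "((%s. kk (Y (\<tau> * cis s)) * (\<i> * (\<tau> * cis s))) has_integral (T (\<tau> * cis th) - T (\<tau> * cis 0))) {0..th}"
   by (rule fundamental_theorem_of_calculus[OF that]) (intro circle_derivative dT circle_in)
  from has_integral_divide[OF this, of \<tau>]
  have "((%s. kk (Y (\<tau> * cis s)) * (\<i> * cis s)) has_integral ((T (\<tau> * cis th) - T \<tau>) / \<tau>)) {0..th}"
   using \<tau> by (simp add: mult.left_commute)
  thus ?thesis unfolding Iint_def by (simp add: integral_unique diff_divide_distrib)
 qed
 have "T holomorphic_on ball 0 \<rho>" by (rule holomorphicI) (use dT in blast)
 hence "((%th. T (\<tau> * cis th)) has_integral 0) {0..2*pi}" using circle_mean_value[of T \<rho> \<tau>] \<tau> T0 by simp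
 from has_integral_divide[OF this, of \<tau>]
 have "((%th. T (\<tau> * cis th) / \<tau> - T \<tau> / \<tau>) has_integral (0 - 2 * pi * (T \<tau> / \<tau>))) {0..2*pi}"
  using has_integral_const_real[of "T \<tau> / \<tau>" 0 "2*pi"] by (intro has_integral_diff) (simp_all add: scaleR_conv_of_real)
 hence "(Iint (%th. Y (\<tau> * cis th)) has_integral (- (2 * pi * (T \<tau> / \<tau>)))) {0..2*pi}"
  by (subst has_integral_cong[where g = "%th. T (\<tau> * cis th) / \<tau> - T \<tau> / \<tau>"]) (use I in auto)
 hence "integral {0..2*pi} (Iint (%th. Y (\<tau> * cis th))) = - (2 * pi * (T \<tau> / \<tau>))" by (rule integral_unique)
 thus ?thesis using I[of th] th by (simp add: tt_def)
qed

lemma zhat_chart_sol: "zhat (%th. Y (\<tau> * cis th)) = \<tau> ^ r * z0"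
proof -
 have T0: "T 0 = 0" using sol unfolding chart_sol_def by blast
 have dT: "(T has_field_derivative kk (Y \<tau>)) (at \<tau>)" if "\<tau> \<in> ball 0 \<rho>" for \<tau>
  using sol that unfolding chart_sol_def by blast
 have "(%w. \<tau> ^ r * (z0 + T w)) holomorphic_on ball 0 \<rho>"
 proof (rule holomorphicI)
  fix w :: complex assume "w \<in> ball 0 \<rho>"
  from DERIV_cmult[OF DERIV_add[OF DERIV_const dT[OF this]], of "\<tau> ^ r" z0]
  show "\<exists>D. ((%w. \<tau> ^ r * (z0 + T w)) has_field_derivative D) (at w)" by blast
 qed
 hence "((%th. \<tau> ^ r * (z0 + T (\<tau> * cis th))) has_integral (2 * pi * (\<tau> ^ r * z0))) {0..2*pi}"
  using circle_mean_value[of "%w. \<tau> ^ r * (z0 + T w)" \<rho> \<tau>] \<tau> T0 by simp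
 moreover have "\<tau> ^ r * (z0 + T (\<tau> * cis th)) = Y (\<tau> * cis th) $ None * cis th powi (- int r)" for th
 proof -
  have "Y (\<tau> * cis th) $ None = (z0 + T (\<tau> * cis th)) * (\<tau> * cis th) ^ r"
   using sol circle_in unfolding chart_sol_def by blast
  thus ?thesis by (simp add: power_mult_distrib power_int_minus)
 qed
 ultimately have "integral {0..2*pi} (%th. Y (\<tau> * cis th) $ None * cis th powi (- int r)) = 2 * pi * (\<tau> ^ r * z0)"
  by (simp add: integral_unique)
 thus ?thesis by (simp add: zhat_def)
qed

end

text \<open>This is the residue formula for the coefficient of \<open>t ^ n\<close> in
  \<open>u i\<close>, with \<open>t = T \<tau>\<close> substituted. The power series may converge on
  a smaller disc than the one where \<open>Y\<close> lives, so the formula is verified on a small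
  circle through \<open>\<tau>1\<close> and carried to \<open>\<tau>\<close> by
  \<open>circle_coefficient\<close>.\<close>

lemma alp_chart_sol:
 assumes sol: "chart_sol z0 Y T \<rho>" and link: "linked a Y T" and n: "n \<ge> 1" and \<tau>: "norm \<tau> < \<rho>" "\<tau> ~= 0"
 shows "alp (%th. Y (\<tau> * cis th)) i n = \<tau> ^ n * a i n"
proof -
 obtain v where v: "v holomorphic_on ball 0 \<rho>" "v 0 = b" "\<And>\<tau>. \<tau> \<in> ball 0 \<rho> ==> v \<tau> ~= 0" "\<And>\<tau>. T \<tau> = \<tau> * v \<tau>"
  using chart_sol_T[OF sol] by blast
 have Yin: "Y w \<in> ball ys RV" if "w \<in> ball 0 \<rho>" for w using sol that unfolding chart_sol_def by blast
 have dT: "(T has_field_derivative kk (Y w)) (at w)" if "w \<in> ball 0 \<rho>" for w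
  using sol that unfolding chart_sol_def by blast
 have T0: "T 0 = 0" and Y0: "Y 0 = ys" and \<rho>: "\<rho> > 0" using sol unfolding chart_sol_def by blast+
 \<comment> \<open>Since \<open>tt = cis th * v\<close> on a solution, all explicit powers of
   \<open>cis th\<close> combine to \<open>cis th powi (- n)\<close>, and what remains is a
   holomorphic function on the disc.\<close>
 define M where "M = (%w. chart_X j (Y w) $ i * v w powi (int (p i) - int n - 1) * kk (Y w))"
 have Xhol: "(%w. chart_X j (Y w) $ i) holomorphic_on ball 0 \<rho>"
  by (rule chart_sol_holomorphic[OF sol cholv_nth[OF cholv_chart_X]])
 have khol: "(%w. kk (Y w)) holomorphic_on ball 0 \<rho>"
  by (rule chart_sol_holomorphic[OF sol chol_kk_ball])
 have Mhol: "M holomorphic_on ball 0 \<rho>"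
  unfolding M_def by (intro holomorphic_intros Xhol khol v(1)) (use v(3) in auto)
 obtain m :: complex where m: "\<And>\<tau>::complex. norm \<tau> < \<rho> ==> ((%th. M (\<tau> * cis th) * cis th powi (- int n)) has_integral (2 * pi * (\<tau> ^ n * m))) {0..2*pi}"
  using circle_coefficient[OF Mhol, of n] by blast
 have alp: "alp (%th. Y (\<tau> * cis th)) i n = \<tau> ^ n * m" if \<tau>: "norm \<tau> < \<rho>" "\<tau> ~= 0" for \<tau>
 proof -
  have "integral {0..2*pi} (%th. chart_X j (Y (\<tau> * cis th)) $ i * cis th powi (1 - int (p i)) *
   tt (%th. Y (\<tau> * cis th)) th powi (int (p i) - int n - 1) * kk (Y (\<tau> * cis th)))
   = integral {0..2*pi} (%th. M (\<tau> * cis th) * cis th powi (- int n))"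
  proof (rule integral_cong)
   fix th assume th: "th \<in> {0..2*pi}"
   have "tt (%th. Y (\<tau> * cis th)) th = cis th * v (\<tau> * cis th)"
    using tt_chart_sol[OF sol \<tau> th] \<tau> by (simp add: v(4))
   moreover have ce: "cis th powi (1 - int (p i)) * cis th powi (int (p i) - int n - 1) = cis th powi (- int n)"
    by (subst power_int_add[symmetric]) auto
   have prod_eq: "X * cis th powi (1 - int (p i)) * (cis th powi (int (p i) - int n - 1) * V1) * k = X * V1 * k * cis th powi (- int n)" for X V1 k
    unfolding ce[symmetric] by (simp only: mult_ac)
   ultimately show "chart_X j (Y (\<tau> * cis th)) $ i * cis th powi (1 - int (p i)) *
     tt (%th. Y (\<tau> * cis th)) th powi (int (p i) - int n - 1) * kk (Y (\<tau> * cis th))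
     = M (\<tau> * cis th) * cis th powi (- int n)"
    unfolding M_def by (simp only: power_int_mult_distrib prod_eq)
  qed
  also have "\<dots> = 2 * pi * (\<tau> ^ n * m)" using m[OF \<tau>(1)] by (rule integral_unique)
  finally show ?thesis by (simp add: alp_def)
 qed
 obtain \<delta> \<delta>' u where d: "\<delta> > 0" "\<delta>' > 0" and u: "\<And>t. t \<in> ball 0 \<delta> ==> (%n. lcoef a i n * t ^ n) sums u i t"
  and uX: "\<And>w. w \<in> ball 0 \<delta>' ==> T w \<in> ball 0 \<delta> \<and> u i (T w) * w ^ p i = chart_X j (Y w) $ i * T w ^ p i"
  using link unfolding linked_def by blast
 define \<rho>1 where "\<rho>1 = min \<rho> \<delta>'"
 define \<tau>1 where "\<tau>1 = complex_of_real (\<rho>1 / 2)"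
 have \<tau>1: "norm \<tau>1 < \<rho>1" "\<tau>1 ~= 0" "norm \<tau>1 < \<rho>" using \<rho> d by (auto simp: \<tau>1_def \<rho>1_def)
 have sub1: "ball 0 \<rho>1 \<subseteq> ball (0::complex) \<rho>" "ball 0 \<rho>1 \<subseteq> ball (0::complex) \<delta>'" by (auto simp: \<rho>1_def)
 have circ: "\<tau>1 * cis th \<in> ball 0 \<rho>1" for th using \<tau>1 by (simp add: norm_mult)
 \<comment> \<open>The tail of the series beyond degree \<open>n\<close>, divided by
   \<open>t ^ Suc n\<close>. Its contribution to the integral is a mean value of a function that
   vanishes at the centre.\<close>
 define R where "R = (%t. \<Sum>k. lcoef a i (k + Suc n) * t ^ k)"
 have Rs: "(%k. lcoef a i (k + Suc n) * t ^ k) sums R t" and uR: "u i t = (\<Sum>k\<le>n. lcoef a i k * t ^ k) + t ^ Suc n * R t"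
  if t: "t \<in> ball 0 \<delta>" for t
 proof -
  have s1: "(%k. lcoef a i (k + Suc n) * t ^ (k + Suc n)) sums (u i t - (\<Sum>k<Suc n. lcoef a i k * t ^ k))"
   unfolding sums_iff_shift[of "%k. lcoef a i k * t ^ k" "Suc n"] diff_add_cancel by (rule u[OF t])
  show Rs: "(%k. lcoef a i (k + Suc n) * t ^ k) sums R t"
  proof (cases "t = 0")
   case True
   have "(%k. lcoef a i (k + Suc n) * t ^ k) sums lcoef a i (0 + Suc n)"
    using powser_sums_zero[of "%k. lcoef a i (k + Suc n)"] True by simp
   thus ?thesis unfolding R_def by (rule summable_sums[OF sums_summable])
  next
   case False
   from sums_divide[OF s1, of "t ^ Suc n"] have "summable (%k. lcoef a i (k + Suc n) * t ^ k)"
    using False by (intro sums_summable[of _ "(u i t - (\<Sum>k<Suc n. lcoef a i k * t ^ k)) / t ^ Suc n"]) (simp add: power_add)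
   thus ?thesis unfolding R_def by (rule summable_sums)
  qed
  from sums_mult[OF Rs, of "t ^ Suc n"] have "(%k. lcoef a i (k + Suc n) * t ^ (k + Suc n)) sums (t ^ Suc n * R t)"
   by (simp add: power_add mult_ac)
  from sums_unique2[OF this s1] show "u i t = (\<Sum>k\<le>n. lcoef a i k * t ^ k) + t ^ Suc n * R t"
   by (simp add: lessThan_Suc_atMost)
 qed
 have Rhol: "R holomorphic_on ball 0 \<delta>"
  by (rule power_series_holomorphic[where a = "%k. lcoef a i (k + Suc n)"]) (use Rs in simp)
 have "T holomorphic_on ball 0 \<rho>1"
  by (rule holomorphicI) (use dT sub1 in blast)
 hence RThol: "(%w. R (T w) * kk (Y w) * w) holomorphic_on ball 0 \<rho>1"
  by (intro holomorphic_intros holomorphic_on_compose_gen[OF _ Rhol, unfolded o_def] holomorphic_on_subset[OF khol sub1(1)])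
    (use uX sub1 in auto)
 let ?w = "%th. \<tau>1 * cis th"
 have I0: "((%th. R (T (?w th)) * kk (Y (?w th)) * ?w th) has_integral 0) {0..2*pi}"
  using circle_mean_value[OF RThol \<tau>1(1)] by simp
 \<comment> \<open>Only the term with exponent -1 has a residue; every other one is the derivative
   of a power of \<open>T\<close>, because \<open>kk\<close> is the derivative of
   \<open>T\<close>.\<close>
 have Ik: "((%th. lcoef a i k * (T (?w th) powi (int k - int n - 1) * kk (Y (?w th)) * ?w th)) has_integral
    (if k = n then 2 * pi * lcoef a i n else 0)) {0..2*pi}" if "k \<le> n" for k
 proof (cases "k = n")
  case True
  have "(%w. kk (Y w) / v w) holomorphic_on ball 0 \<rho>" by (intro holomorphic_intros khol v) (use v in auto)
  from circle_mean_value[OF this \<tau>1(3)] have "((%th. kk (Y (?w th)) / v (?w th)) has_integral (2 * pi)) {0..2*pi}"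
   using b_nz by (simp add: v(2) Y0 kk_ys)
  moreover have "kk (Y (?w th)) / v (?w th) = T (?w th) powi (int k - int n - 1) * kk (Y (?w th)) * ?w th" for th
   using True \<tau>1 v(3)[OF subsetD[OF sub1(1) circ[of th]]] by (simp add: v(4) field_simps)
  ultimately have "((%th. T (?w th) powi (int k - int n - 1) * kk (Y (?w th)) * ?w th) has_integral (2 * pi)) {0..2*pi}"
   by (simp only:)
  from has_integral_mult_right[OF this, of "lcoef a i n"] show ?thesis using True by (simp add: mult.commute)
 next
  case False
  let ?d = "int k - int n"
  have dn: "(of_int ?d :: complex) ~= 0" using False by simp
  have "((%th. (of_int ?d * T (?w th) powi (?d - 1) * kk (Y (?w th))) * ?w th) has_integral 0) {0..2*pi}"
  proof (rule circle_integral_exact[where F = "%w. T w powi ?d"])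
   fix th
   have "?w th \<in> ball 0 \<rho>" using circ sub1 by blast
   moreover from this have "T (?w th) ~= 0" using v(3) \<tau>1 by (simp add: v(4))
   ultimately show "((%w. T w powi ?d) has_field_derivative of_int ?d * T (?w th) powi (?d - 1) * kk (Y (?w th))) (at (?w th))"
    by (intro DERIV_power_int dT disjI2)
  qed
  from has_integral_mult_right[OF this, of "lcoef a i k / of_int ?d"] show ?thesis
   using dn False by (simp add: mult.assoc)
 qed
 have sum: "((%th. \<Sum>k\<le>n. lcoef a i k * (T (?w th) powi (int k - int n - 1) * kk (Y (?w th)) * ?w th)) has_integral
   (\<Sum>k\<le>n. if k = n then 2 * pi * lcoef a i n else 0)) {0..2*pi}"
  by (intro has_integral_sum Ik) auto
 have "M (?w th) * cis th powi (- int n) = \<tau>1 ^ n * ((\<Sum>k\<le>n. lcoef a i k * (T (?w th) powi (int k - int n - 1) * kk (Y (?w th)) * ?w th))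
   + R (T (?w th)) * kk (Y (?w th)) * ?w th)" for th
 proof -
  define w where "w = ?w th"
  have w: "w \<in> ball 0 \<rho>1" "w ~= 0" using circ \<tau>1 by (auto simp: w_def)
  have w2: "w \<in> ball 0 \<rho>" "w \<in> ball 0 \<delta>'" using w sub1 by blast+
  have vw: "v w ~= 0" by (rule v(3)[OF w2(1)])
  have Tw: "T w ~= 0" using w vw by (simp add: v(4))
  have "u i (T w) * w ^ p i = chart_X j (Y w) $ i * T w ^ p i" using uX[OF w2(2)] by blast
  hence Xv: "chart_X j (Y w) $ i * v w ^ p i = u i (T w)" using w by (simp add: v(4) power_mult_distrib)
  have M: "M w = u i (T w) * v w powi (- int (Suc n)) * kk (Y w)"
  proof -
   have "v w powi (int (p i) - int n - 1) = v w powi (int (p i) + (- int (Suc n)))" by (simp add: algebra_simps)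
   also have "\<dots> = v w ^ p i * v w powi (- int (Suc n))" using vw by (subst power_int_add) auto
   finally show ?thesis by (simp add: M_def flip: Xv)
  qed
  have vc: "v w powi (- int (Suc n)) * cis th powi (- int n) = \<tau>1 ^ n * T w powi (- int (Suc n)) * w"
  proof -
   have e1: "T w powi (- int (Suc n)) = w powi (- int (Suc n)) * v w powi (- int (Suc n))"
    by (simp only: v(4) power_int_mult_distrib)
   have "w powi (- int (Suc n)) * w = w powi (- int (Suc n) + 1)"
    using w by (intro power_int_add_1[symmetric]) simp
   hence e2: "w powi (- int (Suc n)) * w = w powi (- int n)" by simp
   have e3: "w powi (- int n) = \<tau>1 powi (- int n) * cis th powi (- int n)"
    by (simp only: w_def power_int_mult_distrib)
   have e4: "\<tau>1 ^ n * \<tau>1 powi (- int n) = 1" using \<tau>1 by (simp add: power_int_minus)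
   have "\<tau>1 ^ n * T w powi (- int (Suc n)) * w = \<tau>1 ^ n * v w powi (- int (Suc n)) * (w powi (- int (Suc n)) * w)"
    unfolding e1 by (simp only: mult_ac)
   also have "\<dots> = (\<tau>1 ^ n * \<tau>1 powi (- int n)) * (v w powi (- int (Suc n)) * cis th powi (- int n))"
    unfolding e2 e3 by (simp only: mult_ac)
   finally show ?thesis unfolding e4 by simp
  qed
  have 1: "M w * cis th powi (- int n) = \<tau>1 ^ n * (u i (T w) * T w powi (- int (Suc n)) * kk (Y w) * w)"
  proof -
   have "M w * cis th powi (- int n) = u i (T w) * kk (Y w) * (v w powi (- int (Suc n)) * cis th powi (- int n))"
    unfolding M by (simp only: mult_ac)
   thus ?thesis unfolding vc by (simp only: mult_ac)
  qed
  have 2: "u i (T w) * T w powi (- int (Suc n)) = (\<Sum>k\<le>n. lcoef a i k * T w powi (int k - int n - 1)) + R (T w)"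
  proof -
   have "T w ^ k * T w powi (- int (Suc n)) = T w powi (int k - int n - 1)" for k
    using Tw power_int_add[of "T w" "int k" "- int (Suc n)"] by (simp add: algebra_simps)
   hence "(\<Sum>k\<le>n. lcoef a i k * T w ^ k) * T w powi (- int (Suc n)) = (\<Sum>k\<le>n. lcoef a i k * T w powi (int k - int n - 1))"
    by (simp only: sum_distrib_right mult.assoc)
   moreover have "T w ^ Suc n * R (T w) * T w powi (- int (Suc n)) = R (T w)"
   proof -
    have "T w ^ Suc n * T w powi (- int (Suc n)) = 1"
     unfolding power_int_minus power_int_of_nat using Tw by (intro right_inverse) (simp del: power_Suc)
    moreover have "T w ^ Suc n * R (T w) * T w powi (- int (Suc n)) = R (T w) * (T w ^ Suc n * T w powi (- int (Suc n)))"
     by (simp only: mult_ac)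
    ultimately show ?thesis by (simp only: mult_1_right)
   qed
   ultimately show ?thesis unfolding uR[OF conjunct1[OF uX[OF w2(2)]]] by (simp only: distrib_right)
  qed
  show ?thesis unfolding 1[unfolded w_def] 2[unfolded w_def]
   by (simp add: distrib_right sum_distrib_right mult.assoc)
 qed
 moreover have "((%th. \<tau>1 ^ n * ((\<Sum>k\<le>n. lcoef a i k * (T (?w th) powi (int k - int n - 1) * kk (Y (?w th)) * ?w th))
   + R (T (?w th)) * kk (Y (?w th)) * ?w th)) has_integral \<tau>1 ^ n * ((\<Sum>k\<le>n. if k = n then 2 * pi * lcoef a i n else 0) + 0)) {0..2*pi}"
  by (intro has_integral_mult_right has_integral_add sum I0)
 ultimately have "2 * pi * (\<tau>1 ^ n * m) = \<tau>1 ^ n * ((\<Sum>k\<le>n. if k = n then 2 * pi * lcoef a i n else 0) + 0)"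
  using has_integral_unique[OF m[OF \<tau>1(3)]] by (simp only:)
 hence "m = a i n" using \<tau>1 n by (simp add: lcoef_def)
 with alp[OF \<tau>] show ?thesis by simp
qed

end

text \<open>The numerator of the quotient rule for \<open>X / \<tau> ^ Suc k\<close>, rewritten with
  the Euler operator \<open>\<tau> d/d\<tau>\<close>, the form in which the chart equation is
  given.\<close>

lemma quotient_numerator:
 fixes \<tau> :: complex
 assumes "\<tau> ~= 0"
 shows "(D * \<tau> ^ Suc k - X * (n * \<tau> ^ (Suc k - 1))) / (\<tau> ^ Suc k * \<tau> ^ Suc k) = (\<tau> * D - n * X) / \<tau> ^ (Suc k + 1)"
proof -
 have "D * \<tau> ^ Suc k - X * (n * \<tau> ^ (Suc k - 1)) = (\<tau> * D - n * X) * \<tau> ^ k" by (simp add: algebra_simps)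
 moreover have "\<tau> ^ Suc k * \<tau> ^ Suc k = \<tau> ^ (Suc k + 1) * \<tau> ^ k" by simp
 moreover have "\<tau> ^ k ~= 0" using assms by simp
 moreover have "A * t / (B * t) = A / B" if "t ~= 0" for A B t :: complex using that by simp
 ultimately show ?thesis by (simp only: not_False_eq_True)
qed

section \<open>Passage between Laurent solutions and curves in the chart\<close>

context qh_chart
begin

text \<open>The weighted homogeneity of \<open>f\<close> and the defining property of \<open>G\<close>, at \<open>\<mu> = 1/\<tau>\<close>.\<close>

lemma field_scaling:
 assumes \<tau>: "\<tau> ~= 0" and Y: "Y $ Some j = \<tau> ^ (r + 1)" and x: "\<And>l. x $ l = chart_X j Y $ l / \<tau> ^ p l"
  and z: "z * \<tau> ^ r = Y $ None"
 shows "(f i x z + g i x z) * \<tau> ^ (p i + 1) = hh i Y"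
proof -
 have xw: "x = wscale p (1 / \<tau>) (chart_X j Y)" by (simp add: vec_eq_iff wscale_def x power_divide)
 have z': "z = (1 / \<tau>) ^ r * Y $ None" using \<tau> z by (simp add: power_divide field_simps)
 have "f i x z = (1 / \<tau>) ^ (p i + 1) * f i (chart_X j Y) (Y $ None)" unfolding xw z' by (rule homog)
 hence F: "f i x z * \<tau> ^ (p i + 1) = f i (chart_X j Y) (Y $ None)" using \<tau> by (simp add: power_divide)
 have xg: "x = (\<chi> l. chart_X j Y $ l * \<tau> powi (- int (p l)))" by (simp add: vec_eq_iff x power_int_minus divide_inverse)
 have zg: "z = Y $ None * \<tau> powi (- int r)" using \<tau> z by (simp add: power_int_minus field_simps)
 have "g i x z = \<tau> powi (int (r + 1) - (1 + int (p i))) * G i Y"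
  using chartG \<tau> Y unfolding chart_G_def xg zg by blast
 also have "\<tau> powi (int (r + 1) - (1 + int (p i))) = \<tau> powi (int (r + 1) - int (p i + 1))" by simp
 also have "\<dots> = \<tau> powi int (r + 1) / \<tau> powi int (p i + 1)" using \<tau> by (intro power_int_diff) simp
 also have "\<dots> = \<tau> ^ (r + 1) / \<tau> ^ (p i + 1)" by (simp only: power_int_of_nat)
 finally have "g i x z * \<tau> ^ (p i + 1) = Y $ Some j * G i Y" using \<tau> Y by simp
 with F show ?thesis by (simp add: hh_def distrib_right)
qed

lemma chart_X_j [simp]: "chart_X j Y $ j = 1" by (simp add: chart_X_def)

lemma chart_X_ys: "chart_X j ys $ i * b ^ p i = c $ i"
 using b_nz by (simp add: X_ys wscale_def power_divide)

text \<open>The parameter \<open>\<tau>\<close> is built as a function of \<open>t = z - z0\<close>: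
  near 0, \<open>u j t = t ^ p j * x\<^sub>j\<close> is close to \<open>c $ j\<close>, hence it has
  a holomorphic root \<open>q\<close> of order \<open>p j\<close> with \<open>q 0 = b\<close>. The
  function \<open>t / q t\<close> is locally invertible, \<open>T\<close> is its inverse, and
  \<open>x\<^sub>j = \<tau> ^ (- p j)\<close> holds by construction.\<close>

lemma laurent_to_chart:
 assumes "laurent_solution f g p c z0 a"
 shows "\<exists>Y T \<rho>. chart_sol z0 Y T \<rho> \<and> linked a Y T"
proof -
 obtain \<rho>0 where \<rho>0: "\<rho>0 > 0" and all: "\<forall>z. 0 < dist z z0 \<and> dist z z0 < \<rho>0 \<longrightarrow>
   (\<forall>i. summable (%n. a i (Suc n) * (z - z0) powi (- int (p i) + int (Suc n))) \<and>
    ((%w. laurent_sum p c a z0 w $ i) has_field_derivative f i (laurent_sum p c a z0 z) z + g i (laurent_sum p c a z0 z) z) (at z))"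
  using assms unfolding laurent_solution_def by (elim exE conjE)
 have L: "\<And>z i. 0 < dist z z0 ==> dist z z0 < \<rho>0 ==>
   summable (%n. a i (Suc n) * (z - z0) powi (- int (p i) + int (Suc n)))"
  "\<And>z i. 0 < dist z z0 ==> dist z z0 < \<rho>0 ==>
    ((%w. laurent_sum p c a z0 w $ i) has_field_derivative f i (laurent_sum p c a z0 z) z + g i (laurent_sum p c a z0 z) z) (at z)"
  using all by simp_all
 define u where "u = (%i t. \<Sum>n. lcoef a i n * t ^ n)"
 have shift: "a i (Suc n) * t powi (- int (p i) + int (Suc n)) = t powi (- int (p i)) * (lcoef a i (Suc n) * t ^ Suc n)"
  if "t ~= 0" for t i n using that by (subst power_int_add) (auto simp: lcoef_def simp del: power_Suc of_nat_Suc)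
 have us: "(%n. lcoef a i n * t ^ n) sums u i t" if t: "t \<in> ball 0 \<rho>0" for t i
 proof (cases "t = 0")
  case True
  have "(%n. lcoef a i n * t ^ n) sums lcoef a i 0" using powser_sums_zero[of "lcoef a i"] True by simp
  thus ?thesis unfolding u_def by (rule summable_sums[OF sums_summable])
 next
  case False
  have "summable (%n. a i (Suc n) * (z0 + t - z0) powi (- int (p i) + int (Suc n)))"
   by (rule L(1)) (use t False in \<open>auto simp: dist_norm\<close>)
  hence "summable (%n. t powi (- int (p i)) * (lcoef a i (Suc n) * t ^ Suc n))"
   unfolding shift[OF False, symmetric] by simp
  from summable_mult[OF this, of "t ^ p i"] have "summable (%n. lcoef a i (Suc n) * t ^ Suc n)"
   using False by (simp add: power_int_minus)
  hence "summable (%n. lcoef a i n * t ^ n)" by (subst summable_Suc_iff[symmetric])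
  thus ?thesis unfolding u_def by (rule summable_sums)
 qed
 have lsum: "laurent_sum p c a z0 (z0 + t) $ i = u i t / t ^ p i" if t: "t \<in> ball 0 \<rho>0" "t ~= 0" for t i
 proof -
  have l0: "lcoef a i 0 * t ^ 0 = c $ i" by (simp add: lcoef_def)
  have "(%n. lcoef a i (Suc n) * t ^ Suc n) sums (u i t - lcoef a i 0 * t ^ 0)"
   using us[OF t(1), of i] by (subst sums_Suc_iff) simp
  from sums_mult[OF this, of "t powi (- int (p i))"]
  have "(%n. a i (Suc n) * t powi (- int (p i) + int (Suc n))) sums (t powi (- int (p i)) * (u i t - c $ i))"
   unfolding shift[OF t(2)] l0 .
  hence "(\<Sum>n. a i (Suc n) * t powi (- int (p i) + int (Suc n))) = t powi (- int (p i)) * (u i t - c $ i)"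
   by (rule sums_unique[symmetric])
  thus ?thesis using t(2) by (simp add: laurent_sum_def power_int_minus field_simps)
 qed
 have uhol: "u i holomorphic_on ball 0 \<rho>0" for i
  by (rule power_series_holomorphic[where a = "lcoef a i"]) (use us in simp)
 have u0: "u i 0 = c $ i" for i
  using sums_unique2[OF us[of 0 i] ] powser_sums_zero[of "lcoef a i"] \<rho>0 by (simp add: lcoef_def)
 have "isCont (u j) 0" using uhol[of j] \<rho>0 holomorphic_on_imp_continuous_on[OF uhol[of j]]
  by (simp add: continuous_on_eq_continuous_at)
 hence "(u j \<longlongrightarrow> c $ j) (at 0)" by (simp add: isCont_def u0)
 from tendsto_divide[OF this tendsto_const cj] have "((%t. u j t / c $ j) \<longlongrightarrow> 1) (at 0)" using cj by simp
 from tendstoD[OF this, of 1] have "\<forall>\<^sub>F t in at 0. dist (u j t / c $ j) 1 < 1" by simp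
 then obtain \<rho>1 where \<rho>1: "\<rho>1 > 0" "\<And>t. t ~= 0 ==> norm t < \<rho>1 ==> dist (u j t / c $ j) 1 < 1"
  unfolding eventually_at by (auto simp: dist_norm)
 define \<rho>2 where "\<rho>2 = min \<rho>0 \<rho>1"
 have \<rho>2: "\<rho>2 > 0" "ball 0 \<rho>2 \<subseteq> ball (0::complex) \<rho>0" using \<rho>0 \<rho>1 by (auto simp: \<rho>2_def)
 \<comment> \<open>\<open>u j t / c $ j\<close> lies in the open disc of radius 1 about 1, hence in
   the domain of the principal logarithm.\<close>
 have near: "u j t / c $ j \<notin> \<real>\<^sub>\<le>\<^sub>0" if "t \<in> ball 0 \<rho>2" for t
 proof -
  have d: "norm (u j t / c $ j - 1) < 1" using \<rho>1(2)[of t] that u0 cj by (cases "t = 0") (auto simp: \<rho>2_def dist_norm)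
  have "1 - Re (u j t / c $ j) \<le> norm (u j t / c $ j - 1)"
   using abs_Re_le_cmod[of "u j t / c $ j - 1"] by simp
  hence "Re (u j t / c $ j) > 0" using d by linarith
  thus ?thesis by (auto simp: complex_nonpos_Reals_iff)
 qed
 define q where "q = (%t. b * exp (Ln (u j t / c $ j) / of_nat (p j)))"
 have qhol: "q holomorphic_on ball 0 \<rho>2"
  unfolding q_def by (intro holomorphic_intros holomorphic_on_subset[OF uhol \<rho>2(2)]) (use near cj p_pos[of j] in auto)
 have qnz: "q t ~= 0" for t using b_nz by (simp add: q_def)
 have q0: "q 0 = b" using u0 cj by (simp add: q_def)
 have qp: "q t ^ p j = u j t" if "t \<in> ball 0 \<rho>2" for t
 proof -
  have "u j t / c $ j ~= 0" using near[OF that] by auto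
  moreover have "exp (Ln (u j t / c $ j) / of_nat (p j)) ^ p j = exp (Ln (u j t / c $ j))"
   using p_pos[of j] by (simp flip: exp_of_nat_mult)
  ultimately show ?thesis using cj by (simp add: q_def power_mult_distrib branch)
 qed
 define F where "F = (%t. t / q t)"
 have Fhol: "F holomorphic_on ball 0 \<rho>2" unfolding F_def by (intro holomorphic_intros qhol) (use qnz in auto)
 have F0: "F 0 = 0" by (simp add: F_def)
 have dq: "(q has_field_derivative deriv q 0) (at 0)" using \<rho>2 by (intro holomorphic_derivI[OF qhol]) auto
 have dF0: "(F has_field_derivative 1 / b) (at 0)"
  unfolding F_def using DERIV_divide[OF DERIV_ident dq qnz] by (simp add: q0 b_nz)
 have dFnz: "deriv F 0 ~= 0" using DERIV_imp_deriv[OF dF0] b_nz by simp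
 have zin: "0 \<in> ball (0::complex) \<rho>2" using \<rho>2(1) by simp
 obtain \<rho>3 where \<rho>3: "\<rho>3 > 0" "ball (0::complex) \<rho>3 \<subseteq> ball 0 \<rho>2" "open (F ` ball 0 \<rho>3)" "inj_on F (ball 0 \<rho>3)"
  by (rule has_complex_derivative_locally_invertible[OF Fhol zin open_ball dFnz])
 obtain T where T: "T holomorphic_on (F ` ball 0 \<rho>3)"
   "\<And>t. t \<in> ball 0 \<rho>3 ==> deriv F t * deriv T (F t) = 1" "\<And>t. t \<in> ball 0 \<rho>3 ==> T (F t) = t"
  using holomorphic_has_inverse[OF holomorphic_on_subset[OF Fhol \<rho>3(2)] open_ball \<rho>3(4)] by blast
 have "0 \<in> F ` ball 0 \<rho>3" using F0 \<rho>3(1) by (intro image_eqI[of _ _ 0]) auto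
 then obtain \<rho>4 where \<rho>4: "\<rho>4 > 0" "ball 0 \<rho>4 \<subseteq> F ` ball 0 \<rho>3" using \<rho>3(3) open_contains_ball by blast
 have TF: "T \<tau> \<in> ball 0 \<rho>3" "F (T \<tau>) = \<tau>" if "\<tau> \<in> ball 0 \<rho>4" for \<tau>
  using subsetD[OF \<rho>4(2) that] T(3) by auto
 have T0: "T 0 = 0" using T(3)[of 0] F0 \<rho>3(1) by simp
 have Tnz: "T \<tau> ~= 0" if "\<tau> \<in> ball 0 \<rho>4" "\<tau> ~= 0" for \<tau> using TF[OF that(1)] that(2) F0 by metis
 have Thol: "T holomorphic_on ball 0 \<rho>4" by (rule holomorphic_on_subset[OF T(1) \<rho>4(2)])
 have dT: "(T has_field_derivative deriv T \<tau>) (at \<tau>)" if "\<tau> \<in> ball 0 \<rho>4" for \<tau>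
  by (rule holomorphic_derivI[OF Thol open_ball that])
 have Tq: "T \<tau> = \<tau> * q (T \<tau>)" if "\<tau> \<in> ball 0 \<rho>4" for \<tau>
  using TF(2)[OF that] qnz[of "T \<tau>"] by (simp add: F_def field_simps)
 have in2: "T \<tau> \<in> ball 0 \<rho>2" "T \<tau> \<in> ball 0 \<rho>0" if "\<tau> \<in> ball 0 \<rho>4" for \<tau>
  using TF(1)[OF that] \<rho>3(2) \<rho>2(2) by blast+
 define X where "X = (%i \<tau>. u i (T \<tau>) / q (T \<tau>) ^ p i)"
 have Xhol: "X i holomorphic_on ball 0 \<rho>4" for i
 proof -
  have "(%\<tau>. u i (T \<tau>)) holomorphic_on ball 0 \<rho>4" "(%\<tau>. q (T \<tau>)) holomorphic_on ball 0 \<rho>4"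
   using holomorphic_on_compose_gen[OF Thol uhol image_subsetI[OF in2(2)]]
    holomorphic_on_compose_gen[OF Thol qhol image_subsetI[OF in2(1)]] by (simp_all add: o_def)
  thus ?thesis unfolding X_def by (intro holomorphic_intros) (use qnz in auto)
 qed
 have Xj: "X j \<tau> = 1" if "\<tau> \<in> ball 0 \<rho>4" for \<tau> using qnz[of "T \<tau>"] by (simp add: X_def flip: qp[OF in2(1)[OF that]])
 define Y where "Y = (%\<tau>. \<chi> l. case l of None => (z0 + T \<tau>) * \<tau> ^ r | Some i => if i = j then \<tau> ^ (r + 1) else X i \<tau>)"
 have YX: "chart_X j (Y \<tau>) $ i = X i \<tau>" if "\<tau> \<in> ball 0 \<rho>4" for \<tau> i
  using Xj[OF that] by (simp add: chart_X_def Y_def)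
 have Y0: "Y 0 = ys"
  using b_nz r_pos by (auto simp: Y_def chart_fixpoint_def vec_eq_iff X_def T0 u0 q0 power_int_minus divide_inverse split: option.splits)
 have xX: "laurent_sum p c a z0 (z0 + T \<tau>) $ i = X i \<tau> / \<tau> ^ p i" if "\<tau> \<in> ball 0 \<rho>4" "\<tau> ~= 0" for \<tau> i
 proof -
  have "T \<tau> ^ p i = \<tau> ^ p i * q (T \<tau>) ^ p i" by (subst Tq[OF that(1)]) (simp add: power_mult_distrib)
  thus ?thesis using lsum[OF in2(2)[OF that(1)] Tnz[OF that]] by (simp add: X_def)
 qed
 have key: "((%\<tau>. X i \<tau> / \<tau> ^ p i) has_field_derivative hh i (Y \<tau>) / \<tau> ^ (p i + 1) * deriv T \<tau>) (at \<tau>)"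
  if \<tau>: "\<tau> \<in> ball 0 \<rho>4" "\<tau> ~= 0" for \<tau> i
 proof -
  let ?x = "laurent_sum p c a z0 (z0 + T \<tau>)"
  have h: "(f i ?x (z0 + T \<tau>) + g i ?x (z0 + T \<tau>)) * \<tau> ^ (p i + 1) = hh i (Y \<tau>)"
  proof (rule field_scaling[OF \<tau>(2)])
   show "Y \<tau> $ Some j = \<tau> ^ (r + 1)" "(z0 + T \<tau>) * \<tau> ^ r = Y \<tau> $ None" by (simp_all add: Y_def)
   show "?x $ l = chart_X j (Y \<tau>) $ l / \<tau> ^ p l" for l using xX[OF \<tau>] YX[OF \<tau>(1)] by simp
  qed
  have "((%w. laurent_sum p c a z0 w $ i) has_field_derivative f i ?x (z0 + T \<tau>) + g i ?x (z0 + T \<tau>)) (at (z0 + T \<tau>))"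
   by (rule L(2)) (use in2(2)[OF \<tau>(1)] Tnz[OF \<tau>] in \<open>auto simp: dist_norm\<close>)
  hence "((%\<tau>. laurent_sum p c a z0 (z0 + T \<tau>) $ i) has_field_derivative (f i ?x (z0 + T \<tau>) + g i ?x (z0 + T \<tau>)) * deriv T \<tau>) (at \<tau>)"
   by (rule DERIV_chain2) (auto intro!: derivative_eq_intros dT \<tau>)
  moreover have "f i ?x (z0 + T \<tau>) + g i ?x (z0 + T \<tau>) = hh i (Y \<tau>) / \<tau> ^ (p i + 1)"
   using h \<tau>(2) by (simp add: eq_divide_eq)
  ultimately have "((%\<tau>. laurent_sum p c a z0 (z0 + T \<tau>) $ i) has_field_derivative hh i (Y \<tau>) / \<tau> ^ (p i + 1) * deriv T \<tau>) (at \<tau>)"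
   by simp
  thus ?thesis
   by (rule has_field_derivative_transform_within_open[where S = "ball 0 \<rho>4 - {0}"]) (use xX \<tau> in auto)
 qed
 have dX: "(X i has_field_derivative deriv (X i) \<tau>) (at \<tau>)" if "\<tau> \<in> ball 0 \<rho>4" for i \<tau>
  by (rule holomorphic_derivI[OF Xhol open_ball that])
 have ode: "\<tau> * deriv (X i) \<tau> - of_nat (p i) * X i \<tau> = hh i (Y \<tau>) * deriv T \<tau>" if \<tau>: "\<tau> \<in> ball 0 \<rho>4" "\<tau> ~= 0" for \<tau> i
 proof -
  have pw: "((%\<tau>. \<tau> ^ p i) has_field_derivative of_nat (p i) * \<tau> ^ (p i - 1)) (at \<tau>)"
   by (auto intro!: derivative_eq_intros)
  have "((%\<tau>. X i \<tau> / \<tau> ^ p i) has_field_derivative (deriv (X i) \<tau> * \<tau> ^ p i - X i \<tau> * (of_nat (p i) * \<tau> ^ (p i - 1))) / (\<tau> ^ p i * \<tau> ^ p i)) (at \<tau>)"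
   by (rule DERIV_divide[OF dX[OF \<tau>(1)] pw]) (use \<tau> in simp)
  from DERIV_unique[OF this key[OF \<tau>]]
  have e: "(deriv (X i) \<tau> * \<tau> ^ p i - X i \<tau> * (of_nat (p i) * \<tau> ^ (p i - 1))) / (\<tau> ^ p i * \<tau> ^ p i) = hh i (Y \<tau>) / \<tau> ^ (p i + 1) * deriv T \<tau>" .
  obtain k where k: "p i = Suc k" using p_pos[of i] gr0_implies_Suc by blast
  have "(\<tau> * deriv (X i) \<tau> - of_nat (Suc k) * X i \<tau>) / \<tau> ^ (Suc k + 1) = hh i (Y \<tau>) * deriv T \<tau> / \<tau> ^ (Suc k + 1)"
   using e quotient_numerator[OF \<tau>(2)] unfolding k by simp
  thus ?thesis using \<tau>(2) unfolding k by (simp only: divide_cancel_right power_eq_0_iff) auto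
 qed
 have dXj: "deriv (X j) \<tau> = 0" if "\<tau> \<in> ball 0 \<rho>4" for \<tau>
 proof -
  have "(X j has_field_derivative 0) (at \<tau>)"
   by (rule has_field_derivative_transform_within_open[OF DERIV_const[of 1] open_ball that]) (use Xj in simp)
  thus ?thesis by (rule DERIV_imp_deriv)
 qed
 \<comment> \<open>Since \<open>X j\<close> is constantly 1, the equation for \<open>i = j\<close>
   reads \<open>- p j = hh j * T'\<close>, which identifies \<open>T'\<close> with
   \<open>kk\<close>. At the centre both sides are \<open>b\<close>.\<close>
 have dTk: "deriv T \<tau> = kk (Y \<tau>)" if \<tau>: "\<tau> \<in> ball 0 \<rho>4" for \<tau>
 proof (cases "\<tau> = 0")
  case True
  have "deriv F 0 * deriv T (F 0) = 1" by (rule T(2)) (use \<rho>3 in simp)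
  thus ?thesis using True DERIV_imp_deriv[OF dF0] b_nz by (simp add: F0 Y0 kk_ys field_simps)
 next
  case False
  have "- of_nat (p j) = hh j (Y \<tau>) * deriv T \<tau>" using ode[OF \<tau> False, of j] dXj[OF \<tau>] Xj[OF \<tau>] by simp
  moreover from this have "hh j (Y \<tau>) ~= 0" using p_pos[of j] by auto
  ultimately show ?thesis by (simp add: kk_def)
 qed
 have Ycont: "continuous_on (ball 0 \<rho>4) Y"
 proof -
  have "continuous_on (ball 0 \<rho>4) (%\<tau>. case l of None => (z0 + T \<tau>) * \<tau> ^ r | Some i => if i = j then \<tau> ^ (r + 1) else X i \<tau>)" for l
  proof (cases l)
   case (Some a)
   thus ?thesis using holomorphic_on_imp_continuous_on[OF Xhol[of a]] by (cases "a = j") (auto intro!: continuous_intros)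
  qed (use holomorphic_on_imp_continuous_on[OF Thol] in \<open>auto intro!: continuous_intros\<close>)
  thus ?thesis unfolding Y_def by (intro continuous_on_vec_lambda)
 qed
 have "\<forall>\<^sub>F \<tau> in at 0. dist (Y \<tau>) ys < RV"
 proof -
  have "isCont Y 0" using Ycont \<rho>4(1) by (simp add: continuous_on_eq_continuous_at)
  thus ?thesis using tendstoD[of Y ys "at 0" RV] RV(1) Y0 by (simp add: isCont_def)
 qed
 then obtain \<rho>5 where \<rho>5: "\<rho>5 > 0" "\<And>\<tau>. \<tau> ~= 0 ==> norm \<tau> < \<rho>5 ==> dist (Y \<tau>) ys < RV"
  unfolding eventually_at by (auto simp: dist_norm)
 define \<rho> where "\<rho> = min \<rho>4 \<rho>5"
 have in4: "\<tau> \<in> ball 0 \<rho>4" if "\<tau> \<in> ball 0 \<rho>" for \<tau> using that by (auto simp: \<rho>_def)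
 have "chart_sol z0 Y T \<rho>"
  unfolding chart_sol_def
 proof (intro conjI ballI allI)
  show "\<rho> > 0" using \<rho>4 \<rho>5 by (simp add: \<rho>_def)
  fix \<tau> :: complex assume \<tau>: "\<tau> \<in> ball 0 \<rho>"
  show "Y \<tau> \<in> ball ys RV" using \<rho>5(2)[of \<tau>] \<tau> Y0 RV(1) by (cases "\<tau> = 0") (auto simp: \<rho>_def dist_commute)
  show "(T has_field_derivative kk (Y \<tau>)) (at \<tau>)" using dT[OF in4[OF \<tau>]] dTk[OF in4[OF \<tau>]] by simp
  show Yj: "Y \<tau> $ Some j = \<tau> ^ (r + 1)" "Y \<tau> $ None = (z0 + T \<tau>) * \<tau> ^ r" by (simp_all add: Y_def)
  fix l
  show "\<exists>D. ((%t. Y t $ l) has_field_derivative D) (at \<tau>) \<and> \<tau> * D = V (Y \<tau>) $ l"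
  proof (cases l)
   case None
   have "((%t. Y t $ l) has_field_derivative kk (Y \<tau>) * \<tau> ^ r + (z0 + T \<tau>) * (of_nat r * \<tau> ^ (r - 1))) (at \<tau>)"
   proof -
    have gen: "((%t. (z0 + T t) * t ^ r) has_field_derivative \<kappa> * \<tau> ^ r + (z0 + T \<tau>) * (of_nat r * \<tau> ^ (r - 1))) (at \<tau>)"
     if "(T has_field_derivative \<kappa>) (at \<tau>)" for \<kappa> using that by (auto intro!: derivative_eq_intros)
    have "(%t. Y t $ l) = (%t. (z0 + T t) * t ^ r)" by (simp add: Y_def None)
    thus ?thesis using gen[OF dT[OF in4[OF \<tau>]]] dTk[OF in4[OF \<tau>]] by simp
   qed
   moreover have "\<tau> * (kk (Y \<tau>) * \<tau> ^ r + (z0 + T \<tau>) * (of_nat r * \<tau> ^ (r - 1))) = V (Y \<tau>) $ l"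
    using r_pos unfolding None V_None Yj by (cases r) (auto simp: algebra_simps)
   ultimately show ?thesis by blast
  next
   case (Some i)
   show ?thesis
   proof (cases "i = j")
    case True
    have "((%t. Y t $ l) has_field_derivative of_nat (r + 1) * \<tau> ^ r) (at \<tau>)"
     unfolding Y_def Some True using DERIV_power[OF DERIV_ident, where x = \<tau> and s = UNIV and n = "r + 1"] by simp
    moreover have "\<tau> * (of_nat (r + 1) * \<tau> ^ r) = V (Y \<tau>) $ l" unfolding Some True V_j Yj by simp
    ultimately show ?thesis by blast
   next
    case False
    have 1: "((%t. Y t $ l) has_field_derivative deriv (X i) \<tau>) (at \<tau>)"
     using dX[OF in4[OF \<tau>], of i] False by (simp add: Y_def Some)
    have "\<tau> * deriv (X i) \<tau> = V (Y \<tau>) $ l"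
    proof (cases "\<tau> = 0")
     case True thus ?thesis by (simp add: Y0 V_ys)
    next
     case nz: False
     have "Y \<tau> $ Some i = X i \<tau>" using False by (simp add: Y_def)
     thus ?thesis using ode[OF in4[OF \<tau>] nz, of i] dTk[OF in4[OF \<tau>]]
      unfolding Some V_i[OF False] by (simp add: algebra_simps)
    qed
    with 1 show ?thesis by blast
   qed
  qed
 qed (use Y0 T0 in auto)
 moreover have "linked a Y T"
  unfolding linked_def
 proof (intro exI conjI allI ballI)
  show "\<rho>0 > 0" "\<rho>4 > 0" by fact+
  show "(%n. lcoef a i n * t ^ n) sums u i t" if "t \<in> ball 0 \<rho>0" for i t by (rule us[OF that])
  fix i \<tau> assume \<tau>: "\<tau> \<in> ball (0::complex) \<rho>4"
  show "T \<tau> \<in> ball 0 \<rho>0" by (rule in2(2)[OF \<tau>])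
  have "T \<tau> ^ p i = \<tau> ^ p i * q (T \<tau>) ^ p i" by (subst Tq[OF \<tau>]) (simp add: power_mult_distrib)
  thus "u i (T \<tau>) * \<tau> ^ p i = chart_X j (Y \<tau>) $ i * T \<tau> ^ p i"
   unfolding YX[OF \<tau>] using qnz[of "T \<tau>"] by (simp add: X_def)
 qed
 ultimately show ?thesis by blast
qed

text \<open>The inverse \<open>S\<close> of \<open>T\<close> expresses \<open>\<tau>\<close> by
  \<open>t\<close>. Then \<open>t ^ p i * x\<^sub>i\<close> becomes a holomorphic function
  \<open>u i\<close> of \<open>t\<close> with value \<open>c $ i\<close> at 0, and its Taylor
  coefficients are the Laurent coefficients.\<close>

lemma chart_to_laurent:
 assumes sol: "chart_sol z0 Y T \<rho>"
 shows "\<exists>a. laurent_solution f g p c z0 a \<and> linked a Y T"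
proof -
 obtain v where v: "v holomorphic_on ball 0 \<rho>" "v 0 = b" "\<And>\<tau>. \<tau> \<in> ball 0 \<rho> ==> v \<tau> ~= 0" "\<And>\<tau>. T \<tau> = \<tau> * v \<tau>"
  using chart_sol_T[OF sol] by blast
 have Yin: "Y w \<in> ball ys RV" and dT: "(T has_field_derivative kk (Y w)) (at w)"
  and Yj: "Y w $ Some j = w ^ (r + 1)" and YZ: "Y w $ None = (z0 + T w) * w ^ r"
  and dY: "\<And>q. \<exists>D. ((%t. Y t $ q) has_field_derivative D) (at w) \<and> w * D = V (Y w) $ q"
  if "w \<in> ball 0 \<rho>" for w
  using sol that unfolding chart_sol_def by blast+
 have T0: "T 0 = 0" and Y0: "Y 0 = ys" and \<rho>: "\<rho> > 0" using sol unfolding chart_sol_def by blast+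
 have Thol: "T holomorphic_on ball 0 \<rho>" by (rule holomorphicI) (use dT in blast)
 have Xder: "\<exists>D. ((%t. chart_X j (Y t) $ i) has_field_derivative D) (at w) \<and> w * D = of_nat (p i) * chart_X j (Y w) $ i + kk (Y w) * hh i (Y w)"
  if w: "w \<in> ball 0 \<rho>" for w i
 proof (cases "i = j")
  case True
  \<comment> \<open>The slot \<open>Some j\<close> of \<open>Y\<close> holds \<epsilon> and not
    \<open>X\<^sub>j = 1\<close>; for \<open>i = j\<close> the equation is true because
    \<open>kk * hh j = - p j\<close>.\<close>
  have "of_nat (p j) + kk (Y w) * hh j (Y w) = 0" using RV(2)[OF Yin[OF w]] by (simp add: kk_def)
  thus ?thesis using True by (intro exI[of _ 0]) simp
 next
  case False
  thus ?thesis using dY[OF w, of "Some i"] V_i[OF False, of "Y w"] by (simp add: chart_X_def)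
 qed
 have Xhol: "(%w. chart_X j (Y w) $ i) holomorphic_on ball 0 \<rho>" for i
  by (rule holomorphicI) (use Xder in blast)
 have dTnz: "deriv T 0 ~= 0" using DERIV_imp_deriv[OF dT[of 0]] \<rho> b_nz by (simp add: Y0 kk_ys)
 have zin: "0 \<in> ball (0::complex) \<rho>" using \<rho> by simp
 obtain \<rho>1 where \<rho>1: "\<rho>1 > 0" "ball (0::complex) \<rho>1 \<subseteq> ball 0 \<rho>" "open (T ` ball 0 \<rho>1)" "inj_on T (ball 0 \<rho>1)"
  by (rule has_complex_derivative_locally_invertible[OF Thol zin open_ball dTnz])
 obtain S where S: "S holomorphic_on (T ` ball 0 \<rho>1)"
   "\<And>t. t \<in> ball 0 \<rho>1 ==> deriv T t * deriv S (T t) = 1" "\<And>t. t \<in> ball 0 \<rho>1 ==> S (T t) = t"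
  using holomorphic_has_inverse[OF holomorphic_on_subset[OF Thol \<rho>1(2)] open_ball \<rho>1(4)] by blast
 have "0 \<in> T ` ball 0 \<rho>1" using T0 \<rho>1(1) by (intro image_eqI[of _ _ 0]) auto
 then obtain \<delta> where \<delta>: "\<delta> > 0" "ball 0 \<delta> \<subseteq> T ` ball 0 \<rho>1" using \<rho>1(3) open_contains_ball by blast
 have ST: "S t \<in> ball 0 \<rho>1" "T (S t) = t" if "t \<in> ball 0 \<delta>" for t
  using subsetD[OF \<delta>(2) that] S(3) by auto
 have Sin: "S t \<in> ball 0 \<rho>" if "t \<in> ball 0 \<delta>" for t using ST(1)[OF that] \<rho>1(2) by blast
 have Shol: "S holomorphic_on ball 0 \<delta>" by (rule holomorphic_on_subset[OF S(1) \<delta>(2)])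
 have S0: "S 0 = 0" using S(3)[of 0] T0 \<rho>1(1) by simp
 have Snz: "S t ~= 0" if "t \<in> ball 0 \<delta>" "t ~= 0" for t using ST[OF that(1)] that(2) T0 by metis
 define u where "u = (%i t. chart_X j (Y (S t)) $ i * v (S t) ^ p i)"
 have uhol: "u i holomorphic_on ball 0 \<delta>" for i
 proof -
  have "(%t. chart_X j (Y (S t)) $ i) holomorphic_on ball 0 \<delta>" "(%t. v (S t)) holomorphic_on ball 0 \<delta>"
   using holomorphic_on_compose_gen[OF Shol Xhol[of i] image_subsetI[OF Sin]]
    holomorphic_on_compose_gen[OF Shol v(1) image_subsetI[OF Sin]] by (simp_all add: o_def)
  thus ?thesis unfolding u_def by (intro holomorphic_intros)
 qed
 have u0: "u i 0 = c $ i" for i by (simp add: u_def S0 Y0 v(2) chart_X_ys)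
 define a where "a = (%i n. (deriv ^^ n) (u i) 0 / fact n)"
 have la: "lcoef a i n = (deriv ^^ n) (u i) 0 / fact n" for i n
  by (simp add: lcoef_def a_def u0)
 have us: "(%n. lcoef a i n * t ^ n) sums u i t" if "t \<in> ball 0 \<delta>" for i t
  using holomorphic_power_series[OF uhol that, of i] by (simp add: la)
 have uS: "u i t / t ^ p i = chart_X j (Y (S t)) $ i / S t ^ p i" if "t \<in> ball 0 \<delta>" "t ~= 0" for i t
 proof -
  have "t ^ p i = S t ^ p i * v (S t) ^ p i" using ST(2)[OF that(1)] by (simp add: v(4) flip: power_mult_distrib)
  thus ?thesis using v(3)[OF Sin[OF that(1)]] by (simp add: u_def)
 qed
 have shift: "a i (Suc n) * t powi (- int (p i) + int (Suc n)) = t powi (- int (p i)) * (lcoef a i (Suc n) * t ^ Suc n)"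
  if "t ~= 0" for t i n using that by (subst power_int_add) (auto simp: lcoef_def simp del: power_Suc of_nat_Suc)
 have lsums: "(%n. a i (Suc n) * t powi (- int (p i) + int (Suc n))) sums (t powi (- int (p i)) * (u i t - c $ i))"
  if t: "t \<in> ball 0 \<delta>" "t ~= 0" for t i
 proof -
  have l0: "lcoef a i 0 * t ^ 0 = c $ i" by (simp add: lcoef_def)
  have "(%n. lcoef a i (Suc n) * t ^ Suc n) sums (u i t - lcoef a i 0 * t ^ 0)"
   using us[OF t(1), of i] by (subst sums_Suc_iff) simp
  from sums_mult[OF this, of "t powi (- int (p i))"]
  show ?thesis unfolding shift[OF t(2)] l0 .
 qed
 have lsum: "laurent_sum p c a z0 z $ i = chart_X j (Y (S (z - z0))) $ i / S (z - z0) ^ p i"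
  if "z - z0 \<in> ball 0 \<delta>" "z ~= z0" for z i
 proof -
  have "laurent_sum p c a z0 z $ i = u i (z - z0) / (z - z0) ^ p i"
   using that sums_unique[OF lsums[of "z - z0" i]] by (simp add: laurent_sum_def power_int_minus field_simps)
  thus ?thesis using uS[of "z - z0" i] that by simp
 qed
 have "laurent_solution f g p c z0 a"
  unfolding laurent_solution_def
 proof (intro exI[of _ \<delta>] conjI allI impI)
  fix z i assume "0 < dist z z0 \<and> dist z z0 < \<delta>"
  hence z: "z - z0 \<in> ball 0 \<delta>" "z - z0 ~= 0" "z ~= z0" unfolding mem_ball_0 dist_norm by auto
  show "summable (%n. a i (Suc n) * (z - z0) powi (- int (p i) + int (Suc n)))"
   using lsums[OF z(1,2)] by (rule sums_summable)
  define t where "t = z - z0"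
  define w where "w = S t"
  have t: "t \<in> ball 0 \<delta>" "t ~= 0" using z by (simp_all add: t_def)
  have w: "w \<in> ball 0 \<rho>" "w ~= 0" "T w = t" using Sin[OF t(1)] Snz[OF t] ST(2)[OF t(1)] by (simp_all add: w_def)
  let ?x = "laurent_sum p c a z0 z"
  have h: "(f i ?x z + g i ?x z) * w ^ (p i + 1) = hh i (Y w)"
  proof (rule field_scaling[OF w(2) Yj[OF w(1)]])
   show "z * w ^ r = Y w $ None" unfolding YZ[OF w(1)] w(3) by (simp add: t_def)
   show "?x $ l = chart_X j (Y w) $ l / w ^ p l" for l using lsum[OF z(1) z(3), of l] by (simp add: w_def t_def)
  qed
  obtain D where D: "((%t. chart_X j (Y t) $ i) has_field_derivative D) (at w)" "w * D = of_nat (p i) * chart_X j (Y w) $ i + kk (Y w) * hh i (Y w)"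
   using Xder[OF w(1)] by blast
  have pw: "((%\<tau>. \<tau> ^ p i) has_field_derivative of_nat (p i) * w ^ (p i - 1)) (at w)"
   by (auto intro!: derivative_eq_intros)
  have "((%\<tau>. chart_X j (Y \<tau>) $ i / \<tau> ^ p i) has_field_derivative (D * w ^ p i - chart_X j (Y w) $ i * (of_nat (p i) * w ^ (p i - 1))) / (w ^ p i * w ^ p i)) (at w)"
   by (rule DERIV_divide[OF D(1) pw]) (use w in simp)
  moreover have "(D * w ^ p i - chart_X j (Y w) $ i * (of_nat (p i) * w ^ (p i - 1))) / (w ^ p i * w ^ p i) = kk (Y w) * hh i (Y w) / w ^ (p i + 1)"
  proof -
   obtain k where k: "p i = Suc k" using p_pos[of i] gr0_implies_Suc by blast
   have "kk (Y w) * hh i (Y w) = w * D - of_nat (p i) * chart_X j (Y w) $ i" using D(2) by simp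
   thus ?thesis using quotient_numerator[OF w(2), of D k] unfolding k by simp
  qed
  ultimately have 1: "((%\<tau>. chart_X j (Y \<tau>) $ i / \<tau> ^ p i) has_field_derivative kk (Y w) * hh i (Y w) / w ^ (p i + 1)) (at w)" by simp
  have dS: "(S has_field_derivative 1 / kk (Y w)) (at t)"
  proof -
   have "deriv T w * deriv S (T w) = 1" by (rule S(2)) (use ST(1)[OF t(1)] in \<open>simp add: w_def\<close>)
   hence "deriv S t = 1 / kk (Y w)" using DERIV_imp_deriv[OF dT[OF w(1)]] kk_nz[OF Yin[OF w(1)]] w(3) by (simp add: field_simps)
   thus ?thesis using holomorphic_derivI[OF Shol open_ball t(1)] by simp
  qed
  have dz: "((%z. S (z - z0)) has_field_derivative 1 / kk (Y w)) (at z)"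
  proof -
   have "((%z. z - z0) has_field_derivative 1) (at z)" by (auto intro!: derivative_eq_intros)
   from DERIV_chain2[OF dS[unfolded t_def] this] show ?thesis by simp
  qed
  have "((%z. chart_X j (Y (S (z - z0))) $ i / S (z - z0) ^ p i) has_field_derivative kk (Y w) * hh i (Y w) / w ^ (p i + 1) * (1 / kk (Y w))) (at z)"
  proof -
   have "((%\<tau>. chart_X j (Y \<tau>) $ i / \<tau> ^ p i) has_field_derivative kk (Y w) * hh i (Y w) / w ^ (p i + 1)) (at (S (z - z0)))"
    using 1 unfolding w_def t_def .
   from DERIV_chain2[OF this dz] show ?thesis .
  qed
  moreover have "kk (Y w) * hh i (Y w) / w ^ (p i + 1) * (1 / kk (Y w)) = f i ?x z + g i ?x z"
   using h w(2) kk_nz[OF Yin[OF w(1)]] by (simp add: divide_eq_eq)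
  ultimately have 2: "((%z. chart_X j (Y (S (z - z0))) $ i / S (z - z0) ^ p i) has_field_derivative f i ?x z + g i ?x z) (at z)" by simp
  show "((%w. laurent_sum p c a z0 w $ i) has_field_derivative f i ?x z + g i ?x z) (at z)"
  proof (rule has_field_derivative_transform_within_open[OF 2])
   show "open (ball z0 \<delta> - {z0})" by auto
   show "z \<in> ball z0 \<delta> - {z0}" using z by (simp add: dist_norm norm_minus_commute)
   fix y assume "y \<in> ball z0 \<delta> - {z0}"
   hence "y - z0 \<in> ball 0 \<delta>" "y ~= z0" by (simp_all add: dist_norm norm_minus_commute)
   thus "chart_X j (Y (S (y - z0))) $ i / S (y - z0) ^ p i = laurent_sum p c a z0 y $ i" using lsum by simp
  qed
 qed (use \<delta> in auto)
 moreover have "linked a Y T"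
 proof -
  have "isCont T 0" using dT[of 0] \<rho> by (auto intro: DERIV_isCont)
  hence "\<forall>\<^sub>F \<tau> in at 0. dist (T \<tau>) 0 < \<delta>" using \<delta>(1) T0 by (intro tendstoD) (auto simp: isCont_def)
  then obtain \<delta>1 where \<delta>1: "\<delta>1 > 0" "\<And>\<tau>. \<tau> ~= 0 ==> norm \<tau> < \<delta>1 ==> norm (T \<tau>) < \<delta>"
   unfolding eventually_at by (auto simp: dist_norm)
  have Tin: "T \<tau> \<in> ball 0 \<delta>" if "\<tau> \<in> ball 0 \<delta>1" for \<tau> using \<delta>1(2)[of \<tau>] that T0 \<delta> by (cases "\<tau> = 0") auto
  show ?thesis unfolding linked_def
  proof (intro exI conjI allI ballI)
   show "\<delta> > 0" "min \<delta>1 \<rho>1 > 0" using \<delta> \<delta>1 \<rho>1 by auto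
   show "(%n. lcoef a i n * t ^ n) sums u i t" if "t \<in> ball 0 \<delta>" for i t by (rule us[OF that])
   fix i \<tau> assume \<tau>: "\<tau> \<in> ball (0::complex) (min \<delta>1 \<rho>1)"
   show "T \<tau> \<in> ball 0 \<delta>" using Tin \<tau> by simp
   have "S (T \<tau>) = \<tau>" using S(3) \<tau> by simp
   thus "u i (T \<tau>) * \<tau> ^ p i = chart_X j (Y \<tau>) $ i * T \<tau> ^ p i"
    by (simp add: u_def v(4) power_mult_distrib)
  qed
 qed
 ultimately show ?thesis by blast
qed

end

section \<open>Periodic flows and their eigenfunctions\<close>

text \<open>The images of \<open>v\<close> under the powers of \<open>A\<close> up to the dimension
  are dependent, so a nonzero polynomial in \<open>A\<close> kills \<open>v\<close>. Its linear
  factors \<open>A - \<mu>\<close> are applied one after the other; the last vector before zero is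
  an eigenvector, and it lies in \<open>W\<close>.\<close>

lemma invariant_subspace_eigenvector:
 fixes A :: "complex^'n::finite^'n"
 assumes W: "\<And>x y. x \<in> W ==> y \<in> W ==> x + y \<in> W" "\<And>c x. x \<in> W ==> c *s x \<in> W" "\<And>x. x \<in> W ==> A *v x \<in> W"
  and v: "v \<in> W" "v ~= 0"
 shows "\<exists>w \<mu>. w \<in> W \<and> w ~= 0 \<and> A *v w = \<mu> *s w"
proof -
 define ev where "ev = (%(q::complex poly) v. \<Sum>i\<le>degree q. coeff q i *s (((*v) A ^^ i) v))"
 have pw_add: "((*v) A ^^ i) (x + y) = ((*v) A ^^ i) x + ((*v) A ^^ i) y" for i x y
  by (induction i) (simp_all add: matrix_vector_right_distrib)
 have pw_smult: "((*v) A ^^ i) (k *s x) = k *s ((*v) A ^^ i) x" for i k x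
  by (induction i) (simp_all add: matrix_vec_smult)
 have ev_bound: "ev q x = (\<Sum>i\<le>N. coeff q i *s (((*v) A ^^ i) x))" if "degree q \<le> N" for q x N
  unfolding ev_def by (rule sum.mono_neutral_left) (use that in \<open>auto simp: coeff_eq_0\<close>)
 have ev_factor: "ev ([:- \<mu>, 1:] * q) x = ev q (A *v x - \<mu> *s x)" for q x \<mu>
 proof -
  define N where "N = degree q"
  have co: "coeff ([:- \<mu>, 1:] * q) i = (case i of 0 => 0 | Suc k => coeff q k) - \<mu> * coeff q i" for i
   by (cases i) (simp_all add: algebra_simps)
  have "degree ([:- \<mu>, 1:] * q) \<le> Suc N" using degree_mult_le[of "[:- \<mu>, 1:]" q] by (simp add: N_def)
  hence "ev ([:- \<mu>, 1:] * q) x = (\<Sum>i\<le>Suc N. (case i of 0 => 0 | Suc k => coeff q k) *s (((*v) A ^^ i) x)) - (\<Sum>i\<le>Suc N. (\<mu> * coeff q i) *s (((*v) A ^^ i) x))"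
   by (subst ev_bound) (simp_all only: co sum_subtractf[symmetric] vector_sub_rdistrib[symmetric])
  also have "(\<Sum>i\<le>Suc N. (case i of 0 => 0 | Suc k => coeff q k) *s (((*v) A ^^ i) x)) = (\<Sum>i\<le>N. coeff q i *s (((*v) A ^^ Suc i) x))"
   by (subst sum.atMost_Suc_shift) simp
  also have "\<dots> = (\<Sum>i\<le>N. coeff q i *s (((*v) A ^^ i) (A *v x)))" by (simp add: funpow_swap1)
  also have "(\<Sum>i\<le>Suc N. (\<mu> * coeff q i) *s (((*v) A ^^ i) x)) = (\<Sum>i\<le>N. coeff q i *s (((*v) A ^^ i) (\<mu> *s x)))"
   by (simp add: N_def coeff_eq_0 pw_smult vector_smult_assoc mult.commute)
  also have "(\<Sum>i\<le>N. coeff q i *s (((*v) A ^^ i) (A *v x))) - (\<Sum>i\<le>N. coeff q i *s (((*v) A ^^ i) (\<mu> *s x)))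
    = (\<Sum>i\<le>N. coeff q i *s (((*v) A ^^ i) (A *v x - \<mu> *s x)))"
  proof -
   have "((*v) A ^^ i) (A *v x - \<mu> *s x) = ((*v) A ^^ i) (A *v x) - ((*v) A ^^ i) (\<mu> *s x)" for i
    using pw_add[of i "A *v x - \<mu> *s x" "\<mu> *s x"] by (simp add: eq_diff_eq)
   thus ?thesis by (simp add: sum_subtractf vector_ssub_ldistrib)
  qed
  finally show ?thesis by (simp add: ev_def N_def)
 qed
 have main: "\<exists>w \<mu>. w \<in> W \<and> w ~= 0 \<and> A *v w = \<mu> *s w" if "q ~= 0" "ev q x = 0" "x \<in> W" "x ~= 0" for q x
  using that
 proof (induction "degree q" arbitrary: q x rule: less_induct)
  case less
  show ?case
  proof (cases "degree q = 0")
   case True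
   then obtain k where "q = [:k:]" by (meson degree_eq_zeroE)
   hence "k ~= 0" "k *s x = 0" using less.prems by (auto simp: ev_def)
   thus ?thesis using less.prems(4) by (simp add: vec_eq_iff)
  next
   case False
   hence "\<not> constant (poly q)" by (simp add: constant_degree)
   then obtain \<mu> where "poly q \<mu> = 0" using fundamental_theorem_of_algebra by blast
   then obtain q' where q': "q = [:- \<mu>, 1:] * q'" by (metis dvdE poly_eq_0_iff_dvd)
   have q'0: "q' ~= 0" using q' less.prems(1) by auto
   have deg: "degree q' < degree q" unfolding q' using q'0 by (subst degree_mult_eq) auto
   define x' where "x' = A *v x - \<mu> *s x"
   show ?thesis
   proof (cases "x' = 0")
    case True
    hence "A *v x = \<mu> *s x" by (simp add: x'_def)
    thus ?thesis using less.prems by blast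
   next
    case x': False
    have "x' \<in> W" using W(1)[OF W(3)[OF less.prems(3)] W(2)[OF less.prems(3), of "-\<mu>"]] by (simp add: x'_def)
    moreover have "ev q' x' = 0" using less.prems(2) unfolding q' ev_factor x'_def .
    ultimately show ?thesis using less.hyps[OF deg q'0 _ _ x'] by blast
   qed
  qed
 qed
 have "\<exists>q. q ~= 0 \<and> ev q v = 0"
 proof -
  define N where "N = CARD('n)"
  let ?a = "%i. ((*v) A ^^ i) v"
  show ?thesis
  \<comment> \<open>Linear dependence is a property of sets, so a repetition among the powers is
    treated apart.\<close>
  proof (cases "inj_on ?a {..N}")
   case False
   then obtain i k where ik: "i < k" "?a i = ?a k" by (metis linorder_inj_onI')
   define q where "q = monom 1 k - monom (1::complex) i"
   have cq: "coeff q l = (if l = k then 1 else 0) - (if l = i then 1 else 0)" for l by (simp add: q_def)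
   have "degree q \<le> k" unfolding q_def using ik by (intro degree_diff_le) (auto simp: degree_monom_le intro: order_trans[OF degree_monom_le])
   hence "ev q v = (\<Sum>l\<le>k. coeff q l *s ?a l)" by (rule ev_bound)
   also have "\<dots> = (\<Sum>l\<le>k. (if l = k then ?a l else 0) - (if l = i then ?a l else 0))"
    by (intro sum.cong) (auto simp: cq)
   also have "\<dots> = 0" using ik by (simp add: sum_subtractf)
   finally have "ev q v = 0" .
   moreover have "q ~= 0"
   proof
    assume "q = 0"
    thus False using cq[of k] ik by simp
   qed
   ultimately show ?thesis by blast
  next
   case True
   have "\<not> vec.independent (?a ` {..N})"
   proof
    assume ind: "vec.independent (?a ` {..N})"
    have "card (?a ` {..N}) \<le> vec.dim (UNIV :: (complex^'n) set)"
     by (rule vec.independent_card_le_dim[OF _ ind]) auto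
    thus False using card_image[OF True] by (simp add: N_def vec.dim_UNIV card_cart_basis)
   qed
   then obtain u where u: "\<exists>w\<in>?a ` {..N}. u w ~= 0" "(\<Sum>w\<in>?a ` {..N}. u w *s w) = 0"
    using vec.dependent_finite[of "?a ` {..N}"] by auto
   define q where "q = (\<Sum>i\<le>N. monom (u (?a i)) i)"
   have cq: "coeff q l = (if l \<le> N then u (?a l) else 0)" for l
    unfolding q_def coeff_sum by simp
   have "degree q \<le> N" by (rule degree_le) (simp add: cq)
   hence "ev q v = (\<Sum>l\<le>N. u (?a l) *s ?a l)" by (subst ev_bound) (auto simp: cq)
   also have "\<dots> = 0" using u(2) by (subst (asm) sum.reindex[OF True]) (simp add: o_def)
   finally have "ev q v = 0" .
   moreover have "q ~= 0"
   proof -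
    obtain i where "i \<le> N" "u (?a i) ~= 0" using u(1) by auto
    thus ?thesis using cq[of i] by auto
   qed
   ultimately show ?thesis by blast
  qed
 qed
 with main v show ?thesis by blast
qed

text \<open>Bilinear, without conjugation: the rows are to be differentials of holomorphic
  functions.\<close>

definition rdot :: "complex^'n::finite => complex^'n => complex" where
 "rdot R v = (\<Sum>k\<in>UNIV. R $ k * v $ k)"

lemma matrix_rdot: "(M *v v) $ k = rdot (M $ k) v"
 by (simp add: rdot_def matrix_vector_mult_def)

text \<open>Greedy choice of rows: the vector killed by all rows but the \<open>k\<close>-th decides which row may
  replace the \<open>k\<close>-th one without destroying invertibility.\<close>

lemma row_selection:
 fixes M0 :: "complex^'n::finite^'n"
 assumes M0: "det M0 ~= 0"
  and ker: "\<And>v. v ~= 0 ==> (\<And>k. k \<notin> Q ==> rdot (M0 $ k) v = 0) ==> \<exists>R\<in>Rows. rdot R v ~= 0"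
 shows "\<exists>M :: complex^'n^'n. det M ~= 0 \<and> (\<forall>k. k \<notin> Q \<longrightarrow> M $ k = M0 $ k) \<and> (\<forall>k\<in>Q. M $ k \<in> Rows)"
proof -
 have "finite Q" by simp
 moreover have "Q \<subseteq> Q" ..
 ultimately have "\<exists>M :: complex^'n^'n. det M ~= 0 \<and> (\<forall>k. k \<notin> Q \<longrightarrow> M $ k = M0 $ k) \<and> (\<forall>k\<in>Q. M $ k \<in> Rows)"
 proof (induction rule: finite_subset_induct')
  case empty
  thus ?case using M0 by (intro exI[of _ M0]) simp
 next
  case (insert k F)
  then obtain M :: "complex^'n^'n" where M: "det M ~= 0" "\<And>l. l \<notin> F ==> M $ l = M0 $ l" "\<And>l. l \<in> F ==> M $ l \<in> Rows" by blast
  obtain B where B: "M ** B = mat 1" using M(1) invertible_det_nz invertible_right_inverse by metis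
  \<comment> \<open>\<open>w\<close> is killed by all rows of \<open>M\<close> except the
    \<open>k\<close>-th. The rows outside \<open>Q\<close> are still those of \<open>M0\<close>, so
    the kernel hypothesis supplies a row \<open>R\<close> that does not kill
    \<open>w\<close>.\<close>
  define w where "w = B *v axis k 1"
  have Mw: "M *v w = axis k 1" by (simp add: w_def matrix_vector_mul_assoc B)
  have "w ~= 0"
  proof
   assume "w = 0"
   hence "(axis k 1 :: complex^'n) = 0" using Mw by simp
   thus False by (metis axis_eq_0_iff one_neq_zero)
  qed
  moreover have "rdot (M0 $ l) w = 0" if "l \<notin> Q" for l
  proof -
   have "l \<notin> F" "l ~= k" using that insert by auto
   moreover have "rdot (M $ l) w = axis k 1 $ l" using Mw by (simp flip: matrix_rdot)
   ultimately show ?thesis using M(2) by (simp add: axis_def)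
  qed
  ultimately obtain R where R: "R \<in> Rows" "rdot R w ~= 0" using ker by blast
  define M' where "M' = (\<chi> l. if l = k then R else M $ l)"
  \<comment> \<open>A kernel vector of \<open>M'\<close> is killed by all old rows except the
    \<open>k\<close>-th, hence it is a multiple of \<open>w\<close>; the new row then forces this
    multiple to be zero.\<close>
  have "det M' ~= 0"
  proof
   assume "det M' = 0"
   then obtain x where x: "x ~= 0" "M' *v x = 0" using det_zero_iff_kernel by blast
   have rows: "rdot (M' $ l) x = 0" for l using x(2) by (simp flip: matrix_rdot)
   define t where "t = (M *v x) $ k"
   have "M *v x = t *s axis k 1"
   proof -
    have "(M *v x) $ l = t * axis k 1 $ l" for l
     using rows[of l] by (cases "l = k") (auto simp: t_def M'_def matrix_rdot axis_def)
    thus ?thesis by (simp add: vec_eq_iff)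
   qed
   hence "M *v (x - t *s w) = 0" by (simp add: matrix_vector_mult_diff_distrib matrix_vec_smult Mw)
   hence "x = t *s w" using M(1) det_zero_iff_kernel[of M] by (metis eq_iff_diff_eq_0)
   moreover have "rdot R x = 0" using rows[of k] by (simp add: M'_def)
   ultimately have "t * rdot R w = 0" by (simp add: rdot_def sum_distrib_left mult.left_commute)
   hence "t = 0" using R by simp
   thus False using x \<open>x = t *s w\<close> by simp
  qed
  moreover have "M' $ l = M0 $ l" if "l \<notin> insert k F" for l using that M(2) by (simp add: M'_def)
  moreover have "M' $ l \<in> Rows" if "l \<in> insert k F" for l using that M(3) R by (auto simp: M'_def)
  ultimately show ?case by blast
 qed
 thus ?thesis .
qed

section \<open>Coordinate subspaces and linear parts at the fixed point\<close>

lemma coord_proj_simps [simp]: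
 "coord_proj U x $ i = (if i \<in> U then x $ i else 0)" "coord_proj U (coord_proj U x) = coord_proj U x"
 "coord_proj U x \<in> coord_space U" "coord_proj U 0 = 0"
 by (auto simp: coord_proj_def coord_space_def vec_eq_iff)

lemma coord_proj_id: "x \<in> coord_space U ==> coord_proj U x = x"
 by (auto simp: coord_space_def vec_eq_iff)

lemma norm_coord_proj_le: "norm (coord_proj U x) \<le> norm (x :: complex^'n::finite)"
 by (rule norm_le_componentwise_cart) simp

lemma cholv_coord_proj: "cholv S f ==> cholv S (%x. coord_proj U (f x))"
proof -
 assume f: "cholv S f"
 have "chol S (%x. coord_proj U (f x) $ i)" for i by (cases "i \<in> U") (simp_all add: cholv_nth[OF f])
 thus ?thesis by (simp add: cholv_def)
qed

lemma bounded_linear_coord_proj: "bounded_linear (coord_proj U :: complex^'n::finite => complex^'n)"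
 by (rule bounded_linear_intro[where K = 1]) (simp_all add: vec_eq_iff norm_coord_proj_le)

lemma coord_proj_smult: "coord_proj U (c *s x) = c *s coord_proj U x"
 and coord_proj_add: "coord_proj U (x + y) = coord_proj U x + coord_proj U y"
 by (simp_all add: vec_eq_iff)

lemma cholv_quadratic:
 fixes H :: "complex^'n::finite => complex^'k::finite"
 assumes H: "cholv (ball 0 R) H" and R: "R > 0" and H0: "H 0 = 0"
 shows "\<exists>C\<ge>0. \<forall>x\<in>ball 0 (R/4). norm (H x - cjac H 0 *v x) \<le> C * (norm x)\<^sup>2"
proof -
 have R2: "R / 2 < R" using R by simp
 have "\<exists>C\<ge>0. \<forall>x\<in>ball 0 (R/4). norm (H x $ i - cdir (%x. H x $ i) 0 x) \<le> C * (norm x)\<^sup>2" for i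
 proof -
  obtain M where M: "M \<ge> 0" "\<forall>y\<in>cball 0 (R/2). norm (H y $ i) \<le> M"
   using chol_bounded_cball[OF cholv_nth[OF H] R2] by blast
  have c: "chol (ball 0 (R/2)) (%x. H x $ i)" by (rule chol_subset[OF cholv_nth[OF H]]) (use R in auto)
  have "norm (H x $ i - cdir (%x. H x $ i) 0 x) \<le> (8 * M / (R/2)\<^sup>2) * (norm x)\<^sup>2" if "x \<in> ball 0 (R/4)" for x
   using chol_quadratic_remainder[OF c, of M x] M R that H0 by (auto simp: power2_eq_square)
  moreover have "8 * M / (R/2)\<^sup>2 \<ge> 0" using M by simp
  ultimately show ?thesis by blast
 qed
 then obtain C where C: "\<And>i. C i \<ge> 0" "\<And>i x. x \<in> ball 0 (R/4) ==> norm (H x $ i - cdir (%x. H x $ i) 0 x) \<le> C i * (norm x)\<^sup>2"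
  by metis
 have "norm (H x - cjac H 0 *v x) \<le> sum C UNIV * (norm x)\<^sup>2" if x: "x \<in> ball 0 (R/4)" for x
 proof -
  have "norm (H x - cjac H 0 *v x) \<le> (\<Sum>i\<in>UNIV. norm ((H x - cjac H 0 *v x) $ i))"
   unfolding norm_vec_def by (rule L2_set_le_sum) auto
  also have "\<dots> \<le> (\<Sum>i\<in>UNIV. C i * (norm x)\<^sup>2)"
   by (intro sum_mono) (use C(2)[OF x] R in \<open>simp add: cjac_nth[OF H]\<close>)
  finally show ?thesis by (simp add: sum_distrib_right)
 qed
 thus ?thesis using C(1) by (intro exI[of _ "sum C UNIV"]) (auto intro: sum_nonneg)
qed

lemma has_vector_derivative_smult:
 fixes v :: "complex^'n::finite"
 assumes "(q has_vector_derivative q') F" shows "((%t. q t *s v) has_vector_derivative q' *s v) F"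
 by (rule bounded_linear.has_vector_derivative[OF bounded_linear_smult_vec assms])

text \<open>The first-order terms of \<open>Dq(y) (H y) = q2 y\<close> are compared along a line
  through 0. As \<open>H 0 = 0\<close>, dividing by \<open>\<zeta>\<close> and using continuity of
  \<open>Dq\<close> gives the claim; second derivatives of \<open>q\<close> do not enter.\<close>

lemma semiconjugacy_linear_part:
 fixes q :: "complex^'n::finite => complex"
 assumes q: "chol (ball 0 R) q" and R: "R > 0" and H: "cholv (ball 0 R) H" and H0: "H 0 = 0" and q2: "chol (ball 0 R) q2"
  and eig: "\<And>y. y \<in> ball 0 R ==> cdir q y (H y) = q2 y"
 shows "cdir q 0 (cjac H 0 *v v) = cdir q2 0 v"
proof -
 have zin: "(0 :: complex^'n) \<in> ball 0 R" using R by simp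
 have line: "((%\<zeta>. (0::complex^'n) + \<zeta> *s v) \<longlongrightarrow> 0) (at (0::complex))"
  using bounded_linear.tendsto[OF bounded_linear_smult_vec[of v] tendsto_ident_at[of 0 UNIV]] by simp
 have near: "\<forall>\<^sub>F \<zeta> in at (0::complex). 0 + \<zeta> *s v \<in> ball 0 R"
  using topological_tendstoD[OF line open_ball zin] .
 have quot: "((%\<zeta>. F (0 + \<zeta> *s v) / \<zeta>) \<longlongrightarrow> cdir F 0 v) (at 0)" if F: "chol (ball 0 R) F" "F 0 = 0" for F
 proof -
  have "((%\<zeta>. F (0 + \<zeta> *s v)) has_field_derivative cdir F (0 + 0 *s v) v) (at 0)"
   by (rule chol_line_deriv[OF F(1)]) (use R in simp)
  thus ?thesis using F(2) by (simp add: DERIV_def)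
 qed
 have ck: "((%\<zeta>. cdir q (0 + \<zeta> *s v) (axis l 1)) \<longlongrightarrow> cdir q 0 (axis l 1)) (at (0::complex))" for l
 proof -
  have "continuous_on (ball 0 R) (%y. cjac (%x. \<chi> i::'n. q x) y *v axis l 1)"
   by (rule cjac_continuous) (use q in \<open>simp add: cholv_def\<close>)
  hence "continuous_on (ball 0 R) (%y. (cjac (%x. \<chi> i::'n. q x) y *v axis l 1) $ l)"
   by (intro bounded_linear.continuous_on[OF bounded_linear_vec_nth])
  hence "continuous_on (ball 0 R) (%y. cdir q y (axis l 1))"
  proof (rule continuous_on_eq)
   fix y :: "complex^'n" assume "y \<in> ball 0 R"
   thus "(cjac (%x. \<chi> i::'n. q x) y *v axis l 1) $ l = cdir q y (axis l 1)"
    using cjac_nth[of "ball 0 R" "%x. \<chi> i::'n. q x" y "axis l 1" l] q by (simp add: cholv_def)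
  qed
  hence "isCont (%y. cdir q y (axis l 1)) 0" using R by (simp add: continuous_on_eq_continuous_at)
  from isCont_tendsto_compose[OF this line] show ?thesis by simp
 qed
 have 1: "((%\<zeta>. \<Sum>l\<in>UNIV. cdir q (0 + \<zeta> *s v) (axis l 1) * (H (0 + \<zeta> *s v) $ l / \<zeta>)) \<longlongrightarrow> (\<Sum>l\<in>UNIV. cdir q 0 (axis l 1) * cdir (%x. H x $ l) 0 v)) (at 0)"
  by (intro tendsto_sum tendsto_mult ck quot cholv_nth[OF H]) (simp add: H0)
 have "q2 0 = 0" using eig[OF zin] chol_deriv(2)[OF q zin, of 0 0] by (simp add: H0)
 hence 2: "((%\<zeta>. q2 (0 + \<zeta> *s v) / \<zeta>) \<longlongrightarrow> cdir q2 0 v) (at 0)" by (intro quot q2)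
 have "\<forall>\<^sub>F \<zeta> in at 0. (\<Sum>l\<in>UNIV. cdir q (0 + \<zeta> *s v) (axis l 1) * (H (0 + \<zeta> *s v) $ l / \<zeta>)) = q2 (0 + \<zeta> *s v) / \<zeta>"
  using near
 proof eventually_elim
  case (elim \<zeta>)
  have "(\<Sum>l\<in>UNIV. cdir q (0 + \<zeta> *s v) (axis l 1) * (H (0 + \<zeta> *s v) $ l / \<zeta>)) = cdir q (0 + \<zeta> *s v) (H (0 + \<zeta> *s v)) / \<zeta>"
   by (subst cdir_expand[OF q elim, of "H (0 + \<zeta> *s v)"]) (simp add: sum_divide_distrib)
  thus ?case using eig[OF elim] by simp
 qed
 from Lim_transform_eventually[OF 1 this] have "(\<Sum>l\<in>UNIV. cdir q 0 (axis l 1) * cdir (%x. H x $ l) 0 v) = cdir q2 0 v"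
  by (rule tendsto_unique[OF _ _ 2, rotated]) simp
 moreover have "(\<Sum>l\<in>UNIV. cdir q 0 (axis l 1) * cdir (%x. H x $ l) 0 v) = cdir q 0 (cjac H 0 *v v)"
  by (subst cdir_expand[OF q zin, of "cjac H 0 *v v"]) (simp add: cjac_nth[OF H zin])
 ultimately show ?thesis by simp
qed

lemma eigenfunction_linear_part:
 fixes q :: "complex^'n::finite => complex"
 assumes q: "chol (ball 0 R) q" and R: "R > 0" and H: "cholv (ball 0 R) H" and H0: "H 0 = 0" and q0: "q 0 = 0"
  and eig: "\<And>y. y \<in> ball 0 R ==> cdir q y (H y) = k * q y"
 shows "cdir q 0 (cjac H 0 *v v) = k * cdir q 0 v"
proof -
 have zin: "(0 :: complex^'n) \<in> ball 0 R" using R by simp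
 have kq: "chol (ball 0 R) (%y. k * q y)" by (intro chol_mult chol_const q)
 have "cdir q 0 (cjac H 0 *v v) = cdir (%y. k * q y) 0 v"
  by (rule semiconjugacy_linear_part[OF q R H H0 kq eig])
 moreover have "cdir (%y. k * q y) 0 = (%v. k * cdir q 0 v)"
  by (rule cdir_eqI) (auto intro!: has_derivative_mult_right chol_deriv(1)[OF q zin] simp: chol_deriv(2)[OF q zin])
 ultimately show ?thesis by simp
qed

lemma continuous_on_smult_vec:
 fixes q :: "'a::topological_space => complex" and w :: "'a => complex^'n::finite"
 assumes "continuous_on S q" "continuous_on S w"
 shows "continuous_on S (%x. q x *s w x)"
 unfolding vector_scalar_mult_def
 by (intro continuous_on_vec_lambda continuous_on_mult assms bounded_linear.continuous_on[OF bounded_linear_vec_nth])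

lemma circle_curve:
 assumes "(w has_derivative (%h. h *s D)) (at (\<tau> * cis th))"
 shows "((%th. w (\<tau> * cis th)) has_vector_derivative (\<i> * (\<tau> * cis th)) *s D) (at th within A)"
proof -
 have "((%th. \<tau> * cis th) has_vector_derivative \<i> * (\<tau> * cis th)) (at th within A)"
  unfolding has_vector_derivative_def
  by (rule derivative_eq_intros refl)+ (simp add: scaleR_conv_of_real algebra_simps)
 from has_derivative_compose[OF this[unfolded has_vector_derivative_def] assms]
 have "((%th. w (\<tau> * cis th)) has_derivative (%h. (h *\<^sub>R (\<i> * (\<tau> * cis th))) *s D)) (at th within A)" .
 moreover have "(%h. (h *\<^sub>R (\<i> * (\<tau> * cis th))) *s D) = (%h. h *\<^sub>R ((\<i> * (\<tau> * cis th)) *s D))"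
  by (simp add: vec_eq_iff fun_eq_iff)
 ultimately show ?thesis unfolding has_vector_derivative_def by simp
qed

text \<open>\<open>H\<close> reads and writes only the coordinates in \<open>U\<close>; the others
  are inert parameters. In this way a field on \<open>coord_space U\<close> is studied on the whole
  vector type, where measure, balls and determinants are at hand. \<open>u\<close> is the flow of
  \<open>\<i> H\<close>; the time span 4 pi leaves room for a full period after a shift by up to 2
  pi.\<close>

locale proj_flow =
 fixes U :: "'n::finite set" and H :: "complex^'n => complex^'n" and R0 r \<rho> :: real
  and u :: "complex^'n => real => complex^'n"
 assumes H: "cholv (ball 0 R0) H" and H_proj: "\<And>y. H y = coord_proj U (H (coord_proj U y))" and H0: "H 0 = 0"
  and r: "0 < r" "r < R0" and \<rho>: "0 < \<rho>" "\<rho> \<le> r"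
  and u_cont: "continuous_on (ball 0 \<rho> \<times> {0..4*pi}) (%(y, t). u y t)"
  and u_chol: "\<And>t. t \<in> {0..4*pi} ==> cholv (ball 0 \<rho>) (%y. u y t)"
  and u_0: "\<And>y. y \<in> ball 0 \<rho> ==> u y 0 = y"
  and u_in: "\<And>y t. y \<in> ball 0 \<rho> ==> t \<in> {0..4*pi} ==> u y t \<in> cball 0 r"
  and u_ode: "\<And>y t. y \<in> ball 0 \<rho> ==> t \<in> {0..4*pi} ==>
    ((%t. u y t) has_vector_derivative \<i> *s H (u y t)) (at t within {0..4*pi})"
begin

lemma H_proj_arg: "H (coord_proj U y) = H y"
 by (subst (1 2) H_proj) simp

lemma H_off: "i \<notin> U ==> H y $ i = 0"
 by (subst H_proj) simp

text \<open>The quantifiers stand inside so that one constant \<open>L\<close> serves all starting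
  points and all approximate solutions.\<close>

lemma flow_approx: "\<exists>L\<ge>0. \<forall>T x x' \<delta> y t. y \<in> ball 0 \<rho> \<and> T \<le> 4*pi \<and> t \<in> {0..T} \<and> x 0 = y \<and>
  (\<forall>t\<in>{0..T}. (x has_vector_derivative x' t) (at t within {0..T}) \<and> norm (x' t - \<i> *s H (x t)) \<le> \<delta> \<and> x t \<in> cball 0 r)
  \<longrightarrow> norm (x t - u y t) \<le> \<delta> * T * exp (L * t)"
proof -
 obtain L where L: "L \<ge> 0" "\<And>x y. x \<in> cball 0 r ==> y \<in> cball 0 r ==> norm (H x - H y) \<le> L * norm (x - y)"
  using cholv_Lipschitz[OF H r(2)] by metis
 have lip: "norm (\<i> *s H x - \<i> *s H y) \<le> L * norm (x - y)" if "x \<in> cball 0 r" "y \<in> cball 0 r" for x y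
  using L(2)[OF that] by (simp add: norm_cvec_smult flip: vector_ssub_ldistrib)
 show ?thesis
 proof (intro exI[of _ L] conjI allI impI)
  fix T x x' \<delta> y t
  assume *: "y \<in> ball 0 \<rho> \<and> T \<le> 4*pi \<and> t \<in> {0..T} \<and> x 0 = y \<and>
   (\<forall>t\<in>{0..T}. (x has_vector_derivative x' t) (at t within {0..T}) \<and> norm (x' t - \<i> *s H (x t)) \<le> \<delta> \<and> x t \<in> cball 0 r)"
  hence y: "y \<in> ball 0 \<rho>" and T: "T \<le> 4*pi" and t: "t \<in> {0..T}" and x0: "x 0 = y"
   and x: "\<And>t. t \<in> {0..T} ==> (x has_vector_derivative x' t) (at t within {0..T})"
    "\<And>t. t \<in> {0..T} ==> norm (x' t - \<i> *s H (x t)) \<le> \<delta>" "\<And>t. t \<in> {0..T} ==> x t \<in> cball 0 r" by simp_all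
  have "norm (x t - u y t) \<le> (norm (x 0 - u y 0) + \<delta> * T) * exp (L * t)"
  proof (rule ode_compare[where B = "cball 0 r" and K = "%x. \<i> *s H x" and x' = x'])
   fix s assume s: "s \<in> {0..T}"
   hence s4: "s \<in> {0..4*pi}" using T by simp
   show "((%t. u y t) has_vector_derivative \<i> *s H (u y s)) (at s within {0..T})"
    by (rule has_vector_derivative_within_subset[OF u_ode[OF y s4]]) (use T in simp)
   show "u y s \<in> cball 0 r" by (rule u_in[OF y s4])
   show "x s \<in> cball 0 r" "norm (x' s - \<i> *s H (x s)) \<le> \<delta>"
    "(x has_vector_derivative x' s) (at s within {0..T})" by (rule x[OF s])+
  qed (rule lip L(1) t | assumption)+
  thus "norm (x t - u y t) \<le> \<delta> * T * exp (L * t)" using x0 u_0[OF y] by simp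
 qed (rule L(1))
qed

lemma flow_unique:
 assumes "y \<in> ball 0 \<rho>" "T \<le> 4*pi" "t \<in> {0..T}" "x 0 = y"
  and "\<And>t. t \<in> {0..T} ==> (x has_vector_derivative \<i> *s H (x t)) (at t within {0..T})"
  and "\<And>t. t \<in> {0..T} ==> x t \<in> cball 0 r"
 shows "x t = u y t"
proof -
 obtain L where L: "\<forall>T x x' \<delta> y t. y \<in> ball 0 \<rho> \<and> T \<le> 4*pi \<and> t \<in> {0..T} \<and> x 0 = y \<and>
  (\<forall>t\<in>{0..T}. (x has_vector_derivative x' t) (at t within {0..T}) \<and> norm (x' t - \<i> *s H (x t)) \<le> \<delta> \<and> x t \<in> cball 0 r)
  \<longrightarrow> norm (x t - u y t) \<le> \<delta> * T * exp (L * t)" using flow_approx by (elim exE conjE) (rule that)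
 have "norm (x t - u y t) \<le> 0 * T * exp (L * t)"
  by (rule L[rule_format, where x' = "%t. \<i> *s H (x t)"]) (intro conjI ballI assms order_refl | simp add: assms)+
 thus ?thesis by simp
qed

lemma flow_group:
 assumes y: "y \<in> ball 0 \<rho>" "u y t \<in> ball 0 \<rho>" and t: "0 \<le> t" "t + T \<le> 4*pi" "s \<in> {0..T}"
 shows "u (u y t) s = u y (s + t)"
proof (rule flow_unique[symmetric, where T = T and x = "%s. u y (s + t)"])
 fix s assume s: "s \<in> {0..T}"
 have st: "s + t \<in> {0..4*pi}" using s t by auto
 show "u y (s + t) \<in> cball 0 r" by (rule u_in[OF y(1) st])
 have "((%s. s + t) has_vector_derivative 1) (at s within {0..T})"
  by (auto intro!: derivative_eq_intros simp: has_real_derivative_iff_has_vector_derivative[symmetric])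
 moreover have "((%t. u y t) has_vector_derivative \<i> *s H (u y (s + t))) (at (s + t) within (%s. s + t) ` {0..T})"
  by (rule has_vector_derivative_within_subset[OF u_ode[OF y(1) st]]) (use t in auto)
 ultimately have "((%t. u y t) \<circ> (%s. s + t) has_vector_derivative 1 *\<^sub>R (\<i> *s H (u y (s + t)))) (at s within {0..T})"
  by (rule vector_diff_chain_within)
 thus "((%s. u y (s + t)) has_vector_derivative \<i> *s H (u y (s + t))) (at s within {0..T})" by (simp add: o_def)
qed (use assms in auto)

lemma flow_proj:
 assumes y: "y \<in> ball 0 \<rho>" and t: "t \<in> {0..4*pi}"
 shows "u (coord_proj U y) t = coord_proj U (u y t)"
proof (rule flow_unique[symmetric, OF _ order_refl t])
 show "coord_proj U y \<in> ball 0 \<rho>" using y norm_coord_proj_le[of U y] by simp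
 show "coord_proj U (u y 0) = coord_proj U y" using u_0 y by simp
 fix t assume t: "t \<in> {0..4*pi}"
 show "coord_proj U (u y t) \<in> cball 0 r" using u_in[OF y t] norm_coord_proj_le[of U "u y t"] by simp
 have "((%t. coord_proj U (u y t)) has_vector_derivative coord_proj U (\<i> *s H (u y t))) (at t within {0..4*pi})"
  by (rule bounded_linear.has_vector_derivative[OF bounded_linear_coord_proj u_ode[OF y t]])
 moreover have "coord_proj U (\<i> *s H (u y t)) = \<i> *s H (coord_proj U (u y t))"
  unfolding H_proj_arg coord_proj_smult using H_off[of _ "u y t"] by (simp add: vec_eq_iff)
 ultimately show "((%t. coord_proj U (u y t)) has_vector_derivative \<i> *s H (coord_proj U (u y t))) (at t within {0..4*pi})" by simp
qed

lemma flow_off: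
 assumes y: "y \<in> ball 0 \<rho>" and t: "t \<in> {0..4*pi}" and i: "i \<notin> U"
 shows "u y t $ i = y $ i"
proof -
 have "((%s. 0) has_integral (u y t $ i - u y 0 $ i)) {0..t}"
 proof (rule fundamental_theorem_of_calculus)
  fix s assume s: "s \<in> {0..t}"
  have "((%s. u y s $ i) has_vector_derivative (\<i> *s H (u y s)) $ i) (at s within {0..t})"
   by (rule bounded_linear.has_vector_derivative[OF bounded_linear_vec_nth has_vector_derivative_within_subset[OF u_ode[OF y]]])
     (use s t in auto)
  thus "((%s. u y s $ i) has_vector_derivative 0) (at s within {0..t})" using H_off[OF i] by simp
 qed (use t in simp)
 hence "u y t $ i - u y 0 $ i = 0" by (simp add: has_integral_0_eq)
 thus ?thesis using u_0[OF y] by simp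
qed

text \<open>\<open>coord_proj U y\<close> is the point at \<open>\<tau>0\<close> of a holomorphic
  curve through 0 that satisfies \<open>\<tau> w' = H w\<close>. The coordinates of \<open>y\<close>
  outside \<open>U\<close> are left free, so such points can fill a set of full dimension.\<close>

definition orb :: "complex^'n => (complex => complex^'n) => complex => real => bool" where
 "orb y w \<tau>0 \<rho>1 \<longleftrightarrow> \<tau>0 ~= 0 \<and> norm \<tau>0 < \<rho>1 \<and> w \<tau>0 = coord_proj U y \<and> w 0 = 0 \<and>
   (\<forall>\<tau>\<in>ball 0 \<rho>1. w \<tau> \<in> coord_space U \<and> w \<tau> \<in> ball 0 \<rho> \<and> (\<exists>D. (w has_derivative (%h. h *s D)) (at \<tau>) \<and> \<tau> *s D = H (w \<tau>)))"

text \<open>Differentiating \<open>w (\<tau>0 * cis t)\<close> in \<open>t\<close> brings out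
  \<open>\<i> \<tau> w' = \<i> H w\<close>, so turning the parameter of the curve is the flow;
  uniqueness does the rest.\<close>

lemma orb_flow:
 assumes y: "y \<in> ball 0 \<rho>" and orb: "orb y w \<tau>0 \<rho>1" and t: "t \<in> {0..4*pi}"
 shows "coord_proj U (u y t) = w (\<tau>0 * cis t)"
proof -
 have "w (\<tau>0 * cis t) = u (coord_proj U y) t"
 proof (rule flow_unique[OF _ order_refl t])
  show "coord_proj U y \<in> ball 0 \<rho>" using y norm_coord_proj_le[of U y] by simp
  show "w (\<tau>0 * cis 0) = coord_proj U y" using orb by (simp add: orb_def)
  fix t :: real
  have in1: "\<tau>0 * cis t \<in> ball 0 \<rho>1" using orb by (simp add: orb_def norm_mult)
  show "w (\<tau>0 * cis t) \<in> cball 0 r" using orb in1 \<rho> unfolding orb_def by fastforce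
  obtain D where D: "(w has_derivative (%h. h *s D)) (at (\<tau>0 * cis t))" "(\<tau>0 * cis t) *s D = H (w (\<tau>0 * cis t))"
   using orb in1 unfolding orb_def by blast
  have "((%t. w (\<tau>0 * cis t)) has_vector_derivative (\<i> * (\<tau>0 * cis t)) *s D) (at t within {0..4*pi})"
   by (rule circle_curve[OF D(1)])
  moreover have "(\<i> * (\<tau>0 * cis t)) *s D = \<i> *s H (w (\<tau>0 * cis t))"
   by (simp flip: D(2))
  ultimately show "((%t. w (\<tau>0 * cis t)) has_vector_derivative \<i> *s H (w (\<tau>0 * cis t))) (at t within {0..4*pi})" by simp
 qed
 thus ?thesis using flow_proj[OF y t] by simp
qed

lemma orb_periodic:
 assumes y: "y \<in> ball 0 \<rho>" and orb: "orb y w \<tau>0 \<rho>1"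
 shows "u y (2*pi) = y"
proof -
 have t: "2*pi \<in> {0..4*pi}" by simp
 have "u y (2*pi) $ i = y $ i" for i
 proof (cases "i \<in> U")
  case True
  have "coord_proj U (u y (2*pi)) = coord_proj U y" using orb_flow[OF y orb t] orb by (simp add: orb_def)
  thus ?thesis using True by (metis coord_proj_simps(1))
 qed (use flow_off[OF y t] in simp)
 thus ?thesis by (simp add: vec_eq_iff)
qed

end

text \<open>The points known to lie on closed orbits need not form a measurable set. What the
  identity theorem asks for is that they are not contained in a null set.\<close>

locale periodic_flow = proj_flow U H R0 r \<rho> u
 for U :: "'n::finite set" and H :: "complex^'n => complex^'n" and R0 r \<rho> :: real
  and u :: "complex^'n => real => complex^'n" +
 assumes nonneg: "\<not> negligible {y \<in> ball 0 \<rho>. \<exists>w \<tau>0 \<rho>1. orb y w \<tau>0 \<rho>1}"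
begin

lemma zero_on_orbits:
 assumes q: "chol (ball 0 \<rho>) q" and z: "\<And>y w \<tau>0 \<rho>1. y \<in> ball 0 \<rho> ==> orb y w \<tau>0 \<rho>1 ==> q y = 0" and y: "y \<in> ball 0 \<rho>"
 shows "q y = 0"
proof (rule chol_zero_negligible[OF q _ y])
 show "\<not> negligible {x \<in> ball 0 \<rho>. q x = 0}"
 proof
  assume "negligible {x \<in> ball 0 \<rho>. q x = 0}"
  hence "negligible {y \<in> ball 0 \<rho>. \<exists>w \<tau>0 \<rho>1. orb y w \<tau>0 \<rho>1}"
   by (rule negligible_subset) (use z in blast)
  with nonneg show False by blast
 qed
qed

section \<open>Fourier modes of the periodic flow\<close>

lemma periodic: assumes y: "y \<in> ball 0 \<rho>" shows "u y (2*pi) = y"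
proof -
 have t: "2*pi \<in> {0..4*pi}" by simp
 have "u y (2*pi) $ i - y $ i = 0" for i
  by (rule zero_on_orbits[OF chol_diff[OF cholv_nth[OF u_chol[OF t]] chol_nth] _ y])
    (use orb_periodic in simp)
 thus ?thesis by (simp add: vec_eq_iff)
qed

text \<open>Fourier coefficient of the orbit of \<open>y\<close> under \<open>\<i> H\<close>,
  without the factor \<open>1 / (2 pi)\<close>; hence the \<open>2 * pi\<close> in
  \<open>eigenvalue_integer\<close>.\<close>

definition mode :: "int => complex^'n => complex^'n" where
 "mode n y = integral {0..2*pi} (%th. cis th powi (- n) *s u y th)"

lemma sect: "y \<in> ball 0 \<rho> ==> continuous_on {0..4*pi} (%th. cis th powi (- n) *s u y th)"
proof -
 assume y: "y \<in> ball 0 \<rho>"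
 have "continuous_on {0..4*pi} (%th. (%(y, t). u y t) (y, th))"
  by (rule continuous_on_compose2[OF u_cont]) (use y in \<open>auto intro!: continuous_intros\<close>)
 thus ?thesis by (intro continuous_on_smult_vec continuous_intros) auto
qed

lemma cholv_mode: "cholv (ball 0 \<rho>) (mode n)"
proof -
 have "cholv (ball 0 \<rho>) (%y. integral {0..2*pi} (%th. cis th powi (- n) *s u y th))"
 proof (rule cholv_integral)
  have "ball (0::complex^'n) \<rho> \<times> {0..2*pi} \<subseteq> ball 0 \<rho> \<times> {0..4*pi}" by (intro Sigma_mono) auto
  from continuous_on_subset[OF u_cont this]
  have c: "continuous_on (ball 0 \<rho> \<times> {0..2*pi}) (%p. u (fst p) (snd p))" by (simp add: case_prod_beta)
  show "continuous_on (ball 0 \<rho> \<times> {0..2*pi}) (%(y, th). cis th powi (- n) *s u y th)"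
   unfolding case_prod_beta by (intro continuous_on_smult_vec c continuous_intros) auto
  fix t :: real assume "t \<in> {0..2*pi}"
  hence "t \<in> {0..4*pi}" by auto
  from u_chol[OF this] show "cholv (ball 0 \<rho>) (%y. cis t powi (- n) *s u y t)"
   unfolding cholv_def vector_smult_component by (intro allI chol_mult chol_const) blast
 qed auto
 thus ?thesis unfolding mode_def .
qed

lemma mode_nth: "y \<in> ball 0 \<rho> ==> mode n y $ i = integral {0..2*pi} (%th. cis th powi (- n) * u y th $ i)"
proof -
 assume y: "y \<in> ball 0 \<rho>"
 have "(%th. cis th powi (- n) *s u y th) integrable_on {0..2*pi}"
  by (intro integrable_continuous_real continuous_on_subset[OF sect[OF y]]) auto
 thus ?thesis by (simp add: mode_def integral_vec_nth)
qed

lemma mode_proj: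
 assumes y: "y \<in> ball 0 \<rho>" and i: "i \<in> U" shows "mode n (coord_proj U y) $ i = mode n y $ i"
proof -
 have y': "coord_proj U y \<in> ball 0 \<rho>" using y norm_coord_proj_le[of U y] by simp
 show ?thesis unfolding mode_nth[OF y] mode_nth[OF y']
  by (intro integral_cong) (use flow_proj[OF y] i in simp)
qed

lemma zero_in: "(0 :: complex^'n) \<in> ball 0 \<rho>" using \<rho> by simp

lemma flow_zero: "t \<in> {0..4*pi} ==> u 0 t = 0"
 by (rule flow_unique[symmetric, OF zero_in order_refl]) (use r in \<open>auto simp: H0\<close>)

lemma mode_zero: "mode n 0 = 0"
proof -
 have "mode n 0 $ i = integral {0..2*pi} (%th. 0)" for i
  unfolding mode_nth[OF zero_in] by (intro integral_cong) (simp add: flow_zero)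
 thus ?thesis by (simp add: vec_eq_iff)
qed

text \<open>The integration variable is shifted by \<open>a\<close>, which reaches beyond time 2 pi.
  The result is written with indefinite integrals of one fixed integrand so that it can be
  differentiated in \<open>a\<close>.\<close>

lemma mode_flow:
 assumes y: "y \<in> ball 0 \<rho>" and a: "a \<in> {0..2*pi}" "u y a \<in> ball 0 \<rho>"
 shows "mode n (u y a) = cis a powi n *s (integral {0..2*pi + a} (%th. cis th powi (- n) *s u y th)
      - integral {0..a} (%th. cis th powi (- n) *s u y th))"
proof -
 define \<Phi> where "\<Phi> = (%t. integral {0..t} (%th. cis th powi (- n) *s u y th))"
 have "((%s. cis a powi n *s (cis (s + a) powi (- n) *s u y (s + a))) has_integral (cis a powi n *s \<Phi> (2*pi + a) - cis a powi n *s \<Phi> (0 + a))) {0..2*pi}"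
 proof (rule fundamental_theorem_of_calculus)
  fix s :: real assume s: "s \<in> {0..2*pi}"
  have "((%s. s + a) has_vector_derivative 1) (at s within {0..2*pi})"
   by (auto intro!: derivative_eq_intros simp: has_real_derivative_iff_has_vector_derivative[symmetric])
  moreover have "(\<Phi> has_vector_derivative cis (s + a) powi (- n) *s u y (s + a)) (at (s + a) within (%s. s + a) ` {0..2*pi})"
   unfolding \<Phi>_def by (rule has_vector_derivative_within_subset[OF integral_has_vector_derivative[OF sect[OF y]]])
    (use s a in auto)
  ultimately have "(\<Phi> \<circ> (%s. s + a) has_vector_derivative 1 *\<^sub>R (cis (s + a) powi (- n) *s u y (s + a))) (at s within {0..2*pi})"
   by (rule vector_diff_chain_within)
  from bounded_linear.has_vector_derivative[OF bounded_linear_smult_scalar this]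
  show "((%s. cis a powi n *s \<Phi> (s + a)) has_vector_derivative cis a powi n *s (cis (s + a) powi (- n) *s u y (s + a))) (at s within {0..2*pi})"
   by (simp add: o_def)
 qed simp
 hence "integral {0..2*pi} (%s. cis a powi n *s (cis (s + a) powi (- n) *s u y (s + a))) = cis a powi n *s \<Phi> (2*pi + a) - cis a powi n *s \<Phi> (0 + a)"
  by (rule integral_unique)
 moreover have "integral {0..2*pi} (%s. cis a powi n *s (cis (s + a) powi (- n) *s u y (s + a))) = mode n (u y a)"
  unfolding mode_def
 proof (rule integral_cong)
  fix s :: real assume s: "s \<in> {0..2*pi}"
  have "u (u y a) s = u y (s + a)" by (rule flow_group[OF y a(2), where T = "2*pi"]) (use a s in auto)
  moreover have "cis a powi n * cis (s + a) powi (- n) = cis s powi (- n)"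
  proof -
   have "cis (s + a) powi (- n) = cis s powi (- n) * cis a powi (- n)" by (simp add: cis_mult[symmetric] power_int_mult_distrib)
   thus ?thesis by (simp add: power_int_minus)
  qed
  ultimately show "cis a powi n *s (cis (s + a) powi (- n) *s u y (s + a)) = cis s powi (- n) *s u (u y a) s"
   by (simp add: vector_smult_assoc)
 qed
 ultimately show ?thesis by (simp add: \<Phi>_def vector_ssub_ldistrib)
qed

text \<open>Both sides differentiate \<open>a \<mapsto> mode n (u y a)\<close> at \<open>a = 0\<close>; periodicity kills the boundary terms.\<close>

lemma mode_eigen:
 assumes y: "y \<in> ball 0 \<rho>"
 shows "cdir (%y. mode n y $ i) y (H y) = of_int n * mode n y $ i"
proof -
 have "continuous_on {0..4*pi} (%th. (%(y, t). u y t) (y, th))"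
  by (rule continuous_on_compose2[OF u_cont]) (use y in \<open>auto intro!: continuous_intros\<close>)
 hence uc: "continuous_on {0..4*pi} (u y)" by simp
 define e where "e = \<rho> - norm y"
 have e: "e > 0" using y by (simp add: e_def)
 obtain d where d: "d > 0" "\<And>t. t \<in> {0..4*pi} ==> dist t 0 < d ==> dist (u y t) (u y 0) < e"
  using uc e unfolding continuous_on_iff by (metis atLeastAtMost_iff order_refl pi_ge_zero zero_le_mult_iff zero_le_numeral)
 \<comment> \<open>Time runs forward only, so derivatives in \<open>a\<close> are taken within
   \<open>{0..\<delta>}\<close>; for these \<open>a\<close> the point \<open>u y a\<close> is again
   an admissible starting point.\<close>
 define \<delta> where "\<delta> = min (d / 2) (2*pi)"
 have \<delta>: "\<delta> > 0" "\<delta> \<le> 2*pi" "\<delta> < d" using d by (auto simp: \<delta>_def min_def)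
 have uin: "u y a \<in> ball 0 \<rho>" if "a \<in> {0..\<delta>}" for a
 proof -
  have "dist (u y a) y < e" using d(2)[of a] that \<delta> u_0[OF y] by auto
  thus ?thesis using norm_triangle_sub[of "u y a" y] by (simp add: e_def dist_norm)
 qed
 define \<Phi> where "\<Phi> = (%t. integral {0..t} (%th. cis th powi (- n) *s u y th))"
 have \<Phi>d: "(\<Phi> has_vector_derivative cis t powi (- n) *s u y t) (at t within {0..4*pi})" if "t \<in> {0..4*pi}" for t
  unfolding \<Phi>_def by (rule integral_has_vector_derivative[OF sect[OF y] that])
 define m where "m = (%a. mode n (u y a) $ i)"
 have d1: "(m has_vector_derivative cdir (%y. mode n y $ i) y (\<i> *s H y)) (at 0 within {0..\<delta>})"
 proof -
  have "((%t. u y t) has_vector_derivative \<i> *s H (u y 0)) (at 0 within {0..\<delta>})"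
   by (rule has_vector_derivative_within_subset[OF u_ode[OF y]]) (use \<delta> in auto)
  hence "((%t. u y t) has_derivative (%h. h *\<^sub>R (\<i> *s H y))) (at 0 within {0..\<delta>})" using u_0[OF y] by (simp add: has_vector_derivative_def)
  moreover have yy: "u y 0 \<in> ball 0 \<rho>" using u_0[OF y] y by simp
  from has_derivative_compose[OF calculation chol_deriv(1)[OF cholv_nth[OF cholv_mode, of n i] yy]]
  have "(m has_derivative (%h. cdir (%y. mode n y $ i) (u y 0) (h *\<^sub>R (\<i> *s H y)))) (at 0 within {0..\<delta>})"
   unfolding m_def .
  thus ?thesis using linear_simps(5)[OF cdir_linear[OF cholv_nth[OF cholv_mode] y]]
   by (simp add: has_vector_derivative_def u_0[OF y])
 qed
 have d2: "(m has_vector_derivative (\<i> * of_int n) * mode n y $ i) (at 0 within {0..\<delta>})"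
 proof -
  have s1: "((%a. \<Phi> (2*pi + a)) has_vector_derivative cis (2*pi + 0) powi (- n) *s u y (2*pi + 0)) (at 0 within {0..\<delta>})"
  proof -
   have "((%a. 2*pi + a) has_vector_derivative 1) (at 0 within {0..\<delta>})"
    by (auto intro!: derivative_eq_intros simp: has_real_derivative_iff_has_vector_derivative[symmetric])
   moreover have "(\<Phi> has_vector_derivative cis (2*pi + 0) powi (- n) *s u y (2*pi + 0)) (at (2*pi + 0) within (%a. 2*pi + a) ` {0..\<delta>})"
    by (rule has_vector_derivative_within_subset[OF \<Phi>d]) (use \<delta> in auto)
   ultimately have "(\<Phi> \<circ> (%a. 2*pi + a) has_vector_derivative 1 *\<^sub>R (cis (2*pi + 0) powi (- n) *s u y (2*pi + 0))) (at 0 within {0..\<delta>})"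
    by (rule vector_diff_chain_within)
   thus ?thesis by (simp add: o_def)
  qed
  have s2: "(\<Phi> has_vector_derivative cis 0 powi (- n) *s u y 0) (at 0 within {0..\<delta>})"
   by (rule has_vector_derivative_within_subset[OF \<Phi>d]) (use \<delta> in auto)
  \<comment> \<open>The two derivatives are values of the integrand at \<open>2*pi\<close> and at 0,
    equal by periodicity of the flow.\<close>
  have "((%a. \<Phi> (2*pi + a) - \<Phi> a) has_vector_derivative 0) (at 0 within {0..\<delta>})"
   using has_vector_derivative_diff[OF s1 s2] by (simp add: periodic[OF y] u_0[OF y])
  hence s3: "((%a. (\<Phi> (2*pi + a) - \<Phi> a) $ i) has_vector_derivative 0) (at 0 within {0..\<delta>})"
   using bounded_linear.has_vector_derivative[OF bounded_linear_vec_nth] by fastforce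
  have s4: "((%a. cis a powi n) has_vector_derivative \<i> * of_int n) (at 0 within {0..\<delta>})"
  proof -
   have "((%z. z powi n) has_field_derivative of_int n * (1 * cis 0) powi (n - 1) * 1) (at (1 * cis 0))"
    by (rule DERIV_power_int[OF DERIV_ident]) simp
   from circle_derivative[OF this] show ?thesis by (simp add: mult.commute)
  qed
  have "((%a. cis a powi n * (\<Phi> (2*pi + a) - \<Phi> a) $ i) has_vector_derivative
    (cis 0 powi n * 0 + (\<i> * of_int n) * (\<Phi> (2*pi + 0) - \<Phi> 0) $ i)) (at 0 within {0..\<delta>})"
   by (rule has_vector_derivative_mult[OF s4 s3])
  moreover have "(\<Phi> (2*pi + 0) - \<Phi> 0) = mode n y" by (simp add: \<Phi>_def mode_def)
  ultimately have "((%a. cis a powi n * (\<Phi> (2*pi + a) - \<Phi> a) $ i) has_vector_derivative (\<i> * of_int n) * mode n y $ i) (at 0 within {0..\<delta>})"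
   by (simp only: mult_zero_right add_0_left)
  thus ?thesis
  proof (rule has_vector_derivative_transform[rotated 2])
   show "0 \<in> {0..\<delta>}" using \<delta> by simp
   fix a assume a: "a \<in> {0..\<delta>}"
   show "m a = cis a powi n * (\<Phi> (2*pi + a) - \<Phi> a) $ i"
    unfolding m_def \<Phi>_def using mode_flow[OF y _ uin[OF a], of n] a \<delta> by (simp add: right_diff_distrib)
  qed
 qed
 have "cdir (%y. mode n y $ i) y (\<i> *s H y) = (\<i> * of_int n) * mode n y $ i"
  by (rule vector_derivative_unique_within[OF _ d1 d2]) (use \<delta> in \<open>simp add: trivial_limit_within\<close>)
 thus ?thesis by (simp add: chol_deriv(2)[OF cholv_nth[OF cholv_mode] y])
qed

end
text \<open>The form in which first-order terms in \<open>s\<close> are compared below when an error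
  quadratic in \<open>s\<close> is present.\<close>

lemma le_zero_of_quadratic:
 fixes a C s0 :: real
 assumes "s0 > 0" "\<And>s. 0 < s ==> s < s0 ==> a * s \<le> C * s\<^sup>2"
 shows "a \<le> 0"
proof (rule ccontr)
 assume a: "\<not> a \<le> 0"
 define s where "s = min (s0 / 2) (a / (2 * (\<bar>C\<bar> + 1)))"
 have s: "0 < s" "s < s0" using a assms(1) by (auto simp: s_def)
 have "a \<le> C * s"
  using assms(2)[OF s] s by (simp add: power2_eq_square)
 also have "\<dots> \<le> (\<bar>C\<bar> + 1) * s" using s by (intro mult_right_mono) auto
 also have "\<dots> \<le> (\<bar>C\<bar> + 1) * (a / (2 * (\<bar>C\<bar> + 1)))" by (intro mult_left_mono) (auto simp: s_def)
 also have "\<dots> = a / 2"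
 proof -
  have "K * (a / (2 * K)) = a / 2" if "K ~= 0" for K :: real using that by simp
  from this[of "\<bar>C\<bar> + 1"] show ?thesis by linarith
 qed
 finally show False using a by simp
qed

section \<open>Eigenvalues of the linear part and choice of eigenfunctions\<close>

context periodic_flow
begin

lemma H_ball: "cholv (ball 0 \<rho>) H" by (rule cholv_subset[OF H]) (use \<rho> r in auto)

lemma mode_linear_part:
 "cdir (%y. mode n y $ i) 0 (cjac H 0 *v v) = of_int n * cdir (%y. mode n y $ i) 0 v"
 by (rule eigenfunction_linear_part[OF cholv_nth[OF cholv_mode] \<rho>(1) H_ball H0])
   (auto simp: mode_zero mode_eigen)

lemma A_off: "k \<notin> U ==> (cjac H 0 *v v) $ k = 0"
proof -
 assume k: "k \<notin> U"
 have "(%x. H x $ k) = (%_. 0)" using H_off[OF k] by auto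
 thus ?thesis by (simp add: cjac_nth[OF H_ball zero_in] cdir_def)
qed

text \<open>The linear solution \<open>s * exp (\<i> \<mu> \<theta>) w\<close> satisfies the
  nonlinear equation up to a defect quadratic in \<open>s\<close>, so by Gronwall it stays
  quadratically close to the flow over a whole period. Working along an eigenvector replaces a
  matrix exponential.\<close>

lemma eigen_flow_approx:
 assumes w: "cjac H 0 *v w = \<mu> *s w"
 shows "\<exists>C s0. s0 > 0 \<and> (\<forall>s. 0 < s \<and> s < s0 \<longrightarrow> of_real s *s w \<in> ball 0 (\<rho>/4) \<and>
  (\<forall>th\<in>{0..2*pi}. norm ((of_real s * exp (\<i> * \<mu> * of_real th)) *s w - u (of_real s *s w) th) \<le> C * s\<^sup>2))"
proof -
 obtain L where L: "L \<ge> 0" "\<forall>T x x' \<delta> y t. y \<in> ball 0 \<rho> \<and> T \<le> 4*pi \<and> t \<in> {0..T} \<and> x 0 = y \<and>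
  (\<forall>t\<in>{0..T}. (x has_vector_derivative x' t) (at t within {0..T}) \<and> norm (x' t - \<i> *s H (x t)) \<le> \<delta> \<and> x t \<in> cball 0 r)
  \<longrightarrow> norm (x t - u y t) \<le> \<delta> * T * exp (L * t)" using flow_approx by blast
 obtain C where C: "C \<ge> 0" "\<And>x. x \<in> ball 0 (\<rho>/4) ==> norm (H x - cjac H 0 *v x) \<le> C * (norm x)\<^sup>2"
  using cholv_quadratic[OF H_ball \<rho>(1) H0] by blast
 define B where "B = exp (norm \<mu> * (2*pi))"
 have B: "B \<ge> 1" by (simp add: B_def)
 have expB: "norm (exp (\<i> * \<mu> * of_real th)) \<le> B" if "th \<in> {0..2*pi}" for th
 proof -
  have "norm (exp (\<i> * \<mu> * of_real th)) \<le> exp (norm (\<i> * \<mu> * of_real th))" by (rule norm_exp)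
  also have "norm (\<i> * \<mu> * of_real th) = norm \<mu> * th" using that by (simp add: norm_mult)
  also have "exp (norm \<mu> * th) \<le> B" unfolding B_def using that by (simp add: mult_left_mono)
  finally show ?thesis .
 qed
 define N where "N = norm w + 1"
 have N: "N > 0" "norm w \<le> N" by (auto simp: N_def add_nonneg_pos)
 define s0 where "s0 = \<rho> / (4 * B * N)"
 have s0: "s0 > 0" using \<rho> B N by (simp add: s0_def)
 have small: "s * B * norm w < \<rho> / 4" if "0 < s" "s < s0" for s
 proof -
  have "s * B * norm w \<le> s * B * N" using that B N by (intro mult_left_mono) auto
  also have "\<dots> < s0 * B * N" using that B N by (intro mult_strict_right_mono) auto
  also have "\<dots> = \<rho> / 4" using B N by (simp add: s0_def)
  finally show ?thesis .
 qed
 have "of_real s *s w \<in> ball 0 (\<rho>/4) \<and> (\<forall>th\<in>{0..2*pi}. norm ((of_real s * exp (\<i> * \<mu> * of_real th)) *s w - u (of_real s *s w) th)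
   \<le> (C * (B * norm w)\<^sup>2 * (2*pi) * exp (L * (2*pi))) * s\<^sup>2)" if s: "0 < s" "s < s0" for s
 proof
  have "s * norm w \<le> s * B * norm w" using s B by (intro mult_right_mono) auto
  also note small[OF s]
  finally show in4: "of_real s *s w \<in> ball 0 (\<rho>/4)" using s by (simp add: norm_cvec_smult)
  show "\<forall>th\<in>{0..2*pi}. norm ((of_real s * exp (\<i> * \<mu> * of_real th)) *s w - u (of_real s *s w) th)
   \<le> (C * (B * norm w)\<^sup>2 * (2*pi) * exp (L * (2*pi))) * s\<^sup>2"
  proof
   fix th :: real assume th: "th \<in> {0..2*pi}"
   define x where "x = (%th. (of_real s * exp (\<i> * \<mu> * of_real th)) *s w)"
   define x' where "x' = (%th. (of_real s * (\<i> * \<mu> * exp (\<i> * \<mu> * of_real th))) *s w)"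
   have nx: "norm (x t) \<le> s * B * norm w" if "t \<in> {0..2*pi}" for t
    unfolding x_def norm_cvec_smult using expB[OF that] s by (intro mult_right_mono) (auto simp: norm_mult)
   have "norm (x th - u (of_real s *s w) th) \<le> (C * (s * B * norm w)\<^sup>2) * (2*pi) * exp (L * th)"
   proof (rule L(2)[rule_format, where x' = x'], intro conjI ballI)
    show "of_real s *s w \<in> ball 0 \<rho>" using in4 \<rho> by auto
    show "x 0 = of_real s *s w" by (simp add: x_def)
    fix t :: real assume t: "t \<in> {0..2*pi}"
    have "((%t. of_real s * exp (\<i> * \<mu> * of_real t)) has_vector_derivative of_real s * (\<i> * \<mu> * exp (\<i> * \<mu> * of_real t))) (at t within {0..2*pi})"
    proof -
     have "((%z. of_real s * exp (\<i> * \<mu> * z)) has_field_derivative of_real s * (\<i> * \<mu> * exp (\<i> * \<mu> * of_real t))) (at (of_real t))"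
      by (rule derivative_eq_intros refl)+ simp
     from has_vector_derivative_real_field[OF this] show ?thesis .
    qed
    thus "(x has_vector_derivative x' t) (at t within {0..2*pi})" unfolding x_def x'_def
     by (rule has_vector_derivative_smult)
    have xin: "x t \<in> ball 0 (\<rho>/4)" using nx[OF t] small[OF s] by simp
    thus "x t \<in> cball 0 r" using \<rho> by auto
    have "x' t - \<i> *s H (x t) = \<i> *s (cjac H 0 *v x t - H (x t))"
     by (simp add: x'_def x_def matrix_vec_smult w vector_smult_assoc vector_ssub_ldistrib mult_ac)
    hence "norm (x' t - \<i> *s H (x t)) = norm (H (x t) - cjac H 0 *v x t)"
     by (simp only: norm_cvec_smult norm_ii mult_1 norm_minus_commute)
    also have "\<dots> \<le> C * (norm (x t))\<^sup>2" by (rule C(2)[OF xin])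
    also have "\<dots> \<le> C * (s * B * norm w)\<^sup>2" using C nx[OF t] by (intro mult_left_mono power_mono) auto
    finally show "norm (x' t - \<i> *s H (x t)) \<le> C * (s * B * norm w)\<^sup>2" .
   qed (use th in auto)
   also have "\<dots> \<le> (C * (s * B * norm w)\<^sup>2) * (2*pi) * exp (L * (2*pi))"
    using C L(1) th by (intro mult_left_mono) (auto intro!: mult_left_mono)
   finally show "norm ((of_real s * exp (\<i> * \<mu> * of_real th)) *s w - u (of_real s *s w) th)
     \<le> (C * (B * norm w)\<^sup>2 * (2*pi) * exp (L * (2*pi))) * s\<^sup>2"
    by (simp add: x_def power_mult_distrib mult_ac)
  qed
 qed
 with s0 show ?thesis by blast
qed

text \<open>The flow returns after 2 pi, so \<open>s * (exp (2 pi \<i> \<mu>) - 1) w\<close> is of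
  order two in \<open>s\<close>, hence zero, and \<open>\<mu>\<close> is an integer
  \<open>n\<close>. To first order the \<open>n\<close>-th mode of the same approximate orbit is
  \<open>2 pi s w\<close>.\<close>

lemma eigenvalue_integer:
 assumes w: "cjac H 0 *v w = \<mu> *s w" "w ~= 0"
 shows "\<exists>n. \<mu> = of_int n \<and> (\<forall>i. cdir (%y. mode n y $ i) 0 w = 2 * pi * w $ i)"
proof -
 obtain C s0 where s0: "s0 > 0" and near: "\<And>s. 0 < s ==> s < s0 ==> of_real s *s w \<in> ball 0 (\<rho>/4)"
  and C: "\<And>s th. 0 < s ==> s < s0 ==> th \<in> {0..2*pi} ==>
   norm ((of_real s * exp (\<i> * \<mu> * of_real th)) *s w - u (of_real s *s w) th) \<le> C * s\<^sup>2"
  using eigen_flow_approx[OF w(1)] by blast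
 have near': "of_real s *s w \<in> ball 0 \<rho>" if "0 < s" "s < s0" for s using near[OF that] \<rho> by auto
 have "norm (exp (\<i> * \<mu> * of_real (2*pi)) - 1) * norm w \<le> 0"
 proof (rule le_zero_of_quadratic[OF s0])
  fix s assume s: "0 < s" "s < s0"
  have "norm ((of_real s * exp (\<i> * \<mu> * of_real (2*pi))) *s w - of_real s *s w) \<le> C * s\<^sup>2"
   using C[OF s, of "2*pi"] periodic[OF near'[OF s]] by simp
  moreover have "(of_real s * exp (\<i> * \<mu> * of_real (2*pi))) *s w - of_real s *s w = (of_real s * (exp (\<i> * \<mu> * of_real (2*pi)) - 1)) *s w"
   by (simp add: vec_eq_iff algebra_simps)
  ultimately show "norm (exp (\<i> * \<mu> * of_real (2*pi)) - 1) * norm w * s \<le> C * s\<^sup>2"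
   using s by (simp add: norm_cvec_smult norm_mult mult_ac)
 qed
 moreover have "norm w > 0" using w(2) by simp
 ultimately have "exp (\<i> * \<mu> * of_real (2*pi)) = 1" by (simp add: mult_le_0_iff)
 then obtain n :: int where n: "Re (\<i> * \<mu> * of_real (2*pi)) = 0" "Im (\<i> * \<mu> * of_real (2*pi)) = of_int (2 * n) * pi"
  unfolding exp_eq_1 by blast
 have \<mu>: "\<mu> = of_int n" using n by (simp add: complex_eq_iff)
 have "cdir (%y. mode n y $ i) 0 w = 2 * pi * w $ i" for i
 proof -
  obtain C3 where C3: "C3 \<ge> 0" "\<And>x. x \<in> ball 0 (\<rho>/4) ==> norm (mode n x - cjac (mode n) 0 *v x) \<le> C3 * (norm x)\<^sup>2"
   using cholv_quadratic[OF cholv_mode \<rho>(1) mode_zero] by blast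
  have "norm (cdir (%y. mode n y $ i) 0 w - 2 * pi * w $ i) \<le> 0"
  proof (rule le_zero_of_quadratic[OF s0])
   fix s assume s: "0 < s" "s < s0"
   let ?y = "of_real s *s w :: complex^'n"
   have yin: "?y \<in> ball 0 \<rho>" by (rule near'[OF s])
   have "norm ((mode n ?y - cjac (mode n) 0 *v ?y) $ i) \<le> C3 * (norm ?y)\<^sup>2"
    using order_trans[OF Finite_Cartesian_Product.norm_nth_le C3(2)[OF near[OF s]]] .
   moreover have "(cjac (mode n) 0 *v ?y) $ i = of_real s * cdir (%y. mode n y $ i) 0 w"
    by (simp add: cjac_nth[OF cholv_mode zero_in] chol_deriv(2)[OF cholv_nth[OF cholv_mode] zero_in])
   ultimately have 1: "norm (mode n ?y $ i - of_real s * cdir (%y. mode n y $ i) 0 w) \<le> C3 * (norm w)\<^sup>2 * s\<^sup>2"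
    using s by (simp add: norm_cvec_smult power_mult_distrib mult_ac)
   have cont: "continuous_on {0..2*pi} (%th. cis th powi (- n) * u ?y th $ i)"
   proof -
    have "continuous_on {0..2*pi} (%th. cis th powi (- n) *s u ?y th)"
     by (rule continuous_on_subset[OF sect[OF yin]]) auto
    from bounded_linear.continuous_on[OF bounded_linear_vec_nth[of i] this] show ?thesis by simp
   qed
   have "integral {0..2*pi} (%th. of_real s * w $ i - cis th powi (- n) * u ?y th $ i) = 2 * pi * (of_real s * w $ i) - mode n ?y $ i"
    unfolding mode_nth[OF yin]
    by (subst integral_diff) (auto intro!: integrable_continuous_real cont simp: scaleR_conv_of_real)
   moreover have "norm (integral {0..2*pi} (%th. of_real s * w $ i - cis th powi (- n) * u ?y th $ i)) \<le> (C * s\<^sup>2) * (2*pi - 0)"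
   proof (rule integral_bound)
    show "continuous_on {0..2*pi} (%th. of_real s * w $ i - cis th powi (- n) * u ?y th $ i)"
     by (intro continuous_intros cont)
    fix th assume th: "th \<in> {0..2*pi}"
    have e: "exp (\<i> * \<mu> * of_real th) = cis th powi n"
     unfolding \<mu> by (simp add: cis_conv_exp exp_power_int mult_ac)
    have "of_real s * w $ i - cis th powi (- n) * u ?y th $ i = cis th powi (- n) * (((of_real s * exp (\<i> * \<mu> * of_real th)) *s w - u ?y th) $ i)"
     unfolding e by (simp add: algebra_simps power_int_minus)
    also have "norm \<dots> = norm (((of_real s * exp (\<i> * \<mu> * of_real th)) *s w - u ?y th) $ i)"
     by (simp add: norm_mult norm_power_int)
    also have "\<dots> \<le> norm ((of_real s * exp (\<i> * \<mu> * of_real th)) *s w - u ?y th)" by (rule Finite_Cartesian_Product.norm_nth_le)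
    also have "\<dots> \<le> C * s\<^sup>2" by (rule C[OF s th])
    finally show "norm (of_real s * w $ i - cis th powi (- n) * u ?y th $ i) \<le> C * s\<^sup>2" .
   qed simp
   ultimately have 2: "norm (2 * pi * (of_real s * w $ i) - mode n ?y $ i) \<le> C * 2 * pi * s\<^sup>2" by (simp add: mult_ac)
   have "norm (of_real s * (cdir (%y. mode n y $ i) 0 w - 2 * pi * w $ i)) \<le> C3 * (norm w)\<^sup>2 * s\<^sup>2 + C * 2 * pi * s\<^sup>2"
   proof -
    have "of_real s * (cdir (%y. mode n y $ i) 0 w - 2 * pi * w $ i) = - (mode n ?y $ i - of_real s * cdir (%y. mode n y $ i) 0 w)
      - (2 * pi * (of_real s * w $ i) - mode n ?y $ i)" by (simp add: algebra_simps)
    thus ?thesis using norm_triangle_ineq4[of "- (mode n ?y $ i - of_real s * cdir (%y. mode n y $ i) 0 w)" "2 * pi * (of_real s * w $ i) - mode n ?y $ i"] 1 2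
     by (simp only: norm_minus_cancel)
   qed
   thus "norm (cdir (%y. mode n y $ i) 0 w - 2 * pi * w $ i) * s \<le> (C3 * (norm w)\<^sup>2 + C * 2 * pi) * s\<^sup>2"
    using s unfolding norm_mult by (simp only: norm_of_real) (simp add: algebra_simps)
  qed
  thus ?thesis by simp
 qed
 with \<mu> show ?thesis by blast
qed

text \<open>The common kernel of the differentials of all modes is invariant under the linear part.
  If it were nonzero on \<open>coord_space U\<close>, it would contain an eigenvector
  \<open>w\<close>, but the mode belonging to its eigenvalue has derivative \<open>2 pi w\<close>
  along \<open>w\<close>. So the modes furnish a full set of left eigenvectors, which excludes
  Jordan blocks.\<close>

lemma kernel_trivial:
 assumes v: "v \<in> coord_space U" "v ~= 0"
 shows "\<exists>n. \<exists>i\<in>U. cdir (%y. mode n y $ i) 0 v ~= 0"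
proof (rule ccontr)
 assume no: "\<not> ?thesis"
 define W where "W = {v \<in> coord_space U. \<forall>n. \<forall>i\<in>U. cdir (%y. mode n y $ i) 0 v = 0}"
 note lin = cdir_linear[OF cholv_nth[OF cholv_mode] zero_in]
 have "\<exists>w \<mu>. w \<in> W \<and> w ~= 0 \<and> cjac H 0 *v w = \<mu> *s w"
 proof (rule invariant_subspace_eigenvector[OF _ _ _ _ v(2)])
  show "v \<in> W" using no v by (auto simp: W_def)
  show "x + y \<in> W" if "x \<in> W" "y \<in> W" for x y
   using that by (auto simp: W_def coord_space_def linear_simps(1)[OF lin])
  show "k *s x \<in> W" if "x \<in> W" for k x
   using that by (auto simp: W_def coord_space_def chol_deriv(2)[OF cholv_nth[OF cholv_mode] zero_in])
  show "cjac H 0 *v x \<in> W" if "x \<in> W" for x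
   using that A_off by (auto simp: W_def coord_space_def mode_linear_part)
 qed
 then obtain w \<mu> where w: "w \<in> W" "w ~= 0" "cjac H 0 *v w = \<mu> *s w" by blast
 obtain n where n: "\<And>i. cdir (%y. mode n y $ i) 0 w = 2 * pi * w $ i" using eigenvalue_integer[OF w(3,2)] by blast
 have "w $ i = 0" for i
 proof (cases "i \<in> U")
  case True
  have "cdir (%y. mode n y $ i) 0 w = 0" using w(1) True by (auto simp: W_def)
  thus ?thesis using n[of i] by simp
 qed (use w(1) in \<open>auto simp: W_def coord_space_def\<close>)
 with w(2) show False by (simp add: vec_eq_iff)
qed

text \<open>Components of modes with independent differentials replace the coordinates in
  \<open>U\<close>. A mode component \<open>q\<close> of frequency \<open>- m \<le> 0\<close> would
  vanish: along a curve \<open>w\<close> the function \<open>\<tau> ^ m * q (w \<tau>)\<close> is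
  constant and zero at the centre, so \<open>q\<close> is zero on a non-negligible set and hence
  everywhere.\<close>

lemma linearizing_map:
 "\<exists>Ps ns. cholv (ball 0 \<rho>) Ps \<and> Ps 0 = 0 \<and> det (cjac Ps 0) ~= 0 \<and> (\<forall>k y. k \<notin> U \<longrightarrow> Ps y $ k = y $ k) \<and>
   (\<forall>k\<in>U. 0 < (ns k :: nat) \<and> (\<forall>y\<in>ball 0 \<rho>. cdir (%y. Ps y $ k) y (H y) = of_nat (ns k) * Ps y $ k))"
proof -
 define Rows where "Rows = {(\<chi> k. cdir (%y. mode n y $ i) 0 (axis k 1)) | n i. i \<in> U}"
 have rd: "rdot (\<chi> k. cdir (%y. mode n y $ i) 0 (axis k 1)) v = cdir (%y. mode n y $ i) 0 v" for n i v
  by (simp add: rdot_def cdir_expand[OF cholv_nth[OF cholv_mode] zero_in, of n i v])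
 \<comment> \<open>Starting from the identity matrix, the rows with index in \<open>U\<close> are
   exchanged for differentials of mode components.\<close>
 have "\<exists>M :: complex^'n^'n. det M ~= 0 \<and> (\<forall>k. k \<notin> U \<longrightarrow> M $ k = mat 1 $ k) \<and> (\<forall>k\<in>U. M $ k \<in> Rows)"
 proof (rule row_selection)
  show "det (mat 1 :: complex^'n^'n) ~= 0" by simp
  fix v :: "complex^'n" assume v: "v ~= 0" "\<And>k. k \<notin> U ==> rdot (mat 1 $ k) v = 0"
  have "rdot (mat 1 $ k) v = v $ k" for k by (simp flip: matrix_rdot)
  hence "v \<in> coord_space U" using v(2) by (simp add: coord_space_def)
  from kernel_trivial[OF this v(1)] obtain n i where ni: "i \<in> U" "cdir (%y. mode n y $ i) 0 v ~= 0" by blast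
  show "\<exists>R\<in>Rows. rdot R v ~= 0"
   by (rule bexI[of _ "\<chi> k. cdir (%y. mode n y $ i) 0 (axis k 1)"]) (use ni rd in \<open>auto simp: Rows_def\<close>)
 qed
 then obtain M :: "complex^'n^'n" where M: "det M ~= 0" "\<And>k. k \<notin> U ==> M $ k = mat 1 $ k" "\<And>k. k \<in> U ==> M $ k \<in> Rows" by blast
 have "\<forall>k\<in>U. \<exists>n i. i \<in> U \<and> M $ k = (\<chi> l. cdir (%y. mode n y $ i) 0 (axis l 1))"
  using M(3) unfolding Rows_def by blast
 then obtain nn ii where ni: "\<And>k. k \<in> U ==> ii k \<in> U" "\<And>k. k \<in> U ==> M $ k = (\<chi> l. cdir (%y. mode (nn k) y $ ii k) 0 (axis l 1))"
  by metis
 define Ps where "Ps = (%y. \<chi> k. if k \<in> U then mode (nn k) y $ ii k else y $ k)"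
 have PsU: "(%y. Ps y $ k) = (%y. mode (nn k) y $ ii k)" if "k \<in> U" for k using that by (simp add: Ps_def)
 have PsN: "(%y. Ps y $ k) = (%y. y $ k)" if "k \<notin> U" for k using that by (simp add: Ps_def)
 have Psc: "cholv (ball 0 \<rho>) Ps"
  unfolding cholv_def
 proof
  fix k show "chol (ball 0 \<rho>) (%y. Ps y $ k)"
   by (cases "k \<in> U") (simp_all add: PsU PsN cholv_nth[OF cholv_mode])
 qed
 have "cjac Ps 0 $ k = M $ k" for k
 proof (cases "k \<in> U")
  case True
  thus ?thesis by (simp add: cjac_def PsU ni(2))
 next
  case False
  have "cdir (%y. y $ k) 0 (axis l 1) = (mat 1 :: complex^'n^'n) $ k $ l" for l
  proof -
   have "cdir (%y. y $ k) 0 = (%v::complex^'n. v $ k)"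
    by (rule cdir_eqI) (auto intro!: bounded_linear_imp_has_derivative bounded_linear_vec_nth)
   thus ?thesis by (simp add: axis_def mat_def)
  qed
  thus ?thesis using False M(2) by (simp add: cjac_def PsN vec_eq_iff)
 qed
 hence cM: "cjac Ps 0 = M" by (simp add: vec_eq_iff)
 have Ps0: "Ps 0 = 0" by (simp add: Ps_def mode_zero vec_eq_iff)
 have eig: "cdir (%y. Ps y $ k) y (H y) = of_int (nn k) * Ps y $ k" if "k \<in> U" "y \<in> ball 0 \<rho>" for k y
  using mode_eigen[OF that(2), of "nn k" "ii k"] that(1) by (simp add: PsU Ps_def)
 have pos: "nn k > 0" if k: "k \<in> U" for k
 proof (rule ccontr)
  assume np: "\<not> nn k > 0"
  define m where "m = nat (- nn k)"
  have m: "(of_int (nn k) :: complex) = - of_nat m" using np by (simp add: m_def)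
  let ?q = "%y. Ps y $ k"
  have qc: "chol (ball 0 \<rho>) ?q" by (rule cholv_nth[OF Psc])
  have "?q y = 0" if y: "y \<in> ball 0 \<rho>" for y
  proof (rule zero_on_orbits[OF qc _ y])
   fix y w \<tau>0 \<rho>1 assume y: "y \<in> ball 0 \<rho>" and orb: "orb y w \<tau>0 \<rho>1"
   define F where "F = (%\<tau>. \<tau> ^ m * ?q (w \<tau>))"
   have win: "w \<tau> \<in> ball 0 \<rho>" and wD: "\<exists>D. (w has_derivative (%h. h *s D)) (at \<tau>) \<and> \<tau> *s D = H (w \<tau>)" if "\<tau> \<in> ball 0 \<rho>1" for \<tau>
    using orb that unfolding orb_def by blast+
   have dF: "\<exists>D. (F has_field_derivative D) (at \<tau>) \<and> \<tau> * D = 0" if \<tau>: "\<tau> \<in> ball 0 \<rho>1" for \<tau>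
   proof -
    obtain D where D: "(w has_derivative (%h. h *s D)) (at \<tau>)" "\<tau> *s D = H (w \<tau>)" using wD[OF \<tau>] by blast
    have 1: "((%\<tau>. ?q (w \<tau>)) has_field_derivative cdir ?q (w \<tau>) D) (at \<tau>)"
     by (rule chol_curve[OF qc win[OF \<tau>] D(1)])
    have 2: "\<tau> * cdir ?q (w \<tau>) D = - of_nat m * ?q (w \<tau>)"
     using eig[OF k win[OF \<tau>]] chol_deriv(2)[OF qc win[OF \<tau>], of \<tau> D] by (simp add: D(2) m)
    have "((%\<tau>. \<tau> ^ m) has_field_derivative of_nat m * \<tau> ^ (m - 1)) (at \<tau>)" by (auto intro!: derivative_eq_intros)
    from DERIV_mult[OF this 1]
    have "(F has_field_derivative of_nat m * \<tau> ^ (m - 1) * ?q (w \<tau>) + cdir ?q (w \<tau>) D * \<tau> ^ m) (at \<tau>)"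
     by (simp add: F_def)
    moreover have "\<tau> * (of_nat m * \<tau> ^ (m - 1) * ?q (w \<tau>) + cdir ?q (w \<tau>) D * \<tau> ^ m) = 0"
    proof -
     have "\<tau> * (of_nat m * \<tau> ^ (m - 1)) = of_nat m * \<tau> ^ m" by (cases m) auto
     hence "\<tau> * (of_nat m * \<tau> ^ (m - 1) * ?q (w \<tau>) + cdir ?q (w \<tau>) D * \<tau> ^ m) = of_nat m * \<tau> ^ m * ?q (w \<tau>) + (\<tau> * cdir ?q (w \<tau>) D) * \<tau> ^ m"
      by (simp only: distrib_left mult.assoc[symmetric])
     thus ?thesis unfolding 2 by simp
    qed
    ultimately show ?thesis by blast
   qed
   have Fhol: "F holomorphic_on ball 0 \<rho>1" by (rule holomorphicI) (use dF in blast)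
   have dF0: "deriv F \<tau> = 0" if "\<tau> \<in> ball 0 \<rho>1" "\<tau> ~= 0" for \<tau>
    using dF[OF that(1)] that(2) DERIV_imp_deriv by fastforce
   have \<rho>1: "\<rho>1 > 0" using orb by (auto simp: orb_def intro: le_less_trans[OF norm_ge_zero])
   have "deriv F holomorphic_on ball 0 \<rho>1" by (rule holomorphic_deriv[OF Fhol open_ball])
   hence "isCont (deriv F) 0" using \<rho>1 holomorphic_on_imp_continuous_on by (fastforce simp: continuous_on_eq_continuous_at)
   hence "(deriv F \<longlongrightarrow> deriv F 0) (at 0)" by (simp add: isCont_def)
   moreover have "(deriv F \<longlongrightarrow> 0) (at 0)"
   proof (rule Lim_transform_eventually[OF tendsto_const])
    have "\<forall>\<^sub>F \<tau> in at (0::complex). \<tau> \<in> ball 0 \<rho>1 - {0}" by (rule eventually_at_in_open) (use \<rho>1 in auto)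
    thus "\<forall>\<^sub>F \<tau> in at 0. 0 = deriv F \<tau>" by eventually_elim (use dF0 in auto)
   qed
   ultimately have "deriv F 0 = 0" using tendsto_unique[OF at_neq_bot] by blast
   hence all: "deriv F \<tau> = 0" if "\<tau> \<in> ball 0 \<rho>1" for \<tau> using dF0[OF that] by (cases "\<tau> = 0") auto
   have "\<exists>k. \<forall>\<tau>\<in>ball 0 \<rho>1. F \<tau> = k"
   proof (rule has_field_derivative_zero_constant)
    fix \<tau> :: complex assume t: "\<tau> \<in> ball 0 \<rho>1"
    show "(F has_field_derivative 0) (at \<tau> within ball 0 \<rho>1)"
     using holomorphic_derivI[OF Fhol open_ball t] all[OF t] by (simp add: has_field_derivative_at_within)
   qed simp
   moreover have t0: "\<tau>0 \<in> ball 0 \<rho>1" "\<tau>0 ~= 0" using orb by (auto simp: orb_def)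
   ultimately have "F \<tau>0 = F 0" using \<rho>1 by (metis centre_in_ball)
   also have "F 0 = 0" using orb by (simp add: F_def orb_def Ps0)
   finally have "?q (w \<tau>0) = 0" using t0 by (simp add: F_def)
   hence "?q (coord_proj U y) = 0" using orb by (simp add: orb_def)
   thus "?q y = 0" using mode_proj[OF y ni(1)[OF k]] k by (simp add: Ps_def)
  qed
  hence "cdir ?q 0 v = 0" for v
  proof -
   have "cdir ?q 0 = (%_. 0)"
   proof (rule cdir_eqI)
    show "(?q has_derivative (%_. 0)) (at 0)"
     by (rule has_derivative_transform_within_open[OF has_derivative_const[of 0] open_ball zero_in])
       (use \<open>\<And>y. y \<in> ball 0 \<rho> ==> ?q y = 0\<close> in simp)
   qed simp
   thus ?thesis by simp
  qed
  \<comment> \<open>The differential of the vanishing function is row \<open>k\<close> of the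
    invertible matrix \<open>M\<close>.\<close>
  hence row: "rdot (M $ k) v = 0" for v
   using rd[of "nn k" "ii k" v] k by (simp add: ni(2) PsU)
  obtain B where B: "M ** B = mat 1" using M(1) invertible_det_nz invertible_right_inverse by metis
  have "(M *v (B *v axis k 1)) $ k = (axis k 1 :: complex^'n) $ k" by (simp add: matrix_vector_mul_assoc B)
  thus False using row by (simp add: matrix_rdot axis_def)
 qed
 define ns where "ns = (%k. nat (nn k))"
 have "0 < ns k \<and> (\<forall>y\<in>ball 0 \<rho>. cdir (%y. Ps y $ k) y (H y) = of_nat (ns k) * Ps y $ k)" if "k \<in> U" for k
 proof -
  have "(of_nat (ns k) :: complex) = of_int (nn k)" using pos[OF that] by (simp add: ns_def)
  thus ?thesis using pos[OF that] eig[OF that] by (simp add: ns_def)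
 qed
 moreover have "Ps y $ k = y $ k" if "k \<notin> U" for k y using that by (simp add: Ps_def)
 ultimately show ?thesis using Psc Ps0 M(1) cM by (intro exI[of _ Ps] exI[of _ ns]) auto
qed

end

lemma analytic_near_0_cholv: "analytic_near_0 U h \<longleftrightarrow> (\<exists>e>0. cholv (ball 0 e) (%x. h (coord_proj U x)))"
 (is "?l \<longleftrightarrow> ?r")
proof
 assume ?l
 then obtain e where e: "e > 0" "\<And>x. x \<in> ball 0 e ==> \<exists>A. ((%y. h (coord_proj U y)) has_derivative (*v) A) (at x)"
  unfolding analytic_near_0_def by blast
 have "cholv (ball 0 e) (%x. h (coord_proj U x))" by (rule cholvI) (rule e(2))
 with e(1) show ?r by blast
next
 assume ?r
 then obtain e where e: "e > 0" "cholv (ball 0 e) (%x. h (coord_proj U x))" by blast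
 show ?l unfolding analytic_near_0_def
  by (intro exI[of _ e] conjI ballI e(1)) (rule exI, erule cholv_deriv[OF e(2)])
qed

lemma matrix_vec_sum: "(A :: complex^'n::finite^'k::finite) *v (\<Sum>i\<in>I. f i) = (\<Sum>i\<in>I. A *v f i)"
 by (induction I rule: infinite_finite_induct) (simp_all add: matrix_vector_right_distrib)

lemma vec_expand_axis: "(x :: complex^'n::finite) = (\<Sum>k\<in>UNIV. x $ k *s axis k 1)"
 by (simp add: vec_eq_iff axis_def if_distrib cong: if_cong)

text \<open>What the necessity argument delivers: coordinates \<open>Ps\<close> whose components in
  \<open>U\<close> are eigenfunctions of \<open>H\<close>. \<open>A\<close> and \<open>h\<close>
  stand for the linear part and the field of the statement, which agree with those of
  \<open>H\<close> on \<open>coord_space U\<close>.\<close>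

locale eigenfunctions =
 fixes U :: "'n::finite set" and H Ps h :: "complex^'n => complex^'n" and R :: real and ns :: "'n => nat" and A :: "complex^'n^'n"
 assumes R: "R > 0" and Ps: "cholv (ball 0 R) Ps" "Ps 0 = 0" "det (cjac Ps 0) ~= 0" and Ps_off: "\<And>k y. k \<notin> U ==> Ps y $ k = y $ k"
  and ns: "\<And>k. k \<in> U ==> 0 < ns k"
  and eig: "\<And>k y. k \<in> U ==> y \<in> ball 0 R ==> cdir (%y. Ps y $ k) y (H y) = of_nat (ns k) * Ps y $ k"
  and H: "cholv (ball 0 R) H" "H 0 = 0" and H_off: "\<And>k y. k \<notin> U ==> H y $ k = 0"
  and A: "\<And>v. v \<in> coord_space U ==> A *v v = cjac H 0 *v v"
  and h: "\<And>y. y \<in> coord_space U ==> y \<in> ball 0 R ==> h y = H y"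
begin

lemma zin: "(0 :: complex^'n) \<in> ball 0 R" using R by simp

lemma jac_U: "k \<in> U ==> (cjac Ps 0 *v (cjac H 0 *v v)) $ k = of_nat (ns k) * (cjac Ps 0 *v v) $ k"
 unfolding cjac_nth[OF Ps(1) zin]
 by (rule eigenfunction_linear_part[OF cholv_nth[OF Ps(1)] R H]) (use Ps(2) eig in simp_all)

lemma jac_off: "k \<notin> U ==> (cjac Ps 0 *v v) $ k = v $ k"
proof -
 assume k: "k \<notin> U"
 have "cdir (%y. y $ k) 0 = (%v::complex^'n. v $ k)"
  by (rule cdir_eqI) (auto intro!: bounded_linear_imp_has_derivative bounded_linear_vec_nth)
 thus ?thesis unfolding cjac_nth[OF Ps(1) zin] using k by (simp add: Ps_off)
qed

lemma jac_H_off: "k \<notin> U ==> (cjac H 0 *v v) $ k = 0"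
proof -
 assume k: "k \<notin> U"
 have "cdir (%y. 0) 0 = (%v::complex^'n. 0)" by (rule cdir_eqI) simp_all
 thus ?thesis unfolding cjac_nth[OF H(1) zin] using k by (simp add: H_off)
qed

definition B where "B = (SOME B. cjac Ps 0 ** B = mat 1 \<and> B ** cjac Ps 0 = mat 1)"
text \<open>The basis dual to the differentials at 0 of the components of \<open>Ps\<close>. These
  differentials are left eigenvectors for indices in \<open>U\<close>, so the dual vectors are
  eigenvectors of \<open>A\<close> there.\<close>

definition basis :: "'n => complex^'n" where "basis k = B *v axis k 1"

lemma B: "cjac Ps 0 ** B = mat 1" "B ** cjac Ps 0 = mat 1"
proof -
 have "\<exists>B. cjac Ps 0 ** B = mat 1 \<and> B ** cjac Ps 0 = mat 1"
  using Ps(3) unfolding invertible_det_nz[symmetric] invertible_def .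
 from someI_ex[OF this] show "cjac Ps 0 ** B = mat 1" "B ** cjac Ps 0 = mat 1" unfolding B_def by blast+
qed

lemma jac_basis: "cjac Ps 0 *v basis k = axis k 1"
 by (simp add: basis_def matrix_vector_mul_assoc B)

lemma B_jac: "B *v (cjac Ps 0 *v v) = v"
 by (simp add: matrix_vector_mul_assoc B)

lemma jac_inj: "cjac Ps 0 *v v = cjac Ps 0 *v w ==> v = w"
 by (metis B_jac)

lemma basis_in: assumes k: "k \<in> U" shows "basis k \<in> coord_space U"
proof -
 have "basis k $ i = 0" if i: "i \<notin> U" for i
 proof -
  have "i ~= k" using k i by blast
  thus ?thesis using jac_off[OF i, of "basis k"] by (simp add: jac_basis axis_def)
 qed
 thus ?thesis by (simp add: coord_space_def)
qed

lemma basis_eigen: assumes k: "k \<in> U" shows "A *v basis k = of_nat (ns k) *s basis k"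
proof (rule jac_inj)
 have "(cjac Ps 0 *v (A *v basis k)) $ l = (cjac Ps 0 *v (of_nat (ns k) *s basis k)) $ l" for l
 proof (cases "l \<in> U")
  case True
  thus ?thesis by (simp add: A[OF basis_in[OF k]] jac_U matrix_vec_smult jac_basis axis_def)
 next
  case False
  hence "l ~= k" using k by blast
  thus ?thesis using False by (simp add: A[OF basis_in[OF k]] jac_off jac_H_off matrix_vec_smult jac_basis axis_def)
 qed
 thus "cjac Ps 0 *v (A *v basis k) = cjac Ps 0 *v (of_nat (ns k) *s basis k)" by (simp add: vec_eq_iff)
qed

lemma basis_inj: "inj basis"
proof (rule injI)
 fix k l assume "basis k = basis l"
 hence "axis k (1::complex) = axis l 1" using jac_basis by metis
 thus "k = l" by (simp add: axis_eq_axis)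
qed

lemma semisimple: "semisimple_on U A"
 unfolding semisimple_on_def
proof (intro exI[of _ "basis ` U"] conjI ballI)
 show "vec.independent (basis ` U)"
 proof (rule vec.independent_if_scalars_zero)
  fix q x assume s: "(\<Sum>x\<in>basis ` U. q x *s x) = 0" and x: "x \<in> basis ` U"
  obtain k where k: "k \<in> U" "x = basis k" using x by blast
  have "(\<Sum>x\<in>basis ` U. q x *s x) = (\<Sum>k\<in>U. q (basis k) *s basis k)"
   by (rule sum.reindex_cong[OF inj_on_subset[OF basis_inj subset_UNIV]]) auto
  hence "cjac Ps 0 *v (\<Sum>k\<in>U. q (basis k) *s basis k) = 0" using s by simp
  hence "(\<Sum>k\<in>U. q (basis k) *s axis k (1::complex)) $ k = 0" by (simp only: matrix_vec_sum matrix_vec_smult jac_basis zero_index)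
  thus "q x = 0" using k by (simp add: axis_def if_distrib cong: if_cong)
 qed simp
 show "vec.span (basis ` U) = coord_space U"
 proof
  show "vec.span (basis ` U) \<subseteq> coord_space U"
   by (rule vec.span_minimal) (auto simp: basis_in, auto simp: vec.subspace_def coord_space_def)
  show "coord_space U \<subseteq> vec.span (basis ` U)"
  proof
   fix v :: "complex^'n" assume v: "v \<in> coord_space U"
   let ?w = "cjac Ps 0 *v v"
   have "v = B *v (\<Sum>k\<in>UNIV. ?w $ k *s axis k 1)" by (subst vec_expand_axis[symmetric]) (simp add: B_jac)
   also have "\<dots> = (\<Sum>k\<in>UNIV. ?w $ k *s basis k)" by (simp only: matrix_vec_sum matrix_vec_smult basis_def)
   also have "\<dots> = (\<Sum>k\<in>U. ?w $ k *s basis k)"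
   proof (rule sum.mono_neutral_right)
    have "?w $ k = 0" if "k \<notin> U" for k using v that by (simp add: jac_off coord_space_def)
    thus "\<forall>k\<in>UNIV - U. ?w $ k *s basis k = 0" by simp
   qed auto
   finally have "v = (\<Sum>k\<in>U. ?w $ k *s basis k)" .
   also have "\<dots> \<in> vec.span (basis ` U)"
    by (intro vec.span_sum vec.span_scale vec.span_base) auto
   finally show "v \<in> vec.span (basis ` U)" .
  qed
 qed
 fix v assume "v \<in> basis ` U"
 thus "\<exists>\<mu>. A *v v = \<mu> *s v" using basis_eigen by blast
qed

text \<open>In the coordinates \<open>cjac Ps 0 *v v\<close> the matrix acts on
  \<open>coord_space U\<close> diagonally with entries \<open>ns k\<close>.\<close>

lemma eigenvalues: assumes "eigenvalue_on U A \<mu>" shows "positive_integer \<mu>"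
proof -
 obtain v where v: "v \<in> coord_space U" "v ~= 0" "A *v v = \<mu> *s v" using assms unfolding eigenvalue_on_def by blast
 have "cjac Ps 0 *v v ~= 0" using jac_inj[of v 0] v(2) by auto
 then obtain k where k: "(cjac Ps 0 *v v) $ k ~= 0" by (auto simp: vec_eq_iff)
 have kU: "k \<in> U"
 proof (rule ccontr)
  assume "k \<notin> U" thus False using k v(1) by (simp add: jac_off coord_space_def)
 qed
 have "of_nat (ns k) * (cjac Ps 0 *v v) $ k = \<mu> * (cjac Ps 0 *v v) $ k"
  unfolding jac_U[OF kU, symmetric] A[OF v(1), symmetric] v(3) matrix_vec_smult by simp
 hence "\<mu> = of_nat (ns k)" using k by (simp add: eq_commute[of \<mu>])
 thus ?thesis using ns[OF kU] by (auto simp: positive_integer_def)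
qed

text \<open>\<open>Ps\<close> itself is the linearizing change of variables and \<open>L\<close> the
  diagonal matrix of its eigenvalues. \<open>Ps\<close> fixes the coordinates outside
  \<open>U\<close>, so it and its local inverse preserve \<open>coord_space U\<close>; the
  projections in \<open>\<psi>\<close> and \<open>th\<close> extend this to total maps.\<close>

lemma linearizable: "linearizable_on U h"
proof -
 have "invertible (cjac Ps 0)" using Ps(3) by (simp add: invertible_det_nz)
 from cholv_inverse_function[OF Ps(1) R Ps(2) this] obtain e q where e: "e > 0" and q: "cholv (ball 0 e) q" "q 0 = 0"
  and inv: "\<And>y. y \<in> ball 0 e ==> Ps (q y) = y" "\<And>x. x \<in> ball 0 e ==> q (Ps x) = x" by metis
 define L :: "complex^'n^'n" where "L = (\<chi> i l. if i = l \<and> i \<in> U then of_nat (ns i) else 0)"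
 have L: "(L *v v) $ i = (if i \<in> U then of_nat (ns i) * v $ i else 0)" for v i
  by (simp add: L_def matrix_vector_mult_def if_distrib if_distribR cong: if_cong)
 define \<psi> where "\<psi> = (%y. coord_proj U (Ps (coord_proj U y)))"
 define th where "th = (%y. coord_proj U (q (coord_proj U y)))"
 have img: "coord_proj U ` ball 0 d \<subseteq> ball (0::complex^'n) d" for d
  using le_less_trans[OF norm_coord_proj_le[of U]] by auto
 have pc: "cholv S (coord_proj U)" for S :: "(complex^'n) set" by (rule cholv_coord_proj) simp
 have \<psi>c: "cholv (ball 0 R) \<psi>" unfolding \<psi>_def by (intro cholv_coord_proj cholv_comp[OF Ps(1) pc img])
 have thc: "cholv (ball 0 e) th" unfolding th_def by (intro cholv_coord_proj cholv_comp[OF q(1) pc img])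
 have \<psi>U: "\<psi> y = Ps y" if "y \<in> coord_space U" for y
 proof -
  have "Ps y \<in> coord_space U" using that by (simp add: coord_space_def Ps_off)
  thus ?thesis using that by (simp add: \<psi>_def coord_proj_id)
 qed
 have thU: "th y = q y \<and> q y \<in> coord_space U" if "y \<in> coord_space U" "y \<in> ball 0 e" for y
 proof -
  have "q y $ k = 0" if k: "k \<notin> U" for k
   using Ps_off[OF k, of "q y"] inv(1)[OF \<open>y \<in> ball 0 e\<close>] \<open>y \<in> coord_space U\<close> k by (simp add: coord_space_def)
  hence "q y \<in> coord_space U" by (simp add: coord_space_def)
  thus ?thesis using that by (simp add: th_def coord_proj_id)
 qed
 show ?thesis unfolding linearizable_on_def
 proof (rule exI[of _ \<psi>], rule exI[of _ th], rule exI[of _ L], intro conjI)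
  show "analytic_near_0 U \<psi>" unfolding analytic_near_0_cholv
   by (rule exI[of _ R]) (use R \<psi>c in \<open>simp add: \<psi>_def\<close>)
  show "analytic_near_0 U th" unfolding analytic_near_0_cholv
   by (rule exI[of _ e]) (use e thc in \<open>simp add: th_def\<close>)
  show "\<psi> 0 = 0" "th 0 = 0" by (simp_all add: \<psi>_def th_def Ps(2) q(2))
  show "\<psi> ` coord_space U \<subseteq> coord_space U" "th ` coord_space U \<subseteq> coord_space U" by (auto simp: \<psi>_def th_def)
  show "\<exists>e>0. \<forall>y\<in>coord_space U \<inter> ball 0 e. th (\<psi> y) = y \<and> \<psi> (th y) = y \<and>
    frechet_derivative (%x. \<psi> (coord_proj U x)) (at y) (h y) = L *v \<psi> y"
  proof (intro exI[of _ "min e R"] conjI ballI)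
  show "min e R > 0" using e R by simp
  fix y assume "y \<in> coord_space U \<inter> ball 0 (min e R)"
  hence y: "y \<in> coord_space U" "y \<in> ball 0 e" "y \<in> ball 0 R" by auto
  have P: "Ps y \<in> coord_space U" using y(1) by (simp add: coord_space_def Ps_off)
  show "th (\<psi> y) = y" unfolding \<psi>U[OF y(1)] by (simp add: th_def coord_proj_id[OF P] inv(2)[OF y(2)] coord_proj_id[OF y(1)])
  show "\<psi> (th y) = y" using thU[OF y(1,2)] \<psi>U[of "q y"] inv(1)[OF y(2)] by simp
  have "((%x. \<psi> (coord_proj U x)) has_derivative (*v) (cjac \<psi> y)) (at y)"
   using cholv_deriv[OF \<psi>c y(3)] by (simp add: \<psi>_def)
  hence "frechet_derivative (%x. \<psi> (coord_proj U x)) (at y) = (*v) (cjac \<psi> y)"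
   by (rule frechet_derivative_at[symmetric])
  moreover have "(cjac \<psi> y *v H y) $ k = (L *v \<psi> y) $ k" for k
  proof (cases "k \<in> U")
   case True
   have d: "(Ps has_derivative (*v) (cjac Ps y)) (at (coord_proj U y))"
    using cholv_deriv[OF Ps(1) y(3)] y(1) by (simp add: coord_proj_id)
   from has_derivative_compose[OF bounded_linear_imp_has_derivative[OF bounded_linear_coord_proj] d]
   have "((%x. Ps (coord_proj U x)) has_derivative (%v. cjac Ps y *v coord_proj U v)) (at y)" .
   from bounded_linear.has_derivative[OF bounded_linear_coord_proj this]
   have "(\<psi> has_derivative (%v. coord_proj U (cjac Ps y *v coord_proj U v))) (at y)" unfolding \<psi>_def .
   from has_derivative_unique[OF this cholv_deriv[OF \<psi>c y(3)]]
   have "cjac \<psi> y *v H y = coord_proj U (cjac Ps y *v coord_proj U (H y))" by metis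
   moreover have "coord_proj U (H y) = H y" by (rule coord_proj_id) (simp add: coord_space_def H_off)
   ultimately have "(cjac \<psi> y *v H y) $ k = (cjac Ps y *v H y) $ k" using True by simp
   also have "\<dots> = of_nat (ns k) * Ps y $ k" unfolding cjac_nth[OF Ps(1) y(3)] by (rule eig[OF True y(3)])
   finally show ?thesis using True by (simp add: L \<psi>U[OF y(1)])
  next
   case False
   have "cdir (%y. 0) y = (%v::complex^'n. 0)" by (rule cdir_eqI) simp_all
   moreover have "(%y. \<psi> y $ k) = (%_. 0)" using False by (simp add: \<psi>_def)
   ultimately show ?thesis unfolding cjac_nth[OF \<psi>c y(3)] using False by (simp add: L)
  qed
  hence "cjac \<psi> y *v H y = L *v \<psi> y" by (simp add: vec_eq_iff)
  ultimately show "frechet_derivative (%x. \<psi> (coord_proj U x)) (at y) (h y) = L *v \<psi> y" using h[OF y(1,3)] by simp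
  qed
 qed
qed

end

section \<open>Contour integrals depending on parameters\<close>

text \<open>The hypotheses under which an integral over the loop is holomorphic in the parameter
  \<open>y\<close>. They are stable under the operations that build \<open>zhat\<close> and
  \<open>alp\<close>, including the indefinite integral in the angle.\<close>

definition loop_family :: "(complex^'k::finite) set => (complex^'k => real => complex) => bool" where
 "loop_family D F \<longleftrightarrow> continuous_on (D \<times> {0..2*pi}) (%(y, th). F y th) \<and> (\<forall>th\<in>{0..2*pi}. chol D (%y. F y th))"

lemma loop_family_angle: "continuous_on {0..2*pi} q ==> loop_family D (%y th. q th)"
 unfolding loop_family_def case_prod_beta
 by (auto intro!: continuous_on_compose2[of "{0..2*pi}" q "D \<times> {0..2*pi}" snd] continuous_on_snd continuous_on_id)

lemma loop_family_point: "chol D q ==> loop_family D (%y th. q y)"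
 unfolding loop_family_def case_prod_beta
 by (auto intro!: continuous_on_compose2[of D q "D \<times> {0..2*pi}" fst] chol_continuous continuous_on_fst continuous_on_id)

lemma loop_family_mult: "loop_family D F ==> loop_family D F' ==> loop_family D (%y th. F y th * F' y th)"
 unfolding loop_family_def case_prod_beta by (auto intro!: continuous_intros chol_mult)

lemma loop_family_diff: "loop_family D F ==> loop_family D F' ==> loop_family D (%y th. F y th - F' y th)"
 unfolding loop_family_def case_prod_beta by (auto intro!: continuous_intros chol_diff)

lemma loop_family_powi:
 assumes "loop_family D F" "\<And>y th. y \<in> D ==> th \<in> {0..2*pi} ==> F y th ~= 0"
 shows "loop_family D (%y th. F y th powi q)"
 using assms unfolding loop_family_def case_prod_beta by (auto intro!: continuous_intros chol_powi)

lemma loop_family_comp: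
 fixes W :: "complex^'k::finite => real => complex^'n::finite"
 assumes "\<And>i. loop_family D (%y th. W y th $ i)" and "chol S f" and "\<And>y th. y \<in> D ==> th \<in> {0..2*pi} ==> W y th \<in> S"
 shows "loop_family D (%y th. f (W y th))"
 unfolding loop_family_def
proof (intro conjI ballI)
 have "continuous_on (D \<times> {0..2*pi}) (%p. \<chi> i. W (fst p) (snd p) $ i)"
  using assms(1) unfolding loop_family_def case_prod_beta by (intro continuous_on_vec_lambda) blast
 hence "continuous_on (D \<times> {0..2*pi}) (%p. W (fst p) (snd p))" by simp
 hence "continuous_on (D \<times> {0..2*pi}) (%p. f (W (fst p) (snd p)))"
  by (rule continuous_on_compose2[OF chol_continuous[OF assms(2)]]) (use assms(3) in auto)
 thus "continuous_on (D \<times> {0..2*pi}) (%(y, th). f (W y th))" by (simp add: case_prod_beta)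
 fix th :: real assume t: "th \<in> {0..2*pi}"
 have "cholv D (%y. W y th)" using assms(1) t unfolding loop_family_def cholv_def by blast
 thus "chol D (%y. f (W y th))" by (rule chol_comp[OF assms(2)]) (use assms(3) t in auto)
qed

lemma loop_family_integral:
 assumes D: "open D" and F: "loop_family D F"
 shows "chol D (%y. integral {0..2*pi} (F y))" and "loop_family D (%y th. integral {0..th} (F y))"
proof -
 show "chol D (%y. integral {0..2*pi} (F y))"
  by (rule chol_integral[OF D]) (use F in \<open>auto simp: loop_family_def\<close>)
 have "chol D (%y. integral {0..th} (F y))" if t: "th \<in> {0..2*pi}" for th
 proof (rule chol_integral[OF D])
  have "D \<times> {0..th} \<subseteq> D \<times> {0..2*pi}" using t by (intro Sigma_mono) auto
  with F show "continuous_on (D \<times> {0..th}) (%(y, th). F y th)" unfolding loop_family_def by (metis continuous_on_subset)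
  show "chol D (%x. F x s)" if "s \<in> {0..th}" for s using F t that unfolding loop_family_def by auto
 qed (use t in simp)
 moreover have "continuous_on (D \<times> {0..2*pi}) (%(y, th). integral {0..th} (F y))"
  by (rule continuous_on_indefinite_integral_param) (use F in \<open>simp add: loop_family_def\<close>)
 ultimately show "loop_family D (%y th. integral {0..th} (F y))" by (simp add: loop_family_def)
qed

lemma cis_powi: "cis th powi n = cis (of_int n * th)"
 by (simp add: cis_conv_exp exp_power_int mult_ac)

lemma integral_cis:
 fixes m :: int assumes m: "m ~= 0" and that: "0 \<le> th"
 shows "integral {0..th} (%s. \<i> * cis (of_int m * s)) = (cis (of_int m * th) - 1) / of_int m"
proof (rule integral_unique)
 have "((%s. \<i> * cis (of_int m * s)) has_integral cis (of_int m * th) / of_int m - cis (of_int m * 0) / of_int m) {0..th}"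
 proof (rule fundamental_theorem_of_calculus)
  fix s :: real
  have "((%z. exp (\<i> * of_int m * z) / of_int m) has_field_derivative (exp (\<i> * of_int m * of_real s) * (\<i> * of_int m)) / of_int m) (at (of_real s))"
   by (auto intro!: derivative_eq_intros)
  from has_vector_derivative_real_field[OF this]
  show "((%s. cis (of_int m * s) / of_int m) has_vector_derivative \<i> * cis (of_int m * s)) (at s within {0..th})"
   using m by (simp add: cis_conv_exp mult_ac)
 qed (use that in simp)
 thus "((%s. \<i> * cis (of_int m * s)) has_integral (cis (of_int m * th) - 1) / of_int m) {0..th}"
  by (simp add: diff_divide_distrib)
qed

lemma integral_cis_period:
 fixes m :: int shows "integral {0..2*pi} (%th. cis (of_int m * th)) = (if m = 0 then 2 * pi else 0)"
proof (cases "m = 0")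
 case False
 have "cis (of_int m * (2*pi)) = 1" using cis_multiple_2pi[of "of_int m"] by (simp add: mult_ac)
 hence "integral {0..2*pi} (%s. \<i> * cis (of_int m * s)) = 0" by (subst integral_cis[OF False]) auto
 thus ?thesis using False by simp
qed (simp add: scaleR_conv_of_real)

context qh_chart begin

text \<open>On any loop near the fixed point, \<open>tt\<close> differs from
  \<open>b * cis th\<close> by the indefinite integral of the deviation of \<open>kk\<close> and by
  the mean of that integral, each at most \<open>2 pi |b| / 16\<close>. Hence \<open>tt\<close> has
  no zeros, and the integer powers in \<open>alp\<close> make sense for arbitrary loops, not only
  for those of solutions.\<close>

lemma tt_near:
 assumes W: "\<And>th. th \<in> {0..2*pi} ==> W th \<in> ball ys RV" and c: "continuous_on {0..2*pi} W" and th: "th \<in> {0..2*pi}"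
 shows "norm (tt W th - b * cis th) < norm b"
proof -
 define E where "E = (%th. integral {0..th} (%s. (kk (W s) - b) * (\<i> * cis s)))"
 have kc: "continuous_on {0..2*pi} (%s. kk (W s))"
  by (rule continuous_on_compose2[OF chol_continuous[OF chol_kk_ball] c]) (use W in auto)
 have Ec: "continuous_on {0..2*pi} E" unfolding E_def
  by (intro indefinite_integral_continuous_1 integrable_continuous_real continuous_intros kc)
 have I: "Iint W th = b * (cis th - 1) + E th" if t: "th \<in> {0..2*pi}" for th
 proof -
  have kc': "continuous_on {0..th} (%s. kk (W s))" by (rule continuous_on_subset[OF kc]) (use t in auto)
  have "Iint W th = integral {0..th} (%s. b * (\<i> * cis s) + (kk (W s) - b) * (\<i> * cis s))"
   unfolding Iint_def by (intro integral_cong) (simp add: algebra_simps)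
  also have "\<dots> = integral {0..th} (%s. b * (\<i> * cis s)) + E th"
   unfolding E_def by (intro integral_add integrable_continuous_real continuous_intros kc')
  also have "integral {0..th} (%s. b * (\<i> * cis s)) = b * integral {0..th} (%s. \<i> * cis s)" by simp
  also have "integral {0..th} (%s. \<i> * cis s) = cis th - 1" using integral_cis[of 1 th] t by simp
  finally show ?thesis .
 qed
 have Eb: "norm (E th) \<le> norm b / 16 * (2*pi)" if t: "th \<in> {0..2*pi}" for th
 proof -
  have "norm (E th) \<le> norm b / 16 * (th - 0)" unfolding E_def
  proof (rule integral_bound)
   show "continuous_on {0..th} (%s. (kk (W s) - b) * (\<i> * cis s))"
    by (intro continuous_intros continuous_on_subset[OF kc]) (use t in auto)
   show "norm ((kk (W s) - b) * (\<i> * cis s)) \<le> norm b / 16" if "s \<in> {0..th}" for s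
    using RV(3)[OF W, of s] t that by (simp add: norm_mult)
  qed (use t in simp)
  also have "\<dots> \<le> norm b / 16 * (2*pi)" using t by (intro mult_left_mono) auto
  finally show ?thesis .
 qed
 have "integral {0..2*pi} (Iint W) = integral {0..2*pi} (%th. b * cis th - b + E th)"
  by (intro integral_cong) (simp add: I algebra_simps)
 also have "\<dots> = integral {0..2*pi} (%th. b * cis th - b) + integral {0..2*pi} E"
  by (intro integral_add integrable_continuous_real continuous_intros Ec)
 also have "integral {0..2*pi} (%th. b * cis th - b) = b * integral {0..2*pi} cis - 2 * pi * b"
  by (subst integral_diff) (auto intro!: integrable_continuous_real continuous_intros simp: scaleR_conv_of_real)
 also have "integral {0..2*pi} cis = 0" using integral_cis_period[of 1] by simp
 finally have J: "integral {0..2*pi} (Iint W) / (2 * pi) = integral {0..2*pi} E / (2*pi) - b" by (simp add: field_simps)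
 have "norm (integral {0..2*pi} E) \<le> norm b / 16 * (2*pi) * (2*pi - 0)"
  by (rule integral_bound[OF _ Ec]) (use Eb in auto)
 hence m: "norm (integral {0..2*pi} E / (2*pi)) \<le> norm b / 16 * (2*pi)"
  by (simp add: norm_divide norm_mult field_simps)
 have "tt W th - b * cis th = E th - integral {0..2*pi} E / (2*pi)" unfolding tt_def J I[OF th] by (simp add: algebra_simps)
 hence "norm (tt W th - b * cis th) \<le> norm b / 16 * (2*pi) + norm b / 16 * (2*pi)"
  using order_trans[OF norm_triangle_ineq4 add_mono[OF Eb[OF th] m]] by simp
 also have "\<dots> = norm b * (pi / 4)" by (simp add: field_simps)
 also have "\<dots> < norm b * 1" using b_nz pi_less_4 by (intro mult_strict_left_mono) auto
 finally show ?thesis by simp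
qed

lemma tt_nz:
 assumes "\<And>th. th \<in> {0..2*pi} ==> W th \<in> ball ys RV" "continuous_on {0..2*pi} W" "th \<in> {0..2*pi}"
 shows "tt W th ~= 0"
 using tt_near[OF assms] by (auto simp: norm_mult)

text \<open>The loops form an arbitrary holomorphic family: for necessity they are orbits of the
  flow, for sufficiency the loops of a linearization.\<close>

lemma loop_functionals:
 fixes W :: "complex^'k::finite => real => complex^('m option)"
 assumes D: "open D" and W: "\<And>q. loop_family D (%y th. W y th $ q)"
  and Win: "\<And>y th. y \<in> D ==> th \<in> {0..2*pi} ==> W y th \<in> ball ys RV"
 shows "chol D (%y. zhat (W y))" and "chol D (%y. alp (W y) i n)"
proof -
 have cp: "loop_family D (%y th. cis th powi q)" for q
  by (intro loop_family_angle continuous_intros) auto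
 have "chol D (%y. integral {0..2*pi} (%th. W y th $ None * cis th powi (- int r)))"
  by (rule loop_family_integral[OF D loop_family_mult[OF W cp]])
 from chol_mult[OF this chol_const[of _ "1 / (2*pi)"]] show "chol D (%y. zhat (W y))" by (simp add: zhat_def)
 have k: "loop_family D (%y th. kk (W y th))" by (rule loop_family_comp[OF W chol_kk_ball Win])
 have I: "loop_family D (%y. Iint (W y))" unfolding Iint_def
  by (intro loop_family_integral[OF D] loop_family_mult[OF k] loop_family_angle continuous_intros)
 have "chol D (%y. integral {0..2*pi} (Iint (W y)) * (1 / (2*pi)))"
  by (intro chol_mult chol_const loop_family_integral[OF D I])
 hence t: "loop_family D (%y. tt (W y))" unfolding tt_def
  by (intro loop_family_diff I loop_family_point) simp
 have nz: "tt (W y) th ~= 0" if y: "y \<in> D" and th: "th \<in> {0..2*pi}" for y th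
 proof (rule tt_nz[OF _ _ th])
  have "continuous_on {0..2*pi} (%th. W y th $ q)" for q
  proof -
   have "continuous_on (D \<times> {0..2*pi}) (%p. W (fst p) (snd p) $ q)" using W unfolding loop_family_def case_prod_beta by blast
   moreover have "continuous_on {0..2*pi} (%th. (y, th))" by (intro continuous_on_Pair continuous_on_const continuous_on_id)
   ultimately have "continuous_on {0..2*pi} (%th. W (fst (y, th)) (snd (y, th)) $ q)"
    by (rule continuous_on_compose2) (use y in auto)
   thus ?thesis by simp
  qed
  hence "continuous_on {0..2*pi} (%th. \<chi> q. W y th $ q)" by (intro continuous_on_vec_lambda)
  thus "continuous_on {0..2*pi} (W y)" by simp
 qed (rule Win[OF y])
 have X: "loop_family D (%y th. chart_X j (W y th) $ i)"
  by (rule loop_family_comp[OF W cholv_nth[OF cholv_chart_X] Win])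
 have "chol D (%y. integral {0..2*pi} (%th. chart_X j (W y th) $ i * cis th powi (1 - int (p i)) *
   tt (W y) th powi (int (p i) - int n - 1) * kk (W y th)))"
  by (rule loop_family_integral[OF D]) (intro loop_family_mult X cp k loop_family_powi t nz)
 from chol_mult[OF this chol_const[of _ "1 / (2*pi)"]] show "chol D (%y. alp (W y) i n)" by (simp add: alp_def)
qed

end
text \<open>The expansion \<open>F0 + \<zeta> F1\<close> with an error quadratic in
  \<open>\<zeta>\<close>, uniform in the angle. Uniformity makes it compatible with integration, so
  the derivatives at 0 of the nested integrals and powers in \<open>alp\<close> can be computed
  factor by factor.\<close>

definition expands :: "(complex => real => complex) => (real => complex) => (real => complex) => bool" where
 "expands F F0 F1 \<longleftrightarrow> continuous_on {0..2*pi} F0 \<and> continuous_on {0..2*pi} F1 \<and>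
   (\<exists>C\<ge>0. \<exists>e>0. \<forall>\<zeta> th. norm \<zeta> < e \<and> th \<in> {0..2*pi} \<longrightarrow> norm (F \<zeta> th - F0 th - \<zeta> * F1 th) \<le> C * (norm \<zeta>)\<^sup>2)"

lemma expandsI:
 assumes "continuous_on {0..2*pi} F0" "continuous_on {0..2*pi} F1" "C \<ge> 0" "e > 0"
  "\<And>\<zeta> th. norm \<zeta> < e ==> th \<in> {0..2*pi} ==> norm (F \<zeta> th - F0 th - \<zeta> * F1 th) \<le> C * (norm \<zeta>)\<^sup>2"
 shows "expands F F0 F1"
 unfolding expands_def using assms by blast

text \<open>The radius is normalized to at most 1, so that cubic and quartic terms in products are
  absorbed by the quadratic one.\<close>

lemma expandsE:
 assumes "expands F F0 F1"
 obtains C e where "continuous_on {0..2*pi} F0" "continuous_on {0..2*pi} F1" "C \<ge> 0" "0 < e" "e \<le> 1"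
  "\<And>\<zeta> th. norm \<zeta> < e ==> th \<in> {0..2*pi} ==> norm (F \<zeta> th - F0 th - \<zeta> * F1 th) \<le> C * (norm \<zeta>)\<^sup>2"
proof -
 obtain C e where *: "continuous_on {0..2*pi} F0" "continuous_on {0..2*pi} F1" "C \<ge> 0" "0 < e"
  "\<And>\<zeta> th. norm \<zeta> < e ==> th \<in> {0..2*pi} ==> norm (F \<zeta> th - F0 th - \<zeta> * F1 th) \<le> C * (norm \<zeta>)\<^sup>2"
  using assms unfolding expands_def by blast
 show ?thesis by (rule that[OF *(1-3), of "min e 1"]) (use * in auto)
qed

lemma expands_cong:
 assumes "expands F F0 F1" "\<And>th. th \<in> {0..2*pi} ==> F0 th = F0' th" "\<And>th. th \<in> {0..2*pi} ==> F1 th = F1' th"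
  "e0 > 0" "\<And>\<zeta> th. norm \<zeta> < e0 ==> th \<in> {0..2*pi} ==> F \<zeta> th = F' \<zeta> th"
 shows "expands F' F0' F1'"
proof -
 from assms(1) obtain C e where *: "continuous_on {0..2*pi} F0" "continuous_on {0..2*pi} F1" "C \<ge> 0" "0 < e" "e \<le> 1"
  "\<And>\<zeta> th. norm \<zeta> < e ==> th \<in> {0..2*pi} ==> norm (F \<zeta> th - F0 th - \<zeta> * F1 th) \<le> C * (norm \<zeta>)\<^sup>2" by (rule expandsE) (rule that; assumption)
 show ?thesis
 proof (rule expandsI[of _ _ C "min e e0"])
  show "continuous_on {0..2*pi} F0'" by (rule iffD1[OF continuous_on_cong[OF refl assms(2)] *(1)])
  show "continuous_on {0..2*pi} F1'" by (rule iffD1[OF continuous_on_cong[OF refl assms(3)] *(2)])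
  show "norm (F' \<zeta> th - F0' th - \<zeta> * F1' th) \<le> C * (norm \<zeta>)\<^sup>2" if "norm \<zeta> < min e e0" "th \<in> {0..2*pi}" for \<zeta> th
   using *(6)[of \<zeta> th] assms(2,3)[OF that(2)] assms(5)[of \<zeta> th] that by simp
 qed (use * assms(4) in auto)
qed

lemma expands_angle: "continuous_on {0..2*pi} q ==> expands (%\<zeta> th. q th) q (%_. 0)"
 by (rule expandsI[of _ _ 0 1]) auto

lemma expands_diff:
 assumes "expands F F0 F1" "expands H H0 H1"
 shows "expands (%\<zeta> th. F \<zeta> th - H \<zeta> th) (%th. F0 th - H0 th) (%th. F1 th - H1 th)"
proof -
 from assms(1) obtain C e where F: "continuous_on {0..2*pi} F0" "continuous_on {0..2*pi} F1" "C \<ge> 0" "0 < e" "e \<le> 1"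
  "\<And>\<zeta> th. norm \<zeta> < e ==> th \<in> {0..2*pi} ==> norm (F \<zeta> th - F0 th - \<zeta> * F1 th) \<le> C * (norm \<zeta>)\<^sup>2" by (rule expandsE) (rule that; assumption)
 from assms(2) obtain C' e' where H: "continuous_on {0..2*pi} H0" "continuous_on {0..2*pi} H1" "C' \<ge> 0" "0 < e'" "e' \<le> 1"
  "\<And>\<zeta> th. norm \<zeta> < e' ==> th \<in> {0..2*pi} ==> norm (H \<zeta> th - H0 th - \<zeta> * H1 th) \<le> C' * (norm \<zeta>)\<^sup>2" by (rule expandsE) (rule that; assumption)
 show ?thesis
 proof (rule expandsI[of _ _ "C + C'" "min e e'"])
  fix \<zeta> :: complex and th :: real assume z: "norm \<zeta> < min e e'" "th \<in> {0..2*pi}"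
  have "F \<zeta> th - H \<zeta> th - (F0 th - H0 th) - \<zeta> * (F1 th - H1 th) = (F \<zeta> th - F0 th - \<zeta> * F1 th) - (H \<zeta> th - H0 th - \<zeta> * H1 th)"
   by (simp add: algebra_simps)
  also have "norm \<dots> \<le> C * (norm \<zeta>)\<^sup>2 + C' * (norm \<zeta>)\<^sup>2"
   by (rule order_trans[OF norm_triangle_ineq4 add_mono[OF F(6) H(6)]]) (use z in auto)
  finally show "norm (F \<zeta> th - H \<zeta> th - (F0 th - H0 th) - \<zeta> * (F1 th - H1 th)) \<le> (C + C') * (norm \<zeta>)\<^sup>2"
   by (simp only: distrib_right)
 qed (use F H in \<open>auto intro!: continuous_intros\<close>)
qed

lemma continuous_on_period_bound:
 fixes q :: "real => complex"
 assumes "continuous_on {0..2*pi} q" shows "\<exists>B\<ge>0. \<forall>th\<in>{0..2*pi}. norm (q th) \<le> B"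
proof -
 have "bounded (q ` {0..2*pi})" by (intro compact_imp_bounded compact_continuous_image assms) simp
 then obtain B where "\<forall>th\<in>{0..2*pi}. norm (q th) \<le> B" using bounded_imageD by blast
 thus ?thesis by (intro exI[of _ "max B 0"]) auto
qed

lemma expands_mult:
 assumes "expands F F0 F1" "expands H H0 H1"
 shows "expands (%\<zeta> th. F \<zeta> th * H \<zeta> th) (%th. F0 th * H0 th) (%th. F1 th * H0 th + F0 th * H1 th)"
proof -
 from assms(1) obtain C e where F: "continuous_on {0..2*pi} F0" "continuous_on {0..2*pi} F1" "C \<ge> 0" "0 < e" "e \<le> 1"
  "\<And>\<zeta> th. norm \<zeta> < e ==> th \<in> {0..2*pi} ==> norm (F \<zeta> th - F0 th - \<zeta> * F1 th) \<le> C * (norm \<zeta>)\<^sup>2" by (rule expandsE) (rule that; assumption)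
 from assms(2) obtain C' e' where H: "continuous_on {0..2*pi} H0" "continuous_on {0..2*pi} H1" "C' \<ge> 0" "0 < e'" "e' \<le> 1"
  "\<And>\<zeta> th. norm \<zeta> < e' ==> th \<in> {0..2*pi} ==> norm (H \<zeta> th - H0 th - \<zeta> * H1 th) \<le> C' * (norm \<zeta>)\<^sup>2" by (rule expandsE) (rule that; assumption)
 obtain B0 where B0: "B0 \<ge> 0" "\<And>th. th \<in> {0..2*pi} ==> norm (F0 th) \<le> B0" using continuous_on_period_bound[OF F(1)] by blast
 obtain B1 where B1: "B1 \<ge> 0" "\<And>th. th \<in> {0..2*pi} ==> norm (F1 th) \<le> B1" using continuous_on_period_bound[OF F(2)] by blast
 obtain D0 where D0: "D0 \<ge> 0" "\<And>th. th \<in> {0..2*pi} ==> norm (H0 th) \<le> D0" using continuous_on_period_bound[OF H(1)] by blast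
 obtain D1 where D1: "D1 \<ge> 0" "\<And>th. th \<in> {0..2*pi} ==> norm (H1 th) \<le> D1" using continuous_on_period_bound[OF H(2)] by blast
 show ?thesis
 proof (rule expandsI[of _ _ "C * (C' + D0 + D1) + (B0 + B1) * C' + B1 * D1" "min e e'"])
  fix \<zeta> :: complex and th :: real assume z: "norm \<zeta> < min e e'" "th \<in> {0..2*pi}"
  have z1: "norm \<zeta> \<le> 1" using z F by simp
  hence z2: "(norm \<zeta>)\<^sup>2 \<le> 1" by (simp add: power_le_one)
  define x y where "x = F \<zeta> th - F0 th - \<zeta> * F1 th" and "y = H \<zeta> th - H0 th - \<zeta> * H1 th"
  have x: "norm x \<le> C * (norm \<zeta>)\<^sup>2" and y: "norm y \<le> C' * (norm \<zeta>)\<^sup>2" using F(6)[of \<zeta> th] H(6)[of \<zeta> th] z by (auto simp: x_def y_def)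
  have y1: "C' * (norm \<zeta>)\<^sup>2 \<le> C'" using z2 H(3) mult_left_mono[OF z2 H(3)] by simp
  have m1: "norm (\<zeta> * F1 th) \<le> B1" using mult_mono[OF z1 B1(2)[OF z(2)]] by (simp add: norm_mult)
  have m2: "norm (\<zeta> * H1 th) \<le> D1" using mult_mono[OF z1 D1(2)[OF z(2)]] by (simp add: norm_mult)
  have "F \<zeta> th * H \<zeta> th - F0 th * H0 th - \<zeta> * (F1 th * H0 th + F0 th * H1 th)
    = x * (y + H0 th + \<zeta> * H1 th) + (F0 th + \<zeta> * F1 th) * y + (\<zeta> * \<zeta>) * (F1 th * H1 th)"
   by (simp add: x_def y_def algebra_simps)
  also have "norm \<dots> \<le> norm (x * (y + H0 th + \<zeta> * H1 th)) + norm ((F0 th + \<zeta> * F1 th) * y) + norm ((\<zeta> * \<zeta>) * (F1 th * H1 th))"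
   by (intro order_trans[OF norm_triangle_ineq] add_right_mono norm_triangle_ineq)
  also have "norm (x * (y + H0 th + \<zeta> * H1 th)) \<le> (C * (norm \<zeta>)\<^sup>2) * (C' + D0 + D1)"
   unfolding norm_mult
  proof (rule mult_mono[OF x])
   show "norm (y + H0 th + \<zeta> * H1 th) \<le> C' + D0 + D1"
    using norm_triangle_ineq[of "y + H0 th" "\<zeta> * H1 th"] norm_triangle_ineq[of y "H0 th"] y y1 m2 D0(2)[OF z(2)] by linarith
  qed (use F(3) in auto)
  also have "norm ((F0 th + \<zeta> * F1 th) * y) \<le> (B0 + B1) * (C' * (norm \<zeta>)\<^sup>2)"
   unfolding norm_mult[of "F0 th + \<zeta> * F1 th"]
  proof (rule mult_mono[OF _ y])
   show "norm (F0 th + \<zeta> * F1 th) \<le> B0 + B1" using norm_triangle_ineq[of "F0 th" "\<zeta> * F1 th"] m1 B0(2)[OF z(2)] by linarith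
  qed (use B0 B1 in auto)
  also have "norm ((\<zeta> * \<zeta>) * (F1 th * H1 th)) \<le> (norm \<zeta>)\<^sup>2 * (B1 * D1)"
   unfolding norm_mult power2_eq_square using B1(2)[OF z(2)] D1(2)[OF z(2)] B1(1) D1(1)
   by (intro mult_left_mono mult_mono) auto
  finally show "norm (F \<zeta> th * H \<zeta> th - F0 th * H0 th - \<zeta> * (F1 th * H0 th + F0 th * H1 th))
    \<le> (C * (C' + D0 + D1) + (B0 + B1) * C' + B1 * D1) * (norm \<zeta>)\<^sup>2"
   by (simp add: algebra_simps)
 qed (use F H B0 B1 D0 D1 in \<open>auto intro!: continuous_intros\<close>)
qed

lemma holomorphic_second_order:
 assumes h: "h holomorphic_on ball a d" and d: "d > 0"
 shows "\<exists>C\<ge>0. \<forall>w\<in>ball a (d/2). norm (h w - h a - (w - a) * deriv h a) \<le> C * (norm (w - a))\<^sup>2"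
proof -
 have h2: "deriv (deriv h) holomorphic_on ball a d" by (intro holomorphic_deriv h open_ball)
 have "bounded (deriv (deriv h) ` cball a (d/2))"
  by (intro compact_imp_bounded compact_continuous_image compact_cball continuous_on_subset[OF holomorphic_on_imp_continuous_on[OF h2]])
    (use d in auto)
 then obtain B where B: "\<And>w. w \<in> cball a (d/2) ==> norm (deriv (deriv h) w) \<le> B" using bounded_imageD by blast
 have "norm (h w - h a - (w - a) * deriv h a) \<le> max B 0 * (norm (w - a))\<^sup>2" if w: "w \<in> ball a (d/2)" for w
 proof -
  let ?f = "%i. (deriv ^^ i) h"
  have "norm (?f 0 w - (\<Sum>i\<le>1. ?f i a * (w - a) ^ i / fact i)) \<le> B * norm (w - a) ^ Suc 1 / fact 1"
  proof (rule complex_Taylor[of "ball a (d/2)"])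
   fix i x assume "x \<in> ball a (d/2)" "i \<le> (1::nat)"
   hence x: "x \<in> ball a d" using d by auto
   have "?f i holomorphic_on ball a d" by (rule holomorphic_higher_deriv[OF h open_ball])
   from holomorphic_derivI[OF this open_ball x] show "(?f i has_field_derivative ?f (Suc i) x) (at x within ball a (d/2))"
    by (simp add: has_field_derivative_at_within)
  next
   fix x assume "x \<in> ball a (d/2)"
   thus "norm (?f (Suc 1) x) \<le> B" using B[of x] by simp
  qed (use w d in auto)
  also have "\<dots> \<le> max B 0 * (norm (w - a))\<^sup>2" by (simp add: power2_eq_square mult_right_mono)
  finally show ?thesis by (simp add: algebra_simps)
 qed
 thus ?thesis by (intro exI[of _ "max B 0"]) auto
qed

text \<open>The argument \<open>\<zeta> * cis (k th)\<close> is a loop winding \<open>k\<close>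
  times, the trace of a dilation of weight \<open>k\<close> along an eigendirection.\<close>

lemma expands_holomorphic:
 assumes h: "h holomorphic_on ball 0 d" and d: "d > 0" and h': "(h has_field_derivative h1) (at 0)"
 shows "expands (%\<zeta> th. h (\<zeta> * cis (of_int k * th))) (%_. h 0) (%th. h1 * cis (of_int k * th))"
proof -
 obtain C where C: "C \<ge> 0" "\<And>w. w \<in> ball 0 (d/2) ==> norm (h w - h 0 - w * deriv h 0) \<le> C * (norm w)\<^sup>2"
  using holomorphic_second_order[OF h d] by auto
 show ?thesis
 proof (rule expandsI[of _ _ C "d/2"])
  fix \<zeta> :: complex and th :: real assume "norm \<zeta> < d/2"
  thus "norm (h (\<zeta> * cis (of_int k * th)) - h 0 - \<zeta> * (h1 * cis (of_int k * th))) \<le> C * (norm \<zeta>)\<^sup>2"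
   using C(2)[of "\<zeta> * cis (of_int k * th)"] DERIV_imp_deriv[OF h'] by (simp add: norm_mult mult_ac)
 qed (use C d in \<open>auto intro!: continuous_intros\<close>)
qed

text \<open>Taylor's formula for \<open>w powi q\<close> about \<open>w = 1\<close>. Powers of
  \<open>tt\<close> are brought to this case by splitting off the factor
  \<open>b * cis th\<close>.\<close>

lemma expands_powi:
 assumes "expands F (%_. 1) F1" shows "expands (%\<zeta> th. F \<zeta> th powi q) (%_. 1) (%th. of_int q * F1 th)"
proof -
 from assms obtain C e where F: "continuous_on {0..2*pi} F1" "C \<ge> 0" "0 < e" "e \<le> 1"
  "\<And>\<zeta> th. norm \<zeta> < e ==> th \<in> {0..2*pi} ==> norm (F \<zeta> th - 1 - \<zeta> * F1 th) \<le> C * (norm \<zeta>)\<^sup>2" by (rule expandsE) (rule that; assumption)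
 obtain B where B: "B \<ge> 0" "\<And>th. th \<in> {0..2*pi} ==> norm (F1 th) \<le> B" using continuous_on_period_bound[OF F(1)] by blast
 have "(%w::complex. w powi q) holomorphic_on ball 1 1" by (intro holomorphic_intros) auto
 from holomorphic_second_order[OF this] obtain C' where C': "C' \<ge> 0"
  "\<And>w::complex. w \<in> ball 1 (1/2) ==> norm (w powi q - 1 - (w - 1) * deriv (%w. w powi q) 1) \<le> C' * (norm (w - 1))\<^sup>2" by auto
 have "((%w::complex. w powi q) has_field_derivative of_int q * 1 powi (q - 1) * 1) (at 1)"
  by (rule DERIV_power_int[OF DERIV_ident]) simp
 hence dq: "deriv (%w::complex. w powi q) 1 = of_int q" using DERIV_imp_deriv by fastforce
 \<comment> \<open>This radius keeps \<open>F\<close> within distance 1/2 of 1, where the Taylor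
   remainder is controlled.\<close>
 define e' where "e' = min e (1 / (2 * (C + B + 1)))"
 have e': "e' > 0" using F B by (simp add: e'_def)
 show ?thesis
 proof (rule expandsI[of _ _ "C' * (C + B)\<^sup>2 + \<bar>real_of_int q\<bar> * C" e'])
  fix \<zeta> :: complex and th :: real assume z: "norm \<zeta> < e'" "th \<in> {0..2*pi}"
  have z1: "norm \<zeta> \<le> 1" and ze: "norm \<zeta> < e" using z F by (auto simp: e'_def)
  have 1: "norm (F \<zeta> th - 1 - \<zeta> * F1 th) \<le> C * (norm \<zeta>)\<^sup>2" by (rule F(5)[OF ze z(2)])
  have "C * (norm \<zeta>)\<^sup>2 \<le> C * norm \<zeta>" using z1 F(2) by (intro mult_left_mono) (auto simp: power2_eq_square mult_left_le)
  moreover have "norm (\<zeta> * F1 th) \<le> B * norm \<zeta>" using mult_left_mono[OF B(2)[OF z(2)], of "norm \<zeta>"] by (simp add: norm_mult mult.commute)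
  ultimately have 2: "norm (F \<zeta> th - 1) \<le> (C + B) * norm \<zeta>"
   using norm_triangle_sub[of "F \<zeta> th - 1" "\<zeta> * F1 th"] 1 by (simp add: distrib_right)
  have "(C + B) * norm \<zeta> \<le> (C + B + 1) * norm \<zeta>" by (intro mult_right_mono) auto
  also have "\<dots> < (C + B + 1) * (1 / (2 * (C + B + 1)))" using z(1) F B by (intro mult_strict_left_mono) (auto simp: e'_def)
  also have "\<dots> = 1/2"
  proof -
   have "K * (1 / (2 * K)) = 1 / 2" if "K ~= 0" for K :: real using that by simp
   from this[of "C + B + 1"] F B show ?thesis by linarith
  qed
  finally have "F \<zeta> th \<in> ball 1 (1/2)" using 2 by (simp add: dist_norm norm_minus_commute)
  from C'(2)[OF this] have 3: "norm (F \<zeta> th powi q - 1 - (F \<zeta> th - 1) * of_int q) \<le> C' * (norm (F \<zeta> th - 1))\<^sup>2" by (simp only: dq)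
  also have "\<dots> \<le> C' * ((C + B) * norm \<zeta>)\<^sup>2" using 2 C'(1) by (intro mult_left_mono power_mono) auto
  finally have 4: "norm (F \<zeta> th powi q - 1 - (F \<zeta> th - 1) * of_int q) \<le> C' * (C + B)\<^sup>2 * (norm \<zeta>)\<^sup>2" by (simp add: power_mult_distrib mult.assoc)
  have 5: "norm (of_int q * (F \<zeta> th - 1 - \<zeta> * F1 th)) \<le> \<bar>real_of_int q\<bar> * (C * (norm \<zeta>)\<^sup>2)"
   using mult_left_mono[OF 1, of "\<bar>real_of_int q\<bar>"] by (simp add: norm_mult)
  have "F \<zeta> th powi q - 1 - \<zeta> * (of_int q * F1 th) = (F \<zeta> th powi q - 1 - (F \<zeta> th - 1) * of_int q) + of_int q * (F \<zeta> th - 1 - \<zeta> * F1 th)"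
   by (simp add: algebra_simps)
  also have "norm \<dots> \<le> C' * (C + B)\<^sup>2 * (norm \<zeta>)\<^sup>2 + \<bar>real_of_int q\<bar> * (C * (norm \<zeta>)\<^sup>2)"
   by (rule order_trans[OF norm_triangle_ineq add_mono[OF 4 5]])
  finally show "norm (F \<zeta> th powi q - 1 - \<zeta> * (of_int q * F1 th)) \<le> (C' * (C + B)\<^sup>2 + \<bar>real_of_int q\<bar> * C) * (norm \<zeta>)\<^sup>2"
   by (simp only: distrib_right mult.assoc)
 qed (use F B C' e' in \<open>auto intro!: continuous_intros\<close>)
qed

lemma expands_integral:
 assumes F: "expands F F0 F1" and e0: "e0 > 0" and c: "\<And>\<zeta>. norm \<zeta> < e0 ==> continuous_on {0..2*pi} (F \<zeta>)"
 shows "expands (%\<zeta> th. integral {0..th} (F \<zeta>)) (%th. integral {0..th} F0) (%th. integral {0..th} F1)"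
proof -
 from F obtain C e where F: "continuous_on {0..2*pi} F0" "continuous_on {0..2*pi} F1" "C \<ge> 0" "0 < e" "e \<le> 1"
  "\<And>\<zeta> th. norm \<zeta> < e ==> th \<in> {0..2*pi} ==> norm (F \<zeta> th - F0 th - \<zeta> * F1 th) \<le> C * (norm \<zeta>)\<^sup>2" by (rule expandsE) (rule that; assumption)
 show ?thesis
 proof (rule expandsI[of _ _ "C * (2*pi)" "min e e0"])
  show "continuous_on {0..2*pi} (%th. integral {0..th} F0)" "continuous_on {0..2*pi} (%th. integral {0..th} F1)"
   by (intro indefinite_integral_continuous_1 integrable_continuous_real F)+
  fix \<zeta> :: complex and th :: real assume z: "norm \<zeta> < min e e0" "th \<in> {0..2*pi}"
  have sub: "{0..th} \<subseteq> {0..2*pi}" using z by auto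
  have cz: "continuous_on {0..2*pi} (F \<zeta>)" using c z by simp
  note cs = continuous_on_subset[OF cz sub] continuous_on_subset[OF F(1) sub] continuous_on_subset[OF F(2) sub]
  have "integral {0..th} (%s. F \<zeta> s - F0 s - \<zeta> * F1 s) = integral {0..th} (%s. F \<zeta> s - F0 s) - integral {0..th} (%s. \<zeta> * F1 s)"
   by (intro integral_diff integrable_continuous_real continuous_intros cs)
  also have "integral {0..th} (%s. F \<zeta> s - F0 s) = integral {0..th} (F \<zeta>) - integral {0..th} F0"
   by (intro integral_diff integrable_continuous_real continuous_intros cs)
  finally have "integral {0..th} (F \<zeta>) - integral {0..th} F0 - \<zeta> * integral {0..th} F1 = integral {0..th} (%s. F \<zeta> s - F0 s - \<zeta> * F1 s)" by simp
  also have "norm \<dots> \<le> C * (norm \<zeta>)\<^sup>2 * (th - 0)"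
   by (rule integral_bound) (use z sub F(6) in \<open>auto intro!: continuous_intros cs\<close>)
  also have "\<dots> \<le> C * (norm \<zeta>)\<^sup>2 * (2*pi)" using z F(3) by (intro mult_left_mono) auto
  finally show "norm (integral {0..th} (F \<zeta>) - integral {0..th} F0 - \<zeta> * integral {0..th} F1) \<le> C * (2*pi) * (norm \<zeta>)\<^sup>2"
   by (simp add: mult_ac)
 qed (use F e0 in auto)
qed

lemma expands_derivative:
 assumes "expands F F0 F1" and th: "th \<in> {0..2*pi}"
 shows "((%\<zeta>. F \<zeta> th) has_field_derivative F1 th) (at 0)" and "F 0 th = F0 th"
proof -
 from assms(1) obtain C e where F: "continuous_on {0..2*pi} F0" "continuous_on {0..2*pi} F1" "C \<ge> 0" "0 < e" "e \<le> 1"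
  "\<And>\<zeta> th. norm \<zeta> < e ==> th \<in> {0..2*pi} ==> norm (F \<zeta> th - F0 th - \<zeta> * F1 th) \<le> C * (norm \<zeta>)\<^sup>2" by (rule expandsE) (rule that; assumption)
 show 0: "F 0 th = F0 th" using F(6)[of 0 th] F(4) th by simp
 have "((%\<zeta>. F \<zeta> th) has_derivative (%h. F1 th * h)) (at 0)"
  by (rule has_derivative_quadraticI[OF bounded_linear_mult_right F(4), where C = C]) (use F(6) th 0 in \<open>simp add: mult.commute\<close>)
 thus "((%\<zeta>. F \<zeta> th) has_field_derivative F1 th) (at 0)" by (simp add: has_field_derivative_def)
qed

lemma complex_root: "n > 0 ==> \<exists>w::complex. w ^ n = z"
proof (cases "z = 0")
 case False
 assume n: "n > 0"
 have "exp (Ln z / of_nat n) ^ n = z" using n False by (simp flip: exp_of_nat_mult)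
 thus ?thesis by blast
qed (auto intro: exI[of _ 0])

context qh_chart begin

lemma
 assumes "\<And>th. th \<in> {0..2*pi} ==> W th = W' th"
 shows zhat_cong: "zhat W = zhat W'" and alp_cong: "alp W i n = alp W' i n"
proof -
 show "zhat W = zhat W'" unfolding zhat_def using assms by (intro arg_cong2[of _ _ _ _ "(/)"] integral_cong) auto
 have I: "Iint W th = Iint W' th" if "th \<in> {0..2*pi}" for th
  unfolding Iint_def by (intro integral_cong) (use that assms in auto)
 have J: "integral {0..2*pi} (Iint W) = integral {0..2*pi} (Iint W')" by (intro integral_cong I)
 show "alp W i n = alp W' i n" unfolding alp_def tt_def J using assms I
  by (intro arg_cong2[of _ _ _ _ "(/)"] integral_cong) auto
qed

end

text \<open>Linear coordinates in block form, with a graph \<open>\<phi>\<close> tangent to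
  \<open>coord_space U\<close>. That the graph is the unstable manifold is brought in separately,
  through \<open>trap\<close> and \<open>graph_invariant\<close>. The case \<open>U = UNIV\<close>,
  \<open>\<phi> = 0\<close> of this locale yields the second half of the theorem.\<close>

locale split_chart = qh_chart f g p r c j b G
 for f g :: "'m::finite => complex^'m => complex => complex"
  and p :: "'m => nat" and r :: nat
  and c :: "complex^'m" and j :: 'm and b :: complex
  and G :: "'m => complex^('m option) => complex" +
 fixes P :: "complex^('m option)^('m option)" and U :: "'m option set" and \<phi> :: "complex^('m option) => complex^('m option)"
 assumes P_inv: "invertible P"
  and block: "\<And>i l. (i \<in> U) ~= (l \<in> U) ==> conj_matrix P J $ i $ l = 0"
  and \<phi>_an: "analytic_near_0 U \<phi>" and \<phi>_im: "\<phi> ` coord_space U \<subseteq> coord_space (- U)" and \<phi>_0: "\<phi> 0 = 0"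
  and \<phi>_d: "((%x. \<phi> (coord_proj U x)) has_derivative (%_. 0)) (at 0)"
begin

abbreviation "A \<equiv> conj_matrix P J"
abbreviation "Pinv \<equiv> matrix_inv P"

lemma P_Pinv: "P ** Pinv = mat 1" "Pinv ** P = mat 1"
proof -
 have "P ** Pinv = mat 1 \<and> Pinv ** P = mat 1"
  unfolding matrix_inv_def by (rule someI_ex) (use P_inv in \<open>simp add: invertible_def\<close>)
 thus "P ** Pinv = mat 1" "Pinv ** P = mat 1" by blast+
qed

lemma P_Pinv_mul [simp]: "P *v (Pinv *v x) = x" "Pinv *v (P *v x) = x"
 by (simp_all add: matrix_vector_mul_assoc P_Pinv)

lemma A_mul: "A *v x = P *v (J *v (Pinv *v x))"
 by (simp add: conj_matrix_def matrix_vector_mul_assoc matrix_mul_assoc)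

lemma A_U: assumes "v \<in> coord_space U" shows "A *v v \<in> coord_space U"
 unfolding coord_space_def
proof (intro CollectI allI impI)
 fix i assume i: "i \<notin> U"
 have "A $ i $ l * v $ l = 0" for l using assms block[of i l] i by (cases "l \<in> U") (auto simp: coord_space_def)
 thus "(A *v v) $ i = 0" by (simp only: matrix_vector_mult_def vec_lambda_beta sum.neutral_const)
qed

lemma A_S: assumes "v \<in> coord_space (- U)" shows "A *v v \<in> coord_space (- U)"
 unfolding coord_space_def
proof (intro CollectI allI impI)
 fix i assume i: "i \<notin> - U"
 have "A $ i $ l * v $ l = 0" for l using assms block[of i l] i by (cases "l \<in> U") (auto simp: coord_space_def)
 thus "(A *v v) $ i = 0" by (simp only: matrix_vector_mult_def vec_lambda_beta sum.neutral_const)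
qed

text \<open>Parametrizes the graph of \<open>\<phi>\<close> inside the original chart. The argument
  is projected first, so that the map is defined on the whole vector type.\<close>

definition iota :: "complex^('m option) => complex^('m option)" where
 "iota y = ys + Pinv *v (coord_proj U y + \<phi> (coord_proj U y))"

text \<open>The field that \<open>V\<close> induces on the graph, read in the coordinates of
  \<open>U\<close>, and extended so as to fit \<open>proj_flow\<close>.\<close>

definition Hred :: "complex^('m option) => complex^('m option)" where
 "Hred y = coord_proj U (P *v V (iota y))"

lemma \<phi>_S: "coord_proj (- U) (\<phi> (coord_proj U y)) = \<phi> (coord_proj U y)" "coord_proj U (\<phi> (coord_proj U y)) = 0"
proof -
 have *: "\<phi> (coord_proj U y) \<in> coord_space (- U)" using \<phi>_im by auto
 thus "coord_proj (- U) (\<phi> (coord_proj U y)) = \<phi> (coord_proj U y)" by (rule coord_proj_id)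
 show "coord_proj U (\<phi> (coord_proj U y)) = 0" using * by (simp add: coord_space_def vec_eq_iff)
qed

lemma iota_0: "iota 0 = ys" by (simp add: iota_def \<phi>_0)

lemma iota_proj: "iota (coord_proj U y) = iota y" by (simp add: iota_def)

lemma ex_RI: "\<exists>R>0. cholv (ball 0 R) iota \<and> iota ` ball 0 R \<subseteq> ball ys RV"
proof -
 obtain e where e: "e > 0" "cholv (ball 0 e) (%x. \<phi> (coord_proj U x))" using \<phi>_an unfolding analytic_near_0_cholv by blast
 have c: "cholv (ball 0 e) iota" unfolding iota_def[abs_def]
  by (intro cholv_add cholv_const cholv_matrix e(2) cholv_coord_proj cholv_id)
 have "isCont iota 0" using cholv_continuous[OF c] e(1) by (simp add: continuous_on_eq_continuous_at)
 then obtain d where d: "d > 0" "\<And>x. dist x 0 < d ==> dist (iota x) ys < RV"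
  unfolding continuous_at_eps_delta iota_0 using RV(1) by metis
 show ?thesis
  by (rule exI[of _ "min e d"]) (use e d in \<open>auto intro: cholv_subset[OF c] simp: dist_commute\<close>)
qed

definition "RI = (SOME R. R > 0 \<and> cholv (ball 0 R) iota \<and> iota ` ball 0 R \<subseteq> ball ys RV)"

lemma RI: "RI > 0" "cholv (ball 0 RI) iota" "y \<in> ball 0 RI ==> iota y \<in> ball ys RV"
proof -
 have *: "RI > 0 \<and> cholv (ball 0 RI) iota \<and> iota ` ball 0 RI \<subseteq> ball ys RV"
  using someI_ex[OF ex_RI] unfolding RI_def[symmetric] .
 thus "RI > 0" "cholv (ball 0 RI) iota" by blast+
 show "iota y \<in> ball ys RV" if "y \<in> ball 0 RI" using * that by blast
qed

lemma cholv_V_ball: "cholv (ball ys RV) V" by (rule cholv_V) (rule RV(2))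

lemma cholv_Hred: "cholv (ball 0 RI) Hred"
 unfolding Hred_def[abs_def]
 by (intro cholv_coord_proj cholv_matrix cholv_comp[OF cholv_V_ball RI(2)]) (use RI(3) in auto)

lemma Hred_0: "Hred 0 = 0" by (simp add: Hred_def iota_0 V_ys)

lemma Hred_proj: "Hred y = coord_proj U (Hred (coord_proj U y))" by (simp add: Hred_def iota_proj)

lemma Hred_off: "k \<notin> U ==> Hred y $ k = 0" by (simp add: Hred_def)

lemma iota_deriv: "(iota has_derivative (%v. Pinv *v coord_proj U v)) (at 0)"
proof -
 have "((%y. coord_proj U y + \<phi> (coord_proj U y)) has_derivative (%v. coord_proj U v + 0)) (at 0)"
  by (intro has_derivative_add \<phi>_d bounded_linear_imp_has_derivative bounded_linear_coord_proj)
 from has_derivative_add[OF has_derivative_const[of ys] bounded_linear.has_derivative[OF matrix_vector_mul_bounded_linear[of Pinv] this]]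
 show ?thesis by (simp add: iota_def[abs_def])
qed

text \<open>The graph is tangent to \<open>coord_space U\<close>, so \<open>\<phi>\<close> makes no
  first-order contribution.\<close>

lemma jac_Hred: assumes v: "v \<in> coord_space U" shows "cjac Hred 0 *v v = A *v v"
proof -
 have "((%y. iota y - ys) has_derivative (%v. Pinv *v coord_proj U v - 0)) (at 0)"
  by (intro has_derivative_diff iota_deriv has_derivative_const)
 moreover have "((%x. V (ys + x)) has_derivative (*v) J) (at (iota 0 - ys))" using V_deriv by (simp add: iota_0)
 ultimately have "((%y. V (ys + (iota y - ys))) has_derivative (%v. J *v (Pinv *v coord_proj U v - 0))) (at 0)"
  by (rule has_derivative_compose)
 from bounded_linear.has_derivative[OF bounded_linear_coord_proj[of U] bounded_linear.has_derivative[OF matrix_vector_mul_bounded_linear[of P] this]]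
 have 1: "(Hred has_derivative (%v. coord_proj U (P *v (J *v (Pinv *v coord_proj U v))))) (at 0)"
  by (simp add: Hred_def[abs_def])
 have "(Hred has_derivative (*v) (cjac Hred 0)) (at 0)" by (rule cholv_deriv[OF cholv_Hred]) (use RI(1) in simp)
 from has_derivative_unique[OF 1 this] have "cjac Hred 0 *v v = coord_proj U (A *v coord_proj U v)" by (metis A_mul)
 thus ?thesis using v by (simp add: coord_proj_id A_U)
qed

text \<open>\<open>\<phi> y\<close> lies in the complementary coordinates, and the block form of
  \<open>A\<close> keeps it there; projecting to \<open>U\<close> therefore leaves
  \<open>A *v y\<close> and the nonlinear part.\<close>

lemma field_Hred: assumes y: "y \<in> coord_space U"
 shows "unstable_field U A (conj_map P (nonlinear_part V ys)) \<phi> y = Hred y"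
proof -
 have *: "coord_proj U (P *v (J *v (Pinv *v (y + \<phi> y)))) = A *v y"
 proof -
  have "A *v \<phi> y \<in> coord_space (- U)" using \<phi>_im y by (intro A_S) auto
  hence 1: "coord_proj U (A *v \<phi> y) = 0" by (simp add: coord_space_def vec_eq_iff)
  have "coord_proj U (A *v (y + \<phi> y)) = A *v y"
   by (simp add: matrix_vector_right_distrib coord_proj_add 1 coord_proj_id[OF A_U[OF y]])
  thus ?thesis by (simp add: A_mul)
 qed
 have "coord_proj U (conj_map P (nonlinear_part V ys) (y + \<phi> y)) = Hred y - A *v y"
 proof -
  have "conj_map P (nonlinear_part V ys) (y + \<phi> y) = P *v V (iota y) - P *v (J *v (Pinv *v (y + \<phi> y)))"
   by (simp add: conj_map_def nonlinear_part_def iota_def coord_proj_id[OF y] matrix_vector_mult_diff_distrib)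
  hence "coord_proj U (conj_map P (nonlinear_part V ys) (y + \<phi> y)) = Hred y - coord_proj U (P *v (J *v (Pinv *v (y + \<phi> y))))"
   by (simp add: Hred_def vec_eq_iff)
  thus ?thesis by (simp only: *)
 qed
 thus ?thesis by (simp add: unstable_field_def)
qed

lemma iota_of_graph:
 assumes "coord_proj (- U) (P *v (Y - ys)) = \<phi> (coord_proj U (P *v (Y - ys)))"
 shows "iota (P *v (Y - ys)) = Y"
proof -
 have "coord_proj U (P *v (Y - ys)) + \<phi> (coord_proj U (P *v (Y - ys))) = P *v (Y - ys)"
  unfolding assms[symmetric] by (simp add: vec_eq_iff)
 thus ?thesis by (simp add: iota_def)
qed

end

text \<open>Turns the value at one angle, in practice an integral over the full period, into a
  constant function of the angle that can take part in further expansions.\<close>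

lemma expands_freeze:
 assumes "expands F F0 F1" and th0: "th0 \<in> {0..2*pi}"
 shows "expands (%\<zeta> th. F \<zeta> th0) (%th. F0 th0) (%th. F1 th0)"
proof -
 from assms(1) obtain C e where F: "continuous_on {0..2*pi} F0" "continuous_on {0..2*pi} F1" "C \<ge> 0" "0 < e" "e \<le> 1"
  "\<And>\<zeta> th. norm \<zeta> < e ==> th \<in> {0..2*pi} ==> norm (F \<zeta> th - F0 th - \<zeta> * F1 th) \<le> C * (norm \<zeta>)\<^sup>2" by (rule expandsE) (rule that; assumption)
 show ?thesis by (rule expandsI[OF continuous_on_const continuous_on_const F(3,4)]) (rule F(6)[OF _ th0])
qed

context qh_chart begin

lemma continuous_on_kk_loop:
 assumes "\<And>th. th \<in> {0..2*pi} ==> W th \<in> ball ys RV" "continuous_on {0..2*pi} W"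
 shows "continuous_on {0..2*pi} (%th. kk (W th))"
 by (rule continuous_on_compose2[OF chol_continuous[OF chol_kk_ball] assms(2)]) (use assms(1) in auto)

lemma continuous_on_Iint:
 assumes "\<And>th. th \<in> {0..2*pi} ==> W th \<in> ball ys RV" "continuous_on {0..2*pi} W"
 shows "continuous_on {0..2*pi} (Iint W)"
 unfolding Iint_def
 by (intro indefinite_integral_continuous_1 integrable_continuous_real continuous_intros continuous_on_kk_loop assms)

lemma continuous_on_alp_integrand:
 assumes W: "\<And>th. th \<in> {0..2*pi} ==> W th \<in> ball ys RV" "continuous_on {0..2*pi} W"
 shows "continuous_on {0..2*pi} (%th. chart_X j (W th) $ i * cis th powi m * tt W th powi q * kk (W th))"
proof -
 have t: "continuous_on {0..2*pi} (tt W)" unfolding tt_def by (intro continuous_intros continuous_on_Iint W)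
 have x: "continuous_on {0..2*pi} (%th. chart_X j (W th) $ i)"
  by (rule continuous_on_compose2[OF chol_continuous[OF cholv_nth[OF cholv_chart_X[of UNIV]]] W(2)]) simp
 show ?thesis by (intro continuous_on_mult continuous_on_power_int x t continuous_on_kk_loop W continuous_intros)
  (use tt_nz[OF W] in auto)
qed

text \<open>For a curve leaving \<open>ys\<close> in direction \<open>e\<close> and a loop winding
  \<open>k\<close> times, the first-order effect on a coefficient of order \<open>n\<close> vanishes
  unless \<open>n = k\<close>. The formula can be read from the model
  \<open>T = b \<tau> + \<kappa> \<zeta> \<tau>^(k+1)\<close> with
  \<open>\<kappa> = cdir kk ys e / (k + 1)\<close>: in \<open>X\<^sub>i (T / \<tau>) ^ p i\<close>
  the first summand is the change of \<open>X\<^sub>i\<close>, the second the change of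
  \<open>T\<close>, and \<open>\<tau> = t / b\<close> to leading order explains the power of
  \<open>b\<close>.\<close>

lemma
 fixes Y :: "complex => complex^('m option)" and k :: int
 assumes R: "R > 0" and Yh: "\<And>q. (%w. Y w $ q) holomorphic_on ball 0 R" and Y0: "Y 0 = ys"
  and Yin: "\<And>w. w \<in> ball 0 R ==> Y w \<in> ball ys RV"
  and e: "\<And>q. ((%w. Y w $ q) has_field_derivative e $ q) (at 0)" and k: "k \<ge> 1"
 shows alp_derivative: "n \<ge> 1 ==> ((%\<zeta>. alp (%th. Y (\<zeta> * cis (of_int k * th))) i n) has_field_derivative
   (if k = int n then b powi (int (p i) - int n) * ((if i = j then 0 else e $ Some i)
     + cdir kk ys e / (of_int k + 1) * of_nat (p i) * chart_X j ys $ i / b) else 0)) (at 0)" (is "_ ==> ?alp")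
  and alp_ys: "n \<ge> 1 ==> alp (%th. ys) i n = 0"
  and zhat_derivative: "((%\<zeta>. zhat (%th. Y (\<zeta> * cis (of_int k * th)))) has_field_derivative (if k = int r then e $ None else 0)) (at 0)"
proof -
 define w :: "complex => real => complex" where "w = (%\<zeta> th. \<zeta> * cis (of_int k * th))"
 have win: "w \<zeta> th \<in> ball 0 R" if "norm \<zeta> < R" for \<zeta> th using that by (simp add: w_def norm_mult)
 have Yd: "(Y has_derivative (%h. h *s e)) (at 0)" by (rule vec_curve_derivative[OF e])
 have Yd': "\<exists>D. (Y has_derivative (%h. h *s D)) (at x)" if x: "x \<in> ball 0 R" for x
 proof (rule exI, rule vec_curve_derivative)
  fix q show "((%t. Y t $ q) has_field_derivative (\<chi> q. deriv (%w. Y w $ q) x) $ q) (at x)"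
   using holomorphic_derivI[OF Yh open_ball x, of q] by simp
 qed
 have hol: "(%x. q (Y x)) holomorphic_on ball 0 R" if q: "chol (ball ys RV) q" for q
 proof (rule holomorphicI)
  fix x :: complex assume x: "x \<in> ball 0 R"
  then obtain D where "(Y has_derivative (%h. h *s D)) (at x)" using Yd' by metis
  from chol_curve[OF q Yin[OF x] this] show "\<exists>D. ((%x. q (Y x)) has_field_derivative D) (at x)" by (rule exI)
 qed
 have Wc: "continuous_on {0..2*pi} (%th. Y (w \<zeta> th))" if z: "norm \<zeta> < R" for \<zeta>
 proof (rule continuous_on_compose2[of "ball 0 R" Y])
  show "continuous_on (ball 0 R) Y"
   by (intro continuous_at_imp_continuous_on ballI) (use Yd' has_derivative_continuous in blast)
  show "continuous_on {0..2*pi} (w \<zeta>)" unfolding w_def by (intro continuous_intros)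
 qed (use win[OF z] in auto)
 have Win: "Y (w \<zeta> th) \<in> ball ys RV" if "norm \<zeta> < R" for \<zeta> th by (rule Yin[OF win[OF that]])
 define \<kappa>1 where "\<kappa>1 = cdir kk ys e"
 define \<kappa> where "\<kappa> = \<kappa>1 / (of_int k + 1)"
 have "(of_int (k + 1) :: complex) ~= 0" using k unfolding of_int_eq_0_iff by simp
 hence k1: "of_int k + 1 ~= (0::complex)" by simp
 have ysin: "Y 0 \<in> ball ys RV" using Yin[of 0] R by simp
 have E1: "expands (%\<zeta> th. kk (Y (w \<zeta> th))) (%_. b) (%th. \<kappa>1 * cis (of_int k * th))"
 proof -
  have "((%x. kk (Y x)) has_field_derivative \<kappa>1) (at 0)" using chol_curve[OF chol_kk_ball ysin Yd] by (simp add: \<kappa>1_def Y0)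
  from expands_holomorphic[OF hol[OF chol_kk_ball] R this, of k] show ?thesis by (simp add: w_def Y0 kk_ys)
 qed
 have E3: "expands (%\<zeta>. Iint (%th. Y (w \<zeta> th))) (%th. b * (cis th - 1)) (%th. \<kappa> * (cis (of_int (k + 1) * th) - 1))"
 proof -
  have ci: "continuous_on {0..2*pi} (%th. \<i> * cis th)" by (intro continuous_intros)
  have "expands (%\<zeta> th. integral {0..th} (%th. kk (Y (w \<zeta> th)) * (\<i> * cis th))) (%th. integral {0..th} (%th. b * (\<i> * cis th)))
   (%th. integral {0..th} (%th. (\<kappa>1 * cis (of_int k * th)) * (\<i> * cis th) + b * 0))"
   by (rule expands_integral[OF expands_mult[OF E1 expands_angle[OF ci]] R])
     (intro continuous_on_mult continuous_on_kk_loop Win Wc ci)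
  thus ?thesis
  proof (rule expands_cong[OF _ _ _ R])
   fix th :: real assume t: "th \<in> {0..2*pi}"
   show "integral {0..th} (%th. b * (\<i> * cis th)) = b * (cis th - 1)"
    using integral_cis[of 1 th] t by (simp only: integral_mult_right) simp
   have "integral {0..th} (%th. (\<kappa>1 * cis (of_int k * th)) * (\<i> * cis th) + b * 0) = integral {0..th} (%th. \<kappa>1 * (\<i> * cis (of_int (k + 1) * th)))"
    by (intro integral_cong) (simp add: cis_mult[symmetric] distrib_right)
   also have "\<dots> = \<kappa>1 * integral {0..th} (%th. \<i> * cis (of_int (k + 1) * th))" by (simp only: integral_mult_right)
   also have "integral {0..th} (%th. \<i> * cis (of_int (k + 1) * th)) = (cis (of_int (k + 1) * th) - 1) / of_int (k + 1)"
    by (rule integral_cis) (use k t in auto)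
   finally show "integral {0..th} (%th. (\<kappa>1 * cis (of_int k * th)) * (\<i> * cis th) + b * 0) = \<kappa> * (cis (of_int (k + 1) * th) - 1)"
    by (simp add: \<kappa>_def)
  qed (simp add: Iint_def)
 qed
 have E5: "expands (%\<zeta>. tt (%th. Y (w \<zeta> th))) (%th. b * cis th) (%th. \<kappa> * cis (of_int (k + 1) * th))"
 proof -
  have "expands (%\<zeta> th. integral {0..2*pi} (Iint (%th. Y (w \<zeta> th)))) (%th. integral {0..2*pi} (%th. b * (cis th - 1)))
    (%th. integral {0..2*pi} (%th. \<kappa> * (cis (of_int (k + 1) * th) - 1)))"
   by (rule expands_freeze[OF expands_integral[OF E3 R]]) (auto intro!: continuous_on_Iint Win Wc)
  moreover have "continuous_on {0..2*pi} (%_::real. complex_of_real (1 / (2*pi)))" by (rule continuous_on_const)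
  ultimately have "expands (%\<zeta> th. integral {0..2*pi} (Iint (%th. Y (w \<zeta> th))) * (1 / (2*pi)))
    (%th. integral {0..2*pi} (%th. b * (cis th - 1)) * (1 / (2*pi)))
    (%th. integral {0..2*pi} (%th. \<kappa> * (cis (of_int (k + 1) * th) - 1)) * (1 / (2*pi)) + integral {0..2*pi} (%th. b * (cis th - 1)) * 0)"
   by (rule expands_mult[OF _ expands_angle])
  \<comment> \<open>The mean reproduces the constant terms of \<open>Iint\<close> at both orders, so
    \<open>tt\<close> is left with pure exponentials.\<close>
  hence "expands (%\<zeta> th. integral {0..2*pi} (Iint (%th. Y (w \<zeta> th))) / (2*pi)) (%_. - b) (%_. - \<kappa>)"
  proof (rule expands_cong[OF _ _ _ R])
   have ic: "integral {0..2*pi} (%th. q * (cis (of_int m * th) - 1)) = - q * (2 * pi)" if "m ~= 0" for m :: int and q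
   proof -
    have "integral {0..2*pi} (%th. cis (of_int m * th) - 1) = integral {0..2*pi} (%th. cis (of_int m * th)) - integral {0..2*pi} (%th::real. 1::complex)"
     by (intro integral_diff integrable_continuous_real continuous_intros)
    also have "\<dots> = - (2 * pi)" using that by (simp add: integral_cis_period scaleR_conv_of_real)
    finally have "integral {0..2*pi} (%th. cis (of_int m * th) - 1) = - complex_of_real (2 * pi)" by simp
    thus ?thesis by (simp only: integral_mult_right) simp
   qed
   show "integral {0..2*pi} (%th. b * (cis th - 1)) * (1 / (2*pi)) = - b" using ic[of 1 b] by simp
   show "integral {0..2*pi} (%th. \<kappa> * (cis (of_int (k + 1) * th) - 1)) * (1 / (2*pi)) + integral {0..2*pi} (%th. b * (cis th - 1)) * 0 = - \<kappa>"
    using ic[of "k + 1" \<kappa>] k by simp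
  qed simp
  from expands_diff[OF E3 this] show ?thesis
   by (rule expands_cong[OF _ _ _ R]) (simp_all add: tt_def algebra_simps)
 qed
 \<comment> \<open>After division by \<open>b * cis th\<close> the zeroth-order term of
   \<open>tt\<close> is 1, as \<open>expands_powi\<close> requires.\<close>
 have E7: "expands (%\<zeta> th. (tt (%th. Y (w \<zeta> th)) th * (cis (- th) / b)) powi q) (%_. 1) (%th. of_int q * (\<kappa> / b * cis (of_int k * th)))" for q
 proof (rule expands_powi)
  have ci: "continuous_on {0..2*pi} (%th. cis (- th) / b)" by (intro continuous_intros) (use b_nz in simp)
  from expands_mult[OF E5 expands_angle[OF ci]]
  show "expands (%\<zeta> th. tt (%th. Y (w \<zeta> th)) th * (cis (- th) / b)) (%_. 1) (%th. \<kappa> / b * cis (of_int k * th))"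
  proof (rule expands_cong[OF _ _ _ R])
   fix th :: real
   show "b * cis th * (cis (- th) / b) = 1" using b_nz by (simp add: cis_mult)
   show "\<kappa> * cis (of_int (k + 1) * th) * (cis (- th) / b) + b * cis th * 0 = \<kappa> / b * cis (of_int k * th)"
    by (simp add: cis_mult algebra_simps)
  qed simp
 qed
 define x1 where "x1 = (if i = j then 0 else e $ Some i)"
 have E8: "expands (%\<zeta> th. chart_X j (Y (w \<zeta> th)) $ i) (%_. chart_X j ys $ i) (%th. x1 * cis (of_int k * th))"
 proof -
  have "((%x. chart_X j (Y x) $ i) has_field_derivative x1) (at 0)"
   using e[of "Some i"] by (cases "i = j") (simp_all add: chart_X_def x1_def)
  from expands_holomorphic[OF hol[OF cholv_nth[OF cholv_chart_X]] R this, of k] show ?thesis by (simp add: w_def Y0)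
 qed
 define X0 where "X0 = chart_X j ys $ i"
 define P where "P = (%n. int (p i) - int n - 1)"
 define Z where "Z = (%n. x1 * b + X0 * (of_int (P n) * \<kappa>) + X0 * \<kappa>1)"
 have E11: "expands (%\<zeta> th. chart_X j (Y (w \<zeta> th)) $ i * cis th powi (1 - int (p i)) * tt (%th. Y (w \<zeta> th)) th powi (P n) * kk (Y (w \<zeta> th)))
   (%th. X0 * b * b powi (P n) * cis (of_int (- int n) * th)) (%th. b powi (P n) * Z n * cis (of_int (k - int n) * th))" for n
 proof -
  \<comment> \<open>This factor restores the powers of \<open>b\<close> and of \<open>cis th\<close>
    which the normalization of \<open>tt\<close> has removed from the integrand of
    \<open>alp\<close>.\<close>
  have ci: "continuous_on {0..2*pi} (%th. b powi (P n) * cis (of_int (- int n) * th))" by (intro continuous_intros)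
  from expands_mult[OF expands_mult[OF expands_mult[OF E8 E7[of "P n"]] E1] expands_angle[OF ci]]
  show ?thesis
  proof (rule expands_cong[OF _ _ _ R])
   fix th :: real
   show "chart_X j ys $ i * 1 * b * (b powi P n * cis (of_int (- int n) * th)) = X0 * b * b powi P n * cis (of_int (- int n) * th)" by (simp add: X0_def)
   have c: "cis (of_int (k - int n) * th) = cis (of_int k * th) * cis (of_int (- int n) * th)" by (simp add: cis_mult algebra_simps)
   show "((x1 * cis (of_int k * th) * 1 + chart_X j ys $ i * (of_int (P n) * (\<kappa> / b * cis (of_int k * th)))) * b
     + chart_X j ys $ i * 1 * (\<kappa>1 * cis (of_int k * th))) * (b powi P n * cis (of_int (- int n) * th)) + chart_X j ys $ i * 1 * b * 0
     = b powi P n * Z n * cis (of_int (k - int n) * th)"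
    unfolding c Z_def X0_def using b_nz by (simp add: field_simps)
   fix \<zeta> :: complex
   let ?t = "tt (%th. Y (w \<zeta> th)) th"
   have "(?t * (cis (- th) / b)) powi P n * b powi P n = (?t * (cis (- th) / b) * b) powi P n"
    by (rule power_int_mult_distrib[symmetric])
   also have "?t * (cis (- th) / b) * b = ?t * cis (- th)" using b_nz by simp
   also have "(?t * cis (- th)) powi P n = ?t powi P n * cis th powi (- P n)"
    by (simp add: power_int_mult_distrib cis_powi)
   finally have "(?t * (cis (- th) / b)) powi P n * b powi P n = ?t powi P n * cis th powi (- P n)" .
   moreover have "cis th powi (- P n) * cis (of_int (- int n) * th) = cis th powi (1 - int (p i))"
    by (simp add: cis_powi cis_mult P_def algebra_simps)
   ultimately show "chart_X j (Y (w \<zeta> th)) $ i * (?t * (cis (- th) / b)) powi P n * kk (Y (w \<zeta> th)) * (b powi P n * cis (of_int (- int n) * th))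
     = chart_X j (Y (w \<zeta> th)) $ i * cis th powi (1 - int (p i)) * ?t powi P n * kk (Y (w \<zeta> th))"
    by algebra
  qed
 qed
 have E12: "expands (%\<zeta> th. integral {0..2*pi} (%th. chart_X j (Y (w \<zeta> th)) $ i * cis th powi (1 - int (p i)) * tt (%th. Y (w \<zeta> th)) th powi (P n) * kk (Y (w \<zeta> th))))
   (%_. X0 * b * b powi (P n) * (if n = 0 then 2 * pi else 0)) (%_. b powi (P n) * Z n * (if k = int n then 2 * pi else 0))" for n
 proof -
  have ic: "integral {0..2*pi} (%th. q * cis (of_int m * th)) = q * (if m = 0 then 2 * pi else 0)" for m :: int and q
   by (simp only: integral_mult_right integral_cis_period)
  have tp: "2*pi \<in> {0..2*pi}" by simp
  show ?thesis
   by (rule expands_cong[OF expands_freeze[OF expands_integral[OF E11 R] tp] _ _ R])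
     (simp_all only: ic continuous_on_alp_integrand[OF Win Wc], simp_all)
 qed
 have tp: "2*pi \<in> {0..2*pi}" by simp
 show "alp (%th. ys) i n = 0" if "n \<ge> 1"
  using expands_derivative(2)[OF E12[of n] tp] that by (simp add: w_def Y0 alp_def P_def)
 show ?alp if n: "n \<ge> 1"
 proof -
  from DERIV_cmult_right[OF expands_derivative(1)[OF E12[of n] tp], of "1 / (2*pi)"]
  have "((%\<zeta>. alp (%th. Y (w \<zeta> th)) i n) has_field_derivative b powi (P n) * Z n * (if k = int n then 1 else 0)) (at 0)"
   unfolding alp_def P_def by (simp split: if_splits)
  moreover have "b powi (P n) * Z n * (if k = int n then 1 else 0) = (if k = int n then b powi (int (p i) - int n) * (x1 + \<kappa> * of_nat (p i) * X0 / b) else 0)"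
  proof (cases "k = int n")
   case True
   have k1': "\<kappa>1 = (of_nat n + 1) * \<kappa>" using k1 by (simp add: \<kappa>_def True)
   \<comment> \<open>The term \<open>(p i - n - 1) * \<kappa>\<close> from the power of
     \<open>tt\<close> and the term \<open>(n + 1) * \<kappa>\<close> from \<open>kk\<close> add up
     to \<open>p i * \<kappa>\<close>.\<close>
   have "Z n = b * (x1 + \<kappa> * of_nat (p i) * X0 / b)" unfolding Z_def k1' P_def using b_nz by (simp add: field_simps)
   moreover have "b powi (int (p i) - int n) = b powi (P n) * b" using b_nz by (simp add: P_def power_int_diff)
   ultimately show ?thesis using True by simp
  qed simp
  ultimately have "((%\<zeta>. alp (%th. Y (w \<zeta> th)) i n) has_field_derivative
    (if k = int n then b powi (int (p i) - int n) * (x1 + \<kappa> * of_nat (p i) * X0 / b) else 0)) (at 0)" by (simp only:)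
  thus ?thesis unfolding w_def x1_def \<kappa>_def \<kappa>1_def X0_def .
 qed
 have "((%\<zeta>. zhat (%th. Y (w \<zeta> th))) has_field_derivative (if k = int r then e $ None else 0)) (at 0)"
 proof -
  have ci: "continuous_on {0..2*pi} (%th. cis th powi (- int r))" by (intro continuous_intros) auto
  have z: "expands (%\<zeta> th. Y (w \<zeta> th) $ None) (%_. 0) (%th. e $ None * cis (of_int k * th))"
   using expands_holomorphic[OF Yh[of None] R e[of None], of k] by (simp add: w_def Y0)
  have "expands (%\<zeta> th. Y (w \<zeta> th) $ None * cis th powi (- int r)) (%_. 0) (%th. e $ None * cis (of_int (k - int r) * th))"
   by (rule expands_cong[OF expands_mult[OF z expands_angle[OF ci]] _ _ R]) (simp_all add: cis_powi cis_mult algebra_simps)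
  note E = expands_derivative(1)[OF expands_integral[OF this R] tp]
  have "((%\<zeta>. integral {0..2*pi} (%th. Y (w \<zeta> th) $ None * cis th powi (- int r))) has_field_derivative
    integral {0..2*pi} (%th. e $ None * cis (of_int (k - int r) * th))) (at 0)"
  proof (rule E)
   fix \<zeta> :: complex assume z: "norm \<zeta> < R"
   have "continuous_on {0..2*pi} (%th. Y (w \<zeta> th) $ None)"
    using bounded_linear.continuous_on[OF bounded_linear_vec_nth Wc[OF z]] .
   thus "continuous_on {0..2*pi} (%th. Y (w \<zeta> th) $ None * cis th powi (- int r))" by (intro continuous_on_mult ci)
  qed
  from DERIV_cmult_right[OF this, of "1 / (2*pi)"] show ?thesis unfolding zhat_def
   by (simp only: integral_mult_right integral_cis_period) (auto split: if_splits)
 qed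
 thus "((%\<zeta>. zhat (%th. Y (\<zeta> * cis (of_int k * th)))) has_field_derivative (if k = int r then e $ None else 0)) (at 0)"
  by (simp add: w_def)
qed

end

section \<open>Necessity\<close>

context split_chart begin

text \<open>All parameters under one kind of index: \<open>None\<close> is \<epsilon> at the
  starting point of the loop, \<open>Some None\<close> the position of the pole,
  \<open>Some (Some (i, n))\<close> the coefficient \<open>a i n\<close>. On a solution at
  \<open>\<tau>\<close> the value is the parameter times \<open>\<tau> ^ fwt q\<close>, where the
  parameter of \<epsilon> is 1.\<close>

definition fval :: "('m \<times> nat) option option => (real => complex^('m option)) => complex" where
 "fval q W = (case q of None => W 0 $ Some j | Some None => zhat W | Some (Some (i, n)) => alp W i n)"

definition fwt :: "('m \<times> nat) option option => nat" where
 "fwt q = (case q of None => r + 1 | Some None => r | Some (Some (i, n)) => n)"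

lemma chol_fval:
 fixes W :: "complex^'k::finite => real => complex^('m option)"
 assumes D: "open D" and W: "\<And>q. loop_family D (%y th. W y th $ q)"
  and Win: "\<And>y th. y \<in> D ==> th \<in> {0..2*pi} ==> W y th \<in> ball ys RV"
 shows "chol D (%y. fval q (W y))"
proof (cases q)
 case None
 thus ?thesis using W[of "Some j"] unfolding loop_family_def fval_def by simp
next
 case (Some q')
 show ?thesis
 proof (cases q')
  case None
  thus ?thesis using Some loop_functionals(1)[OF D W Win] by (simp add: fval_def)
 next
  case (Some q'')
  thus ?thesis using \<open>q = Some q'\<close> loop_functionals(2)[OF D W Win] by (cases q'') (simp add: fval_def)
 qed
qed

lemma fval_cong: "(\<And>th. th \<in> {0..2*pi} ==> W th = W' th) ==> fval q W = fval q W'"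
 unfolding fval_def using zhat_cong[of W W'] alp_cong[of W W'] by (auto split: option.split)

definition positions :: "('m \<times> nat) set => ('m \<times> nat) option option set" where
 "positions S = {None, Some None} \<union> (%q. Some (Some q)) ` S"

lemma positions: "finite S ==> finite (positions S)" "finite S ==> card (positions S) = card S + 2"
proof -
 assume S: "finite S"
 show "finite (positions S)" using S by (simp add: positions_def)
 have "card (positions S) = card {None :: ('m \<times> nat) option option, Some None} + card ((%q. Some (Some q)) ` S)"
  unfolding positions_def by (rule card_Un_disjoint) (use S in auto)
 also have "card ((%q. Some (Some q)) ` S) = card S" by (rule card_image) (simp add: inj_on_def)
 finally show "card (positions S) = card S + 2" by simp
qed

lemma fval_chart_sol:
 assumes sol: "chart_sol z0 Y T \<rho>" and link: "linked a Y T" and \<tau>: "norm \<tau> < \<rho>" "\<tau> ~= 0"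
  and S: "\<forall>(i, n)\<in>S. 1 \<le> n"
  and q: "q \<in> positions S"
 shows "fval q (%th. Y (\<tau> * cis th)) = \<tau> ^ fwt q * (case q of None => 1 | Some None => z0 | Some (Some (i, n)) => a i n)"
proof -
 have "q = None \<or> q = Some None \<or> (\<exists>i n. q = Some (Some (i, n)) \<and> 1 \<le> n)" using q S by (auto simp: positions_def)
 moreover have "Y \<tau> $ Some j = \<tau> ^ (r + 1)" using sol \<tau> unfolding chart_sol_def by simp
 ultimately show ?thesis
  using zhat_chart_sol[OF sol \<tau>] alp_chart_sol[OF sol link _ \<tau>] by (auto simp: fval_def fwt_def)
qed

text \<open>The hypothesis \<open>trap\<close> puts every solution on the graph, where the reduced
  field sees it. The map \<open>\<Psi>\<close> keeps the coordinates outside \<open>U\<close>, so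
  the measure argument takes place in full dimension; the count \<open>card U = N + 2\<close>
  matches the \<open>N\<close> coefficients together with \<epsilon> and \<open>z0\<close>.\<close>

theorem necessary:
 assumes fam: "laurent_family f g p c N" and cU: "card U = N + 2"
  and trap: "\<And>z0 Y T \<rho>. chart_sol z0 Y T \<rho> ==> \<exists>\<rho>1>0. \<rho>1 \<le> \<rho> \<and>
    (\<forall>\<tau>\<in>ball 0 \<rho>1. coord_proj (- U) (P *v (Y \<tau> - ys)) = \<phi> (coord_proj U (P *v (Y \<tau> - ys))))"
 shows "semisimple_on U A \<and> (\<forall>\<mu>. eigenvalue_on U A \<mu> \<longrightarrow> positive_integer \<mu>) \<and>
   linearizable_on U (unstable_field U A (conj_map P (nonlinear_part V ys)) \<phi>)"
proof -
 obtain S where S: "finite S" "card S = N" "\<forall>(i, n)\<in>S. 1 \<le> n"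
  and ex: "\<forall>z0 \<alpha>. \<exists>a. laurent_solution f g p c z0 a \<and> (\<forall>(i, n)\<in>S. a i n = \<alpha> i n)"
  using fam unfolding laurent_family_def by (elim exE conjE) (rule that; assumption)
 have "card U = card (positions S)" using positions(2)[OF S(1)] S(2) cU by simp
 then obtain \<sigma> where \<sigma>: "bij_betw \<sigma> U (positions S)"
  using finite_same_card_bij[OF _ positions(1)[OF S(1)], of U] by auto
 define \<kappa> where "\<kappa> = the_inv_into U \<sigma>"
 have \<kappa>\<sigma>: "\<kappa> (\<sigma> k) = k" if "k \<in> U" for k
  using that \<sigma> by (simp add: \<kappa>_def bij_betw_def the_inv_into_f_f)
 have \<sigma>in: "\<sigma> k \<in> positions S" if "k \<in> U" for k using that \<sigma> by (auto simp: bij_betw_def)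
 have \<kappa>in: "\<kappa> q \<in> U" "\<sigma> (\<kappa> q) = q" if "q \<in> positions S" for q
  using that \<sigma> the_inv_into_into[of \<sigma> U q U] f_the_inv_into_f[of \<sigma> U q] by (auto simp: \<kappa>_def bij_betw_def)
 define r0 where "r0 = RI / 2"
 have r0: "0 < r0" "r0 < RI" using RI(1) by (auto simp: r0_def)
 have Kc: "cholv (ball 0 RI) (%x. \<i> *s Hred x)"
  using cholv_Hred unfolding cholv_def vector_smult_component by (intro allI chol_mult chol_const) blast
 have K0: "\<i> *s Hred 0 = 0" by (simp add: Hred_0)
 have T0: "0 \<le> 4 * pi" by simp
 obtain \<rho> u where \<rho>: "0 < \<rho>" "\<rho> \<le> r0" and u1: "continuous_on (ball 0 \<rho> \<times> {0..4*pi}) (%(y, t). u y t)"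
  and u2: "\<forall>t\<in>{0..4*pi}. cholv (ball 0 \<rho>) (%y. u y t)"
  and u3: "\<forall>y\<in>ball 0 \<rho>. u y 0 = y \<and> (\<forall>t\<in>{0..4*pi}. u y t \<in> cball 0 r0 \<and>
     ((%t. u y t) has_vector_derivative \<i> *s Hred (u y t)) (at t within {0..4*pi}))"
  using flow_exists[OF Kc K0 r0 T0] by (elim exE conjE) (rule that; assumption)
 interpret pf: proj_flow U Hred RI r0 \<rho> u
 proof
  show "cholv (ball 0 RI) Hred" by (rule cholv_Hred)
  show "Hred y = coord_proj U (Hred (coord_proj U y))" for y by (rule Hred_proj)
  show "Hred 0 = 0" by (rule Hred_0)
  show "continuous_on (ball 0 \<rho> \<times> {0..4*pi}) (%(y, t). u y t)" by (rule u1)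
  show "cholv (ball 0 \<rho>) (%y. u y t)" if "t \<in> {0..4*pi}" for t using u2 that by blast
  show "u y 0 = y" if "y \<in> ball 0 \<rho>" for y using u3 that by blast
  show "u y t \<in> cball 0 r0" if "y \<in> ball 0 \<rho>" "t \<in> {0..4*pi}" for y t using u3 that by blast
  show "((%t. u y t) has_vector_derivative \<i> *s Hred (u y t)) (at t within {0..4*pi})"
   if "y \<in> ball 0 \<rho>" "t \<in> {0..4*pi}" for y t using u3 that by blast
 qed (rule r0 \<rho>)+
 define W where "W = (%y th. iota (u y th))"
 have t4: "th \<in> {0..4*pi}" if "th \<in> {0..2*pi}" for th :: real using that by auto
 have uRI: "u y th \<in> ball 0 RI" if "y \<in> ball 0 \<rho>" "th \<in> {0..2*pi}" for y th
  using pf.u_in[OF that(1) t4[OF that(2)]] r0 by auto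
 have lu: "loop_family (ball 0 \<rho>) (%y th. u y th $ i)" for i
  unfolding loop_family_def
 proof (intro conjI ballI)
  have "ball (0::complex^('m option)) \<rho> \<times> {0..2*pi} \<subseteq> ball 0 \<rho> \<times> {0..4*pi}" by (intro Sigma_mono) auto
  from continuous_on_subset[OF u1 this]
  have "continuous_on (ball 0 \<rho> \<times> {0..2*pi}) (%p. u (fst p) (snd p))" by (simp add: case_prod_beta)
  from bounded_linear.continuous_on[OF bounded_linear_vec_nth this, of i]
  show "continuous_on (ball 0 \<rho> \<times> {0..2*pi}) (%(y, th). u y th $ i)" by (simp add: case_prod_beta)
  show "chol (ball 0 \<rho>) (%y. u y th $ i)" if "th \<in> {0..2*pi}" for th by (rule cholv_nth[OF pf.u_chol[OF t4[OF that]]])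
 qed
 have lW: "loop_family (ball 0 \<rho>) (%y th. W y th $ q)" for q
  unfolding W_def by (rule loop_family_comp[OF lu cholv_nth[OF RI(2)] uRI])
 have Win: "W y th \<in> ball ys RV" if "y \<in> ball 0 \<rho>" "th \<in> {0..2*pi}" for y th
  unfolding W_def by (rule RI(3)[OF uRI[OF that]])
 define \<Psi> where "\<Psi> = (%y. \<chi> k. if k \<in> U then fval (\<sigma> k) (W y) else y $ k)"
 have \<Psi>c: "cholv (ball 0 \<rho>) \<Psi>"
  unfolding cholv_def
 proof
  fix k show "chol (ball 0 \<rho>) (%y. \<Psi> y $ k)"
  proof (cases "k \<in> U")
   case True
   hence "(%y. \<Psi> y $ k) = (%y. fval (\<sigma> k) (W y))" by (simp add: \<Psi>_def)
   moreover have "chol (ball 0 \<rho>) (%y. fval (\<sigma> k) (W y))" by (rule chol_fval[OF open_ball lW Win])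
   ultimately show ?thesis by (simp only:)
  qed (simp add: \<Psi>_def)
 qed
 define WW where "WW = {y \<in> ball 0 \<rho>. \<exists>w \<tau>0 \<rho>1. pf.orb y w \<tau>0 \<rho>1}"
 \<comment> \<open>Weighted dilation by an integer: applied to data at
   \<open>\<tau>0 = \<tau>1 / l\<close>, it turns the factors \<open>\<tau>0 ^ fwt\<close> into
   \<open>\<tau>1 ^ fwt\<close>. There are countably many of them, so null sets stay null. The
   weight 1 outside \<open>U\<close> is a choice of convenience.\<close>
 define sc :: "nat => complex^('m option) => complex^('m option)" where
  "sc = (%l v. \<chi> k. of_nat l ^ (if k \<in> U then fwt (\<sigma> k) else 1) * v $ k)"
 have cover: "q \<in> (\<Union>l. sc l ` \<Psi> ` WW)" if q: "q $ \<kappa> None ~= 0" for q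
 proof -
  \<comment> \<open>\<open>\<tau>1\<close> is a root of the wanted value of \<epsilon>; dividing the
    target by its powers gives the values for which the family is asked. The disc of the resulting
    solution need not contain \<open>\<tau>1\<close>.\<close>
  obtain \<tau>1 where \<tau>1: "\<tau>1 ^ (r + 1) = q $ \<kappa> None" using complex_root[of "r + 1"] by auto
  have \<tau>1nz: "\<tau>1 ~= 0" using \<tau>1 q by auto
  define z0 where "z0 = q $ \<kappa> (Some None) / \<tau>1 ^ r"
  define \<alpha> where "\<alpha> = (%i n. q $ \<kappa> (Some (Some (i, n))) / \<tau>1 ^ n)"
  obtain a where a: "laurent_solution f g p c z0 a" "\<forall>(i, n)\<in>S. a i n = \<alpha> i n" using ex[rule_format, of z0 \<alpha>] by blast
  obtain Y T \<rho>' where sol: "chart_sol z0 Y T \<rho>'" and link: "linked a Y T" using laurent_to_chart[OF a(1)] by metis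
  obtain \<rho>1 where \<rho>1: "\<rho>1 > 0" "\<rho>1 \<le> \<rho>'"
   "\<forall>\<tau>\<in>ball 0 \<rho>1. coord_proj (- U) (P *v (Y \<tau> - ys)) = \<phi> (coord_proj U (P *v (Y \<tau> - ys)))" using trap[OF sol] by metis
  define w where "w = (%\<tau>. coord_proj U (P *v (Y \<tau> - ys)))"
  have iw: "iota (w \<tau>) = Y \<tau>" if "\<tau> \<in> ball 0 \<rho>1" for \<tau>
   unfolding w_def iota_proj by (rule iota_of_graph) (use \<rho>1(3) that in blast)
  have wd: "\<exists>D. (w has_derivative (%h. h *s D)) (at \<tau>) \<and> \<tau> *s D = Hred (w \<tau>)" if t: "\<tau> \<in> ball 0 \<rho>1" for \<tau>
  proof -
   have "\<tau> \<in> ball 0 \<rho>'" using t \<rho>1(2) by auto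
   then obtain D where D: "(Y has_derivative (%h. h *s D)) (at \<tau>)" "\<tau> *s D = V (Y \<tau>)" using chart_sol_curve[OF sol] by metis
   have "((%\<tau>. Y \<tau> - ys) has_derivative (%h. h *s D - 0)) (at \<tau>)" by (intro has_derivative_diff D(1) has_derivative_const)
   from bounded_linear.has_derivative[OF bounded_linear_coord_proj[of U] bounded_linear.has_derivative[OF matrix_vector_mul_bounded_linear[of P] this]]
   have "(w has_derivative (%h. h *s coord_proj U (P *v D))) (at \<tau>)"
    unfolding w_def by (simp add: matrix_vec_smult coord_proj_smult)
   moreover have "\<tau> *s coord_proj U (P *v D) = Hred (w \<tau>)"
    unfolding Hred_def iw[OF t] D(2)[symmetric] matrix_vec_smult coord_proj_smult ..
   ultimately show ?thesis by blast
  qed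
  have w0: "w 0 = 0" using sol by (simp add: w_def chart_sol_def)
  have "isCont w 0" using wd[of 0] \<rho>1(1) has_derivative_continuous by auto
  then obtain d where d: "d > 0" "\<And>\<tau>. dist \<tau> 0 < d ==> dist (w \<tau>) 0 < \<rho> / 2"
   unfolding continuous_at_eps_delta w0 using \<rho>(1) by (metis half_gt_zero)
  define \<rho>2 where "\<rho>2 = min d \<rho>1"
  have \<rho>2: "\<rho>2 > 0" using d \<rho>1 by (simp add: \<rho>2_def)
  define q' where "q' = coord_proj (- U) q"
  \<comment> \<open>Large enough to bring \<open>\<tau>1 / l\<close> into the disc of the solution
    and to make the coordinates outside \<open>U\<close> small.\<close>
  obtain l :: nat where l: "real l > max (norm \<tau>1 / \<rho>2) (norm q' / (\<rho> / 2))" using reals_Archimedean2 by blast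
  have "0 \<le> norm \<tau>1 / \<rho>2" using \<rho>2 by simp
  also have "\<dots> < real l" using l by simp
  finally have l0: "l > 0" by simp
  define \<tau>0 where "\<tau>0 = \<tau>1 / of_nat l"
  have \<tau>0nz: "\<tau>0 ~= 0" using \<tau>1nz l0 by (simp add: \<tau>0_def)
  have \<tau>0: "norm \<tau>0 < \<rho>2" using l l0 \<rho>2 by (simp add: \<tau>0_def norm_divide field_simps)
  define y where "y = w \<tau>0 + (1 / of_nat l) *s q'"
  have nq: "norm ((1 / of_nat l) *s q') < \<rho> / 2" using l l0 \<rho>(1) by (simp add: norm_cvec_smult norm_divide field_simps)
  have "norm (w \<tau>0) < \<rho> / 2" using d(2)[of \<tau>0] \<tau>0 by (simp add: \<rho>2_def)
  hence y: "y \<in> ball 0 \<rho>" unfolding y_def using nq norm_triangle_ineq[of "w \<tau>0" "(1 / of_nat l) *s q'"] by simp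
  have wU: "w \<tau> \<in> coord_space U" for \<tau> by (simp add: w_def)
  have yU: "coord_proj U y = w \<tau>0"
   using wU[of \<tau>0] by (simp add: y_def q'_def vec_eq_iff coord_space_def)
  have orb: "pf.orb y w \<tau>0 \<rho>2"
   unfolding pf.orb_def
  proof (intro conjI ballI)
   fix \<tau> :: complex assume t: "\<tau> \<in> ball 0 \<rho>2"
   show "w \<tau> \<in> ball 0 \<rho>" using d(2)[of \<tau>] t \<rho>(1) by (simp add: \<rho>2_def)
   show "\<exists>D. (w has_derivative (%h. h *s D)) (at \<tau>) \<and> \<tau> *s D = Hred (w \<tau>)" by (rule wd) (use t in \<open>simp add: \<rho>2_def\<close>)
  qed (use \<tau>0nz \<tau>0 yU w0 wU in auto)
  \<comment> \<open>The loop generated by the flow is the loop of the solution, so the functionals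
    take the values computed for solutions.\<close>
  have Wy: "W y th = Y (\<tau>0 * cis th)" if t: "th \<in> {0..2*pi}" for th
  proof -
   have "W y th = iota (coord_proj U (u y th))" by (simp add: W_def iota_proj)
   also have "\<dots> = iota (w (\<tau>0 * cis th))" by (simp only: pf.orb_flow[OF y orb t4[OF t]])
   also have "\<dots> = Y (\<tau>0 * cis th)" by (rule iw) (use \<tau>0 in \<open>simp add: norm_mult \<rho>2_def\<close>)
   finally show ?thesis .
  qed
  have yW: "y \<in> WW" unfolding WW_def using y orb by blast
  have \<tau>0': "norm \<tau>0 < \<rho>'" using \<tau>0 \<rho>1(2) by (simp add: \<rho>2_def)
  have "q $ k = sc l (\<Psi> y) $ k" for k
  proof (cases "k \<in> U")
   case True
   have v: "fval (\<sigma> k) (W y) = \<tau>0 ^ fwt (\<sigma> k) * (case \<sigma> k of None => 1 | Some None => z0 | Some (Some (i, n)) => a i n)"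
    by (rule trans[OF fval_cong[OF Wy] fval_chart_sol[OF sol link \<tau>0' \<tau>0nz S(3) \<sigma>in[OF True]]])
   have "of_nat l * \<tau>0 = \<tau>1" using l0 by (simp add: \<tau>0_def)
   hence "sc l (\<Psi> y) $ k = \<tau>1 ^ fwt (\<sigma> k) * (case \<sigma> k of None => 1 | Some None => z0 | Some (Some (i, n)) => a i n)"
    using True by (simp add: sc_def \<Psi>_def v flip: power_mult_distrib mult.assoc)
   also have "\<dots> = q $ k"
   proof -
    have "\<sigma> k = None \<or> \<sigma> k = Some None \<or> (\<exists>i n. \<sigma> k = Some (Some (i, n)) \<and> (i, n) \<in> S)" using \<sigma>in[OF True] by (auto simp: positions_def)
    thus ?thesis
    proof (elim disjE exE conjE)
     assume "\<sigma> k = None" thus ?thesis using \<tau>1 \<kappa>\<sigma>[OF True] by (simp add: fwt_def)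
    next
     assume "\<sigma> k = Some None" thus ?thesis using \<tau>1nz \<kappa>\<sigma>[OF True] by (simp add: fwt_def z0_def)
    next
     fix i n assume k: "\<sigma> k = Some (Some (i, n))" "(i, n) \<in> S"
     have "a i n = \<alpha> i n" using a(2) k(2) by blast
     thus ?thesis using \<tau>1nz \<kappa>\<sigma>[OF True] k(1) by (simp add: fwt_def \<alpha>_def)
    qed
   qed
   finally show ?thesis ..
  next
   case False
   thus ?thesis using l0 wU[of \<tau>0] by (simp add: sc_def \<Psi>_def y_def q'_def coord_space_def)
  qed
  hence "q = sc l (\<Psi> y)" by (simp add: vec_eq_iff)
  thus ?thesis using yW by blast
 qed
 \<comment> \<open>Differentiable maps send null sets to null sets. If \<open>WW\<close> were null,
   so would be the union of the dilated images, but this union contains the complement of a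
   hyperplane.\<close>
 have nonneg: "\<not> negligible WW"
 proof
  assume "negligible WW"
  moreover have "\<Psi> differentiable_on WW"
   unfolding differentiable_on_def
  proof
   fix y assume "y \<in> WW"
   hence "y \<in> ball 0 \<rho>" by (simp add: WW_def)
   from has_derivative_at_withinI[OF cholv_deriv[OF \<Psi>c this]] show "\<Psi> differentiable at y within WW" by (rule differentiableI)
  qed
  ultimately have 1: "negligible (\<Psi> ` WW)" by (intro negligible_differentiable_image_negligible) auto
  have "negligible (sc l ` \<Psi> ` WW)" for l
  proof (rule negligible_differentiable_image_negligible[OF _ 1])
   have "linear (sc l)" by (rule linearI) (simp_all add: sc_def vec_eq_iff distrib_left)
   thus "sc l differentiable_on \<Psi> ` WW" by (rule linear_imp_differentiable_on)
  qed simp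
  hence "negligible (\<Union>l. sc l ` \<Psi> ` WW)" by (intro negligible_Union_nat)
  hence "negligible {q :: complex^('m option). q $ \<kappa> None ~= 0}" by (rule negligible_subset) (use cover in blast)
  moreover have "open {q :: complex^('m option). q $ \<kappa> None ~= 0}"
   by (intro open_Collect_neq continuous_intros)
  moreover have "(\<chi> i. 1) \<in> {q :: complex^('m option). q $ \<kappa> None ~= 0}" by simp
  ultimately show False using open_not_negligible by blast
 qed
 interpret periodic_flow U Hred RI r0 \<rho> u
  by unfold_locales (use nonneg in \<open>simp add: WW_def\<close>)
 obtain Ps ns where Ps: "cholv (ball 0 \<rho>) Ps" "Ps 0 = 0" "det (cjac Ps 0) ~= 0" "\<forall>k y. k \<notin> U \<longrightarrow> Ps y $ k = y $ k"
  "\<forall>k\<in>U. 0 < (ns k :: nat) \<and> (\<forall>y\<in>ball 0 \<rho>. cdir (%y. Ps y $ k) y (Hred y) = of_nat (ns k) * Ps y $ k)"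
  using linearizing_map by (elim exE conjE) (rule that; assumption)
 interpret ef: eigenfunctions U Hred Ps "unstable_field U A (conj_map P (nonlinear_part V ys)) \<phi>" \<rho> ns A
  by unfold_locales (use Ps \<rho>(1) H_ball Hred_0 Hred_off jac_Hred field_Hred in auto)
 show ?thesis using ef.semisimple ef.eigenvalues ef.linearizable by blast
qed

end

section \<open>Sufficiency\<close>

text \<open>The quotient \<open>F \<tau> / \<tau> ^ m\<close> has derivative zero on the punctured
  disc, which is connected; at the centre the equation itself forces \<open>F\<close> to
  vanish.\<close>

lemma euler_monomial:
 fixes F :: "complex => complex"
 assumes F: "\<And>\<tau>. \<tau> \<in> ball 0 \<rho> ==> \<exists>D. (F has_field_derivative D) (at \<tau>) \<and> \<tau> * D = of_nat m * F \<tau>" and m: "m > 0" and \<rho>: "\<rho> > 0"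
 shows "\<exists>C. \<forall>\<tau>\<in>ball 0 \<rho>. F \<tau> = C * \<tau> ^ m"
proof -
 let ?S = "ball (0::complex) \<rho> - {0}"
 have d: "((%\<tau>. F \<tau> / \<tau> ^ m) has_field_derivative 0) (at \<tau>)" if t: "\<tau> \<in> ?S" for \<tau>
 proof -
  obtain D where D: "(F has_field_derivative D) (at \<tau>)" "\<tau> * D = of_nat m * F \<tau>" using F t by blast
  have tm: "((%\<tau>. \<tau> ^ m) has_field_derivative of_nat m * \<tau> ^ (m - 1)) (at \<tau>)" by (auto intro!: derivative_eq_intros)
  have nz: "\<tau> ^ m ~= 0" using t by simp
  have "D * \<tau> ^ m - F \<tau> * (of_nat m * \<tau> ^ (m - 1)) = \<tau> ^ (m - 1) * (\<tau> * D - of_nat m * F \<tau>)"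
   using m by (cases m) (simp_all add: algebra_simps)
  with DERIV_divide[OF D(1) tm nz] show ?thesis by (simp add: D(2))
 qed
 have "connected ?S" by (rule connected_punctured_ball) simp
 moreover have "continuous_on ?S (%\<tau>. F \<tau> / \<tau> ^ m)"
  by (intro continuous_at_imp_continuous_on ballI DERIV_isCont[OF d])
 ultimately obtain C where C: "\<And>\<tau>. \<tau> \<in> ?S ==> F \<tau> / \<tau> ^ m = C"
  using DERIV_zero_connected_constant[of ?S "{}" "%\<tau>. F \<tau> / \<tau> ^ m"] d by (auto simp: open_Diff)
 have "F \<tau> = C * \<tau> ^ m" if t: "\<tau> \<in> ball 0 \<rho>" for \<tau>
 proof (cases "\<tau> = 0")
  case True
  obtain D where "\<tau> * D = of_nat m * F \<tau>" using F[OF t] by blast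
  thus ?thesis using True m by simp
 next
  case False
  thus ?thesis using C[of \<tau>] t by (auto simp: field_simps)
 qed
 thus ?thesis by blast
qed

text \<open>\<open>\<Xi>\<close> parametrizes the manifold by coordinates in which the field is
  diagonal: by \<open>\<Xi>_lin\<close>, multiplying each coordinate \<open>k\<close> of
  \<open>s\<close> by \<open>\<tau> ^ ns k\<close> gives a curve with
  \<open>\<tau> Y' = V Y\<close>. The indices \<open>k0\<close> and \<open>k1\<close> are directions
  of weight \<open>r + 1\<close> and \<open>r\<close> in which \<epsilon> and \<open>Z\<close>
  react.\<close>

locale linear_orbits = qh_chart f g p r c j b G
 for f g :: "'m::finite => complex^'m => complex => complex"
  and p :: "'m => nat" and r :: nat
  and c :: "complex^'m" and j :: 'm and b :: complex
  and G :: "'m => complex^('m option) => complex" +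
 fixes \<Xi> :: "complex^('m option) => complex^('m option)" and R :: real and U :: "'m option set" and ns :: "'m option => nat"
  and e :: "'m option => complex^('m option)" and k0 k1 :: "'m option"
 assumes R: "R > 0" and \<Xi>: "cholv (ball 0 R) \<Xi>" and \<Xi>_0: "\<Xi> 0 = ys" and \<Xi>_in: "\<And>s. s \<in> ball 0 R ==> \<Xi> s \<in> ball ys RV"
  and ns: "\<And>k. k \<in> U ==> ns k > 0" and \<Xi>_proj: "\<And>s. \<Xi> (coord_proj U s) = \<Xi> s"
  and \<Xi>_lin: "\<And>s. s \<in> ball 0 R ==> s \<in> coord_space U ==> cjac \<Xi> s *v (\<chi> k. of_nat (ns k) * s $ k) = V (\<Xi> s)"
  and e: "\<And>k. k \<in> U ==> cjac \<Xi> 0 *v axis k 1 = e k" and e_eigen: "\<And>k. k \<in> U ==> J *v e k = of_nat (ns k) *s e k"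
  and indep: "\<And>v. v \<in> coord_space U ==> (\<Sum>k\<in>U. v $ k *s e k) = 0 ==> v = 0"
  and k0: "k0 \<in> U" "ns k0 = r + 1" "e k0 $ Some j ~= 0" and k1: "k1 \<in> U" "ns k1 = r" "e k1 $ None ~= 0"
begin

definition dil :: "complex => complex^('m option) => complex^('m option)" where
 "dil z s = (\<chi> k. if k \<in> U then z ^ ns k * s $ k else 0)"

definition W :: "complex^('m option) => real => complex^('m option)" where "W s th = \<Xi> (dil (cis th) s)"

lemma dil_U: "dil z s \<in> coord_space U" by (simp add: dil_def coord_space_def)

lemma dil_1: "\<Xi> (dil 1 s) = \<Xi> s"
proof -
 have "dil 1 s = coord_proj U s" by (simp add: dil_def vec_eq_iff)
 thus ?thesis by (simp add: \<Xi>_proj)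
qed

text \<open>The sum of all weights serves as a crude common exponent.\<close>

lemma norm_dil: "norm z \<le> B ==> 1 \<le> B ==> norm (dil z s) \<le> B ^ (\<Sum>k\<in>UNIV. ns k) * norm s"
proof -
 assume z: "norm z \<le> B" and B: "1 \<le> B"
 let ?M = "\<Sum>k\<in>UNIV. ns k"
 have "norm (dil z s $ k) \<le> norm ((of_real (B ^ ?M) *s s) $ k)" for k
 proof (cases "k \<in> U")
  case True
  have "norm z ^ ns k \<le> B ^ ns k" using z by (intro power_mono) auto
  also have "\<dots> \<le> B ^ ?M" using B member_le_sum[of k UNIV ns] by (intro power_increasing) auto
  finally have "norm z ^ ns k * norm (s $ k) \<le> B ^ ?M * norm (s $ k)" by (rule mult_right_mono) simp
  thus ?thesis using True B by (simp add: dil_def norm_mult norm_power)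
 qed (simp add: dil_def)
 hence "norm (dil z s) \<le> norm (of_real (B ^ ?M) *s s)" by (rule norm_le_componentwise_cart)
 thus ?thesis using B by (simp add: norm_cvec_smult norm_power)
qed

lemma dil_cis: "s \<in> ball 0 R ==> dil (cis th) s \<in> ball 0 R"
 using norm_dil[of "cis th" 1 s] by simp

lemma W_family: "loop_family (ball 0 R) (%s th. W s th $ q)"
 unfolding W_def
proof (rule loop_family_comp[OF _ cholv_nth[OF \<Xi>] dil_cis])
 fix k
 show "loop_family (ball 0 R) (%s th. dil (cis th) s $ k)"
 proof (cases "k \<in> U")
  case True
  have "loop_family (ball 0 R) (%s th. cis th ^ ns k * s $ k)"
   by (intro loop_family_mult loop_family_angle loop_family_point chol_nth continuous_intros)
  thus ?thesis using True by (simp add: dil_def)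
 next
  case False
  have "loop_family (ball 0 R) (%s::complex^('m option). %th. 0::complex)" by (intro loop_family_angle continuous_intros)
  thus ?thesis using False by (simp add: dil_def)
 qed
qed

lemma W_in: "s \<in> ball 0 R ==> W s th \<in> ball ys RV"
 unfolding W_def by (intro \<Xi>_in dil_cis)

lemma zin: "(0 :: complex^('m option)) \<in> ball 0 R" using R by simp

lemma chol_alp: "chol (ball 0 R) (%s. alp (W s) i n)"
 by (rule loop_functionals(2)[OF open_ball W_family W_in])

lemma chol_zhat: "chol (ball 0 R) (%s. zhat (W s))"
 by (rule loop_functionals(1)[OF open_ball W_family W_in])

text \<open>Entry \<open>k\<close> of the differential at 0 of the coefficient
  \<open>(i, n)\<close>, as computed in \<open>alp_derivative\<close>; only directions of weight
  exactly \<open>n\<close> contribute.\<close>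

definition acoef :: "'m => nat => 'm option => complex" where
 "acoef i n k = (if k \<in> U \<and> ns k = n then b powi (int (p i) - int n) * ((if i = j then 0 else e k $ Some i)
     + cdir kk ys (e k) / (of_nat n + 1) * of_nat (p i) * chart_X j ys $ i / b) else 0)"

lemma axis_loop:
 assumes k: "k \<in> U"
 shows "W (0 + \<zeta> *s axis k 1) th = \<Xi> (0 + (\<zeta> * cis (of_int (int (ns k)) * th)) *s axis k 1)"
proof -
 have "dil (cis th) (\<zeta> *s axis k 1) = (\<zeta> * cis (of_int (int (ns k)) * th)) *s axis k 1"
 proof -
  have "cis (of_int (int (ns k)) * th) = cis th ^ ns k" by (simp only: cis_powi[symmetric] power_int_of_nat)
  thus ?thesis using k by (simp only: vec_eq_iff) (simp add: dil_def axis_def mult.commute)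
 qed
 thus ?thesis by (simp add: W_def)
qed

lemma axis_curve:
 assumes k: "k \<in> U"
 shows "(%w. \<Xi> (0 + w *s axis k 1) $ q) holomorphic_on ball 0 R" "\<Xi> (0 + 0 *s axis k 1) = ys"
  "w \<in> ball 0 R ==> \<Xi> (0 + w *s axis k 1) \<in> ball ys RV"
  "((%w. \<Xi> (0 + w *s axis k 1) $ q) has_field_derivative e k $ q) (at 0)"
proof -
 have in1: "0 + w *s axis k 1 \<in> ball (0::complex^('m option)) R" if "w \<in> ball 0 R" for w
  using that by (simp add: norm_cvec_smult)
 show "(%w. \<Xi> (0 + w *s axis k 1) $ q) holomorphic_on ball 0 R"
  by (rule chol_line_holomorphic[OF cholv_nth[OF \<Xi>] in1])
 show "\<Xi> (0 + 0 *s axis k 1) = ys" by (simp add: \<Xi>_0)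
 show "\<Xi> (0 + w *s axis k 1) \<in> ball ys RV" if "w \<in> ball 0 R" using \<Xi>_in[OF in1[OF that]] .
 have "((%w. \<Xi> (0 + w *s axis k 1) $ q) has_field_derivative cdir (%s. \<Xi> s $ q) (0 + 0 *s axis k 1) (axis k 1)) (at 0)"
  by (rule chol_line_deriv[OF cholv_nth[OF \<Xi>]]) (use R in simp)
 moreover have "cdir (%s. \<Xi> s $ q) (0 + 0 *s axis k 1) (axis k 1) = e k $ q"
  using cjac_nth[OF \<Xi> zin, of "axis k 1" q] e[OF k] by simp
 ultimately show "((%w. \<Xi> (0 + w *s axis k 1) $ q) has_field_derivative e k $ q) (at 0)" by simp
qed

lemma cdir_axis_unique:
 assumes q: "chol (ball 0 R) q" and d: "((%\<zeta>. q (0 + \<zeta> *s v)) has_field_derivative d) (at 0)"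
 shows "cdir q 0 v = d"
proof -
 have "((%\<zeta>. q (0 + \<zeta> *s v)) has_field_derivative cdir q (0 + 0 *s v) v) (at 0)" by (rule chol_line_deriv[OF q]) (use R in simp)
 from DERIV_unique[OF this d] show ?thesis by simp
qed

lemma alp_axis:
 assumes k: "k \<in> U" and n: "n \<ge> 1" shows "cdir (%s. alp (W s) i n) 0 (axis k 1) = acoef i n k"
proof (rule cdir_axis_unique[OF chol_alp])
 have "int (ns k) \<ge> 1" using ns[OF k] by simp
 from alp_derivative[OF R axis_curve[OF k] this n, where i = i]
 show "((%\<zeta>. alp (W (0 + \<zeta> *s axis k 1)) i n) has_field_derivative acoef i n k) (at 0)"
  using k unfolding axis_loop[OF k, abs_def] acoef_def by (cases "i = j"; cases "ns k = n") simp_all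
qed

lemma zhat_axis:
 assumes k: "k \<in> U" shows "cdir (%s. zhat (W s)) 0 (axis k 1) = (if ns k = r then e k $ None else 0)"
proof (rule cdir_axis_unique[OF chol_zhat])
 have "int (ns k) \<ge> 1" using ns[OF k] by simp
 from zhat_derivative[OF R axis_curve[OF k] this]
 show "((%\<zeta>. zhat (W (0 + \<zeta> *s axis k 1))) has_field_derivative (if ns k = r then e k $ None else 0)) (at 0)"
  unfolding axis_loop[OF k, abs_def] by simp
qed

lemma eps_axis: "k \<in> U ==> cdir (%s. \<Xi> s $ Some j) 0 (axis k 1) = e k $ Some j"
 using cjac_nth[OF \<Xi> zin, of "axis k 1" "Some j"] e by simp

lemma cdir_on_U:
 assumes q: "chol (ball 0 R) q" and v: "v \<in> coord_space U" and d: "\<And>k. k \<in> U ==> cdir q 0 (axis k 1) = d k"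
 shows "cdir q 0 v = (\<Sum>k\<in>U. d k * v $ k)"
proof -
 have "cdir q 0 v = (\<Sum>k\<in>UNIV. cdir q 0 (axis k 1) * v $ k)" by (rule cdir_expand[OF q zin])
 also have "\<dots> = (\<Sum>k\<in>U. cdir q 0 (axis k 1) * v $ k)"
  by (rule sum.mono_neutral_right) (use v in \<open>auto simp: coord_space_def\<close>)
 also have "\<dots> = (\<Sum>k\<in>U. d k * v $ k)" by (rule sum.cong) (simp_all add: d)
 finally show ?thesis .
qed

lemma e_eps: "k \<in> U ==> ns k ~= r + 1 ==> e k $ Some j = 0"
 by (rule eigen_eps[OF e_eigen]) (simp_all only: of_nat_eq_iff not_False_eq_True)

text \<open>Grouping \<open>v\<close> by weight gives vectors \<open>E n\<close> with
  \<open>J *v E n = of_nat n *s E n\<close>. As \<open>X\<^sub>j = 1\<close>, the functional for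
  \<open>i = j\<close> contains only the derivative of \<open>kk\<close>, which therefore vanishes
  on \<open>E n\<close>; then the functionals for the other \<open>i\<close> kill the
  \<open>X\<close>-entries. The entries \<epsilon> and \<open>Z\<close> vanish by the triangular
  form of \<open>J\<close>, except for \<open>n = r + 1\<close> and \<open>n = r\<close>, where the
  two remaining functionals step in.\<close>

lemma kernel:
 assumes v: "v \<in> coord_space U"
  and al: "\<And>i n. n \<ge> 1 ==> (\<Sum>k\<in>U. acoef i n k * v $ k) = 0"
  and ep: "(\<Sum>k\<in>U. e k $ Some j * v $ k) = 0"
  and ze: "(\<Sum>k\<in>U. (if ns k = r then e k $ None else 0) * v $ k) = 0"
 shows "v = 0"
proof (rule indep[OF v])
 define E where "E = (%n. \<Sum>k\<in>{k\<in>U. ns k = n}. v $ k *s e k)"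
 have En: "E n $ q = (\<Sum>k\<in>{k\<in>U. ns k = n}. e k $ q * v $ k)" for n q by (simp add: E_def mult.commute)
 have JE: "J *v E n = of_nat n *s E n" for n
 proof -
  have "J *v E n = (\<Sum>k\<in>{k\<in>U. ns k = n}. v $ k *s (J *v e k))" unfolding E_def by (simp add: matrix_vec_sum matrix_vec_smult)
  also have "\<dots> = (\<Sum>k\<in>{k\<in>U. ns k = n}. v $ k *s (of_nat n *s e k))" by (rule sum.cong) (auto simp: e_eigen)
  also have "\<dots> = of_nat n *s E n" unfolding E_def by (simp add: vec_eq_iff sum_distrib_left mult_ac)
  finally show ?thesis .
 qed
 have E0: "E n = 0" if n: "n \<ge> 1" for n
 proof -
  let ?k = "cdir kk ys (E n)"
  have ysin: "ys \<in> ball ys RV" using RV(1) by simp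
  interpret kl: bounded_linear "cdir kk ys" by (rule cdir_linear[OF chol_kk_ball ysin])
  have kE: "?k = (\<Sum>k\<in>{k\<in>U. ns k = n}. cdir kk ys (e k) * v $ k)"
   unfolding E_def kl.sum by (intro sum.cong) (simp_all add: chol_deriv(2)[OF chol_kk_ball ysin] mult.commute)
  have S: "(if i = j then 0 else E n $ Some i) + ?k / (of_nat n + 1) * of_nat (p i) * chart_X j ys $ i / b = 0" for i
  proof -
   define B where "B = b powi (int (p i) - int n)"
   define q where "q = of_nat (p i) * chart_X j ys $ i / b / (of_nat n + 1)"
   have "0 = (\<Sum>k\<in>U. acoef i n k * v $ k)" by (simp only: al[OF n])
   also have "\<dots> = (\<Sum>k\<in>{k\<in>U. ns k = n}. acoef i n k * v $ k)"
    by (rule sum.mono_neutral_right) (auto simp: acoef_def)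
   also have "\<dots> = (\<Sum>k\<in>{k\<in>U. ns k = n}. B * ((if i = j then 0 else e k $ Some i * v $ k) + q * (cdir kk ys (e k) * v $ k)))"
    by (rule sum.cong) (auto simp: acoef_def B_def q_def field_simps)
   also have "\<dots> = B * ((if i = j then 0 else E n $ Some i) + q * ?k)"
    unfolding kE En by (simp add: sum_distrib_left[symmetric] sum.distrib)
   finally have "(if i = j then 0 else E n $ Some i) + q * ?k = 0" using b_nz by (simp add: B_def)
   thus ?thesis by (simp add: q_def mult_ac)
  qed
  have n1: "(of_nat n + 1 :: complex) ~= 0" by (metis of_nat_Suc of_nat_eq_0_iff Suc_not_Zero add.commute)
  have "?k = 0" using S[of j] n1 b_nz p_pos[of j] by simp
  hence i0: "E n $ Some i = 0" if "i ~= j" for i using S[of i] that by simp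
  have s0: "E n $ Some j = 0"
  proof (cases "n = r + 1")
   case True
   have "E n $ Some j = (\<Sum>k\<in>U. e k $ Some j * v $ k)"
    unfolding En by (rule sum.mono_neutral_left) (use True e_eps in auto)
   thus ?thesis using ep by simp
  next
   case False
   thus ?thesis by (intro eigen_eps[OF JE]) (simp only: of_nat_eq_iff not_False_eq_True)
  qed
  have "E n $ None = 0"
  proof (cases "n = r")
   case True
   have "E n $ None = (\<Sum>k\<in>U. (if ns k = r then e k $ None else 0) * v $ k)"
    unfolding En by (rule sum.mono_neutral_cong_left) (use True in auto)
   thus ?thesis using ze by simp
  next
   case False
   thus ?thesis by (intro eigen_Z[OF JE _ s0]) simp
  qed
  hence "E n $ q = 0" for q
  proof (cases q)
   case (Some i) thus ?thesis using i0 s0 by (cases "i = j") auto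
  qed simp
  thus ?thesis by (simp add: vec_eq_iff)
 qed
 have "(\<Sum>k\<in>U. v $ k *s e k) = (\<Sum>n\<in>ns ` U. E n)" unfolding E_def by (rule sum.image_gen) simp
 also have "\<dots> = 0" by (rule sum.neutral) (use E0 ns in force)
 finally show "(\<Sum>k\<in>U. v $ k *s e k) = 0" .
qed

text \<open>Rows \<open>k0\<close> and \<open>k1\<close> are reserved for \<epsilon> and
  \<open>z0\<close>; the other rows in \<open>U\<close> are filled with coefficient functionals,
  \<open>kernel\<close> being the condition of \<open>row_selection\<close>. An invertible matrix
  has no equal rows, so different indices receive different positions \<open>(i, n)\<close>.\<close>

lemma selection:
 "\<exists>M ii nn. det M ~= 0 \<and> (\<forall>v\<in>coord_space U. rdot (M $ k0) v = (\<Sum>k\<in>U. e k $ Some j * v $ k) \<and>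
   rdot (M $ k1) v = (\<Sum>k\<in>U. (if ns k = r then e k $ None else 0) * v $ k) \<and>
   (\<forall>l\<in>U - {k0, k1}. rdot (M $ l) v = (\<Sum>k\<in>U. acoef (ii l) (nn l) k * v $ k))) \<and>
   (\<forall>l. l \<notin> U \<longrightarrow> (\<forall>v. rdot (M $ l) v = v $ l)) \<and> (\<forall>l\<in>U - {k0, k1}. nn l \<ge> 1) \<and> inj_on (%l. (ii l, nn l)) (U - {k0, k1})"
proof -
 define rw :: "('m option => complex) => complex^('m option)" where "rw = (%d. \<chi> k. if k \<in> U then d k else 0)"
 have rw: "rdot (rw d) v = (\<Sum>k\<in>U. d k * v $ k)" for d v
 proof -
  have "rdot (rw d) v = (\<Sum>k\<in>U. rw d $ k * v $ k)"
   unfolding rdot_def by (rule sum.mono_neutral_right) (auto simp: rw_def)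
  thus ?thesis by (simp add: rw_def)
 qed
 define re where "re = (%k. e k $ Some j)"
 define rz where "rz = (%k. if ns k = r then e k $ None else 0)"
 \<comment> \<open>The identity apart from two rows. It is invertible because \<epsilon> does not
   react in direction \<open>k1\<close>, so the block on \<open>k0\<close>, \<open>k1\<close> is
   triangular.\<close>
 define M0 :: "complex^('m option)^('m option)" where "M0 = (\<chi> k. if k = k0 then rw re else if k = k1 then rw rz else mat 1 $ k)"
 have k01: "k0 ~= k1" using k0(2) k1(2) by auto
 have id: "rdot (mat 1 $ k) v = v $ k" for k and v :: "complex^('m option)" by (simp flip: matrix_rdot)
 have detM0: "det M0 ~= 0"
 proof
  assume "det M0 = 0"
  then obtain v where v: "v ~= 0" "M0 *v v = 0" unfolding det_zero_iff_kernel by blast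
  have row: "rdot (M0 $ k) v = 0" for k using v(2) by (simp flip: matrix_rdot)
  have off: "v $ k = 0" if "k ~= k0" "k ~= k1" for k using row[of k] that by (simp add: M0_def id)
  have sum2: "(\<Sum>k\<in>U. d k * v $ k) = d k0 * v $ k0 + d k1 * v $ k1" for d
  proof -
   have "(\<Sum>k\<in>U. d k * v $ k) = (\<Sum>k\<in>{k0, k1}. d k * v $ k)"
    by (rule sum.mono_neutral_right) (use k0 k1 off in auto)
   thus ?thesis using k01 by simp
  qed
  have "re k1 = 0" unfolding re_def by (rule e_eps[OF k1(1)]) (use k1(2) in simp)
  hence v0: "v $ k0 = 0" using row[of k0] k0(3) by (simp add: M0_def rw sum2 re_def)
  have "v $ k1 = 0" using row[of k1] k01 k1(2,3) v0 by (simp add: M0_def rw sum2 rz_def)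
  hence "v $ k = 0" for k using off[of k] v0 by (cases "k = k0"; cases "k = k1") auto
  thus False using v(1) by (simp add: vec_eq_iff)
 qed
 have kerM0: "\<exists>Rw\<in>{rw (acoef i n) | i n. n \<ge> 1}. rdot Rw v ~= 0"
  if v: "v ~= 0" and z: "\<And>k. k \<notin> U - {k0, k1} ==> rdot (M0 $ k) v = 0" for v
 proof (rule ccontr)
  assume no: "\<not> ?thesis"
  have "v = 0"
  proof (rule kernel)
   have "v $ k = 0" if k: "k \<notin> U" for k
   proof -
    have "k ~= k0" "k ~= k1" using k k0(1) k1(1) by auto
    thus ?thesis using z[of k] k by (simp add: M0_def id)
   qed
   thus "v \<in> coord_space U" by (simp add: coord_space_def)
   show "(\<Sum>k\<in>U. acoef i n k * v $ k) = 0" if "n \<ge> 1" for i n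
   proof -
    have "rw (acoef i n) \<in> {rw (acoef i n) | i n. n \<ge> 1}" using that by blast
    hence "rdot (rw (acoef i n)) v = 0" using no by blast
    thus ?thesis by (simp only: rw)
   qed
   have "rdot (M0 $ k0) v = 0" by (rule z) simp
   thus "(\<Sum>k\<in>U. e k $ Some j * v $ k) = 0" by (simp add: M0_def rw re_def)
   have "rdot (M0 $ k1) v = 0" by (rule z) simp
   thus "(\<Sum>k\<in>U. (if ns k = r then e k $ None else 0) * v $ k) = 0" using k01 by (simp add: M0_def rw rz_def)
  qed
  thus False using v by blast
 qed
 have "\<exists>M :: complex^('m option)^('m option). det M ~= 0 \<and> (\<forall>k. k \<notin> U - {k0, k1} \<longrightarrow> M $ k = M0 $ k) \<and>
   (\<forall>k\<in>U - {k0, k1}. M $ k \<in> {rw (acoef i n) | i n. n \<ge> 1})"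
  by (rule row_selection[OF detM0 kerM0])
 then obtain M :: "complex^('m option)^('m option)" where M: "det M ~= 0" "\<And>k. k \<notin> U - {k0, k1} ==> M $ k = M0 $ k"
  "\<And>k. k \<in> U - {k0, k1} ==> M $ k \<in> {rw (acoef i n) | i n. n \<ge> 1}" by blast
 have "\<forall>k\<in>U - {k0, k1}. \<exists>i n. M $ k = rw (acoef i n) \<and> n \<ge> 1" using M(3) by blast
 then obtain ii nn where in1: "\<And>k. k \<in> U - {k0, k1} ==> M $ k = rw (acoef (ii k) (nn k)) \<and> nn k \<ge> 1" by metis
 have "inj_on (%l. (ii l, nn l)) (U - {k0, k1})"
 proof (rule inj_onI, rule ccontr)
  fix k l assume kl: "k \<in> U - {k0, k1}" "l \<in> U - {k0, k1}" "(ii k, nn k) = (ii l, nn l)" "k ~= l"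
  hence "M $ k = M $ l" using in1[OF kl(1)] in1[OF kl(2)] by simp
  hence "det M = 0" by (intro det_identical_rows[OF kl(4)]) (simp add: row_def)
  thus False using M(1) by blast
 qed
 moreover have "M $ k0 = rw re" "M $ k1 = rw rz" using M(2)[of k0] M(2)[of k1] k01 by (simp_all add: M0_def)
 moreover have "rdot (M $ l) v = v $ l" if l: "l \<notin> U" for l v
 proof -
  have "l ~= k0" "l ~= k1" using l k0(1) k1(1) by auto
  thus ?thesis using M(2)[of l] l by (simp add: M0_def id)
 qed
 ultimately show ?thesis using M(1) in1
  by (intro exI[of _ M] exI[of _ ii] exI[of _ nn]) (simp add: rw re_def rz_def)
qed

end
context linear_orbits begin

text \<open>The inverse function theorem reaches only small data. Every weight is positive, so
  wanted parameters multiplied by the corresponding powers of a small \<open>\<tau>0\<close> are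
  small; a curve that has these data at \<open>\<tau>0\<close> has the wanted parameters.\<close>

theorem sufficient:
 assumes cU: "card U = N + 2"
 shows "laurent_family f g p c N"
proof -
 obtain M ii nn where M: "det M ~= 0"
  and Mr: "\<forall>v\<in>coord_space U. rdot (M $ k0) v = (\<Sum>k\<in>U. e k $ Some j * v $ k) \<and>
   rdot (M $ k1) v = (\<Sum>k\<in>U. (if ns k = r then e k $ None else 0) * v $ k) \<and>
   (\<forall>l\<in>U - {k0, k1}. rdot (M $ l) v = (\<Sum>k\<in>U. acoef (ii l) (nn l) k * v $ k))"
  and Moff: "\<forall>l. l \<notin> U \<longrightarrow> (\<forall>v. rdot (M $ l) v = v $ l)"
  and nn: "\<forall>l\<in>U - {k0, k1}. nn l \<ge> 1" and inj: "inj_on (%l. (ii l, nn l)) (U - {k0, k1})"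
  using selection by (elim exE conjE) (rule that; assumption)
 have k01: "k0 ~= k1" using k0(2) k1(2) by auto
 define \<Psi> where "\<Psi> = (%s. \<chi> k. if k = k0 then \<Xi> s $ Some j else if k = k1 then zhat (W s)
   else if k \<in> U then alp (W s) (ii k) (nn k) else s $ k)"
 have \<Psi>k: "(%s. \<Psi> s $ k0) = (%s. \<Xi> s $ Some j)" "(%s. \<Psi> s $ k1) = (%s. zhat (W s))"
  "l \<in> U - {k0, k1} ==> (%s. \<Psi> s $ l) = (%s. alp (W s) (ii l) (nn l))"
  "l \<notin> U ==> (%s. \<Psi> s $ l) = (%s. s $ l)" for l
  using k01 k0(1) k1(1) by (auto simp: \<Psi>_def)
 have \<Psi>c: "cholv (ball 0 R) \<Psi>"
  unfolding cholv_def
 proof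
  fix k
  consider "k = k0" | "k = k1" | "k \<in> U - {k0, k1}" | "k \<notin> U" by blast
  thus "chol (ball 0 R) (%s. \<Psi> s $ k)"
  proof cases
   case 3 thus ?thesis unfolding \<Psi>k(3)[OF 3] by (rule_tac chol_alp)
  next
   case 4 thus ?thesis unfolding \<Psi>k(4)[OF 4] by (rule_tac chol_nth)
  qed (simp_all only: \<Psi>k(1,2) cholv_nth[OF \<Xi>] chol_zhat)
 qed
 have W0: "W 0 = (%th. ys)"
 proof
  fix th have "dil (cis th) 0 = 0" by (simp add: dil_def vec_eq_iff)
  thus "W 0 th = ys" by (simp add: W_def \<Xi>_0)
 qed
 have alp0: "alp (%th. ys) i n = 0" if "n \<ge> 1" for i n
  by (rule alp_ys[OF R axis_curve[OF k0(1)] order_refl that])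
 have \<Psi>0: "\<Psi> 0 = 0"
 proof -
  have "\<Psi> 0 $ k = 0" for k
   using alp0 nn by (cases "k = k0"; cases "k = k1"; cases "k \<in> U") (auto simp: \<Psi>_def \<Xi>_0 W0 zhat_def)
  thus ?thesis by (simp add: vec_eq_iff)
 qed
 have "det (cjac \<Psi> 0) ~= 0"
 proof
  assume "det (cjac \<Psi> 0) = 0"
  then obtain v where v: "v ~= 0" "cjac \<Psi> 0 *v v = 0" unfolding det_zero_iff_kernel by blast
  have row: "cdir (%s. \<Psi> s $ k) 0 v = 0" for k using v(2) cjac_nth[OF \<Psi>c zin, of v k] by simp
  have "v $ k = 0" if k: "k \<notin> U" for k
  proof -
   have "cdir (%s. s $ k) 0 = (%v::complex^('m option). v $ k)"
    by (rule cdir_eqI) (auto intro!: bounded_linear_imp_has_derivative bounded_linear_vec_nth)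
   thus ?thesis using row[of k] by (simp only: \<Psi>k(4)[OF k])
  qed
  hence vU: "v \<in> coord_space U" by (simp add: coord_space_def)
  have "rdot (M $ k) v = 0" if kU: "k \<in> U" for k
  proof -
   consider "k = k0" | "k = k1" | "k \<in> U - {k0, k1}" using kU by blast
   thus ?thesis
   proof cases
    case 1
    have "rdot (M $ k0) v = cdir (%s. \<Xi> s $ Some j) 0 v"
     using Mr vU cdir_on_U[OF cholv_nth[OF \<Xi>] vU eps_axis] by simp
    thus ?thesis using row[of k0] 1 by (simp only: \<Psi>k)
   next
    case 2
    have "rdot (M $ k1) v = cdir (%s. zhat (W s)) 0 v"
     using Mr vU cdir_on_U[OF chol_zhat vU zhat_axis] by simp
    thus ?thesis using row[of k1] 2 by (simp only: \<Psi>k)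
   next
    case 3
    have n1: "nn k \<ge> 1" using nn 3 by blast
    have "rdot (M $ k) v = cdir (%s. alp (W s) (ii k) (nn k)) 0 v"
     using Mr vU 3 cdir_on_U[OF chol_alp vU alp_axis[OF _ n1]] by simp
    thus ?thesis using row[of k] by (simp only: \<Psi>k(3)[OF 3])
   qed
  qed
  moreover have "rdot (M $ k) v = 0" if k: "k \<notin> U" for k using Moff[rule_format, OF k, of v] vU k by (simp add: coord_space_def)
  ultimately have "(M *v v) $ k = 0" for k unfolding matrix_rdot by blast
  hence "M *v v = 0" by (simp add: vec_eq_iff)
  thus False using M v(1) det_zero_iff_kernel by blast
 qed
 hence inv: "invertible (cjac \<Psi> 0)" by (simp add: invertible_det_nz)
 define Mx where "Mx = (\<Sum>k\<in>(UNIV :: 'm option set). ns k)"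
 \<comment> \<open>Leaves room to define the curve on the disc of radius
   \<open>2 * norm \<tau>0\<close>, which contains the circle through \<open>\<tau>0\<close>: a
   dilation by a factor of modulus at most 2 enlarges norms by at most
   \<open>2 ^ Mx\<close>.\<close>
 define R' where "R' = R / 2 ^ Mx"
 have R': "R' > 0" "R' \<le> R" using R by (auto simp: R'_def field_simps)
 have sub: "ball (0::complex^('m option)) R' \<subseteq> ball 0 R" using R' by auto
 obtain d q where d: "d > 0" and q: "\<forall>y\<in>ball 0 d. \<Psi> (q y) = y \<and> q y \<in> ball 0 R'"
  using cholv_inverse_function[OF cholv_subset[OF \<Psi>c sub] R'(1) \<Psi>0 inv] by blast
 define S where "S = (%l. (ii l, nn l)) ` (U - {k0, k1})"
 have Sf: "finite S" by (simp add: S_def)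
 have Sc: "card S = N"
 proof -
  have "card S = card (U - {k0, k1})" unfolding S_def by (rule card_image[OF inj])
  also have "\<dots> = card U - card {k0, k1}" by (rule card_Diff_subset) (use k0(1) k1(1) in auto)
  finally show ?thesis using cU k01 by simp
 qed
 have S1: "\<forall>(i, n)\<in>S. 1 \<le> n" using nn by (auto simp: S_def)
 have "\<exists>a. laurent_solution f g p c z0 a \<and> (\<forall>(i, n)\<in>S. a i n = \<alpha> i n)" for z0 \<alpha>
 proof -
  define tgt where "tgt = (%\<tau>::complex. \<chi> k. if k = k0 then \<tau> ^ (r + 1) else if k = k1 then \<tau> ^ r * z0
    else if k \<in> U then \<tau> ^ nn k * \<alpha> (ii k) (nn k) else 0)"
  have "continuous_on UNIV tgt" unfolding tgt_def
  proof (rule continuous_on_vec_lambda)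
   fix k show "continuous_on UNIV (%\<tau>::complex. if k = k0 then \<tau> ^ (r + 1) else if k = k1 then \<tau> ^ r * z0
    else if k \<in> U then \<tau> ^ nn k * \<alpha> (ii k) (nn k) else 0)"
    by (cases "k = k0"; cases "k = k1"; cases "k \<in> U") (auto intro!: continuous_intros)
  qed
  hence "isCont tgt 0" by (simp add: continuous_on_eq_continuous_at)
  moreover have "tgt 0 = 0"
  proof -
   have "tgt 0 $ k = 0" for k
    using nn r_pos by (cases "k = k0"; cases "k = k1"; cases "k \<in> U") (force simp: tgt_def)+
   thus ?thesis by (simp add: vec_eq_iff)
  qed
  ultimately obtain d' where d': "d' > 0" "\<And>\<tau>. dist \<tau> 0 < d' ==> dist (tgt \<tau>) 0 < d"
   unfolding continuous_at_eps_delta using d by metis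
  define \<tau>0 :: complex where "\<tau>0 = of_real (d' / 2)"
  have \<tau>0: "\<tau>0 ~= 0" "norm \<tau>0 > 0" using d'(1) by (auto simp: \<tau>0_def)
  have "tgt \<tau>0 \<in> ball 0 d" using d'(2)[of \<tau>0] d'(1) by (simp add: \<tau>0_def)
  then obtain s where s: "\<Psi> s = tgt \<tau>0" "s \<in> ball 0 R'" using q by blast
  define Y where "Y = (%\<tau>. \<Xi> (dil (\<tau> / \<tau>0) s))"
  define \<rho> where "\<rho> = 2 * norm \<tau>0"
  have \<rho>: "\<rho> > 0" "norm \<tau>0 < \<rho>" using \<tau>0 by (auto simp: \<rho>_def)
  have din: "dil (\<tau> / \<tau>0) s \<in> ball 0 R" if t: "\<tau> \<in> ball 0 \<rho>" for \<tau>
  proof -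
   have "norm (\<tau> / \<tau>0) \<le> 2" using t \<tau>0 by (simp add: \<rho>_def norm_divide field_simps)
   hence "norm (dil (\<tau> / \<tau>0) s) \<le> 2 ^ Mx * norm s" unfolding Mx_def by (rule norm_dil) simp
   also have "\<dots> < 2 ^ Mx * R'" using s(2) by (intro mult_strict_left_mono) auto
   finally show ?thesis by (simp add: R'_def)
  qed
  have Yin: "Y \<tau> \<in> ball ys RV" if "\<tau> \<in> ball 0 \<rho>" for \<tau> unfolding Y_def by (rule \<Xi>_in[OF din[OF that]])
  have Yd: "\<exists>D. (Y has_derivative (%h. h *s D)) (at \<tau>) \<and> \<tau> *s D = V (Y \<tau>)" if t: "\<tau> \<in> ball 0 \<rho>" for \<tau>
  proof -
   let ?x = "dil (\<tau> / \<tau>0) s"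
   define D where "D = (\<chi> k. if k \<in> U then of_nat (ns k) * (\<tau> / \<tau>0) ^ (ns k - 1) / \<tau>0 * s $ k else 0)"
   have "((%\<tau>. dil (\<tau> / \<tau>0) s) has_derivative (%h. h *s D)) (at \<tau>)"
   proof (rule vec_curve_derivative)
    fix k
    have "((%\<tau>. (\<tau> / \<tau>0) ^ ns k * s $ k) has_field_derivative of_nat (ns k) * (\<tau> / \<tau>0) ^ (ns k - 1) / \<tau>0 * s $ k) (at \<tau>)"
     using \<tau>0(1) by (auto intro!: derivative_eq_intros)
    thus "((%\<tau>. dil (\<tau> / \<tau>0) s $ k) has_field_derivative D $ k) (at \<tau>)"
     by (cases "k \<in> U") (simp_all add: dil_def D_def)
   qed
   from has_derivative_compose[OF this cholv_deriv[OF \<Xi> din[OF t]]]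
   have 1: "(Y has_derivative (%h. h *s (cjac \<Xi> ?x *v D))) (at \<tau>)" unfolding Y_def by (simp add: matrix_vec_smult)
   have "\<tau> *s D = (\<chi> k. of_nat (ns k) * ?x $ k)"
   proof -
    have pw: "\<tau> * ((\<tau> / \<tau>0) ^ (n - 1) / \<tau>0) = (\<tau> / \<tau>0) ^ n" if "n > 0" for n
     using that by (cases n) (auto simp: field_simps)
    have "(\<tau> *s D) $ k = of_nat (ns k) * ?x $ k" for k
    proof (cases "k \<in> U")
     case True
     have "(\<tau> *s D) $ k = of_nat (ns k) * (\<tau> * ((\<tau> / \<tau>0) ^ (ns k - 1) / \<tau>0)) * s $ k" using True by (simp add: D_def)
     also have "\<tau> * ((\<tau> / \<tau>0) ^ (ns k - 1) / \<tau>0) = (\<tau> / \<tau>0) ^ ns k" by (rule pw[OF ns[OF True]])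
     finally show ?thesis using True by (simp add: dil_def)
    qed (simp add: D_def dil_def)
    thus ?thesis by (simp add: vec_eq_iff)
   qed
   hence "\<tau> *s (cjac \<Xi> ?x *v D) = V (Y \<tau>)"
    using \<Xi>_lin[OF din[OF t] dil_U] by (simp add: Y_def flip: matrix_vec_smult)
   with 1 show ?thesis by blast
  qed
  have Yq: "\<exists>D. ((%\<tau>. Y \<tau> $ k) has_field_derivative D) (at \<tau>) \<and> \<tau> * D = V (Y \<tau>) $ k" if t: "\<tau> \<in> ball 0 \<rho>" for k \<tau>
  proof -
   obtain D where D: "(Y has_derivative (%h. h *s D)) (at \<tau>)" "\<tau> *s D = V (Y \<tau>)" using Yd[OF t] by blast
   have "((%\<tau>. Y \<tau> $ k) has_derivative (%h. (h *s D) $ k)) (at \<tau>)"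
    by (rule bounded_linear.has_derivative[OF bounded_linear_vec_nth D(1)])
   hence "((%\<tau>. Y \<tau> $ k) has_field_derivative D $ k) (at \<tau>)" by (simp add: has_field_derivative_def mult_commute_abs)
   moreover have "\<tau> * D $ k = V (Y \<tau>) $ k" by (simp flip: D(2))
   ultimately show ?thesis by blast
  qed
  have "(%\<tau>. kk (Y \<tau>)) holomorphic_on ball 0 \<rho>"
  proof (rule holomorphicI)
   fix \<tau> :: complex assume t: "\<tau> \<in> ball 0 \<rho>"
   then obtain D where "(Y has_derivative (%h. h *s D)) (at \<tau>)" using Yd[OF t] by blast
   from chol_curve[OF chol_kk_ball Yin[OF t] this] show "\<exists>D. ((%\<tau>. kk (Y \<tau>)) has_field_derivative D) (at \<tau>)" by (rule exI)
  qed
  then obtain T0 where T0: "\<And>\<tau>. \<tau> \<in> ball 0 \<rho> ==> (T0 has_field_derivative kk (Y \<tau>)) (at \<tau>)"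
   using holomorphic_convex_primitive'[OF convex_ball open_ball] at_within_open[OF _ open_ball] by metis
  define T where "T = (%\<tau>. T0 \<tau> - T0 0)"
  have Td: "(T has_field_derivative kk (Y \<tau>)) (at \<tau>)" if "\<tau> \<in> ball 0 \<rho>" for \<tau>
   unfolding T_def using DERIV_diff[OF T0[OF that] DERIV_const] by simp
  have Y\<tau>0: "Y (\<tau>0 * cis th) = W s th" for th using \<tau>0(1) by (simp add: Y_def W_def)
  obtain Ce where Ce: "\<forall>\<tau>\<in>ball 0 \<rho>. Y \<tau> $ Some j = Ce * \<tau> ^ (r + 1)"
  proof -
   \<comment> \<open>The equation for \<epsilon> is decoupled, so \<epsilon> is a multiple of
     \<open>\<tau> ^ (r + 1)\<close>; the prescribed value at \<open>\<tau>0\<close> makes the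
     factor 1.\<close>
   have "\<exists>C. \<forall>\<tau>\<in>ball 0 \<rho>. Y \<tau> $ Some j = C * \<tau> ^ (r + 1)"
    by (rule euler_monomial[OF _ _ \<rho>(1)]) (use Yq[of _ "Some j"] V_j in auto)
   thus ?thesis using that by blast
  qed
  have "Y \<tau>0 $ Some j = \<tau>0 ^ (r + 1)"
  proof -
   have "Y \<tau>0 = \<Xi> s" using \<tau>0(1) by (simp add: Y_def dil_1)
   moreover have "\<Xi> s $ Some j = \<Psi> s $ k0" by (simp add: \<Psi>_def)
   ultimately show ?thesis unfolding s(1) by (simp add: tgt_def)
  qed
  hence "Ce = 1" using Ce \<rho>(2) \<tau>0(1) by simp
  hence Ye: "Y \<tau> $ Some j = \<tau> ^ (r + 1)" if "\<tau> \<in> ball 0 \<rho>" for \<tau> using Ce that by simp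
  \<comment> \<open>Subtracting the particular solution \<open>T \<tau> * \<tau> ^ r\<close> leaves
    an Euler equation. Its constant is the position of the pole, which \<open>zhat\<close> then
    identifies with \<open>z0\<close>.\<close>
  have "\<exists>C. \<forall>\<tau>\<in>ball 0 \<rho>. Y \<tau> $ None - T \<tau> * \<tau> ^ r = C * \<tau> ^ r"
  proof (rule euler_monomial[OF _ r_pos \<rho>(1)])
   fix \<tau> :: complex assume t: "\<tau> \<in> ball 0 \<rho>"
   obtain D where D: "((%\<tau>. Y \<tau> $ None) has_field_derivative D) (at \<tau>)" "\<tau> * D = V (Y \<tau>) $ None" using Yq[OF t] by blast
   have "((%\<tau>. \<tau> ^ r) has_field_derivative of_nat r * \<tau> ^ (r - 1)) (at \<tau>)" by (auto intro!: derivative_eq_intros)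
   from DERIV_diff[OF D(1) DERIV_mult[OF Td[OF t] this]]
   have "((%\<tau>. Y \<tau> $ None - T \<tau> * \<tau> ^ r) has_field_derivative D - (kk (Y \<tau>) * \<tau> ^ r + of_nat r * \<tau> ^ (r - 1) * T \<tau>)) (at \<tau>)" .
   moreover have "\<tau> * (D - (kk (Y \<tau>) * \<tau> ^ r + of_nat r * \<tau> ^ (r - 1) * T \<tau>)) = of_nat r * (Y \<tau> $ None - T \<tau> * \<tau> ^ r)"
   proof -
    have r1: "\<tau> * \<tau> ^ (r - 1) = \<tau> ^ r" using r_pos by (cases r) auto
    have "\<tau> * (D - (kk (Y \<tau>) * \<tau> ^ r + of_nat r * \<tau> ^ (r - 1) * T \<tau>)) = \<tau> * D - kk (Y \<tau>) * (\<tau> * \<tau> ^ r) - of_nat r * T \<tau> * (\<tau> * \<tau> ^ (r - 1))"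
     by (simp add: algebra_simps)
    also have "\<dots> = of_nat r * (Y \<tau> $ None - T \<tau> * \<tau> ^ r)"
     unfolding D(2) V_None Ye[OF t] r1 by (simp add: algebra_simps)
    finally show ?thesis .
   qed
   ultimately show "\<exists>D. ((%\<tau>. Y \<tau> $ None - T \<tau> * \<tau> ^ r) has_field_derivative D) (at \<tau>) \<and> \<tau> * D = of_nat r * (Y \<tau> $ None - T \<tau> * \<tau> ^ r)"
    by blast
  qed
  then obtain z1 where z1: "\<forall>\<tau>\<in>ball 0 \<rho>. Y \<tau> $ None - T \<tau> * \<tau> ^ r = z1 * \<tau> ^ r" by blast
  have sol: "chart_sol z1 Y T \<rho>"
   unfolding chart_sol_def
  proof (intro conjI ballI allI)
   have "dil 0 s = 0" using ns by (auto simp: dil_def vec_eq_iff)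
   thus "Y 0 = ys" by (simp add: Y_def \<Xi>_0)
   show "T 0 = 0" by (simp add: T_def)
   fix \<tau> :: complex assume t: "\<tau> \<in> ball 0 \<rho>"
   show "Y \<tau> $ None = (z1 + T \<tau>) * \<tau> ^ r" using z1[rule_format, OF t] by (simp add: algebra_simps)
   show "\<exists>D. ((%t. Y t $ k) has_field_derivative D) (at \<tau>) \<and> \<tau> * D = V (Y \<tau>) $ k" for k by (rule Yq[OF t])
  qed (rule \<rho> Yin Td Ye; assumption)+
  have "zhat (W s) = \<tau>0 ^ r * z1" using zhat_chart_sol[OF sol \<rho>(2) \<tau>0(1)] by (simp only: Y\<tau>0)
  moreover have "zhat (W s) = \<Psi> s $ k1" using k01 by (simp add: \<Psi>_def)
  moreover have "tgt \<tau>0 $ k1 = \<tau>0 ^ r * z0" using k01 by (simp add: tgt_def)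
  ultimately have z01: "z1 = z0" using \<tau>0(1) by (simp add: s(1))
  obtain a where a: "laurent_solution f g p c z1 a" "linked a Y T" using chart_to_laurent[OF sol] by blast
  have "a i n = \<alpha> i n" if inS: "(i, n) \<in> S" for i n
  proof -
   obtain l where l: "l \<in> U - {k0, k1}" "i = ii l" "n = nn l" using inS unfolding S_def by blast
   have n1: "n \<ge> 1" using nn l by blast
   have "alp (W s) i n = \<tau>0 ^ n * a i n" using alp_chart_sol[OF sol a(2) n1 \<rho>(2) \<tau>0(1), of i] by (simp only: Y\<tau>0)
   moreover have "alp (W s) i n = \<Psi> s $ l" using l by (simp add: \<Psi>_def)
   moreover have "tgt \<tau>0 $ l = \<tau>0 ^ n * \<alpha> i n" using l by (simp add: tgt_def)
   ultimately show ?thesis using \<tau>0(1) by (simp add: s(1))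
  qed
  thus ?thesis using a(1) z01 by blast
 qed
 thus ?thesis unfolding laurent_family_def using Sf Sc S1 by blast
qed
end

section \<open>From a linearization on the graph to diagonal coordinates\<close>

lemma cdir_zero_component:
 fixes q :: "complex^'n::finite => complex"
 assumes "\<And>x. q x = (0::complex)" shows "cdir q y v = 0"
proof -
 have "q = (%_. 0)" using assms by (intro ext)
 moreover have "cdir (%_. 0) y = (%_::complex^'n. 0::complex)" by (rule cdir_eqI) simp_all
 ultimately show ?thesis by simp
qed

text \<open>An eigenbasis of \<open>coord_space U\<close> has as many elements as \<open>U\<close>,
  so it can be indexed by \<open>U\<close> itself, and each index receives its eigenvalue
  \<open>ns k\<close>.\<close>

lemma semisimple_basis:
 fixes A :: "complex^'n::finite^'n"
 assumes ss: "semisimple_on U A" and ev: "\<forall>\<mu>. eigenvalue_on U A \<mu> \<longrightarrow> positive_integer \<mu>"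
 shows "\<exists>v ns. (\<forall>k\<in>U. v k \<in> coord_space U \<and> 0 < (ns k :: nat) \<and> A *v v k = of_nat (ns k) *s v k) \<and>
   (\<forall>s. (\<Sum>k\<in>U. s k *s v k) = 0 \<longrightarrow> (\<forall>k\<in>U. s k = 0)) \<and> (\<forall>x\<in>coord_space U. \<exists>s. x = (\<Sum>k\<in>U. s k *s v k))"
proof -
 obtain B where B: "vec.independent B" "vec.span B = coord_space U" "\<forall>v\<in>B. \<exists>\<mu>. A *v v = \<mu> *s v"
  using ss unfolding semisimple_on_def by blast
 define E where "E = (%k. axis k (1::complex) :: complex^'n) ` U"
 have iE: "inj_on (%k. axis k (1::complex) :: complex^'n) U" by (auto simp: inj_on_def axis_eq_axis)
 have "vec.independent E" by (rule vec.independent_mono[OF independent_cart_basis]) (auto simp: E_def cart_basis_def)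
 hence "vec.dim (vec.span E) = card U" unfolding vec.dim_span_eq_card_independent[OF \<open>vec.independent E\<close>]
  unfolding E_def by (rule_tac card_image[OF iE])
 moreover have "vec.span E = coord_space U"
 proof
  show "vec.span E \<subseteq> coord_space U"
   by (rule vec.span_minimal) (auto simp: E_def coord_space_def axis_def vec.subspace_def)
  show "coord_space U \<subseteq> vec.span E"
  proof
   fix x :: "complex^'n" assume x: "x \<in> coord_space U"
   have "x = (\<Sum>k\<in>UNIV. x $ k *s axis k 1)" by (rule vec_expand_axis)
   also have "\<dots> = (\<Sum>k\<in>U. x $ k *s axis k 1)"
    by (rule sum.mono_neutral_right) (use x in \<open>auto simp: coord_space_def\<close>)
   also have "\<dots> \<in> vec.span E" by (intro vec.span_sum vec.span_scale vec.span_base) (auto simp: E_def)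
   finally show "x \<in> vec.span E" .
  qed
 qed
 ultimately have "card B = card U" using vec.dim_span_eq_card_independent[OF B(1)] B(2) by simp
 moreover have fB: "finite B" by (rule vec.finiteI_independent[OF B(1)])
 ultimately obtain v where v: "bij_betw v U B" using finite_same_card_bij[of U B] by auto
 have vB: "v k \<in> B" if "k \<in> U" for k using v that by (auto simp: bij_betw_def)
 have "\<exists>n::nat. 0 < n \<and> A *v v k = of_nat n *s v k" if k: "k \<in> U" for k
 proof -
  obtain \<mu> where \<mu>: "A *v v k = \<mu> *s v k" using B(3) vB[OF k] by blast
  have "v k ~= 0" using vec.dependent_zero[of B] B(1) vB[OF k] by auto
  moreover have "v k \<in> coord_space U" using vB[OF k] vec.span_base B(2) by blast
  ultimately have "eigenvalue_on U A \<mu>" using \<mu> unfolding eigenvalue_on_def by blast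
  thus ?thesis using ev \<mu> unfolding positive_integer_def by blast
 qed
 then obtain ns where ns: "\<And>k. k \<in> U ==> 0 < (ns k :: nat) \<and> A *v v k = of_nat (ns k) *s v k" by metis
 have sumB: "(\<Sum>w\<in>B. s w *s w) = (\<Sum>k\<in>U. s (v k) *s v k)" for s
  by (rule sum.reindex_bij_betw[OF v, symmetric])
 have "s k = 0" if s: "(\<Sum>k\<in>U. s k *s v k) = 0" and k: "k \<in> U" for s k
 proof -
  define s' where "s' = (%w. s (the_inv_into U v w))"
  have inj: "inj_on v U" using v by (simp add: bij_betw_def)
  have s'v: "s' (v k) = s k" if "k \<in> U" for k using that by (simp add: s'_def the_inv_into_f_f[OF inj])
  have "(\<Sum>w\<in>B. s' w *s w) = (\<Sum>k\<in>U. s k *s v k)" unfolding sumB by (rule sum.cong) (simp_all add: s'v)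
  hence "(\<Sum>w\<in>B. s' w *s w) = 0" using s by simp
  hence "s' (v k) = 0" using vec.independentD[OF B(1) fB order_refl _ vB[OF k], of s'] by blast
  thus ?thesis using s'v[OF k] by simp
 qed
 moreover have "\<exists>s. x = (\<Sum>k\<in>U. s k *s v k)" if "x \<in> coord_space U" for x
 proof -
  have "x \<in> range (%u. \<Sum>w\<in>B. u w *s w)" using that vec.span_finite[OF fB] B(2) by simp
  then obtain u where "x = (\<Sum>w\<in>B. u w *s w)" by blast
  thus ?thesis unfolding sumB by (rule exI[of _ "%k. u (v k)"])
 qed
 moreover have "v k \<in> coord_space U" if "k \<in> U" for k using vB[OF that] vec.span_base B(2) by blast
 ultimately show ?thesis using ns by (intro exI[of _ v] exI[of _ ns]) blast
qed

context split_chart begin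

text \<open>\<open>q\<close> is a left eigenvector of \<open>J\<close> whose eigenvalue has positive
  real part. On the stable part \<open>A - \<mu>\<close> is invertible, so \<open>q\<close> vanishes
  there and is determined by its values on the unstable eigenvectors. Used contrapositively, a
  nonzero \<open>q\<close> must be nonzero on one of them; this produces \<open>k0\<close> and
  \<open>k1\<close>.\<close>

lemma left_functional:
 assumes add: "\<And>x y. q (x + y) = q x + q y" and sc: "\<And>a x. q (a *s x) = a * q x" and qJ: "\<And>y. q (J *v y) = \<mu> * q y"
  and \<mu>: "0 < Re \<mu>" and stab: "\<And>\<mu>. eigenvalue_on (- U) A \<mu> ==> Re \<mu> \<le> 0"
  and span: "\<And>x. x \<in> coord_space U ==> \<exists>s. x = (\<Sum>k\<in>U. s k *s v k)"
  and zero: "\<And>k. k \<in> U ==> q (Pinv *v v k) = (0::complex)"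
 shows "q y = 0"
proof -
 have q0: "q 0 = 0" using sc[of 0 0] by simp
 have qsum: "q (\<Sum>k\<in>I. F k) = (\<Sum>k\<in>I. q (F k))" for I and F :: "'m option => complex^('m option)"
  by (induction I rule: infinite_finite_induct) (simp_all add: add q0)
 have qd: "q (x - y) = q x - q y" for x y using add[of "x - y" y] by simp
 have qU: "q (Pinv *v x) = 0" if x: "x \<in> coord_space U" for x
 proof -
  obtain s where "x = (\<Sum>k\<in>U. s k *s v k)" using span[OF x] by blast
  thus ?thesis by (simp add: matrix_vec_sum matrix_vec_smult qsum sc zero)
 qed
 \<comment> \<open>\<open>A - \<mu>\<close> on the stable coordinates, completed by identity rows to
   a matrix of full size.\<close>
 define B :: "complex^('m option)^('m option)" where
  "B = (\<chi> i l. if i \<in> U then (if i = l then 1 else 0) else A $ i $ l - (if i = l then \<mu> else 0))"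
 have B: "(B *v x) $ i = (if i \<in> U then x $ i else (A *v x) $ i - \<mu> * x $ i)" for x i
  unfolding B_def matrix_vector_mult_def
  by (simp add: left_diff_distrib sum_subtractf if_distrib[of "%t. t * _"] cong: if_cong)
 have S: "A *v x - \<mu> *s x = B *v x" if x: "x \<in> coord_space (- U)" for x
 proof -
  have "(A *v x - \<mu> *s x) $ i = (B *v x) $ i" for i
   using A_S[OF x] x by (simp add: B coord_space_def)
  thus ?thesis by (simp only: vec_eq_iff) blast
 qed
 have SU: "x \<in> coord_space (- U)" if "B *v x \<in> coord_space (- U)" for x
  using that B[of x] by (auto simp: coord_space_def)
 have "det B ~= 0"
 proof
  assume "det B = 0"
  then obtain x where x: "x ~= 0" "B *v x = 0" unfolding det_zero_iff_kernel by blast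
  have "x \<in> coord_space (- U)" by (rule SU) (simp add: x(2) coord_space_def)
  moreover from S[OF this] x(2) have "A *v x = \<mu> *s x" by simp
  ultimately have "eigenvalue_on (- U) A \<mu>" using x(1) unfolding eigenvalue_on_def by blast
  thus False using stab \<mu> by fastforce
 qed
 then obtain C where C: "B ** C = mat 1" using invertible_det_nz[of B] unfolding invertible_def by blast
 have qS: "q (Pinv *v x) = 0" if x: "x \<in> coord_space (- U)" for x
 proof -
  let ?x = "C *v x"
  have Bx: "B *v ?x = x" by (simp add: matrix_vector_mul_assoc C)
  hence xS: "?x \<in> coord_space (- U)" using SU[of ?x] x by simp
  have "Pinv *v x = Pinv *v (A *v ?x - \<mu> *s ?x)" by (simp only: S[OF xS] Bx)
  also have "\<dots> = Pinv *v (A *v ?x) - \<mu> *s (Pinv *v ?x)" by (simp only: matrix_vector_mult_diff_distrib matrix_vec_smult)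
  also have "Pinv *v (A *v ?x) = J *v (Pinv *v ?x)" by (simp only: A_mul P_Pinv_mul)
  finally show ?thesis by (simp only: qd qJ sc) simp
 qed
 have "P *v y = coord_proj U (P *v y) + coord_proj (- U) (P *v y)" by (simp add: vec_eq_iff)
 hence "Pinv *v (P *v y) = Pinv *v coord_proj U (P *v y) + Pinv *v coord_proj (- U) (P *v y)"
  by (metis matrix_vector_right_distrib)
 from arg_cong[OF this, of q] show ?thesis
  by (simp only: P_Pinv_mul add qU[OF coord_proj_simps(3)] qS[OF coord_proj_simps(3)] add_0)
qed

text \<open>The hypothesis \<open>inv\<close> says that \<open>iota\<close> carries the reduced
  field to \<open>V\<close>, that is, that the graph is invariant. The inverse \<open>th\<close> of
  the linearization, preceded by a diagonalization \<open>Om\<close> of \<open>L\<close> and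
  followed by \<open>iota\<close>, is the map required by \<open>linear_orbits\<close>.\<close>

theorem sufficient_split:
 assumes ss: "semisimple_on U A" and ev: "\<And>\<mu>. eigenvalue_on U A \<mu> ==> positive_integer \<mu>"
  and lin: "linearizable_on U (unstable_field U A (conj_map P (nonlinear_part V ys)) \<phi>)" and cU: "card U = N + 2"
  and stab: "\<And>\<mu>. eigenvalue_on (- U) A \<mu> ==> Re \<mu> \<le> 0"
  and d: "d > 0" "d \<le> RI" and inv: "\<And>y. y \<in> coord_space U ==> y \<in> ball 0 d ==> cjac iota y *v Hred y = V (iota y)"
 shows "laurent_family f g p c N"
proof -
 have ev': "\<forall>\<mu>. eigenvalue_on U A \<mu> \<longrightarrow> positive_integer \<mu>" using ev by blast
 obtain v ns where vs: "\<forall>k\<in>U. v k \<in> coord_space U \<and> 0 < (ns k :: nat) \<and> A *v v k = of_nat (ns k) *s v k"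
  and vi: "\<forall>s. (\<Sum>k\<in>U. s k *s v k) = 0 \<longrightarrow> (\<forall>k\<in>U. s k = 0)" and vspan: "\<forall>x\<in>coord_space U. \<exists>s. x = (\<Sum>k\<in>U. s k *s v k)"
  using semisimple_basis[OF ss ev'] by (elim exE conjE) (rule that; assumption)
 have vU: "v k \<in> coord_space U" and ns: "0 < ns k" and Av: "A *v v k = of_nat (ns k) *s v k" if "k \<in> U" for k using vs that by blast+
 obtain \<psi>0 th0 L e0 where an: "analytic_near_0 U \<psi>0" "analytic_near_0 U th0" and z: "\<psi>0 0 = 0" "th0 0 = 0"
  and im: "\<psi>0 ` coord_space U \<subseteq> coord_space U" "th0 ` coord_space U \<subseteq> coord_space U" and e0: "e0 > 0"
  and conj: "\<forall>y\<in>coord_space U \<inter> ball 0 e0. th0 (\<psi>0 y) = y \<and> \<psi>0 (th0 y) = y \<and>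
    frechet_derivative (%x. \<psi>0 (coord_proj U x)) (at y) (unstable_field U A (conj_map P (nonlinear_part V ys)) \<phi> y) = L *v \<psi>0 y"
  using lin unfolding linearizable_on_def by (elim exE conjE) (rule that; assumption)
 define \<psi> where "\<psi> = (%x. \<psi>0 (coord_proj U x))"
 define th where "th = (%x. th0 (coord_proj U x))"
 obtain e1 where e1: "e1 > 0" "cholv (ball 0 e1) \<psi>" using an(1) unfolding analytic_near_0_cholv \<psi>_def by blast
 obtain e2 where e2: "e2 > 0" "cholv (ball 0 e2) th" using an(2) unfolding analytic_near_0_cholv th_def by blast
 have \<psi>U: "\<psi> x \<in> coord_space U" and thU: "th x \<in> coord_space U" for x
  using im by (auto simp: \<psi>_def th_def)
 have \<psi>0': "\<psi> 0 = 0" and th0': "th 0 = 0" by (simp_all add: \<psi>_def th_def z)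
 have thproj: "th (coord_proj U x) = th x" and \<psi>proj: "\<psi> (coord_proj U x) = \<psi> x" for x by (simp_all add: \<psi>_def th_def)
 define E where "E = min (min e0 e1) (min e2 d)"
 have E: "E > 0" "E \<le> e0" "E \<le> e1" "E \<le> e2" "E \<le> d" using e0 e1(1) e2(1) d(1) by (auto simp: E_def)
 have pin: "coord_proj U x \<in> ball 0 t" if "x \<in> ball 0 t" for x :: "complex^('m option)" and t
  using that le_less_trans[OF norm_coord_proj_le[of U x]] by simp
 have tp: "th (\<psi> x) = coord_proj U x" and pt: "\<psi> (th x) = coord_proj U x" if "x \<in> ball 0 E" for x
 proof -
  have "coord_proj U x \<in> coord_space U \<inter> ball 0 e0" using pin[OF that] E by auto
  hence "th0 (\<psi>0 (coord_proj U x)) = coord_proj U x \<and> \<psi>0 (th0 (coord_proj U x)) = coord_proj U x" using conj by blast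
  thus "th (\<psi> x) = coord_proj U x" "\<psi> (th x) = coord_proj U x"
   using coord_proj_id[OF \<psi>U[of x]] coord_proj_id[OF thU[of x]] by (simp_all add: th_def \<psi>_def)
 qed
 have fr: "cjac \<psi> y *v Hred y = L *v \<psi> y" if y: "y \<in> coord_space U" "y \<in> ball 0 E" for y
 proof -
  have y1: "y \<in> ball 0 e1" using y(2) E by auto
  have "frechet_derivative \<psi> (at y) (Hred y) = L *v \<psi>0 y"
  proof -
   have "y \<in> coord_space U \<inter> ball 0 e0" using y E by auto
   from conj[rule_format, OF this] show ?thesis unfolding \<psi>_def field_Hred[OF y(1)] by (elim conjE)
  qed
  moreover have "frechet_derivative \<psi> (at y) = (*v) (cjac \<psi> y)"
   by (rule frechet_derivative_at[symmetric]) (rule cholv_deriv[OF e1(2) y1])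
  ultimately show ?thesis by (simp add: \<psi>_def coord_proj_id[OF y(1)])
 qed
 have cpd: "(coord_proj U has_derivative coord_proj U) (at x)" for x :: "complex^('m option)"
  by (rule bounded_linear_imp_has_derivative[OF bounded_linear_coord_proj])
 have cjU: "cjac \<psi> y *v x \<in> coord_space U" if "y \<in> ball 0 e1" for x y
 proof -
  have "(cjac \<psi> y *v x) $ i = 0" if i: "i \<notin> U" for i
   unfolding cjac_nth[OF e1(2) \<open>y \<in> ball 0 e1\<close>]
   by (rule cdir_zero_component) (use \<psi>U i in \<open>auto simp: coord_space_def\<close>)
  thus ?thesis by (simp add: coord_space_def)
 qed
 have inv1: "cjac th (\<psi> y) *v (cjac \<psi> y *v x) = coord_proj U x" if y: "y \<in> ball 0 E" "\<psi> y \<in> ball 0 e2" for x y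
 proof -
  have y1: "y \<in> ball 0 e1" using y(1) E by auto
  have 1: "((%x. th (\<psi> x)) has_derivative (%x. cjac th (\<psi> y) *v (cjac \<psi> y *v x))) (at y)"
   by (rule has_derivative_compose[OF cholv_deriv[OF e1(2) y1] cholv_deriv[OF e2(2) y(2)]])
  have "((%x. th (\<psi> x)) has_derivative coord_proj U) (at y)"
   by (rule has_derivative_transform_within_open[OF cpd open_ball y(1)]) (simp add: tp)
  from has_derivative_unique[OF 1 this] show ?thesis by metis
 qed
 define Q where "Q = cjac \<psi> 0"
 have z1: "(0::complex^('m option)) \<in> ball 0 e1" and z2: "(0::complex^('m option)) \<in> ball 0 e2" and zE: "(0::complex^('m option)) \<in> ball 0 E" using e1 e2 E by auto
 define \<omega> where "\<omega> = (%k. Q *v v k)"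
 have \<omega>U: "\<omega> k \<in> coord_space U" for k unfolding \<omega>_def Q_def by (rule cjU[OF z1])
 have D\<omega>: "cjac th 0 *v \<omega> k = v k" if "k \<in> U" for k
  using inv1[OF zE, of "v k"] z2 coord_proj_id[OF vU[OF that]] by (simp add: \<psi>0' \<omega>_def Q_def)
 \<comment> \<open>Linearizability provides some matrix \<open>L\<close>, of unknown form. The
   first-order part of the conjugacy ties it to \<open>A\<close>, so it inherits an eigenbasis from
   the semisimplicity of \<open>A\<close>.\<close>
 have LQ: "L *v (Q *v x) = Q *v (A *v x)" if x: "x \<in> coord_space U" for x
 proof -
  have "(Q *v (A *v x)) $ i = (L *v (Q *v x)) $ i" for i
  proof -
   have ERI: "ball (0::complex^('m option)) E \<subseteq> ball 0 RI" "ball (0::complex^('m option)) E \<subseteq> ball 0 e1" using E d by auto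
   have \<psi>E: "cholv (ball 0 E) \<psi>" and HE: "cholv (ball 0 E) Hred"
    by (rule cholv_subset[OF e1(2) ERI(2)], rule cholv_subset[OF cholv_Hred ERI(1)])
   have LE: "cholv (ball 0 E) (%y. L *v \<psi> y)" by (rule cholv_matrix[OF \<psi>E])
   have "cdir (%y. \<psi> y $ i) 0 (cjac Hred 0 *v x) = cdir (%y. (L *v \<psi> y) $ i) 0 x"
   proof (rule semiconjugacy_linear_part[OF cholv_nth[OF \<psi>E] E(1) HE Hred_0 cholv_nth[OF LE]])
    fix y :: "complex^('m option)" assume y: "y \<in> ball 0 E"
    have yp: "coord_proj U y \<in> ball 0 E" by (rule pin[OF y])
    have y1: "y \<in> ball 0 e1" "coord_proj U y \<in> ball 0 e1" using y yp E by auto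
    have "((%x. \<psi> (coord_proj U x)) has_derivative (%x. cjac \<psi> (coord_proj U y) *v coord_proj U x)) (at y)"
     by (rule has_derivative_compose[OF cpd cholv_deriv[OF e1(2) y1(2)]])
    hence "(\<psi> has_derivative (%x. cjac \<psi> (coord_proj U y) *v coord_proj U x)) (at y)" by (simp add: \<psi>proj)
    from has_derivative_unique[OF this cholv_deriv[OF e1(2) y1(1)]]
    have "cjac \<psi> y *v Hred y = cjac \<psi> (coord_proj U y) *v coord_proj U (Hred y)" by metis
    also have "coord_proj U (Hred y) = Hred (coord_proj U y)" by (simp add: Hred_def iota_proj)
    also have "cjac \<psi> (coord_proj U y) *v Hred (coord_proj U y) = L *v \<psi> y" using fr[OF _ yp] by (simp add: \<psi>proj)
    finally show "cdir (%y. \<psi> y $ i) y (Hred y) = (L *v \<psi> y) $ i" by (simp flip: cjac_nth[OF e1(2) y1(1)])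
   qed
   moreover have "cjac (%y. L *v \<psi> y) 0 *v x = L *v (Q *v x)"
   proof -
    have "((%y. L *v \<psi> y) has_derivative (%x. L *v (Q *v x))) (at 0)" unfolding Q_def
     by (rule bounded_linear.has_derivative[OF matrix_vector_mul_bounded_linear cholv_deriv[OF e1(2) z1]])
    from has_derivative_unique[OF cholv_deriv[OF LE zE] this] show ?thesis by metis
   qed
   ultimately show ?thesis
    by (simp add: jac_Hred[OF x] Q_def flip: cjac_nth[OF e1(2) z1] cjac_nth[OF LE zE])
  qed
  thus ?thesis by (simp add: vec_eq_iff)
 qed
 have L\<omega>: "L *v \<omega> k = of_nat (ns k) *s \<omega> k" if "k \<in> U" for k
  unfolding \<omega>_def LQ[OF vU[OF that]] Av[OF that] by (rule matrix_vec_smult)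
 have Dfield: "cjac th w *v (L *v w) = Hred (th w)" if w: "w \<in> coord_space U" "w \<in> ball 0 E" "th w \<in> ball 0 E" for w
 proof -
  have pw: "\<psi> (th w) = w" using pt[OF w(2)] coord_proj_id[OF w(1)] by simp
  have w2: "\<psi> (th w) \<in> ball 0 e2" using w(2) E pw by auto
  have "cjac th w *v (L *v w) = cjac th (\<psi> (th w)) *v (cjac \<psi> (th w) *v Hred (th w))" using fr[OF thU w(3)] by (simp add: pw)
  also have "\<dots> = coord_proj U (Hred (th w))" by (rule inv1[OF w(3) w2])
  finally show ?thesis by (simp add: Hred_def)
 qed
 define Om :: "complex^('m option)^('m option)" where "Om = (\<chi> i k. if k \<in> U then \<omega> k $ i else 0)"
 have Om: "Om *v s = (\<Sum>k\<in>U. s $ k *s \<omega> k)" for s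
 proof -
  have "(Om *v s) $ i = (\<Sum>k\<in>U. s $ k *s \<omega> k) $ i" for i
  proof -
   have "(Om *v s) $ i = (\<Sum>k\<in>UNIV. Om $ i $ k * s $ k)" by (simp add: matrix_vector_mult_def)
   also have "\<dots> = (\<Sum>k\<in>U. Om $ i $ k * s $ k)" by (rule sum.mono_neutral_right) (auto simp: Om_def)
   also have "\<dots> = (\<Sum>k\<in>U. s $ k * \<omega> k $ i)" by (rule sum.cong) (simp_all add: Om_def mult.commute)
   finally show ?thesis by simp
  qed
  thus ?thesis by (simp add: vec_eq_iff)
 qed
 have OmU: "Om *v s \<in> coord_space U" for s
  using \<omega>U unfolding Om by (auto simp: coord_space_def)
 define \<Xi> where "\<Xi> = (%s. iota (th (Om *v s)))"
 have "isCont (%s. th (Om *v s)) 0"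
 proof (rule isCont_o2[where f = "(*v) Om" and g = th])
  show "isCont ((*v) Om) 0" by (rule linear_continuous_at[OF matrix_vector_mul_bounded_linear])
  show "isCont th (Om *v 0)" using has_derivative_continuous[OF cholv_deriv[OF e2(2) z2]] by simp
 qed
 then obtain d1 where d1: "d1 > 0" "\<And>s. dist s 0 < d1 ==> dist (th (Om *v s)) 0 < E"
  unfolding continuous_at_eps_delta using E(1) th0' by (metis matrix_vector_mult_0_right)
 have "isCont ((*v) Om) 0" by (rule linear_continuous_at[OF matrix_vector_mul_bounded_linear])
 then obtain d2 where d2: "d2 > 0" "\<And>s. dist s 0 < d2 ==> dist (Om *v s) 0 < E"
  unfolding continuous_at_eps_delta using E(1) by (metis matrix_vector_mult_0_right)
 define R where "R = min d1 d2"
 have R: "R > 0" using d1 d2 by (simp add: R_def)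
 have in1: "Om *v s \<in> ball 0 E" "th (Om *v s) \<in> ball 0 E" if "s \<in> ball 0 R" for s
  using d1(2)[of s] d2(2)[of s] that by (auto simp: R_def)
 have inRI: "th (Om *v s) \<in> ball 0 RI" "Om *v s \<in> ball 0 e2" if "s \<in> ball 0 R" for s
  using in1[OF that] E d by auto
 have \<Xi>d: "(\<Xi> has_derivative (%x. cjac iota (th (Om *v s)) *v (cjac th (Om *v s) *v (Om *v x)))) (at s)" if s: "s \<in> ball 0 R" for s
  unfolding \<Xi>_def
  by (rule has_derivative_compose[OF has_derivative_compose[OF bounded_linear_imp_has_derivative[OF matrix_vector_mul_bounded_linear]
    cholv_deriv[OF e2(2) inRI(2)[OF s]]] cholv_deriv[OF RI(2) inRI(1)[OF s]]])
 have \<Xi>c: "cholv (ball 0 R) \<Xi>"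
 proof (rule cholvI)
  fix s :: "complex^('m option)" assume s: "s \<in> ball 0 R"
  show "\<exists>B. (\<Xi> has_derivative (*v) B) (at s)"
   by (rule exI[of _ "cjac iota (th (Om *v s)) ** (cjac th (Om *v s) ** Om)"])
     (use \<Xi>d[OF s] in \<open>simp add: matrix_vector_mul_assoc\<close>)
 qed
 have \<Xi>j: "cjac \<Xi> s *v x = cjac iota (th (Om *v s)) *v (cjac th (Om *v s) *v (Om *v x))" if s: "s \<in> ball 0 R" for s x
  using has_derivative_unique[OF cholv_deriv[OF \<Xi>c s] \<Xi>d[OF s]] by metis
 have z0: "(0::complex^('m option)) \<in> ball 0 R" using R by simp
 define e where "e = (%k. Pinv *v v k)"
 have ek: "cjac \<Xi> 0 *v axis k 1 = e k" if k: "k \<in> U" for k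
 proof -
  have "Om *v axis k 1 = (\<Sum>l\<in>U. (if l = k then 1 else 0) *s \<omega> l)" unfolding Om by (rule sum.cong) (auto simp: axis_def)
  also have "\<dots> = (\<Sum>l\<in>U. if l = k then \<omega> l else 0)" by (rule sum.cong) auto
  also have "\<dots> = \<omega> k" using k by simp
  finally have 1: "Om *v axis k 1 = \<omega> k" .
  have "cjac iota 0 *v x = Pinv *v coord_proj U x" for x
   using has_derivative_unique[OF cholv_deriv[OF RI(2)] iota_deriv] RI(1) by (metis centre_in_ball)
  thus ?thesis using \<Xi>j[OF z0] 1 D\<omega>[OF k] coord_proj_id[OF vU[OF k]] by (simp add: th0' e_def)
 qed
 have eJ: "J *v e k = of_nat (ns k) *s e k" if "k \<in> U" for k
 proof -
  have "P *v (J *v e k) = P *v (of_nat (ns k) *s e k)" using Av[OF that] by (simp add: e_def A_mul matrix_vec_smult)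
  thus ?thesis by (metis P_Pinv_mul(2))
 qed
 have span': "\<exists>s. x = (\<Sum>k\<in>U. s k *s v k)" if "x \<in> coord_space U" for x using vspan that by blast
 \<comment> \<open>The coordinate \<epsilon> is a left eigenvector of \<open>J\<close> for
   \<open>r + 1\<close>; it vanishes on eigenvectors of other weights, so it must be nonzero on one
   of weight \<open>r + 1\<close>.\<close>
 have "\<exists>k0\<in>U. ns k0 = r + 1 \<and> e k0 $ Some j ~= 0"
 proof (rule ccontr)
  assume no: "\<not> ?thesis"
  have "(axis (Some j) (1::complex)) $ Some j = 0"
  proof (rule left_functional[where q = "%y. y $ Some j" and \<mu> = "of_nat (r + 1)" and v = v])
   show "(J *v y) $ Some j = of_nat (r + 1) * y $ Some j" for y by (rule J_eps)
   fix k assume k: "k \<in> U"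
   show "(Pinv *v v k) $ Some j = 0"
   proof (cases "ns k = r + 1")
    case True thus ?thesis using no k by (auto simp: e_def)
   next
    case False
    have "e k $ Some j = 0" by (rule eigen_eps[OF eJ[OF k]]) (use False in \<open>simp only: of_nat_eq_iff not_False_eq_True\<close>)
    thus ?thesis by (simp add: e_def)
   qed
  qed (use stab span' in \<open>auto\<close>)
  thus False by (simp add: axis_def)
 qed
 then obtain k0 where k0: "k0 \<in> U" "ns k0 = r + 1" "e k0 $ Some j ~= 0" by blast
 have "\<exists>k1\<in>U. ns k1 = r \<and> e k1 $ None ~= 0"
 proof (rule ccontr)
  assume no: "\<not> ?thesis"
  \<comment> \<open>The left eigenvector of \<open>J\<close> for \<open>r\<close>: subtracting
    \<open>b\<close> times \<epsilon> compensates the off-diagonal entry \<open>b\<close> in the row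
    of \<open>Z\<close>.\<close>
  let ?q = "%y. y $ None - b * y $ Some j"
  have qJ: "?q (J *v y) = of_nat r * ?q y" for y by (simp add: J_Z J_eps algebra_simps)
  have "?q (axis None 1) = 0"
  proof (rule left_functional[where q = ?q and \<mu> = "of_nat r" and v = v])
   show "?q (J *v y) = of_nat r * ?q y" for y by (rule qJ)
   fix k assume k: "k \<in> U"
   have "?q (e k) = 0"
   proof (cases "ns k = r")
    case True
    have n: "ns k ~= r + 1" using True by simp
    have "e k $ Some j = 0" by (rule eigen_eps[OF eJ[OF k]]) (use n in \<open>simp only: of_nat_eq_iff not_False_eq_True\<close>)
    thus ?thesis using no k True by auto
   next
    case False
    have "?q (J *v e k) = of_nat (ns k) * ?q (e k)" unfolding eJ[OF k] by (simp add: algebra_simps)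
    thus ?thesis unfolding qJ using False by simp
   qed
   thus "?q (Pinv *v v k) = 0" by (simp add: e_def)
  qed (use stab span' r_pos in \<open>auto simp: algebra_simps\<close>)
  thus False by (simp add: axis_def)
 qed
 then obtain k1 where k1: "k1 \<in> U" "ns k1 = r" "e k1 $ None ~= 0" by blast
 interpret lo: linear_orbits f g p r c j b G \<Xi> R U ns e k0 k1
 proof
  show "R > 0" by (rule R)
  show "cholv (ball 0 R) \<Xi>" by (rule \<Xi>c)
  show "\<Xi> 0 = ys" by (simp add: \<Xi>_def th0' iota_0)
  show "\<Xi> s \<in> ball ys RV" if "s \<in> ball 0 R" for s unfolding \<Xi>_def by (rule RI(3)[OF inRI(1)[OF that]])
  show "\<Xi> (coord_proj U s) = \<Xi> s" for s
  proof -
   have "Om *v coord_proj U s = Om *v s" unfolding Om by (rule sum.cong) auto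
   thus ?thesis by (simp add: \<Xi>_def)
  qed
  show "cjac \<Xi> s *v (\<chi> k. of_nat (ns k) * s $ k) = V (\<Xi> s)" if s: "s \<in> ball 0 R" "s \<in> coord_space U" for s
  proof -
   have "Om *v (\<chi> k. of_nat (ns k) * s $ k) = (\<Sum>k\<in>U. s $ k *s (L *v \<omega> k))"
    unfolding Om by (rule sum.cong) (simp_all add: L\<omega> vector_smult_assoc mult.commute)
   also have "\<dots> = L *v (Om *v s)" unfolding Om by (simp add: matrix_vec_sum matrix_vec_smult)
   finally have "cjac \<Xi> s *v (\<chi> k. of_nat (ns k) * s $ k) = cjac iota (th (Om *v s)) *v Hred (th (Om *v s))"
    using \<Xi>j[OF s(1)] Dfield[OF OmU in1[OF s(1)]] by simp
   also have "\<dots> = V (\<Xi> s)" unfolding \<Xi>_def by (rule inv[OF thU]) (use in1(2)[OF s(1)] E in auto)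
   finally show ?thesis .
  qed
  show "v = 0" if v: "v \<in> coord_space U" "(\<Sum>k\<in>U. v $ k *s e k) = 0" for v
  proof -
   have "P *v (\<Sum>k\<in>U. v $ k *s e k) = 0" using v(2) by simp
   hence "v $ k = 0" if "k \<in> U" for k using vi[rule_format, of "%k. v $ k" k] that by (simp add: matrix_vec_sum matrix_vec_smult e_def)
   thus ?thesis using v(1) by (auto simp: vec_eq_iff coord_space_def)
  qed
 qed (use ns ek eJ k0 k1 in auto)
 show ?thesis by (rule lo.sufficient[OF cU])
qed

end

section \<open>The unstable manifold\<close>

lemma at_within_Iic_nontrivial: "at (0::real) within {..0} ~= bot"
proof -
 have "at_left (0::real) ~= bot" by simp
 moreover have "at_left (0::real) \<le> at 0 within {..0}" by (rule at_le) auto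
 ultimately show ?thesis by (metis bot.extremum_uniqueI)
qed

context split_chart begin

abbreviation "Vnew \<equiv> %y. A *v y + conj_map P (nonlinear_part V ys) y"

lemma Vnew: "Vnew y = P *v V (ys + Pinv *v y)"
 by (simp add: conj_map_def nonlinear_part_def matrix_vector_mult_diff_distrib A_mul)

lemma exp_curve:
 fixes w :: "complex => complex^'n::finite"
 assumes "(w has_derivative (%h. h *s D)) (at (\<tau> * exp (of_real t)))"
 shows "((%t. w (\<tau> * exp (of_real t))) has_vector_derivative (\<tau> * exp (of_real t)) *s D) (at t within S)"
proof -
 have "((%z. \<tau> * exp z) has_field_derivative \<tau> * exp (of_real t)) (at (of_real t))" by (auto intro!: derivative_eq_intros)
 from has_vector_derivative_real_field[OF this]
 have "((%t. \<tau> * exp (of_real t)) has_derivative (%h. h *\<^sub>R (\<tau> * exp (of_real t)))) (at t within S)"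
  by (simp add: has_vector_derivative_def)
 from has_derivative_compose[OF this assms]
 have "((%t. w (\<tau> * exp (of_real t))) has_derivative (%h. (h *\<^sub>R (\<tau> * exp (of_real t))) *s D)) (at t within S)" .
 moreover have "(%h. (h *\<^sub>R (\<tau> * exp (of_real t))) *s D) = (%h. h *\<^sub>R ((\<tau> * exp (of_real t)) *s D))"
  by (simp add: vec_eq_iff fun_eq_iff)
 ultimately show ?thesis unfolding has_vector_derivative_def by simp
qed

text \<open>In the time \<open>t = ln \<tau>\<close> a chart solution is a backward orbit tending to the fixed point like \<open>e\<^sup>t\<close>.\<close>

lemma trap:
 assumes graph: "unstable_graph Vnew U \<phi>" and sol: "chart_sol z0 Y T \<rho>"
 shows "\<exists>\<rho>1>0. \<rho>1 \<le> \<rho> \<and> (\<forall>\<tau>\<in>ball 0 \<rho>1. coord_proj (- U) (P *v (Y \<tau> - ys)) = \<phi> (coord_proj U (P *v (Y \<tau> - ys))))"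
proof -
 obtain N where N: "open N" "0 \<in> N" "local_unstable_set Vnew N = {y\<in>N. coord_proj (- U) y = \<phi> (coord_proj U y)}"
  using graph unfolding unstable_graph_def by blast
 define X where "X = (%\<tau>. P *v (Y \<tau> - ys))"
 have \<rho>: "\<rho> > 0" and Y0: "Y 0 = ys" using sol by (auto simp: chart_sol_def)
 have Xd: "\<exists>D. (X has_derivative (%h. h *s D)) (at \<tau>) \<and> \<tau> *s D = Vnew (X \<tau>)" if t: "\<tau> \<in> ball 0 \<rho>" for \<tau>
 proof -
  obtain D where D: "(Y has_derivative (%h. h *s D)) (at \<tau>)" "\<tau> *s D = V (Y \<tau>)" using chart_sol_curve[OF sol t] by blast
  have "((%\<tau>. Y \<tau> - ys) has_derivative (%h. h *s D - 0)) (at \<tau>)" by (intro has_derivative_diff D(1) has_derivative_const)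
  from bounded_linear.has_derivative[OF matrix_vector_mul_bounded_linear[of P] this]
  have "(X has_derivative (%h. h *s (P *v D))) (at \<tau>)" unfolding X_def by (simp add: matrix_vec_smult)
  moreover have "\<tau> *s (P *v D) = Vnew (X \<tau>)" unfolding Vnew X_def by (simp add: D(2) flip: matrix_vec_smult)
  ultimately show ?thesis by blast
 qed
 have X0: "X 0 = 0" by (simp add: X_def Y0)
 obtain D0 where D0: "(X has_derivative (%h. h *s D0)) (at 0)" using Xd[of 0] \<rho> by auto
 have "\<forall>e>0. \<exists>d>0. \<forall>y. norm (y - 0) < d \<longrightarrow> norm (X y - X 0 - (y - 0) *s D0) \<le> e * norm (y - 0)"
  using D0 unfolding has_derivative_at_alt by blast
 \<comment> \<open>Differentiability at 0 bounds \<open>X \<tau>\<close> linearly in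
   \<open>\<tau>\<close>; along \<open>\<tau> * exp t\<close> this becomes exponential decay with
   rate 1, as the local unstable set demands.\<close>
 from this[rule_format, of 1] obtain d1 where d1: "d1 > 0" "\<And>\<tau>. norm \<tau> < d1 ==> norm (X \<tau> - \<tau> *s D0) \<le> norm \<tau>"
  by (auto simp: X0)
 have "isCont X 0" by (rule has_derivative_continuous[OF D0])
 hence "(X \<longlongrightarrow> 0) (at 0)" by (simp add: isCont_def X0)
 hence "\<forall>\<^sub>F \<tau> in at 0. X \<tau> \<in> N" using N by (auto dest: topological_tendstoD)
 then obtain d2 where d2: "d2 > 0" "\<And>\<tau>. \<tau> ~= 0 ==> dist \<tau> 0 < d2 ==> X \<tau> \<in> N" unfolding eventually_at by auto
 define \<rho>1 where "\<rho>1 = min \<rho> (min d1 d2)"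
 have \<rho>1: "\<rho>1 > 0" "\<rho>1 \<le> \<rho>" using \<rho> d1(1) d2(1) by (auto simp: \<rho>1_def)
 have XN: "X \<tau> \<in> N" if "\<tau> \<in> ball 0 \<rho>1" for \<tau>
  using d2(2)[of \<tau>] that X0 N(2) by (cases "\<tau> = 0") (auto simp: \<rho>1_def)
 have Xb: "norm (X \<tau>) \<le> (1 + norm D0) * norm \<tau>" if "\<tau> \<in> ball 0 \<rho>1" for \<tau>
 proof -
  have "norm (X \<tau> - \<tau> *s D0) \<le> norm \<tau>" using d1(2)[of \<tau>] that by (simp add: \<rho>1_def)
  moreover have "norm (\<tau> *s D0) = norm D0 * norm \<tau>" by (simp add: norm_cvec_smult)
  ultimately show ?thesis using norm_triangle_sub[of "X \<tau>" "\<tau> *s D0"] by (simp add: distrib_right)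
 qed
 have "X \<tau> \<in> local_unstable_set Vnew N" if t: "\<tau> \<in> ball 0 \<rho>1" for \<tau>
 proof -
  have in1: "\<tau> * exp (of_real s) \<in> ball 0 \<rho>1" if "s \<le> 0" for s :: real
  proof -
   have "norm \<tau> * exp s \<le> norm \<tau> * 1" using that by (intro mult_left_mono) auto
   thus ?thesis using t by (simp add: norm_mult)
  qed
  have "((%s. X (\<tau> * exp (of_real s))) has_vector_derivative Vnew (X (\<tau> * exp (of_real s)))) (at s within {..0})" if "s \<le> 0" for s :: real
  proof -
   have "\<tau> * exp (of_real s) \<in> ball 0 \<rho>" using in1[OF that] \<rho>1(2) by simp
   then obtain D where D: "(X has_derivative (%h. h *s D)) (at (\<tau> * exp (of_real s)))" "(\<tau> * exp (of_real s)) *s D = Vnew (X (\<tau> * exp (of_real s)))"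
    using Xd by blast
   from exp_curve[OF D(1)] show ?thesis unfolding D(2) .
  qed
  moreover have "norm (X (\<tau> * exp (of_real s))) \<le> ((1 + norm D0) * norm \<tau>) * exp (1 * s)" if "s \<le> 0" for s :: real
   using Xb[OF in1[OF that]] by (simp add: norm_mult mult.assoc)
  ultimately show ?thesis unfolding local_unstable_set_def using XN[OF in1]
   by (intro CollectI exI[of _ "%s. X (\<tau> * exp (of_real s))"] exI[of _ "(1 + norm D0) * norm \<tau>"] exI[of _ 1]) simp
 qed
 hence "coord_proj (- U) (X \<tau>) = \<phi> (coord_proj U (X \<tau>))" if "\<tau> \<in> ball 0 \<rho>1" for \<tau> using N(3) that by blast
 thus ?thesis using \<rho>1 unfolding X_def by blast
qed

text \<open>An earlier point of a backward orbit starts a tail of the same orbit, with the same rate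
  and another constant.\<close>

lemma local_unstable_set_shift:
 assumes X: "\<And>t. t \<le> 0 ==> X t \<in> N \<and> (X has_vector_derivative W (X t)) (at t within {..0}) \<and> norm (X t) \<le> C * exp (\<delta> * t)"
  and \<delta>: "\<delta> > 0" and a: "a \<le> (0::real)"
 shows "X a \<in> local_unstable_set W N"
proof -
 have "((%s. X (s + a)) has_vector_derivative W (X (s + a))) (at s within {..0})" if s: "s \<le> 0" for s
 proof -
  have "((%s. s + a) has_vector_derivative 1) (at s within {..0})"
   by (auto intro!: derivative_eq_intros simp: has_real_derivative_iff_has_vector_derivative[symmetric])
  moreover have "(X has_vector_derivative W (X (s + a))) (at (s + a) within (%s. s + a) ` {..0})"
   by (rule has_vector_derivative_within_subset[of _ _ _ "{..0}"]) (use X[of "s + a"] s a in auto)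
  ultimately have "(X \<circ> (%s. s + a) has_vector_derivative 1 *\<^sub>R W (X (s + a))) (at s within {..0})" by (rule vector_diff_chain_within)
  thus ?thesis by (simp add: o_def)
 qed
 moreover have "norm (X (s + a)) \<le> (C * exp (\<delta> * a)) * exp (\<delta> * s)" "X (s + a) \<in> N" if "s \<le> 0" for s
  using X[of "s + a"] that a by (auto simp: distrib_left exp_add mult_ac)
 ultimately show ?thesis unfolding local_unstable_set_def
  by (intro CollectI exI[of _ "%s. X (s + a)"] exI[of _ "C * exp (\<delta> * a)"] exI[of _ \<delta>]) (simp add: \<delta>)
qed

text \<open>The graph is described through backward orbits. Earlier points of such an orbit are
  again in the local unstable set, hence on the graph, so the orbit equals \<open>iota\<close> of
  its projection; comparing left derivatives at time 0 gives the equation.\<close>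

lemma graph_invariant:
 assumes graph: "unstable_graph Vnew U \<phi>"
 shows "\<exists>d>0. d \<le> RI \<and> (\<forall>y. y \<in> coord_space U \<longrightarrow> y \<in> ball 0 d \<longrightarrow> cjac iota y *v Hred y = V (iota y))"
proof -
 obtain N where N: "open N" "0 \<in> N" "local_unstable_set Vnew N = {y\<in>N. coord_proj (- U) y = \<phi> (coord_proj U y)}"
  using graph unfolding unstable_graph_def by blast
 have scR: "M *v (h *\<^sub>R x) = h *\<^sub>R (M *v x)" for M :: "complex^('m option)^('m option)" and x h
  by (rule linear_simps(5)[OF matrix_vector_mul_bounded_linear])
 have Pi: "P *v (iota y - ys) = coord_proj U y + \<phi> (coord_proj U y)" for y by (simp add: iota_def)
 have z: "(0::complex^('m option)) \<in> ball 0 RI" using RI(1) by simp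
 have "isCont (%y. P *v (iota y - ys)) 0"
  by (intro bounded_linear.isCont[OF matrix_vector_mul_bounded_linear] isCont_diff continuous_const
    has_derivative_continuous[OF cholv_deriv[OF RI(2) z]])
 hence "((%y. P *v (iota y - ys)) \<longlongrightarrow> 0) (at 0)" by (simp add: isCont_def iota_0)
 hence "\<forall>\<^sub>F y in at 0. P *v (iota y - ys) \<in> N" using N by (auto dest: topological_tendstoD)
 then obtain d0 where d0: "d0 > 0" "\<And>y. y ~= 0 ==> dist y 0 < d0 ==> P *v (iota y - ys) \<in> N" unfolding eventually_at by auto
 define d where "d = min d0 RI"
 have d: "d > 0" "d \<le> RI" using d0 RI(1) by (auto simp: d_def)
 have "cjac iota y *v Hred y = V (iota y)" if y: "y \<in> coord_space U" "y \<in> ball 0 d" for y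
 proof -
  have yRI: "y \<in> ball 0 RI" using y(2) d by auto
  let ?x = "y + \<phi> y"
  have pU: "coord_proj U y = y" by (rule coord_proj_id[OF y(1)])
  have xi: "ys + Pinv *v ?x = iota y" by (simp add: iota_def pU)
  have xN: "?x \<in> N" using d0(2)[of y] y(2) N(2) unfolding Pi pU by (cases "y = 0") (auto simp: d_def \<phi>_0)
  have px: "coord_proj U ?x = y" "coord_proj (- U) ?x = \<phi> y"
   using \<phi>_S[of y] y(1) unfolding pU by (auto simp: coord_proj_add pU) (auto simp: vec_eq_iff coord_space_def)
  hence "?x \<in> local_unstable_set Vnew N" unfolding N(3) using xN by simp
  then obtain X C \<delta> where \<delta>: "0 < \<delta>" and X0: "X 0 = ?x"
   and X: "\<And>t. t \<le> 0 ==> X t \<in> N \<and> (X has_vector_derivative Vnew (X t)) (at t within {..0}) \<and> norm (X t) \<le> C * exp (\<delta> * t)"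
   unfolding local_unstable_set_def by blast
  have gr: "ys + Pinv *v X t = iota (coord_proj U (X t))" if "t \<le> 0" for t
  proof -
   have "X t \<in> local_unstable_set Vnew N" by (rule local_unstable_set_shift[OF X \<delta> that])
   hence 1: "coord_proj (- U) (X t) = \<phi> (coord_proj U (X t))" unfolding N(3) by blast
   have "X t = coord_proj U (X t) + coord_proj (- U) (X t)" by (simp add: vec_eq_iff)
   thus ?thesis unfolding iota_proj by (simp add: iota_def 1)
  qed
  have X1: "(X has_derivative (%h. h *\<^sub>R Vnew ?x)) (at 0 within {..0})"
   using X[of 0] X0 by (simp add: has_vector_derivative_def)
  from has_derivative_add[OF has_derivative_const[of ys] bounded_linear.has_derivative[OF matrix_vector_mul_bounded_linear[of Pinv] X1]]
  have D1: "((%t. ys + Pinv *v X t) has_vector_derivative V (iota y)) (at 0 within {..0})"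
   by (simp add: has_vector_derivative_def Vnew xi scR)
  have cp: "coord_proj U (X 0) = y" using px X0 by simp
  have "(iota has_derivative (*v) (cjac iota y)) (at (coord_proj U (X 0)))" unfolding cp by (rule cholv_deriv[OF RI(2) yRI])
  from has_derivative_compose[OF bounded_linear.has_derivative[OF bounded_linear_coord_proj[of U] X1] this]
  have "((%t. iota (coord_proj U (X t))) has_derivative (%h. cjac iota y *v coord_proj U (h *\<^sub>R Vnew ?x))) (at 0 within {..0})" .
  moreover have "coord_proj U (h *\<^sub>R Vnew ?x) = h *\<^sub>R Hred y" for h
   unfolding Vnew xi Hred_def by (simp add: vec_eq_iff)
  ultimately have D2: "((%t. iota (coord_proj U (X t))) has_vector_derivative cjac iota y *v Hred y) (at 0 within {..0})"
   by (simp add: has_vector_derivative_def scR)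
  have "((%t. ys + Pinv *v X t) has_vector_derivative cjac iota y *v Hred y) (at 0 within {..0})"
   by (rule has_vector_derivative_transform[OF _ _ D2]) (use gr in auto)
  from vector_derivative_unique_within[OF _ this D1] show ?thesis by (simp add: at_within_Iic_nontrivial)
 qed
 thus ?thesis using d by blast
qed

lemma eigenvalue_to_J: assumes "eigenvalue_on U A \<mu>" shows "\<exists>y. J *v y = \<mu> *s y \<and> y ~= 0"
proof -
 obtain v where v: "v ~= 0" "A *v v = \<mu> *s v" using assms unfolding eigenvalue_on_def by blast
 have "Pinv *v (P *v (J *v (Pinv *v v))) = Pinv *v (\<mu> *s v)" using v(2) by (simp only: A_mul)
 hence "J *v (Pinv *v v) = \<mu> *s (Pinv *v v)" by (simp add: matrix_vec_smult)
 moreover have "Pinv *v v ~= 0" using v(1) P_Pinv_mul(1)[of v] by (metis matrix_vector_mult_0_right)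
 ultimately show ?thesis by blast
qed

text \<open>By the block form, the parts of an eigenvector in \<open>U\<close> and outside
  \<open>U\<close> are each zero or an eigenvector. The outer part is zero, since otherwise the
  eigenvalue would have real part at most 0.\<close>

lemma eigenvalue_from_J:
 assumes y: "J *v y = \<mu> *s y" "y ~= 0" and \<mu>: "0 < Re \<mu>" and stab: "\<And>\<mu>. eigenvalue_on (- U) A \<mu> ==> Re \<mu> \<le> 0"
 shows "eigenvalue_on U A \<mu>"
proof -
 define x where "x = P *v y"
 have Ax: "A *v x = \<mu> *s x" by (simp add: x_def A_mul y(1) matrix_vec_smult)
 have x0: "x ~= 0" using y(2) P_Pinv_mul(2)[of y] unfolding x_def by (metis matrix_vector_mult_0_right)
 define xs xu where "xs = coord_proj (- U) x" and "xu = coord_proj U x"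
 have in1: "xs \<in> coord_space (- U)" "xu \<in> coord_space U" by (simp_all add: xs_def xu_def)
 have split: "x = xu + xs" by (simp add: xs_def xu_def vec_eq_iff)
 have s: "A *v xu + A *v xs = \<mu> *s xu + \<mu> *s xs" using Ax unfolding split by (simp add: matrix_vector_right_distrib vector_add_ldistrib)
 have AU: "(A *v xu) $ i = 0" if "i \<notin> U" for i using A_U[OF in1(2)] that by (simp add: coord_space_def)
 have AS: "(A *v xs) $ i = 0" if "i \<in> U" for i using A_S[OF in1(1)] that by (simp add: coord_space_def)
 have si: "(A *v xu) $ i + (A *v xs) $ i = \<mu> * xu $ i + \<mu> * xs $ i" for i using s by (simp add: vec_eq_iff)
 have "(A *v xu) $ i = \<mu> * xu $ i \<and> (A *v xs) $ i = \<mu> * xs $ i" for i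
  using si[of i] AU[of i] AS[of i] by (cases "i \<in> U") (auto simp: xs_def xu_def)
 hence eu: "A *v xu = \<mu> *s xu" and es: "A *v xs = \<mu> *s xs" by (simp_all add: vec_eq_iff)
 have "xs = 0"
 proof (rule ccontr)
  assume "xs ~= 0"
  hence "eigenvalue_on (- U) A \<mu>" using es in1(1) unfolding eigenvalue_on_def by blast
  thus False using stab \<mu> by fastforce
 qed
 hence "xu ~= 0" using x0 split by simp
 thus ?thesis using eu in1(2) unfolding eigenvalue_on_def by blast
qed

end

theorem proposition3p5:
  fixes f g :: "'m::finite \<Rightarrow> complex^'m \<Rightarrow> complex \<Rightarrow> complex"
    and p :: "'m \<Rightarrow> nat" and r :: nat
    and c :: "complex^'m" and j :: 'm and b :: complex
    and \<Lambda> :: "nat \<Rightarrow> complex"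
    and G :: "'m \<Rightarrow> complex^('m option) \<Rightarrow> complex"
    and V :: "complex^('m option) \<Rightarrow> complex^('m option)"
    and J :: "complex^('m option)^('m option)"
    and F :: "complex^('m option) \<Rightarrow> complex^('m option)"
    and m :: nat
  assumes m: "m = CARD('m)"
    and system: "quasihomogeneous_system f g p r"
    and root: "\<And>i. - of_nat (p i) * c $ i = f i c 0"
    and cj: "c $ j \<noteq> 0"
    and branch: "b ^ p j = c $ j"
    and exponents: "\<And>x. det (mat x - kovalevskaya_matrix f p c) = (\<Prod>i=1..m. x - \<Lambda> i)"
    and first: "\<Lambda> 1 = -1"
    and G: "chart_G g p r j G"
    and V: "V = chart_field f G p r j"
    and J: "J = jacobi_matrix V (chart_fixpoint p c j b)"
    and F: "F = nonlinear_part V (chart_fixpoint p c j b)"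
  shows
    "(\<forall>k P U \<phi>.
        1 \<le> k \<and> k \<le> m \<and> (\<forall>i\<in>{2..k}. Re (\<Lambda> i) \<le> 0) \<and> (\<forall>i\<in>{k+1..m}. 0 < Re (\<Lambda> i)) \<and>
        card U = m - k + 2 \<and> spectral_splitting J P U \<and>
        unstable_graph (\<lambda>y. conj_matrix P J *v y + conj_map P F y) U \<phi> \<longrightarrow>
        (laurent_family f g p c (m - k) \<longleftrightarrow>
           (\<forall>i\<in>{k+1..m}. positive_integer (\<Lambda> i)) \<and>
           semisimple_on U (conj_matrix P J) \<and>
           linearizable_on U (unstable_field U (conj_matrix P J) (conj_map P F) \<phi>)))
     \<and>
     (laurent_family f g p c (m - 1) \<longleftrightarrow>
        (\<forall>i\<in>{2..m}. positive_integer (\<Lambda> i)) \<and>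
        semisimple_on UNIV J \<and>
        linearizable_on UNIV (\<lambda>x. J *v x + F x))"
proof -
 interpret q: qh_chart f g p r c j b G
  by unfold_locales (fact system root cj branch G)+
 have m1: "m \<ge> 1" using m by (simp add: Suc_leI)
 note cases = q.J_eigenvalue_cases[OF m exponents first]
 note vec = q.J_eigenvector[OF m exponents first]
 \<comment> \<open>The exponents enter through eigenvectors of \<open>J\<close>: those with positive
   real part are eigenvalues on \<open>U\<close>, and conversely an eigenvalue on \<open>U\<close>
   is \<open>r\<close>, \<open>r + 1\<close> or such an exponent.\<close>
 have part1: "laurent_family f g p c (m - k) \<longleftrightarrow>
      (\<forall>i\<in>{k+1..m}. positive_integer (\<Lambda> i)) \<and> semisimple_on U (conj_matrix P J) \<and>
      linearizable_on U (unstable_field U (conj_matrix P J) (conj_map P F) \<phi>)"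
  if k: "1 \<le> k" "k \<le> m" "\<forall>i\<in>{2..k}. Re (\<Lambda> i) \<le> 0" "\<forall>i\<in>{k+1..m}. 0 < Re (\<Lambda> i)"
   and cU: "card U = m - k + 2" and split: "spectral_splitting J P U"
   and graph: "unstable_graph (%y. conj_matrix P J *v y + conj_map P F y) U \<phi>" for k P U \<phi>
 proof -
  interpret sp: split_chart f g p r c j b G P U \<phi>
   by unfold_locales (use split graph in \<open>auto simp: spectral_splitting_def unstable_graph_def J V\<close>)
  have graph': "unstable_graph sp.Vnew U \<phi>" using graph unfolding J F V .
  have stab: "Re \<mu> \<le> 0" if "eigenvalue_on (- U) sp.A \<mu>" for \<mu>
   using split that unfolding spectral_splitting_def J V by blast
  have pos: "0 < Re \<mu>" if "eigenvalue_on U sp.A \<mu>" for \<mu>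
   using split that unfolding spectral_splitting_def J V by blast
  show ?thesis unfolding J F V
  proof
   assume fam: "laurent_family f g p c (m - k)"
   have nec: "semisimple_on U sp.A \<and> (\<forall>\<mu>. eigenvalue_on U sp.A \<mu> \<longrightarrow> positive_integer \<mu>) \<and>
     linearizable_on U (unstable_field U sp.A (conj_map P (nonlinear_part q.V q.ys)) \<phi>)"
    by (rule sp.necessary[OF fam cU]) (rule sp.trap[OF graph'])
   have "positive_integer (\<Lambda> i)" if i: "i \<in> {k+1..m}" for i
   proof -
    have "i \<in> {2..m}" using i k(1) by auto
    then obtain y where y: "y ~= 0" "q.J *v y = \<Lambda> i *s y" using vec by blast
    have "eigenvalue_on U sp.A (\<Lambda> i)" by (rule sp.eigenvalue_from_J[OF y(2,1) _ stab]) (use k(4) i in auto)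
    thus ?thesis using nec by blast
   qed
   thus "(\<forall>i\<in>{k+1..m}. positive_integer (\<Lambda> i)) \<and> semisimple_on U sp.A \<and>
     linearizable_on U (unstable_field U sp.A (conj_map P (nonlinear_part q.V q.ys)) \<phi>)" using nec by blast
  next
   assume rhs: "(\<forall>i\<in>{k+1..m}. positive_integer (\<Lambda> i)) \<and> semisimple_on U sp.A \<and>
     linearizable_on U (unstable_field U sp.A (conj_map P (nonlinear_part q.V q.ys)) \<phi>)"
   have ev: "positive_integer \<mu>" if e: "eigenvalue_on U sp.A \<mu>" for \<mu>
   proof -
    obtain y where y: "q.J *v y = \<mu> *s y" "y ~= 0" using sp.eigenvalue_to_J[OF e] by blast
    from cases[OF y] consider "\<mu> = of_nat r" | "\<mu> = of_nat (r + 1)" | i where "i \<in> {2..m}" "\<mu> = \<Lambda> i" by blast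
    thus ?thesis
    proof cases
     case 1 thus ?thesis using q.r_pos unfolding positive_integer_def by blast
    next
     case 2 thus ?thesis unfolding positive_integer_def by (intro exI[of _ "r + 1"]) simp
    next
     case (3 i)
     have "\<not> i \<le> k"
     proof
      assume "i \<le> k"
      hence "Re (\<Lambda> i) \<le> 0" using k(3) 3(1) by simp
      thus False using pos[OF e] 3(2) by simp
     qed
     thus ?thesis using rhs 3 by auto
    qed
   qed
   obtain d where d: "d > 0" "d \<le> sp.RI"
    "\<forall>y. y \<in> coord_space U \<longrightarrow> y \<in> ball 0 d \<longrightarrow> cjac sp.iota y *v sp.Hred y = q.V (sp.iota y)"
    using sp.graph_invariant[OF graph'] by blast
   show "laurent_family f g p c (m - k)"
    by (rule sp.sufficient_split[OF _ ev _ cU stab d(1,2)]) (use rhs d(3) in blast)+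
  qed
 qed
 \<comment> \<open>The identity for \<open>P\<close>, \<open>UNIV\<close> for \<open>U\<close> and 0
   for \<open>\<phi>\<close>: every direction is treated as unstable, whatever the signs of the
   exponents, and the reduced field is the full one.\<close>
 have part2: "laurent_family f g p c (m - 1) \<longleftrightarrow> (\<forall>i\<in>{2..m}. positive_integer (\<Lambda> i)) \<and> semisimple_on UNIV J \<and>
    linearizable_on UNIV (%x. J *v x + F x)"
 proof -
  let ?I = "mat 1 :: complex^('m option)^('m option)"
  interpret sp: split_chart f g p r c j b G ?I UNIV "%_. 0"
  proof
   show "invertible ?I" by (simp add: invertible_det_nz)
   show "analytic_near_0 UNIV (%_. 0 :: complex^('m option))" unfolding analytic_near_0_cholv by (auto intro: exI[of _ 1])
  qed (auto simp: coord_space_def)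
  have Pi: "matrix_inv ?I = ?I" using sp.P_Pinv(1) by simp
  have A: "sp.A = q.J" by (simp add: conj_matrix_def Pi)
  have fld: "unstable_field UNIV sp.A (conj_map ?I (nonlinear_part q.V q.ys)) (%_. 0) = (%x. q.J *v x + nonlinear_part q.V q.ys x)"
   unfolding A unstable_field_def conj_map_def Pi by (rule ext) (simp add: coord_proj_def vec_eq_iff)
  have cU: "card (UNIV :: 'm option set) = (m - 1) + 2" using m1 m by (simp add: card_UNIV_option)
  have stab: "Re \<mu> \<le> 0" if "eigenvalue_on (- UNIV) sp.A \<mu>" for \<mu>
   using that by (auto simp: eigenvalue_on_def coord_space_def vec_eq_iff)
  have inv: "cjac sp.iota y *v sp.Hred y = q.V (sp.iota y)" if "y \<in> ball 0 sp.RI" for y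
  proof -
   have cid: "coord_proj UNIV x = x" for x :: "complex^('m option)" by (simp add: vec_eq_iff)
   \<comment> \<open>With these data \<open>iota\<close> is a translation, so its derivative is the
     identity and the invariance of the graph is immediate.\<close>
   have io: "sp.iota = (%y. q.ys + y)" by (rule ext) (simp add: sp.iota_def Pi cid)
   have "(sp.iota has_derivative (%v. v)) (at y)" unfolding io by (auto intro!: derivative_eq_intros)
   from has_derivative_unique[OF cholv_deriv[OF sp.RI(2) that] this] have "cjac sp.iota y *v v = v" for v by metis
   thus ?thesis by (simp add: sp.Hred_def cid)
  qed
  show ?thesis unfolding J F V
  proof
   assume fam: "laurent_family f g p c (m - 1)"
   have nec: "semisimple_on UNIV sp.A \<and> (\<forall>\<mu>. eigenvalue_on UNIV sp.A \<mu> \<longrightarrow> positive_integer \<mu>) \<and>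
     linearizable_on UNIV (unstable_field UNIV sp.A (conj_map ?I (nonlinear_part q.V q.ys)) (%_. 0))"
   proof (rule sp.necessary[OF fam cU])
    fix z0 Y T \<rho> assume "q.chart_sol z0 Y T \<rho>"
    hence "\<rho> > 0" by (simp add: q.chart_sol_def)
    thus "\<exists>\<rho>1>0. \<rho>1 \<le> \<rho> \<and> (\<forall>\<tau>\<in>ball 0 \<rho>1. coord_proj (- UNIV) (?I *v (Y \<tau> - q.ys)) = 0)"
     by (intro exI[of _ \<rho>]) (simp add: coord_proj_def vec_eq_iff)
   qed
   have "positive_integer (\<Lambda> i)" if i: "i \<in> {2..m}" for i
   proof -
    obtain y where y: "y ~= 0" "q.J *v y = \<Lambda> i *s y" using vec[OF i] by blast
    hence "eigenvalue_on UNIV sp.A (\<Lambda> i)" unfolding eigenvalue_on_def A by (intro bexI[of _ y]) (auto simp: coord_space_def)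
    thus ?thesis using nec by blast
   qed
   thus "(\<forall>i\<in>{2..m}. positive_integer (\<Lambda> i)) \<and> semisimple_on UNIV q.J \<and> linearizable_on UNIV (%x. q.J *v x + nonlinear_part q.V q.ys x)"
    using nec unfolding fld unfolding A by blast
  next
   assume rhs: "(\<forall>i\<in>{2..m}. positive_integer (\<Lambda> i)) \<and> semisimple_on UNIV q.J \<and> linearizable_on UNIV (%x. q.J *v x + nonlinear_part q.V q.ys x)"
   have ev: "positive_integer \<mu>" if e: "eigenvalue_on UNIV sp.A \<mu>" for \<mu>
   proof -
    obtain y where y: "q.J *v y = \<mu> *s y" "y ~= 0" using sp.eigenvalue_to_J[OF e] by blast
    from cases[OF y] consider "\<mu> = of_nat r" | "\<mu> = of_nat (r + 1)" | i where "i \<in> {2..m}" "\<mu> = \<Lambda> i" by blast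
    thus ?thesis
    proof cases
     case 1 thus ?thesis using q.r_pos unfolding positive_integer_def by blast
    next
     case 2 thus ?thesis unfolding positive_integer_def by (intro exI[of _ "r + 1"]) simp
    next
     case (3 i) thus ?thesis using rhs by auto
    qed
   qed
   show "laurent_family f g p c (m - 1)"
   proof (rule sp.sufficient_split[OF _ ev _ cU stab sp.RI(1) order_refl inv])
    show "semisimple_on UNIV sp.A" using rhs unfolding A by blast
    show "linearizable_on UNIV (unstable_field UNIV sp.A (conj_map ?I (nonlinear_part q.V q.ys)) (%_. 0))" using rhs unfolding fld by blast
   qed
  qed
 qed
 show ?thesis using part1 part2 by blast
qed

end
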